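(* Let $\mathcal H_S$ be a Hilbert space of arbitrary dimension at least $2$ with orthonormal (pointer) basis $\{|i\rangle\}$, let $N\ge 1$, and let $\mathcal H_{not},\mathcal H_1,\dots,\mathcal H_N$ be nonzero complex Hilbert spaces, with no restriction on their dimensions. Let $\varepsilon_i\in\mathbb R$ and, for each $i$, let $\hat V^i_{not}$ and $\hat V^i_k$ ($1\le k\le N$) be self-adjoint operators on $\mathcal H_{not}$ and $\mathcal H_k$ respectively. Consider on $\mathcal H_S\otimes\mathcal H_{not}\otimes\bigotimes_k\mathcal H_k$ the pure dephasing Hamiltonian $$\hat H=\sum_{i}\Big(\varepsilon_i|i\rangle\langle i|+|i\rangle\langle i|\otimes\hat V^i_{not}+\sum_{k=1}^N|i\rangle\langle i|\otimes\hat V^i_k\Big)$$ (identity operators on the remaining factors are understood), which generates the evolution operator $$\hat U(t)=\sum_i e^{-i\varepsilon_it}|i\rangle\langle i|\otimes e^{-i\hat V^i_{not}t}\otimes\bigotimes_k e^{-i\hat V^i_kt},$$ and the initial state $$\hat{\tilde\sigma}(0)=|\psi_0\rangle\langle\psi_0|\otimes\hat R_{not}(0)\otimes\bigotimes_{k=1}^N\hat\rho^k(0),\qquad |\psi_0\rangle=\sum_i a_i|i\rangle,$$ where $\sum_i|a_i|^2=1$, all $a_i\ne 0$, and $\hat R_{not}(0)$, $\hat\rho^k(0)$ are arbitrary density operators. Put $\hat{\tilde\sigma}(t)=\hat U(t)\,\hat{\tilde\sigma}(0)\,\hat U(t)^\dagger$, $\hat\sigma(t)=\mathrm{Tr}_{\mathcal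 H_{not}}\hat{\tilde\sigma}(t)$, $\hat R_{ii}(t)=e^{-i\hat V^i_{not}t}\hat R_{not}(0)e^{i\hat V^i_{not}t}$ and $\hat\rho^k_{ii}(t)=e^{-i\hat V^i_kt}\hat\rho^k(0)e^{i\hat V^i_kt}$. 1. If $\hat{\tilde\sigma}(t)$ is separable with respect to the bipartition $\mathcal H_S\,|\,\mathcal H_{not}\otimes\bigotimes_k\mathcal H_k$, then for all pairs $i\neq j$ $$\hat R_{ii}(t)\otimes\bigotimes_k\hat\rho^k_{ii}(t)=\hat R_{jj}(t)\otimes\bigotimes_k\hat\rho^k_{jj}(t),$$ and consequently $\hat\rho^k_{ii}(t)=\hat\rho^k_{jj}(t)$ for every observed environment $k$ and all $i\ne j$. (This condition is necessary for separability but in general not sufficient.) 2. If for some observed environment $k$ the evolution of the system with that environment is non-entangling at time $t$, i.e. the state $\hat U_k(t)\big(|\psi_0\rangle\langle\psi_0|\otimes\hat\rho^k(0)\big)\hat U_k(t)^\dagger$ with $\hat U_k(t)=\sum_ie^{-i\varepsilon_it}|i\rangle\langle i|\otimes e^{-i\hat V^i_kt}$ is separable with respect to $\mathcal H_S\,|\,\mathcal H_k$, then $\hat\sigma(t)$ is not a spectrum broadcast structure (SBS) state with respect to the pointer basis $\{|i\rangle\}$. 3. The same conclusion holds also for entangling evolutions that satisfy the necessary separability condition: if for some observed environment $k$ one has $\hat\rho^k_{ii}(t)=\hat\rho^k_{jj}(t)$ for all $i\ne j$, then $\hat\sigma(t)$ is not an SBS state with respect to the pointer basis $\{|i\rangle\}$,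 whether or not entanglement is generated. In particular, if $\hat{\tilde\sigma}(t)$ is separable as in 1, then $\hat\sigma(t)$ is not an SBS state with respect to the pointer basis.
   Context: Units with $\hbar=1$. The space $\mathcal H_{not}$ describes the unobserved environment (which is traced out; entanglement with it is irrelevant for parts 2 and 3), and $\mathcal H_1,\dots,\mathcal H_N$ describe the observed environments. In the operators $\hat V^i$ the free Hamiltonian of the respective environment is included; no commutation relations between them are assumed. A density operator on a bipartite space $\mathcal A\otimes\mathcal B$ is separable if it is a convex combination of product states $\alpha\otimes\beta$ (in infinite dimension: a trace-norm limit of such convex combinations); otherwise it is entangled. A density operator $\hat\sigma$ on $\mathcal H_S\otimes\bigotimes_{k=1}^N\mathcal H_k$ is a spectrum broadcast structure (SBS) state with respect to the orthonormal basis $\{|i\rangle\}$ of $\mathcal H_S$ if there are probabilities $p_i$ and density operators $\hat\rho^k_i$ on $\mathcal H_k$ with $$\hat\sigma=\sum_i p_i|i\rangle\langle i|\otimes\hat\rho^1_i\otimes\cdots\otimes\hat\rho^N_i,$$ such that for every $k$ and all $i\neq i'$ the operators $\hat\rho^k_i$ and $\hat\rho^k_{i'}$ have orthogonal supports, i.e. $\hat\rho^k_i\hat\rho^k_{i'}=0$. *)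

theory Defs
  imports "HOL-Analysis.Analysis"
begin

section \<open>Complex Hilbert spaces\<close>

text \<open>The inner product is antilinear in its first argument, as in bra-ket notation.\<close>

class chilbert_space = banach +
  fixes scaleC :: "complex \<Rightarrow> 'a \<Rightarrow> 'a"  (infixr \<open>*\<^sub>C\<close> 75)
    and cinner :: "'a \<Rightarrow> 'a \<Rightarrow> complex"
  assumes scaleR_scaleC: "scaleR r x = complex_of_real r *\<^sub>C x"
    and scaleC_add_right: "c *\<^sub>C (x + y) = c *\<^sub>C x + c *\<^sub>C y"
    and scaleC_add_left: "(c + d) *\<^sub>C x = c *\<^sub>C x + d *\<^sub>C x"
    and scaleC_scaleC: "c *\<^sub>C (d *\<^sub>C x) = (c * d) *\<^sub>C x"
    and cinner_commute: "cinner x y = cnj (cinner y x)"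
    and cinner_add_right: "cinner x (y + z) = cinner x y + cinner x z"
    and cinner_scaleC_right: "cinner x (c *\<^sub>C y) = c * cinner x y"
    and cinner_self: "cinner x x = complex_of_real ((norm x)\<^sup>2)"

instantiation complex :: chilbert_space
begin

definition scaleC_complex :: "complex \<Rightarrow> complex \<Rightarrow> complex" where
  "scaleC_complex c x = c * x"

definition cinner_complex :: "complex \<Rightarrow> complex \<Rightarrow> complex" where
  "cinner_complex x y = cnj x * y"

instance
  by standard
    (auto simp: scaleC_complex_def cinner_complex_def scaleR_conv_of_real algebra_simps
      complex_norm_square[symmetric] simp flip: complex_norm_square)

end

instantiation vec :: (chilbert_space, finite) chilbert_space
begin

definition scaleC_vec :: "complex \<Rightarrow> 'a ^ 'b \<Rightarrow> 'a ^ 'b" where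
  "scaleC_vec c x = (\<chi> i. c *\<^sub>C (x $ i))"

definition cinner_vec :: "'a ^ 'b \<Rightarrow> 'a ^ 'b \<Rightarrow> complex" where
  "cinner_vec x y = (\<Sum>i\<in>UNIV. cinner (x $ i) (y $ i))"

instance
proof
  fix r :: real and c d :: complex and x y z :: "'a ^ 'b"
  show "scaleR r x = complex_of_real r *\<^sub>C x"
    by (simp add: scaleC_vec_def vec_eq_iff scaleR_scaleC)
  show "c *\<^sub>C (x + y) = c *\<^sub>C x + c *\<^sub>C y"
    by (simp add: scaleC_vec_def vec_eq_iff scaleC_add_right)
  show "(c + d) *\<^sub>C x = c *\<^sub>C x + d *\<^sub>C x"
    by (simp add: scaleC_vec_def vec_eq_iff scaleC_add_left)
  show "c *\<^sub>C (d *\<^sub>C x) = (c * d) *\<^sub>C x"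
    by (simp add: scaleC_vec_def vec_eq_iff scaleC_scaleC)
  show "cinner x y = cnj (cinner y x)"
    by (auto simp: cinner_vec_def intro!: sum.cong cinner_commute)
  show "cinner x (y + z) = cinner x y + cinner x z"
    by (simp add: cinner_vec_def cinner_add_right sum.distrib)
  show "cinner x (c *\<^sub>C y) = c * cinner x y"
    by (simp add: cinner_vec_def scaleC_vec_def cinner_scaleC_right sum_distrib_left)
  show "cinner x x = complex_of_real ((norm x)\<^sup>2)"
    by (simp add: cinner_vec_def cinner_self norm_vec_def L2_set_def sum_nonneg)
qed

end

abbreviation cspan :: "'a::chilbert_space set \<Rightarrow> 'a set" where
  "cspan \<equiv> module.span scaleC"

abbreviation csubspace :: "'a::chilbert_space set \<Rightarrow> bool" where
  "csubspace \<equiv> module.subspace scaleC"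

text \<open>A Hilbert space is represented by a closed complex subspace of a type of class
  \<open>chilbert_space\<close> (possibly the whole type). A finite family of arbitrary Hilbert spaces
  is a family of closed subspaces of one type, e.g. of their direct sum.\<close>

definition hspace :: "'a::chilbert_space set \<Rightarrow> bool" where
  "hspace H \<longleftrightarrow> csubspace H \<and> closed H"

definition is_onb :: "'a::chilbert_space set \<Rightarrow> 'a set \<Rightarrow> bool" where
  "is_onb H B \<longleftrightarrow> B \<subseteq> H \<and> (\<forall>e\<in>B. \<forall>f\<in>B. cinner e f = (if e = f then 1 else 0)) \<and>
     H \<subseteq> closure (cspan B)"


section \<open>Operators\<close>

text \<open>A bounded operator on \<open>H\<close> is a function on the ambient type whose values outside \<open>H\<close>
  are irrelevant.\<close>

definition bounded_op_on :: "'a::chilbert_space set \<Rightarrow> ('a \<Rightarrow> 'a) \<Rightarrow> bool" where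
  "bounded_op_on H A \<longleftrightarrow>
     (\<forall>x\<in>H. A x \<in> H) \<and>
     (\<forall>x\<in>H. \<forall>y\<in>H. A (x + y) = A x + A y) \<and>
     (\<forall>c. \<forall>x\<in>H. A (c *\<^sub>C x) = c *\<^sub>C A x) \<and>
     (\<exists>K. \<forall>x\<in>H. norm (A x) \<le> K * norm x)"

definition unitary_on :: "'a::chilbert_space set \<Rightarrow> ('a \<Rightarrow> 'a) \<Rightarrow> bool" where
  "unitary_on H A \<longleftrightarrow> bounded_op_on H A \<and> A ` H = H \<and>
     (\<forall>x\<in>H. \<forall>y\<in>H. cinner (A x) (A y) = cinner x y)"

definition adj :: "('a::chilbert_space \<Rightarrow> 'a) \<Rightarrow> 'a \<Rightarrow> 'a" where
  "adj A = (THE B. \<forall>x y. cinner (B x) y = cinner x (A y))"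

definition proj :: "'a::chilbert_space \<Rightarrow> 'a \<Rightarrow> 'a" where
  "proj v = (\<lambda>x. cinner v x *\<^sub>C v)"

definition density_op :: "'a::chilbert_space set \<Rightarrow> ('a \<Rightarrow> 'a) \<Rightarrow> bool" where
  "density_op H \<rho> \<longleftrightarrow> bounded_op_on H \<rho> \<and>
     (\<forall>x\<in>H. cinner x (\<rho> x) \<in> \<real>\<^sub>\<ge>\<^sub>0) \<and>
     (\<forall>B. is_onb H B \<longrightarrow> ((\<lambda>e. cinner e (\<rho> e)) has_sum 1) B)"

text \<open>The trace norm of a bounded operator, as the supremum of
  \<open>\<Sum>\<^sub>j |\<langle>e\<^sub>j, A f\<^sub>j\<rangle>|\<close> over all finite orthonormal systems \<open>e\<close>, \<open>f\<close>; it is \<open>\<infinity>\<close> unless \<open>A\<close> is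
  trace class.\<close>

definition orthonormal :: "nat \<Rightarrow> (nat \<Rightarrow> 'a::chilbert_space) \<Rightarrow> bool" where
  "orthonormal n e \<longleftrightarrow> (\<forall>i<n. \<forall>j<n. cinner (e i) (e j) = (if i = j then 1 else 0))"

definition trace_norm :: "('a::chilbert_space \<Rightarrow> 'a) \<Rightarrow> ennreal" where
  "trace_norm A = (SUP (n, e, f) \<in> {(n, e, f). orthonormal n e \<and> orthonormal n f}.
     ennreal (\<Sum>j<n. cmod (cinner (e j) (A (f j)))))"


section \<open>Self-adjoint operators and their unitary groups\<close>

text \<open>Possibly unbounded operators are given by their graphs. The first two conditions say
  that \<open>V\<close> is equal to its adjoint; linearity of \<open>V\<close> follows from this, and single-valuedness
  follows because the domain is dense.\<close>

definition self_adjoint_on :: "'a::chilbert_space set \<Rightarrow> ('a \<times> 'a) set \<Rightarrow> bool" where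
  "self_adjoint_on H V \<longleftrightarrow>
     V \<subseteq> H \<times> H \<and>
     V = {(x, y) \<in> H \<times> H. \<forall>(u, v) \<in> V. cinner v x = cinner u y} \<and>
     H \<subseteq> closure (Domain V)"

definition unitary_group :: "'a::chilbert_space set \<Rightarrow> (real \<Rightarrow> 'a \<Rightarrow> 'a) \<Rightarrow> bool" where
  "unitary_group H W \<longleftrightarrow>
     (\<forall>t. unitary_on H (W t)) \<and>
     (\<forall>x\<in>H. W 0 x = x) \<and>
     (\<forall>s t. \<forall>x\<in>H. W (s + t) x = W s (W t x)) \<and>
     (\<forall>x\<in>H. continuous_on UNIV (\<lambda>t. W t x))"

text \<open>\<open>W t = exp (- \<i> V t)\<close>: the strongly continuous unitary group \<open>W\<close> has infinitesimal
  generator \<open>- \<i> V\<close>, domains included. By Stone's theorem each self-adjoint \<open>V\<close> has exactly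
  one such group.\<close>

definition generates ::
  "'a::chilbert_space set \<Rightarrow> ('a \<times> 'a) set \<Rightarrow> (real \<Rightarrow> 'a \<Rightarrow> 'a) \<Rightarrow> bool" where
  "generates H V W \<longleftrightarrow> unitary_group H W \<and>
     V = {(x, y) \<in> H \<times> H. ((\<lambda>h. (W h x - x) /\<^sub>R h) \<longlongrightarrow> (- \<i>) *\<^sub>C y) (at 0)}"


section \<open>Hilbert tensor products\<close>

text \<open>Up to unitary equivalence, the Hilbert tensor product is the Hilbert space containing
  product vectors that are multilinear in their factors, have the product inner products
  and span a dense subspace.\<close>

definition hilbert_tensor ::
  "'a::chilbert_space set \<Rightarrow> 'b::chilbert_space set \<Rightarrow> ('a \<Rightarrow> 'b \<Rightarrow> 'c::chilbert_space) \<Rightarrow> bool" where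
  "hilbert_tensor H K \<tau> \<longleftrightarrow>
     (\<forall>x\<in>H. \<forall>x'\<in>H. \<forall>y\<in>K. \<tau> (x + x') y = \<tau> x y + \<tau> x' y) \<and>
     (\<forall>x\<in>H. \<forall>y\<in>K. \<forall>y'\<in>K. \<tau> x (y + y') = \<tau> x y + \<tau> x y') \<and>
     (\<forall>c. \<forall>x\<in>H. \<forall>y\<in>K. \<tau> (c *\<^sub>C x) y = c *\<^sub>C \<tau> x y \<and> \<tau> x (c *\<^sub>C y) = c *\<^sub>C \<tau> x y) \<and>
     (\<forall>x\<in>H. \<forall>x'\<in>H. \<forall>y\<in>K. \<forall>y'\<in>K.
        cinner (\<tau> x y) (\<tau> x' y') = cinner x x' * cinner y y') \<and>
     closure (cspan {\<tau> x y |x y. x \<in> H \<and> y \<in> K}) = UNIV"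

definition hilbert_tensors ::
  "'k set \<Rightarrow> ('k \<Rightarrow> 'a::chilbert_space set) \<Rightarrow> (('k \<Rightarrow> 'a) \<Rightarrow> 'c::chilbert_space) \<Rightarrow> bool" where
  "hilbert_tensors I H \<tau> \<longleftrightarrow>
     (\<forall>x\<in>Pi I H. \<forall>k\<in>I. \<forall>u\<in>H k. \<forall>v\<in>H k. \<tau> (x(k := u + v)) = \<tau> (x(k := u)) + \<tau> (x(k := v))) \<and>
     (\<forall>x\<in>Pi I H. \<forall>k\<in>I. \<forall>u\<in>H k. \<forall>c. \<tau> (x(k := c *\<^sub>C u)) = c *\<^sub>C \<tau> (x(k := u))) \<and>
     (\<forall>x\<in>Pi I H. \<forall>y\<in>Pi I H. cinner (\<tau> x) (\<tau> y) = (\<Prod>k\<in>I. cinner (x k) (y k))) \<and>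
     closure (cspan (\<tau> ` Pi I H)) = UNIV"

definition tensor_op ::
  "'a::chilbert_space set \<Rightarrow> 'b::chilbert_space set \<Rightarrow> ('a \<Rightarrow> 'b \<Rightarrow> 'c::chilbert_space) \<Rightarrow>
   ('a \<Rightarrow> 'a) \<Rightarrow> ('b \<Rightarrow> 'b) \<Rightarrow> 'c \<Rightarrow> 'c" where
  "tensor_op H K \<tau> A B =
     (THE C. bounded_op_on UNIV C \<and> (\<forall>x\<in>H. \<forall>y\<in>K. C (\<tau> x y) = \<tau> (A x) (B y)))"

definition tensor_ops ::
  "'k set \<Rightarrow> ('k \<Rightarrow> 'a::chilbert_space set) \<Rightarrow> (('k \<Rightarrow> 'a) \<Rightarrow> 'c::chilbert_space) \<Rightarrow>
   ('k \<Rightarrow> 'a \<Rightarrow> 'a) \<Rightarrow> 'c \<Rightarrow> 'c" where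
  "tensor_ops I H \<tau> A =
     (THE C. bounded_op_on UNIV C \<and> (\<forall>x\<in>Pi I H. C (\<tau> x) = \<tau> (\<lambda>k. A k (x k))))"

text \<open>The partial trace over the middle factor, mapping operators on
  \<open>S \<otimes> (N \<otimes> E)\<close> to operators on \<open>S \<otimes> E\<close>.\<close>

definition partial_trace ::
  "('n::chilbert_space \<Rightarrow> 'c::chilbert_space \<Rightarrow> 'b::chilbert_space) \<Rightarrow>
   ('s::chilbert_space \<Rightarrow> 'b \<Rightarrow> 't::chilbert_space) \<Rightarrow>
   ('s \<Rightarrow> 'c \<Rightarrow> 'r::chilbert_space) \<Rightarrow> ('t \<Rightarrow> 't) \<Rightarrow> 'r \<Rightarrow> 'r" where
  "partial_trace \<tau>NE \<tau>SNE \<tau>SE A =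
     (THE C. bounded_op_on UNIV C \<and>
       (\<forall>B x y x' y'. is_onb UNIV B \<longrightarrow>
         ((\<lambda>e. cinner (\<tau>SNE x (\<tau>NE e y)) (A (\<tau>SNE x' (\<tau>NE e y'))))
            has_sum cinner (\<tau>SE x y) (C (\<tau>SE x' y'))) B))"


section \<open>Separable states and spectrum broadcast structure\<close>

definition product_mixture ::
  "'a::chilbert_space set \<Rightarrow> 'b::chilbert_space set \<Rightarrow> ('a \<Rightarrow> 'b \<Rightarrow> 'c::chilbert_space) \<Rightarrow>
   ('c \<Rightarrow> 'c) \<Rightarrow> bool" where
  "product_mixture H K \<tau> \<sigma> \<longleftrightarrow>
     (\<exists>(m::nat) p \<alpha> \<beta>.
        (\<forall>j<m. 0 \<le> p j \<and> density_op H (\<alpha> j) \<and> density_op K (\<beta> j)) \<and>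
        (\<Sum>j<m. p j) = 1 \<and>
        \<sigma> = (\<lambda>x. \<Sum>j<m. p j *\<^sub>R tensor_op H K \<tau> (\<alpha> j) (\<beta> j) x))"

text \<open>Trace-norm limits of mixtures of product states are density operators. In finite
  dimension the mixtures already form a closed set, so the limit adds nothing.\<close>

definition separable ::
  "'a::chilbert_space set \<Rightarrow> 'b::chilbert_space set \<Rightarrow> ('a \<Rightarrow> 'b \<Rightarrow> 'c::chilbert_space) \<Rightarrow>
   ('c \<Rightarrow> 'c) \<Rightarrow> bool" where
  "separable H K \<tau> \<sigma> \<longleftrightarrow>
     (\<exists>S. (\<forall>n::nat. product_mixture H K \<tau> (S n)) \<and>
          (\<lambda>n. trace_norm (\<lambda>x. S n x - \<sigma> x)) \<longlonglongrightarrow> 0)"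

definition SBS ::
  "('i \<Rightarrow> 's::chilbert_space) \<Rightarrow> 'k set \<Rightarrow> ('k \<Rightarrow> 'e::chilbert_space set) \<Rightarrow>
   (('k \<Rightarrow> 'e) \<Rightarrow> 'c::chilbert_space) \<Rightarrow> ('s \<Rightarrow> 'c \<Rightarrow> 'r::chilbert_space) \<Rightarrow> ('r \<Rightarrow> 'r) \<Rightarrow> bool" where
  "SBS ket I H \<tau>E \<tau>SE \<sigma> \<longleftrightarrow>
     (\<exists>(p :: 'i \<Rightarrow> real) \<rho>.
        (\<forall>i. 0 \<le> p i) \<and> (p has_sum 1) UNIV \<and>
        (\<forall>i. \<forall>k\<in>I. density_op (H k) (\<rho> i k)) \<and>
        (\<forall>x. ((\<lambda>i. p i *\<^sub>R tensor_op UNIV UNIV \<tau>SE (proj (ket i)) (tensor_ops I H \<tau>E (\<rho> i)) x)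
                has_sum \<sigma> x) UNIV) \<and>
        (\<forall>k\<in>I. \<forall>i i'. i \<noteq> i' \<longrightarrow> (\<forall>x\<in>H k. \<rho> i k (\<rho> i' k x) = 0)))"


section \<open>Pure dephasing\<close>

text \<open>\<open>\<Sum>\<^sub>i exp (- \<i> \<epsilon>\<^sub>i t) |i\<rangle>\<langle>i| \<otimes> W\<^sub>i\<close>, as a strongly convergent sum.\<close>

definition dephasing_unitary ::
  "('i \<Rightarrow> 's::chilbert_space) \<Rightarrow> 'b::chilbert_space set \<Rightarrow> ('s \<Rightarrow> 'b \<Rightarrow> 'c::chilbert_space) \<Rightarrow>
   ('i \<Rightarrow> real) \<Rightarrow> real \<Rightarrow> ('i \<Rightarrow> 'b \<Rightarrow> 'b) \<Rightarrow> 'c \<Rightarrow> 'c" where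
  "dephasing_unitary ket K \<tau> \<epsilon> t W =
     (\<lambda>x. \<Sum>\<^sub>\<infinity>i. exp (- \<i> * of_real (\<epsilon> i * t)) *\<^sub>C tensor_op UNIV K \<tau> (proj (ket i)) (W i) x)"

text \<open>The observed environments are \<open>env k\<close> for \<open>k \<in> {1..env_num}\<close>. The product vectors of
  \<open>\<Otimes>\<^sub>k H\<^sub>k\<close>, \<open>H\<^sub>n\<^sub>o\<^sub>t \<otimes> \<Otimes>\<^sub>k H\<^sub>k\<close>, \<open>H\<^sub>S \<otimes> (H\<^sub>n\<^sub>o\<^sub>t \<otimes> \<Otimes>\<^sub>k H\<^sub>k)\<close> and \<open>H\<^sub>S \<otimes> \<Otimes>\<^sub>k H\<^sub>k\<close> are given by
  \<open>tens_obs\<close>, \<open>tens_env\<close>, \<open>tens_tot\<close> and \<open>tens_red\<close>. The groups \<open>W_not i t\<close> and \<open>W_obs i k t\<close>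
  stand for \<open>exp (- \<i> V_not i t)\<close> and \<open>exp (- \<i> V_obs i k t)\<close>.\<close>

record ('i, 's, 'n, 'e, 'c, 'b, 't, 'r) dephasing =
  ket :: "'i \<Rightarrow> 's"
  env_num :: nat
  env :: "nat \<Rightarrow> 'e set"
  tens_obs :: "(nat \<Rightarrow> 'e) \<Rightarrow> 'c"
  tens_env :: "'n \<Rightarrow> 'c \<Rightarrow> 'b"
  tens_tot :: "'s \<Rightarrow> 'b \<Rightarrow> 't"
  tens_red :: "'s \<Rightarrow> 'c \<Rightarrow> 'r"
  energy :: "'i \<Rightarrow> real"
  V_not :: "'i \<Rightarrow> ('n \<times> 'n) set"
  V_obs :: "'i \<Rightarrow> nat \<Rightarrow> ('e \<times> 'e) set"
  W_not :: "'i \<Rightarrow> real \<Rightarrow> 'n \<Rightarrow> 'n"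
  W_obs :: "'i \<Rightarrow> nat \<Rightarrow> real \<Rightarrow> 'e \<Rightarrow> 'e"
  amp :: "'i \<Rightarrow> complex"
  psi0 :: 's
  R_not :: "'n \<Rightarrow> 'n"
  rho :: "nat \<Rightarrow> 'e \<Rightarrow> 'e"

definition pure_dephasing ::
  "('i, 's::chilbert_space, 'n::chilbert_space, 'e::chilbert_space, 'c::chilbert_space,
    'b::chilbert_space, 't::chilbert_space, 'r::chilbert_space) dephasing \<Rightarrow> bool" where
  "pure_dephasing M \<longleftrightarrow>
     (\<exists>i j :: 'i. i \<noteq> j) \<and>
     (\<forall>i j. cinner (ket M i) (ket M j) = (if i = j then 1 else 0)) \<and>
     closure (cspan (range (ket M))) = UNIV \<and>
     1 \<le> env_num M \<and>
     (\<exists>x :: 'n. x \<noteq> 0) \<and>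
     (\<forall>k\<in>{1..env_num M}. hspace (env M k) \<and> env M k \<noteq> {0}) \<and>
     hilbert_tensors {1..env_num M} (env M) (tens_obs M) \<and>
     hilbert_tensor UNIV UNIV (tens_env M) \<and>
     hilbert_tensor UNIV UNIV (tens_tot M) \<and>
     hilbert_tensor UNIV UNIV (tens_red M) \<and>
     (\<forall>i. self_adjoint_on UNIV (V_not M i) \<and> generates UNIV (V_not M i) (W_not M i)) \<and>
     (\<forall>i. \<forall>k\<in>{1..env_num M}. self_adjoint_on (env M k) (V_obs M i k) \<and>
        generates (env M k) (V_obs M i k) (W_obs M i k)) \<and>
     ((\<lambda>i. (cmod (amp M i))\<^sup>2) has_sum 1) UNIV \<and>
     (\<forall>i. amp M i \<noteq> 0) \<and>
     ((\<lambda>i. amp M i *\<^sub>C ket M i) has_sum psi0 M) UNIV \<and>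
     density_op UNIV (R_not M) \<and>
     (\<forall>k\<in>{1..env_num M}. density_op (env M k) (rho M k))"

text \<open>The graph of the (closed) Hamiltonian: the closure of its action on linear combinations
  of product vectors \<open>|i\<rangle> \<otimes> n \<otimes> \<Otimes>\<^sub>k x\<^sub>k\<close> whose factors lie in the domains of \<open>V_not i\<close> and
  \<open>V_obs i k\<close>.\<close>

definition hamiltonian ::
  "('i, 's::chilbert_space, 'n::chilbert_space, 'e::chilbert_space, 'c::chilbert_space,
    'b::chilbert_space, 't::chilbert_space, 'r::chilbert_space) dephasing \<Rightarrow> ('t \<times> 't) set" where
  "hamiltonian M =
     closure (module.span (\<lambda>c (u, v). (c *\<^sub>C u, c *\<^sub>C v))
       {(P n x,
         energy M i *\<^sub>R P n x + P n' x + (\<Sum>k=1..env_num M. P n (x(k := x' k)))) | P i n n' x x'.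
          P = (\<lambda>n x. tens_tot M (ket M i) (tens_env M n (tens_obs M x))) \<and>
          (n, n') \<in> V_not M i \<and> (\<forall>k\<in>{1..env_num M}. (x k, x' k) \<in> V_obs M i k)})"

definition evolution ::
  "('i, 's::chilbert_space, 'n::chilbert_space, 'e::chilbert_space, 'c::chilbert_space,
    'b::chilbert_space, 't::chilbert_space, 'r::chilbert_space) dephasing \<Rightarrow> real \<Rightarrow> 't \<Rightarrow> 't" where
  "evolution M t =
     dephasing_unitary (ket M) UNIV (tens_tot M) (energy M) t
       (\<lambda>i. tensor_op UNIV UNIV (tens_env M) (W_not M i t)
              (tensor_ops {1..env_num M} (env M) (tens_obs M) (\<lambda>k. W_obs M i k t)))"

definition total_state ::
  "('i, 's::chilbert_space, 'n::chilbert_space, 'e::chilbert_space, 'c::chilbert_space,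
    'b::chilbert_space, 't::chilbert_space, 'r::chilbert_space) dephasing \<Rightarrow> real \<Rightarrow> 't \<Rightarrow> 't" where
  "total_state M t =
     evolution M t \<circ>
     tensor_op UNIV UNIV (tens_tot M) (proj (psi0 M))
       (tensor_op UNIV UNIV (tens_env M) (R_not M)
          (tensor_ops {1..env_num M} (env M) (tens_obs M) (rho M))) \<circ>
     adj (evolution M t)"

definition reduced_state ::
  "('i, 's::chilbert_space, 'n::chilbert_space, 'e::chilbert_space, 'c::chilbert_space,
    'b::chilbert_space, 't::chilbert_space, 'r::chilbert_space) dephasing \<Rightarrow> real \<Rightarrow> 'r \<Rightarrow> 'r" where
  "reduced_state M t =
     partial_trace (tens_env M) (tens_tot M) (tens_red M) (total_state M t)"

definition R_cond ::
  "('i, 's::chilbert_space, 'n::chilbert_space, 'e::chilbert_space, 'c::chilbert_space,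
    'b::chilbert_space, 't::chilbert_space, 'r::chilbert_space) dephasing \<Rightarrow>
   real \<Rightarrow> 'i \<Rightarrow> 'n \<Rightarrow> 'n" where
  "R_cond M t i = W_not M i t \<circ> R_not M \<circ> W_not M i (- t)"

definition rho_cond ::
  "('i, 's::chilbert_space, 'n::chilbert_space, 'e::chilbert_space, 'c::chilbert_space,
    'b::chilbert_space, 't::chilbert_space, 'r::chilbert_space) dephasing \<Rightarrow>
   real \<Rightarrow> 'i \<Rightarrow> nat \<Rightarrow> 'e \<Rightarrow> 'e" where
  "rho_cond M t i k = W_obs M i k t \<circ> rho M k \<circ> W_obs M i k (- t)"

definition env_cond ::
  "('i, 's::chilbert_space, 'n::chilbert_space, 'e::chilbert_space, 'c::chilbert_space,
    'b::chilbert_space, 't::chilbert_space, 'r::chilbert_space) dephasing \<Rightarrow>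
   real \<Rightarrow> 'i \<Rightarrow> 'b \<Rightarrow> 'b" where
  "env_cond M t i =
     tensor_op UNIV UNIV (tens_env M) (R_cond M t i)
       (tensor_ops {1..env_num M} (env M) (tens_obs M) (rho_cond M t i))"

definition pair_unitary ::
  "('i, 's::chilbert_space, 'n::chilbert_space, 'e::chilbert_space, 'c::chilbert_space,
    'b::chilbert_space, 't::chilbert_space, 'r::chilbert_space) dephasing \<Rightarrow>
   real \<Rightarrow> nat \<Rightarrow> ('s \<Rightarrow> 'e \<Rightarrow> 'd::chilbert_space) \<Rightarrow> 'd \<Rightarrow> 'd" where
  "pair_unitary M t k \<tau> =
     dephasing_unitary (ket M) (env M k) \<tau> (energy M) t (\<lambda>i. W_obs M i k t)"

definition pair_state ::
  "('i, 's::chilbert_space, 'n::chilbert_space, 'e::chilbert_space, 'c::chilbert_space,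
    'b::chilbert_space, 't::chilbert_space, 'r::chilbert_space) dephasing \<Rightarrow>
   real \<Rightarrow> nat \<Rightarrow> ('s \<Rightarrow> 'e \<Rightarrow> 'd::chilbert_space) \<Rightarrow> 'd \<Rightarrow> 'd" where
  "pair_state M t k \<tau> =
     pair_unitary M t k \<tau> \<circ>
     tensor_op UNIV (env M k) \<tau> (proj (psi0 M)) (rho M k) \<circ>
     adj (pair_unitary M t k \<tau>)"

definition is_SBS ::
  "('i, 's::chilbert_space, 'n::chilbert_space, 'e::chilbert_space, 'c::chilbert_space,
    'b::chilbert_space, 't::chilbert_space, 'r::chilbert_space) dephasing \<Rightarrow>
   ('r \<Rightarrow> 'r) \<Rightarrow> bool" where
  "is_SBS M \<sigma> \<longleftrightarrow> SBS (ket M) {1..env_num M} (env M) (tens_obs M) (tens_red M) \<sigma>"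

end

(*
  Tensor products of operators exist and are positive because of Schur's product theorem for
  positive semidefinite kernels.  The evolution acts on |i> (x) y as exp(-i eps_i t) |i> (x) W_i y.
  Its generator is the closure of its restriction to product vectors, because these span a dense
  invariant subspace.

  If the total state is separable, then its partial transpose is positive (Peres).  The blocks of
  the partial transpose that belong to i and j, tested on the vectors (W_j e, - W_i e), give
  nonnegative numbers whose sum over an orthonormal basis is 1 - 2 + 1 = 0, by invariance of the
  trace.  Hence these vectors lie in the kernel of the partial transpose, which says that
  W_i R W_i* = W_j R W_j*.

  The diagonal blocks of the reduced state are |a_i|^2 times a product of the conditional states;
  if it is an SBS state, then the conditional states of an environment k are its SBS components,
  and if they coincide they satisfy rho^2 = 0, which contradicts tr rho = 1.

  The condition is not sufficient: take W_i proportional to the Pauli matrices 1, X, Z and the maximally mixed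
  qubit: all conditional states agree, but the partial transpose is not positive.
*)
theory Submission
  imports Defs "HOL-Library.Complex_Order"
begin

section \<open>Inner products\<close>

text \<open>The operators \<open>tensor_op\<close>, \<open>tensor_ops\<close>, \<open>adj\<close>
  and \<open>partial_trace\<close> are definite descriptions, and \<open>dephasing_unitary\<close>
  is an unconditional infinite sum, so none of them can be computed with before existence and
  uniqueness are known, in spaces of any dimension. Uniqueness comes from the density of product
  vectors. Existence of a product operator asks for a norm bound on arbitrary finite sums of product
  vectors. Such a bound says that a difference of Gram kernels is positive; for products of kernels
  this difference is (K - L) K' + L (K' - L'), to which Schur's theorem applies. The same theorem
  compares the traces of a positive operator in two bases and gives the sign of the partial
  transpose on product states. The minus sign in the test vectors makes both cross terms equal to -
  <e, R e>, since \<open>W' i\<close> cancels \<open>W i\<close> in them whatever the relation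
  between \<open>W i\<close> and \<open>W j\<close>; the two remaining terms are diagonal elements
  of R in rotated bases. Phases and amplitudes can be divided out of the test vectors because no
  amplitude is 0.\<close>

interpretation cvs: vector_space "scaleC :: complex \<Rightarrow> 'a::chilbert_space \<Rightarrow> 'a"
  \<comment> \<open>The class has no axiom for the scalar 1; \<open>1 *\<^sub>C x = x\<close> is
    obtained from the real scalar 1.\<close>
  using scaleR_scaleC[of 1, symmetric]
  by unfold_locales (auto simp: scaleC_add_right scaleC_add_left scaleC_scaleC)

lemma cinner_add_left: "cinner (x + y) z = cinner x z + cinner y z"
  by (metis cinner_add_right cinner_commute complex_cnj_add)

lemma cinner_scaleC_left: "cinner (c *\<^sub>C x) y = cnj c * cinner x y"
  by (metis cinner_commute cinner_scaleC_right complex_cnj_mult)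

lemma cinner_zero_left [simp]: "cinner 0 x = 0"
  using cinner_scaleC_left[of 0 0 x] by simp

lemma cinner_zero_right [simp]: "cinner x 0 = 0"
  using cinner_scaleC_right[of x 0 0] by simp

lemma cinner_minus_left: "cinner (- x) y = - cinner x y"
  using cinner_add_left[of x "- x" y] by (simp add: add_eq_0_iff)

lemma cinner_minus_right: "cinner x (- y) = - cinner x y"
  using cinner_add_right[of x y "- y"] by (simp add: add_eq_0_iff)

lemma cinner_diff_left: "cinner (x - y) z = cinner x z - cinner y z"
  by (simp only: diff_conv_add_uminus cinner_add_left cinner_minus_left)

lemma cinner_diff_right: "cinner x (y - z) = cinner x y - cinner x z"
  by (simp only: diff_conv_add_uminus cinner_add_right cinner_minus_right)

lemma cinner_sum_left: "cinner (\<Sum>i\<in>F. f i) y = (\<Sum>i\<in>F. cinner (f i) y)"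
  by (induction F rule: infinite_finite_induct) (auto simp: cinner_add_left)

lemma cinner_sum_right: "cinner x (\<Sum>i\<in>F. f i) = (\<Sum>i\<in>F. cinner x (f i))"
  by (induction F rule: infinite_finite_induct) (auto simp: cinner_add_right)

lemmas cinner_simps = cinner_add_left cinner_add_right cinner_diff_left cinner_diff_right
  cinner_scaleC_left cinner_scaleC_right cinner_minus_left cinner_minus_right

lemma cinner_scaleR_left: "cinner (r *\<^sub>R x) y = of_real r * cinner x y"
  by (simp add: scaleR_scaleC cinner_scaleC_left)

lemma cinner_scaleR_right: "cinner x (r *\<^sub>R y) = of_real r * cinner x y"
  by (simp add: scaleR_scaleC cinner_scaleC_right)

lemma cinner_self_eq_0_iff [simp]: "cinner x x = 0 \<longleftrightarrow> x = 0"
  by (simp add: cinner_self)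

lemma norm_power2_cinner: "(norm x)\<^sup>2 = Re (cinner x x)"
  by (simp add: cinner_self)

lemma norm_scaleC: "norm (c *\<^sub>C x) = cmod c * norm (x::'a::chilbert_space)"
proof -
  have "cinner (c *\<^sub>C x) (c *\<^sub>C x) = (c * cnj c) * cinner x x"
    by (simp add: cinner_scaleC_left cinner_scaleC_right)
  then have "complex_of_real ((norm (c *\<^sub>C x))\<^sup>2) = complex_of_real ((cmod c * norm x)\<^sup>2)"
    unfolding cinner_self complex_norm_square[symmetric] by (simp add: power_mult_distrib)
  then have "(norm (c *\<^sub>C x))\<^sup>2 = (cmod c * norm x)\<^sup>2"
    by (simp only: of_real_eq_iff)
  then show ?thesis by simp
qed

lemma cinner_eqI: "(\<And>z. cinner z x = cinner z y) \<Longrightarrow> x = y"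
  by (metis cinner_diff_right cinner_self_eq_0_iff eq_iff_diff_eq_0)

lemma norm_add_power2: "(norm (x + y))\<^sup>2 = (norm x)\<^sup>2 + (norm y)\<^sup>2 + 2 * Re (cinner x y)"
  for x y :: "'a::chilbert_space"
proof -
  have "Re (cinner y x) = Re (cinner x y)"
    by (subst cinner_commute) simp
  then show ?thesis by (simp add: norm_power2_cinner cinner_simps)
qed

lemma norm_diff_power2: "(norm (x - y))\<^sup>2 = (norm x)\<^sup>2 + (norm y)\<^sup>2 - 2 * Re (cinner x y)"
  for x y :: "'a::chilbert_space"
  using norm_add_power2[of x "- y"] by (simp add: cinner_simps)

text \<open>Pythagoras for \<open>y = c *\<^sub>C x + (y - c *\<^sub>C x)\<close>, where
  \<open>c\<close> is the coefficient that makes the second part orthogonal to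
  \<open>x\<close>.\<close>

lemma cinner_Cauchy_Schwarz: "cmod (cinner x y) \<le> norm x * norm y"
proof (cases "x = 0")
  case False
  define c where "c = cinner x y / of_real ((norm x)\<^sup>2)"
  have n: "norm x \<noteq> 0" using False by simp
  have "cinner x (y - c *\<^sub>C x) = 0"
    using n by (simp add: cinner_simps cinner_self c_def)
  then have "(norm y)\<^sup>2 = (norm (y - c *\<^sub>C x))\<^sup>2 + (norm (c *\<^sub>C x))\<^sup>2"
    using norm_add_power2[of "c *\<^sub>C x" "y - c *\<^sub>C x"] by (simp add: cinner_scaleC_left)
  then have "(cmod c * norm x)\<^sup>2 \<le> (norm y)\<^sup>2"
    by (simp add: norm_scaleC)
  then have "cmod c * norm x \<le> norm y"
    by (rule power2_le_imp_le) simp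
  moreover have "cmod c * norm x * norm x = cmod (cinner x y)"
    using n by (simp add: c_def norm_divide norm_mult power2_eq_square)
  ultimately show ?thesis
    by (metis mult.commute mult_right_mono norm_ge_zero)
qed simp

lemma bounded_bilinear_cinner: "bounded_bilinear (cinner :: 'a::chilbert_space \<Rightarrow> _)"
proof
  show "\<exists>K. \<forall>a b::'a. cmod (cinner a b) \<le> norm a * norm b * K"
    using cinner_Cauchy_Schwarz by (intro exI[of _ 1]) auto
qed (auto simp: cinner_simps cinner_scaleR_left cinner_scaleR_right scaleR_conv_of_real)

interpretation cinner: bounded_bilinear "cinner :: 'a::chilbert_space \<Rightarrow> 'a \<Rightarrow> complex"
  by (rule bounded_bilinear_cinner)

lemma bounded_bilinear_scaleC: "bounded_bilinear (scaleC :: complex \<Rightarrow> 'a::chilbert_space \<Rightarrow> 'a)"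
proof
  show "\<exists>K. \<forall>a. \<forall>b::'a. norm (a *\<^sub>C b) \<le> norm a * norm b * K"
    by (intro exI[of _ 1]) (auto simp: norm_scaleC)
qed (auto simp: scaleC_add_right scaleC_add_left scaleR_scaleC[where 'a='a] scaleC_scaleC
    scaleR_conv_of_real mult_ac)

interpretation scaleC: bounded_bilinear "scaleC :: complex \<Rightarrow> 'a::chilbert_space \<Rightarrow> 'a"
  by (rule bounded_bilinear_scaleC)

text \<open>Norm bounds on spans are turned into positivity of Gram kernels through this
  identity.\<close>

lemma norm_sum_power2:
  "of_real ((norm (\<Sum>i\<in>F. c i *\<^sub>C f i))\<^sup>2) =
     (\<Sum>i\<in>F. \<Sum>j\<in>F. cnj (c i) * cinner (f i) (f j) * c j)"
  unfolding cinner_self[symmetric] cinner_sum_left cinner_sum_right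
  by (subst sum.swap) (simp add: cinner_simps mult_ac)


subsection \<open>Products of Hilbert spaces\<close>

text \<open>Direct sums serve two purposes: graphs of operators become closed subspaces of a Hilbert
  space, and 2 by 2 operator matrices become operators.\<close>

instantiation prod :: (chilbert_space, chilbert_space) chilbert_space
begin

definition scaleC_prod :: "complex \<Rightarrow> 'a \<times> 'b \<Rightarrow> 'a \<times> 'b" where
  "scaleC_prod c x = (c *\<^sub>C fst x, c *\<^sub>C snd x)"

definition cinner_prod :: "'a \<times> 'b \<Rightarrow> 'a \<times> 'b \<Rightarrow> complex" where
  "cinner_prod x y = cinner (fst x) (fst y) + cinner (snd x) (snd y)"

instance
proof
  fix x y :: "'a \<times> 'b"
  show "cinner x y = cnj (cinner y x)"
    using cinner_commute[of "fst x" "fst y"] cinner_commute[of "snd x" "snd y"]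
    by (simp add: cinner_prod_def)
  show "cinner x x = complex_of_real ((norm x)\<^sup>2)"
    by (simp only: cinner_prod_def cinner_self norm_prod_def real_sqrt_pow2 sum_power2_ge_zero
        of_real_add)
qed (auto simp: scaleC_prod_def cinner_prod_def scaleR_scaleC scaleC_add_right scaleC_add_left
      scaleC_scaleC cinner_simps algebra_simps intro!: prod_eqI)

end

subsection \<open>Closed subspaces\<close>

lemma csubspace_UNIV [simp]: "csubspace UNIV"
  by (rule cvs.subspace_UNIV)

lemma hspace_UNIV [simp]: "hspace UNIV"
  by (simp add: hspace_def)

lemma csubspaceD:
  assumes "csubspace H"
  shows csubspace_0: "0 \<in> H"
    and csubspace_add: "x \<in> H \<Longrightarrow> y \<in> H \<Longrightarrow> x + y \<in> H"
    and csubspace_scaleC: "x \<in> H \<Longrightarrow> c *\<^sub>C x \<in> H"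
    and csubspace_diff: "x \<in> H \<Longrightarrow> y \<in> H \<Longrightarrow> x - y \<in> H"
    and csubspace_scaleR: "x \<in> H \<Longrightarrow> r *\<^sub>R x \<in> H"
    and csubspace_sum: "(\<And>i. i \<in> F \<Longrightarrow> f i \<in> H) \<Longrightarrow> sum f F \<in> H"
  using assms cvs.subspace_diff[of H] cvs.subspace_sum[of H F f]
  by (simp_all add: cvs.subspace_0 cvs.subspace_add cvs.subspace_scale scaleR_scaleC)

lemma csubspace_closure:
  assumes "csubspace (H::'a::chilbert_space set)"
  shows "csubspace (closure H)"
proof (rule cvs.subspaceI)
  show "0 \<in> closure H"
    using csubspace_0[OF assms] closure_subset by blast
next
  fix x y assume "x \<in> closure H" "y \<in> closure H"
  then obtain f g where "\<And>n::nat. f n \<in> H" "f \<longlonglongrightarrow> x" "\<And>n::nat. g n \<in> H" "g \<longlonglongrightarrow> y"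
    by (metis closure_sequential)
  then show "x + y \<in> closure H"
    unfolding closure_sequential
    by (intro exI[of _ "\<lambda>n. f n + g n"]) (auto intro: csubspace_add[OF assms] tendsto_add)
next
  fix c x assume "x \<in> closure H"
  then obtain f where "\<And>n::nat. f n \<in> H" "f \<longlonglongrightarrow> x"
    by (metis closure_sequential)
  then show "c *\<^sub>C x \<in> closure H"
    unfolding closure_sequential
    by (intro exI[of _ "\<lambda>n. c *\<^sub>C f n"])
      (auto intro: csubspace_scaleC[OF assms] scaleC.tendsto)
qed

lemma hspace_closure: "csubspace H \<Longrightarrow> hspace (closure H)"
  by (simp add: hspace_def csubspace_closure)

lemma closure_cspan_minimal: "hspace H \<Longrightarrow> S \<subseteq> H \<Longrightarrow> closure (cspan S) \<subseteq> H"
  by (metis hspace_def cvs.span_minimal closure_minimal)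

lemma hspace_closure_cspan: "hspace (closure (cspan S))"
  by (intro hspace_closure cvs.subspace_span)

lemma in_closure_cspan: "x \<in> S \<Longrightarrow> x \<in> closure (cspan S)"
  using closure_subset cvs.span_base by blast

lemma hspace_Collect_cinner_right: "hspace {x. cinner a x = 0}"
proof -
  have "closed {x. cinner a x = 0}"
    by (intro closed_Collect_eq continuous_intros cinner.continuous_on)
  then show ?thesis
    by (auto simp: hspace_def cinner_simps intro!: cvs.subspaceI)
qed

lemma cinner_eqI_dense:
  assumes "UNIV \<subseteq> closure (cspan S)" "\<And>s. s \<in> S \<Longrightarrow> cinner s x = cinner s y"
  shows "x = y"
proof -
  have "S \<subseteq> {s. cinner (x - y) s = 0}"
    using assms(2) by (auto simp: cinner_simps) (metis cinner_commute)
  then have "x - y \<in> {s. cinner (x - y) s = 0}"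
    using closure_cspan_minimal[OF hspace_Collect_cinner_right] assms(1) by blast
  then show ?thesis by simp
qed

section \<open>Positive semidefinite kernels\<close>

text \<open>Positive semidefinite matrices over an arbitrary index type, so that vectors or families
  of vectors can be indices; the sums are meaningful for finite \<open>F\<close>. In the order of
  the complex numbers \<open>0 \<le> z\<close> also says that \<open>z\<close> is real.\<close>

definition psd_kernel :: "'i set \<Rightarrow> ('i \<Rightarrow> 'i \<Rightarrow> complex) \<Rightarrow> bool" where
  "psd_kernel F K \<longleftrightarrow> (\<forall>i\<in>F. \<forall>j\<in>F. K j i = cnj (K i j)) \<and>
     (\<forall>c. 0 \<le> (\<Sum>i\<in>F. \<Sum>j\<in>F. cnj (c i) * K i j * c j))"

lemma psd_kernelI:
  assumes "\<And>i j. i \<in> F \<Longrightarrow> j \<in> F \<Longrightarrow> K j i = cnj (K i j)"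
    and "\<And>c. 0 \<le> (\<Sum>i\<in>F. \<Sum>j\<in>F. cnj (c i) * K i j * c j)"
  shows "psd_kernel F K"
  unfolding psd_kernel_def using assms by blast

lemma psd_kernel_hermitian: "psd_kernel F K \<Longrightarrow> i \<in> F \<Longrightarrow> j \<in> F \<Longrightarrow> K j i = cnj (K i j)"
  unfolding psd_kernel_def by blast

lemma psd_kernel_nonneg: "psd_kernel F K \<Longrightarrow> 0 \<le> (\<Sum>i\<in>F. \<Sum>j\<in>F. cnj (c i) * K i j * c j)"
  unfolding psd_kernel_def by blast

lemma psd_kernel_cong:
  "(\<And>i j. i \<in> F \<Longrightarrow> j \<in> F \<Longrightarrow> K i j = L i j) \<Longrightarrow> psd_kernel F K \<longleftrightarrow> psd_kernel F L"
  by (simp add: psd_kernel_def cong: sum.cong)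

lemma psd_kernel_subset:
  assumes "psd_kernel F K" "finite F" "G \<subseteq> F"
  shows "psd_kernel G K"
proof (rule psd_kernelI)
  fix c
  have "0 \<le> (\<Sum>i\<in>F. \<Sum>j\<in>F. cnj (if i \<in> G then c i else 0) * K i j * (if j \<in> G then c j else 0))"
    by (rule psd_kernel_nonneg[OF assms(1)])
  also have "\<dots> = (\<Sum>i\<in>G. \<Sum>j\<in>G. cnj (c i) * K i j * c j)"
    using assms(2,3) by (intro sum.mono_neutral_cong_right) (auto intro!: sum.mono_neutral_cong_right)
  finally show "0 \<le> (\<Sum>i\<in>G. \<Sum>j\<in>G. cnj (c i) * K i j * c j)" .
qed (use assms in \<open>auto intro: psd_kernel_hermitian\<close>)

lemma psd_kernel_diag:
  assumes "psd_kernel F K" "finite F" "i \<in> F"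
  shows "0 \<le> K i i"
proof -
  have "psd_kernel {i} K"
    using assms by (intro psd_kernel_subset[OF assms(1,2)]) auto
  from psd_kernel_nonneg[OF this, of "\<lambda>_. 1"] show ?thesis by simp
qed

text \<open>If the diagonal entry vanishes, the form on vectors with entries t at \<open>a\<close>
  and 1 at \<open>j\<close> is affine in the real and imaginary part of t, so it is unbounded below
  unless \<open>K a j = 0\<close>.\<close>

lemma psd_kernel_zero_row:
  assumes "psd_kernel F K" "finite F" "a \<in> F" "j \<in> F" "K a a = 0"
  shows "K a j = 0"
proof (rule ccontr)
  assume nz: "K a j \<noteq> 0"
  then have "a \<noteq> j" using assms(5) by auto
  have psd: "psd_kernel {a, j} K"
    by (rule psd_kernel_subset[OF assms(1,2)]) (use assms(3,4) in simp)
  \<comment> \<open>With this \<open>s\<close> the form at the vector with entries \<open>t\<close>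
    and 1 has real part - 1.\<close>
  define s where "s = (Re (K j j) + 1) / (2 * (cmod (K a j))\<^sup>2)"
  define t where "t = - of_real s * K a j"
  have z: "cnj t * K a j = - of_real (s * (cmod (K a j))\<^sup>2)"
    "cnj (K a j) * t = - of_real (s * (cmod (K a j))\<^sup>2)"
    unfolding t_def of_real_mult complex_norm_square
    by (simp_all only: complex_cnj_minus complex_cnj_mult complex_cnj_complex_of_real
        mult_minus_left mult_minus_right mult_ac)
  have s: "s * (cmod (K a j))\<^sup>2 = (Re (K j j) + 1) / 2"
    using nz by (simp add: s_def)
  have "K j a = cnj (K a j)"
    using assms(1,3,4) by (rule psd_kernel_hermitian)
  then have "(\<Sum>x\<in>{a, j}. \<Sum>y\<in>{a, j}. cnj (if x = a then t else 1) * K x y * (if y = a then t else 1)) =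
      K j j + cnj t * K a j + cnj (K a j) * t"
    using \<open>a \<noteq> j\<close> assms(5) by simp
  also have "\<dots> = K j j - of_real (Re (K j j) + 1)"
    unfolding z s by simp
  finally have "0 \<le> K j j - of_real (Re (K j j) + 1)"
    using psd_kernel_nonneg[OF psd, of "\<lambda>x. if x = a then t else 1"] by simp
  then show False by (simp add: less_eq_complex_def)
qed

text \<open>Cholesky elimination of one index at a time: \<open>K\<close> is a rank one kernel plus a positive
  kernel that vanishes on the row and the column of that index.\<close>

lemma psd_kernel_sum_mult_nonneg:
  assumes "finite F" "psd_kernel F K" "psd_kernel F L"
  shows "0 \<le> (\<Sum>i\<in>F. \<Sum>j\<in>F. K i j * L i j)"
  using assms
proof (induction F arbitrary: K rule: finite_induct)
  case (insert a F)
  let ?G = "insert a F"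
  have fin: "finite ?G" using insert.hyps by simp
  have herm: "K j i = cnj (K i j)" if "i \<in> ?G" "j \<in> ?G" for i j
    using insert.prems(1) that by (rule psd_kernel_hermitian)
  have k0: "0 \<le> K a a"
    by (rule psd_kernel_diag[OF insert.prems(1) fin]) simp
  define k where "k = Re (K a a)"
  have Kaa: "K a a = of_real k" and k: "0 \<le> k"
    using k0 by (auto simp: k_def less_eq_complex_def complex_eq_iff)
  define K' where "K' = (\<lambda>i j. K i j - K i a * K a j / K a a)"
  have row: "K' a j = 0" if "j \<in> ?G" for j
    using psd_kernel_zero_row[OF insert.prems(1) fin _ that] by (auto simp: K'_def)
  have col: "K' i a = 0" if "i \<in> ?G" for i
    using psd_kernel_zero_row[OF insert.prems(1) fin _ that] herm[of a i] that by (auto simp: K'_def)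
  have "psd_kernel F K'"
  proof (rule psd_kernelI)
    fix i j assume "i \<in> F" "j \<in> F"
    then show "K' j i = cnj (K' i j)"
      using herm[of i j] herm[of i a] herm[of a j] by (simp add: K'_def Kaa mult_ac)
  next
    fix c
    define S where "S = (\<Sum>j\<in>F. K a j * c j)"
    \<comment> \<open>For \<open>K a a \<noteq> 0\<close> the value at \<open>a\<close> minimises
      the form of \<open>K\<close> in that coordinate, and the minimum is the form of the Schur
      complement \<open>K'\<close> at \<open>c\<close>. If \<open>K a a = 0\<close>, division makes
      this value 0 and \<open>K' = K\<close>.\<close>
    define c' where "c' = (\<lambda>i. if i = a then - S / K a a else c i)"
    have S': "(\<Sum>i\<in>F. cnj (c i) * K i a) = cnj S"
      unfolding S_def cnj_sum
    proof (rule sum.cong)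
      fix i assume "i \<in> F"
      then show "cnj (c i) * K i a = cnj (K a i * c i)"
        using herm[of a i] by simp
    qed simp
    have "(\<Sum>i\<in>F. \<Sum>j\<in>F. cnj (c i) * K' i j * c j) =
        (\<Sum>i\<in>F. \<Sum>j\<in>F. cnj (c i) * K i j * c j) - (\<Sum>i\<in>F. \<Sum>j\<in>F. (cnj (c i) * K i a) * (K a j * c j)) / K a a"
      by (simp add: K'_def sum_subtractf algebra_simps sum_divide_distrib)
    also have "(\<Sum>i\<in>F. \<Sum>j\<in>F. (cnj (c i) * K i a) * (K a j * c j)) = cnj S * S"
      by (simp add: sum_distrib_left[symmetric] sum_distrib_right[symmetric] S_def[symmetric] S')
    also have "(\<Sum>i\<in>F. \<Sum>j\<in>F. cnj (c i) * K i j * c j) - cnj S * S / K a a =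
        (\<Sum>i\<in>?G. \<Sum>j\<in>?G. cnj (c' i) * K i j * c' j)"
    proof -
      have c': "c' a = - S / K a a" "\<And>i. i \<in> F \<Longrightarrow> c' i = c i"
        using insert.hyps by (auto simp: c'_def)
      have "(\<Sum>j\<in>F. cnj (c' a) * K a j * c' j) = cnj (c' a) * S"
        unfolding S_def sum_distrib_left by (rule sum.cong) (auto simp: c'(2) mult_ac)
      moreover have "(\<Sum>i\<in>F. cnj (c' i) * K i a * c' a) = cnj S * c' a"
        unfolding S'[symmetric] sum_distrib_right by (rule sum.cong) (auto simp: c'(2) mult_ac)
      moreover have "(\<Sum>i\<in>F. \<Sum>j\<in>F. cnj (c' i) * K i j * c' j) = (\<Sum>i\<in>F. \<Sum>j\<in>F. cnj (c i) * K i j * c j)"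
        by (simp add: c'(2) cong: sum.cong)
      ultimately have "(\<Sum>i\<in>?G. \<Sum>j\<in>?G. cnj (c' i) * K i j * c' j) =
          cnj (c' a) * K a a * c' a + cnj (c' a) * S + (cnj S * c' a + (\<Sum>i\<in>F. \<Sum>j\<in>F. cnj (c i) * K i j * c j))"
        using insert.hyps by (simp add: sum.distrib add_ac)
      then show ?thesis
        by (cases "k = 0") (auto simp: c'(1) Kaa)
    qed
    finally show "0 \<le> (\<Sum>i\<in>F. \<Sum>j\<in>F. cnj (c i) * K' i j * c j)"
      using psd_kernel_nonneg[OF insert.prems(1), of c'] by simp
  qed
  moreover have "psd_kernel F L"
    by (rule psd_kernel_subset[OF insert.prems(2) fin]) auto
  ultimately have *: "0 \<le> (\<Sum>i\<in>F. \<Sum>j\<in>F. K' i j * L i j)"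
    by (rule insert.IH)
  have "(\<Sum>i\<in>?G. \<Sum>j\<in>?G. K i j * L i j) =
      (\<Sum>i\<in>?G. \<Sum>j\<in>?G. K' i j * L i j) + (\<Sum>i\<in>?G. \<Sum>j\<in>?G. cnj (K a i) * L i j * K a j) / K a a"
  proof -
    \<comment> \<open>The sum of the rank one part against \<open>L\<close> is the form of
      \<open>L\<close> at the vector \<open>K a\<close>, divided by \<open>K a a\<close>.\<close>
    have "K i j * L i j = K' i j * L i j + cnj (K a i) * L i j * K a j / K a a" if "i \<in> ?G" "j \<in> ?G" for i j
      using herm[of a i] that by (simp add: K'_def algebra_simps)
    then have "(\<Sum>i\<in>?G. \<Sum>j\<in>?G. K i j * L i j) =
        (\<Sum>i\<in>?G. \<Sum>j\<in>?G. K' i j * L i j + cnj (K a i) * L i j * K a j / K a a)"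
      by (intro sum.cong refl)
    then show ?thesis
      by (simp only: sum.distrib sum_divide_distrib)
  qed
  also have "(\<Sum>i\<in>?G. \<Sum>j\<in>?G. K' i j * L i j) = (\<Sum>i\<in>F. \<Sum>j\<in>F. K' i j * L i j)"
    using insert.hyps row col by simp
  finally have eq: "(\<Sum>i\<in>?G. \<Sum>j\<in>?G. K i j * L i j) =
      (\<Sum>i\<in>F. \<Sum>j\<in>F. K' i j * L i j) + (\<Sum>i\<in>?G. \<Sum>j\<in>?G. cnj (K a i) * L i j * K a j) / K a a" .
  have "0 \<le> (\<Sum>i\<in>?G. \<Sum>j\<in>?G. cnj (K a i) * L i j * K a j) / K a a"
    using psd_kernel_nonneg[OF insert.prems(2), of "K a"] k unfolding Kaa
    by (auto simp: less_eq_complex_def)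
  with * show ?case unfolding eq by (rule add_nonneg_nonneg)
qed simp

text \<open>Schur's product theorem: the form of the product at \<open>c\<close> is the plain double
  sum of \<open>K\<close> against \<open>cnj (c i) * L i j * c j\<close>, which is again a positive
  kernel.\<close>

lemma psd_kernel_mult:
  assumes "finite F" "psd_kernel F K" "psd_kernel F L"
  shows "psd_kernel F (\<lambda>i j. K i j * L i j)"
proof (rule psd_kernelI)
  fix i j assume "i \<in> F" "j \<in> F"
  then show "K j i * L j i = cnj (K i j * L i j)"
    using psd_kernel_hermitian[OF assms(2), of i j] psd_kernel_hermitian[OF assms(3), of i j] by simp
next
  fix c
  have "psd_kernel F (\<lambda>i j. cnj (c i) * L i j * c j)"
  proof (rule psd_kernelI)
    fix i j assume "i \<in> F" "j \<in> F"
    then show "cnj (c j) * L j i * c i = cnj (cnj (c i) * L i j * c j)"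
      using psd_kernel_hermitian[OF assms(3), of i j] by simp
  next
    fix d
    show "0 \<le> (\<Sum>i\<in>F. \<Sum>j\<in>F. cnj (d i) * (cnj (c i) * L i j * c j) * d j)"
      using psd_kernel_nonneg[OF assms(3), of "\<lambda>i. c i * d i"] by (simp add: mult_ac)
  qed
  from psd_kernel_sum_mult_nonneg[OF assms(1,2) this]
  show "0 \<le> (\<Sum>i\<in>F. \<Sum>j\<in>F. cnj (c i) * (K i j * L i j) * c j)"
    by (simp add: mult_ac)
qed

lemma psd_kernel_add:
  assumes "psd_kernel F K" "psd_kernel F L"
  shows "psd_kernel F (\<lambda>i j. K i j + L i j)"
proof (rule psd_kernelI)
  fix i j assume "i \<in> F" "j \<in> F"
  then show "K j i + L j i = cnj (K i j + L i j)"
    using psd_kernel_hermitian[OF assms(1), of i j] psd_kernel_hermitian[OF assms(2), of i j] by simp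
next
  fix c
  show "0 \<le> (\<Sum>i\<in>F. \<Sum>j\<in>F. cnj (c i) * (K i j + L i j) * c j)"
    using add_nonneg_nonneg[OF psd_kernel_nonneg[OF assms(1), of c] psd_kernel_nonneg[OF assms(2), of c]]
    by (simp add: sum.distrib algebra_simps)
qed

lemma mult_cnj_nonneg: "0 \<le> z * cnj z"
  unfolding complex_norm_square[symmetric] by (simp add: less_eq_complex_def)

lemma psd_kernel_const: "0 \<le> r \<Longrightarrow> psd_kernel F (\<lambda>i j. r)"
proof (rule psd_kernelI)
  fix c assume "0 \<le> r"
  have "(\<Sum>i\<in>F. \<Sum>j\<in>F. cnj (c i) * r * c j) = r * ((\<Sum>i\<in>F. c i) * cnj (\<Sum>i\<in>F. c i))"
    by (simp add: sum_distrib_left sum_distrib_right mult_ac)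
  also have "0 \<le> \<dots>"
    using \<open>0 \<le> r\<close> by (intro mult_nonneg_nonneg mult_cnj_nonneg)
  finally show "0 \<le> (\<Sum>i\<in>F. \<Sum>j\<in>F. cnj (c i) * r * c j)" .
qed (simp add: less_eq_complex_def complex_eq_iff)

lemma psd_kernel_cinner: "psd_kernel F (\<lambda>i j. cinner (f i) (f j))"
  by (rule psd_kernelI) (auto simp: norm_sum_power2[symmetric] less_eq_complex_def intro: cinner_commute)

lemma psd_kernel_prod:
  assumes "finite F" "\<And>k. k \<in> I \<Longrightarrow> psd_kernel F (K k)"
  shows "psd_kernel F (\<lambda>i j. \<Prod>k\<in>I. K k i j)"
  using assms(2)
proof (induction I rule: infinite_finite_induct)
  case (insert k I)
  then show ?case by (simp add: psd_kernel_mult assms(1))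
qed (simp_all add: psd_kernel_const less_eq_complex_def)

text \<open>K K' - L L' = (K - L) K' + L (K' - L'), and both products are positive by Schur.\<close>

lemma psd_kernel_mult_diff:
  assumes "finite F" "psd_kernel F (\<lambda>i j. K i j - L i j)" "psd_kernel F (\<lambda>i j. K' i j - L' i j)"
    "psd_kernel F K'" "psd_kernel F L"
  shows "psd_kernel F (\<lambda>i j. K i j * K' i j - L i j * L' i j)"
  using psd_kernel_add[OF psd_kernel_mult[OF assms(1,2,4)] psd_kernel_mult[OF assms(1,5,3)]]
  by (simp add: algebra_simps)

lemma psd_kernel_prod_diff:
  assumes "finite F" "\<And>k. k \<in> I \<Longrightarrow> psd_kernel F (\<lambda>i j. K k i j - L k i j)"
    "\<And>k. k \<in> I \<Longrightarrow> psd_kernel F (K k)" "\<And>k. k \<in> I \<Longrightarrow> psd_kernel F (L k)"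
  shows "psd_kernel F (\<lambda>i j. (\<Prod>k\<in>I. K k i j) - (\<Prod>k\<in>I. L k i j))"
  using assms(2-)
proof (induction I rule: infinite_finite_induct)
  case (insert k I)
  then show ?case
    by (auto intro!: psd_kernel_mult_diff psd_kernel_prod assms(1))
qed (auto intro: psd_kernel_const[of 0, simplified])


section \<open>Bounded linear maps\<close>

definition bounded_clinear :: "('a::chilbert_space \<Rightarrow> 'b::chilbert_space) \<Rightarrow> bool" where
  "bounded_clinear f \<longleftrightarrow> (\<forall>x y. f (x + y) = f x + f y) \<and> (\<forall>c x. f (c *\<^sub>C x) = c *\<^sub>C f x) \<and>
     (\<exists>K. \<forall>x. norm (f x) \<le> K * norm x)"

lemma bounded_op_on_UNIV: "bounded_op_on UNIV A \<longleftrightarrow> bounded_clinear A"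
  by (simp add: bounded_op_on_def bounded_clinear_def)

lemma bounded_clinearD:
  assumes "bounded_clinear f"
  shows bounded_clinear_add: "f (x + y) = f x + f y"
    and bounded_clinear_scaleC: "f (c *\<^sub>C x) = c *\<^sub>C f x"
    and bounded_clinear_zero: "f 0 = 0"
    and bounded_clinear_minus: "f (- x) = - f x"
    and bounded_clinear_diff: "f (x - y) = f x - f y"
    and bounded_clinear_scaleR: "f (r *\<^sub>R x) = r *\<^sub>R f x"
    and bounded_clinear_sum: "f (\<Sum>i\<in>F. g i) = (\<Sum>i\<in>F. f (g i))"
    and bounded_clinear_bounded_linear: "bounded_linear f"
proof -
  show add: "f (x + y) = f x + f y" for x y
    using assms by (simp add: bounded_clinear_def)
  show scaleC: "f (c *\<^sub>C x) = c *\<^sub>C f x" for c x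
    using assms by (simp add: bounded_clinear_def)
  show scaleR: "f (r *\<^sub>R x) = r *\<^sub>R f x" for r x
    by (simp add: scaleR_scaleC scaleC)
  show zero: "f 0 = 0"
    using scaleC[of 0 0] by simp
  show minus: "f (- x) = - f x" for x
    using scaleC[of "-1" x] by simp
  show "f (x - y) = f x - f y"
    using add[of x "- y"] minus by simp
  show "f (\<Sum>i\<in>F. g i) = (\<Sum>i\<in>F. f (g i))"
    by (induction F rule: infinite_finite_induct) (auto simp: zero add)
  obtain K where "\<And>x. norm (f x) \<le> K * norm x"
    using assms by (auto simp: bounded_clinear_def)
  then show "bounded_linear f"
    by (intro bounded_linear_intro[of _ K]) (auto simp: add scaleR mult.commute)
qed

lemma hspace_Collect_eq:
  assumes "bounded_clinear f" "bounded_clinear g"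
  shows "hspace {x. f x = g x}"
proof -
  have "closed {x. f x = g x}"
    using assms[THEN bounded_clinear_bounded_linear]
    by (intro closed_Collect_eq linear_continuous_on)
  then show ?thesis
    using assms by (auto simp: hspace_def bounded_clinearD intro!: cvs.subspaceI)
qed

lemma bounded_clinear_eqI:
  assumes "bounded_clinear f" "bounded_clinear g" "UNIV \<subseteq> closure (cspan S)"
    "\<And>x. x \<in> S \<Longrightarrow> f x = g x"
  shows "f = g"
  using closure_cspan_minimal[OF hspace_Collect_eq[OF assms(1,2)]] assms(3,4) by blast

lemma bounded_clinear_id: "bounded_clinear (\<lambda>x. x)"
  by (auto simp: bounded_clinear_def intro: exI[of _ 1])

lemma bounded_clinear_0: "bounded_clinear (\<lambda>x. 0)"
  by (auto simp: bounded_clinear_def intro: exI[of _ 0])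

lemma bounded_clinear_scaleC_const: "bounded_clinear (\<lambda>x. c *\<^sub>C x)"
  by (auto simp: bounded_clinear_def scaleC_add_right scaleC_scaleC norm_scaleC mult.commute
      intro!: exI[of _ "cmod c"])

lemma bounded_clinear_compose:
  assumes "bounded_clinear f" "bounded_clinear g"
  shows "bounded_clinear (\<lambda>x. f (g x))"
proof -
  obtain K where K: "\<And>x. norm (f (g x)) \<le> norm x * K"
    using bounded_linear.bounded[OF bounded_linear_compose[OF assms[THEN bounded_clinear_bounded_linear]]]
    by auto
  then show ?thesis
    using assms unfolding bounded_clinear_def by (auto simp: mult.commute intro!: exI[of _ K])
qed

lemma bounded_clinear_plus:
  assumes "bounded_clinear f" "bounded_clinear g"
  shows "bounded_clinear (\<lambda>x. f x + g x)"
proof -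
  obtain K where K: "\<And>x. norm (f x + g x) \<le> norm x * K"
    using bounded_linear.bounded[OF bounded_linear_add[OF assms[THEN bounded_clinear_bounded_linear]]]
    by auto
  then show ?thesis
    using assms unfolding bounded_clinear_def
    by (auto simp: scaleC_add_right algebra_simps intro!: exI[of _ K])
qed

lemma bounded_clinear_sum_fun: "(\<And>i. i \<in> F \<Longrightarrow> bounded_clinear (f i)) \<Longrightarrow> bounded_clinear (\<lambda>x. \<Sum>i\<in>F. f i x)"
  by (induction F rule: infinite_finite_induct) (auto intro: bounded_clinear_plus bounded_clinear_0)

lemma bounded_op_onD:
  assumes "bounded_op_on H A"
  shows bounded_op_on_in: "x \<in> H \<Longrightarrow> A x \<in> H"
    and bounded_op_on_add: "x \<in> H \<Longrightarrow> y \<in> H \<Longrightarrow> A (x + y) = A x + A y"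
    and bounded_op_on_scaleC: "x \<in> H \<Longrightarrow> A (c *\<^sub>C x) = c *\<^sub>C A x"
  using assms by (auto simp: bounded_op_on_def)

lemma bounded_op_on_sum:
  assumes "bounded_op_on H A" "csubspace H" "\<And>i. i \<in> F \<Longrightarrow> f i \<in> H"
  shows "A (\<Sum>i\<in>F. c i *\<^sub>C f i) = (\<Sum>i\<in>F. c i *\<^sub>C A (f i))"
  using assms(3)
proof (induction F rule: infinite_finite_induct)
  case empty
  show ?case
    using bounded_op_on_scaleC[OF assms(1) csubspace_0[OF assms(2)], of 0] by simp
next
  case (infinite F)
  show ?case
    using infinite bounded_op_on_scaleC[OF assms(1) csubspace_0[OF assms(2)], of 0] by simp
next
  case (insert i F)
  then show ?case
    by (simp add: bounded_op_on_add[OF assms(1)] bounded_op_on_scaleC[OF assms(1)]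
        csubspaceD[OF assms(2)])
qed

lemma bounded_op_on_bound:
  assumes "bounded_op_on H A"
  obtains K where "0 \<le> K" "\<And>x. x \<in> H \<Longrightarrow> norm (A x) \<le> K * norm x"
proof -
  obtain K where "\<And>x. x \<in> H \<Longrightarrow> norm (A x) \<le> K * norm x"
    using assms unfolding bounded_op_on_def by blast
  then have "norm (A x) \<le> \<bar>K\<bar> * norm x" if "x \<in> H" for x
    using that by (meson abs_ge_self mult_right_mono norm_ge_zero order_trans)
  then show ?thesis using that[of "\<bar>K\<bar>"] by simp
qed

text \<open>The closure of the linear relation spanned by the pairs \<open>(g i, g' i)\<close> is the graph of the
  extension.\<close>

lemma bounded_clinear_extension:
  fixes g :: "'x \<Rightarrow> 'a::chilbert_space" and g' :: "'x \<Rightarrow> 'b::chilbert_space"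
  assumes dense: "UNIV \<subseteq> closure (cspan (g ` X))" and K: "0 \<le> K"
    and bound: "\<And>F c. finite F \<Longrightarrow> F \<subseteq> X \<Longrightarrow>
      norm (\<Sum>i\<in>F. c i *\<^sub>C g' i) \<le> K * norm (\<Sum>i\<in>F. c i *\<^sub>C g i)"
  obtains C where "bounded_clinear C" "\<And>i. i \<in> X \<Longrightarrow> C (g i) = g' i" "\<And>x. norm (C x) \<le> K * norm x"
proof -
  define h where "h = (\<lambda>i. (g i, g' i))"
  define G where "G = closure (cspan (h ` X))"
  have G: "hspace G" unfolding G_def by (rule hspace_closure_cspan)
  have hG: "h i \<in> G" if "i \<in> X" for i
    using that unfolding G_def by (intro in_closure_cspan) auto
  have span_bound: "norm (snd w) \<le> K * norm (fst w)" if w: "w \<in> cspan (h ` X)" for w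
  proof -
    obtain t r where t: "finite t" "t \<subseteq> h ` X" "w = (\<Sum>a\<in>t. r a *\<^sub>C a)"
      using w[unfolded cvs.span_explicit mem_Collect_eq] by (elim exE conjE)
    \<comment> \<open>Different indices may give the same pair, so one index is chosen for each
      vector of the combination.\<close>
    obtain F where F: "F \<subseteq> X" "inj_on h F" "t = h ` F"
      using t(2) unfolding subset_image_inj by (elim exE conjE)
    have finF: "finite F" using t(1) F by (simp add: finite_image_iff)
    have "w = (\<Sum>i\<in>F. r (h i) *\<^sub>C h i)"
      using t(3) F by (simp add: sum.reindex)
    then have "fst w = (\<Sum>i\<in>F. r (h i) *\<^sub>C g i)" "snd w = (\<Sum>i\<in>F. r (h i) *\<^sub>C g' i)"
      by (simp_all add: fst_sum snd_sum h_def scaleC_prod_def)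
    then show ?thesis using bound[OF finF F(1)] by simp
  qed
  have G_bound: "norm (snd w) \<le> K * norm (fst w)" if "w \<in> G" for w
  proof -
    have "closed {w::'a \<times> 'b. norm (snd w) \<le> K * norm (fst w)}"
      by (intro closed_Collect_le continuous_intros)
    then have "G \<subseteq> {w. norm (snd w) \<le> K * norm (fst w)}"
      unfolding G_def using span_bound by (intro closure_minimal) auto
    then show ?thesis using that by blast
  qed
  have diff: "w - w' \<in> G" if "w \<in> G" "w' \<in> G" for w w'
    using G that by (auto simp: hspace_def intro: csubspace_diff)
  have ex: "\<exists>v. (u, v) \<in> G" for u
  proof -
    have "u \<in> closure (cspan (g ` X))" using dense by blast
    then obtain f where f: "\<And>n::nat. f n \<in> cspan (g ` X)" "f \<longlonglongrightarrow> u"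
      unfolding closure_sequential by blast
    have csG: "csubspace G" using G by (simp add: hspace_def)
    have "cspan (g ` X) \<subseteq> fst ` G"
    proof (rule cvs.span_minimal)
      show "g ` X \<subseteq> fst ` G"
      proof
        fix u assume "u \<in> g ` X"
        then obtain i where "i \<in> X" "u = fst (h i)" by (auto simp: h_def)
        then show "u \<in> fst ` G" using hG by blast
      qed
      show "csubspace (fst ` G)"
      proof (rule cvs.subspaceI)
        show "0 \<in> fst ` G"
          by (rule image_eqI[of _ _ 0]) (simp_all add: csubspace_0[OF csG])
      next
        fix x y assume "x \<in> fst ` G" "y \<in> fst ` G"
        then obtain w w' where "w \<in> G" "w' \<in> G" "x = fst w" "y = fst w'" by blast
        then show "x + y \<in> fst ` G"
          by (intro image_eqI[of _ _ "w + w'"]) (simp_all add: csubspace_add[OF csG])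
      next
        fix c x assume "x \<in> fst ` G"
        then obtain w where "w \<in> G" "x = fst w" by blast
        then show "c *\<^sub>C x \<in> fst ` G"
          by (intro image_eqI[of _ _ "c *\<^sub>C w"])
            (simp_all add: csubspace_scaleC[OF csG], simp add: scaleC_prod_def)
      qed
    qed
    then have "f n \<in> fst ` G" for n
      using f(1) by (rule subsetD)
    then have ex_w: "\<exists>w. w \<in> G \<and> fst w = f n" for n
      unfolding image_iff by metis
    define w where "w n = (SOME w. w \<in> G \<and> fst w = f n)" for n
    have w: "w n \<in> G" "fst (w n) = f n" for n
      using someI_ex[OF ex_w[of n]] by (simp_all add: w_def)
    \<comment> \<open>\<open>w n\<close> is a point of the graph over \<open>f n\<close>; the graph
      bound turns convergence of the first components into the Cauchy property of the second
      ones.\<close>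
    have "Cauchy (\<lambda>n. snd (w n))"
    proof (rule CauchyI)
      fix e :: real assume e: "0 < e"
      \<comment> \<open>\<open>K + 1\<close> in the denominator, since \<open>K\<close> may be
        0.\<close>
      obtain M where M: "\<And>m n. m \<ge> M \<Longrightarrow> n \<ge> M \<Longrightarrow> norm (f m - f n) < e / (K + 1)"
        using CauchyD[OF LIMSEQ_imp_Cauchy[OF f(2)], of "e / (K + 1)"] e K by auto
      have "norm (snd (w m) - snd (w n)) < e" if "m \<ge> M" "n \<ge> M" for m n
      proof -
        have "norm (snd (w m) - snd (w n)) \<le> K * norm (f m - f n)"
          using G_bound[OF diff[OF w(1)[of m] w(1)[of n]]] w(2) by simp
        also have "\<dots> \<le> (K + 1) * norm (f m - f n)" by (simp add: mult_right_mono)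
        also have "\<dots> < e" using M[OF that] K by (simp add: field_simps)
        finally show ?thesis .
      qed
      then show "\<exists>M. \<forall>m\<ge>M. \<forall>n\<ge>M. norm (snd (w m) - snd (w n)) < e" by blast
    qed
    then obtain v where "(\<lambda>n. snd (w n)) \<longlonglongrightarrow> v"
      using Cauchy_convergent convergent_def by blast
    then have "(\<lambda>n. (fst (w n), snd (w n))) \<longlonglongrightarrow> (u, v)"
      using f(2) by (intro tendsto_Pair) (simp_all add: w(2))
    then have "(u, v) \<in> G"
      using G w(1) closed_sequentially[of G w] by (simp add: hspace_def)
    then show ?thesis ..
  qed
  have unique: "v = v'" if "(u, v) \<in> G" "(u, v') \<in> G" for u v v'
    using G_bound[OF diff[OF that]] by simp
  define C where "C u = (THE v. (u, v) \<in> G)" for u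
  have CG: "(u, C u) \<in> G" for u
    unfolding C_def
  proof (rule theI')
    obtain v where "(u, v) \<in> G" using ex by blast
    then show "\<exists>!v. (u, v) \<in> G" using unique by blast
  qed
  have C_eq: "C u = v" if "(u, v) \<in> G" for u v
    using unique[OF CG that] .
  show thesis
  proof
    show nb: "norm (C x) \<le> K * norm x" for x
      using G_bound[OF CG] by simp
    show "C (g i) = g' i" if "i \<in> X" for i
      using hG[OF that] by (simp add: h_def C_eq)
    have "C (x + y) = C x + C y" for x y
      using csubspace_add[of G, OF _ CG[of x] CG[of y]] G by (intro C_eq) (simp add: hspace_def)
    moreover have "C (c *\<^sub>C x) = c *\<^sub>C C x" for c x
      using csubspace_scaleC[of G, OF _ CG[of x]] G
      by (intro C_eq) (simp add: hspace_def scaleC_prod_def)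
    ultimately show "bounded_clinear C"
      using nb by (auto simp: bounded_clinear_def)
  qed
qed

text \<open>The form of this kernel at \<open>c\<close> is K^2 times the squared norm of the
  combination of the \<open>g i\<close>, minus the squared norm of that of the \<open>g' i\<close>.
  Its positivity is therefore the norm bound, in a shape to which Schur's theorem applies.\<close>

lemma bounded_clinear_extension_kernel:
  fixes g :: "'x \<Rightarrow> 'a::chilbert_space" and g' :: "'x \<Rightarrow> 'b::chilbert_space"
  assumes "UNIV \<subseteq> closure (cspan (g ` X))" "0 \<le> K"
    and psd: "\<And>F. finite F \<Longrightarrow> F \<subseteq> X \<Longrightarrow>
      psd_kernel F (\<lambda>i j. of_real (K\<^sup>2) * cinner (g i) (g j) - cinner (g' i) (g' j))"
  obtains C where "bounded_clinear C" "\<And>i. i \<in> X \<Longrightarrow> C (g i) = g' i" "\<And>x. norm (C x) \<le> K * norm x"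
proof (rule bounded_clinear_extension[OF assms(1,2)])
  fix F and c :: "'x \<Rightarrow> complex" assume F: "finite F" "F \<subseteq> X"
  have "(\<Sum>i\<in>F. \<Sum>j\<in>F. cnj (c i) * (of_real (K\<^sup>2) * cinner (g i) (g j) - cinner (g' i) (g' j)) * c j) =
      of_real (K\<^sup>2) * (\<Sum>i\<in>F. \<Sum>j\<in>F. cnj (c i) * cinner (g i) (g j) * c j) -
      (\<Sum>i\<in>F. \<Sum>j\<in>F. cnj (c i) * cinner (g' i) (g' j) * c j)"
    by (simp add: right_diff_distrib left_diff_distrib sum_subtractf sum_distrib_left mult.assoc
        mult.left_commute)
  then have "0 \<le> of_real (K\<^sup>2) * (\<Sum>i\<in>F. \<Sum>j\<in>F. cnj (c i) * cinner (g i) (g j) * c j) -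
      (\<Sum>i\<in>F. \<Sum>j\<in>F. cnj (c i) * cinner (g' i) (g' j) * c j)"
    using psd_kernel_nonneg[OF psd[OF F], of c] by (simp only:)
  then have "complex_of_real ((norm (\<Sum>i\<in>F. c i *\<^sub>C g' i))\<^sup>2) \<le> of_real ((K * norm (\<Sum>i\<in>F. c i *\<^sub>C g i))\<^sup>2)"
    unfolding norm_sum_power2[symmetric] of_real_mult[symmetric]
    by (simp add: power_mult_distrib less_eq_complex_def)
  then have "(norm (\<Sum>i\<in>F. c i *\<^sub>C g' i))\<^sup>2 \<le> (K * norm (\<Sum>i\<in>F. c i *\<^sub>C g i))\<^sup>2"
    by (simp add: less_eq_complex_def)
  then show "norm (\<Sum>i\<in>F. c i *\<^sub>C g' i) \<le> K * norm (\<Sum>i\<in>F. c i *\<^sub>C g i)"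
    by (rule power2_le_imp_le) (simp add: assms(2))
qed (use that in blast)

section \<open>Projections, Riesz representation and orthonormal bases\<close>

text \<open>A minimising sequence of the distance is Cauchy by the parallelogram law.\<close>

lemma hspace_nearest_point:
  assumes "hspace H"
  obtains p where "p \<in> H" "\<And>h. h \<in> H \<Longrightarrow> norm (x - p) \<le> norm (x - h)"
proof -
  have H: "csubspace H" "closed H" using assms by (auto simp: hspace_def)
  define d where "d = (INF h\<in>H. norm (x - h))"
  have bdd: "bdd_below ((\<lambda>h. norm (x - h)) ` H)"
    by (rule bdd_belowI[of _ 0]) auto
  have d_le: "d \<le> norm (x - h)" if "h \<in> H" for h
    unfolding d_def by (rule cINF_lower[OF bdd that])
  have "H \<noteq> {}" using csubspace_0[OF H(1)] by blast
  then have d0: "0 \<le> d" unfolding d_def by (rule cINF_greatest) simp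
  have "\<exists>h\<in>H. norm (x - h) < d + 1 / Suc n" for n
    using cINF_less_iff[OF \<open>H \<noteq> {}\<close> bdd, of "d + 1 / Suc n"] unfolding d_def[symmetric] by auto
  then obtain f where f: "\<And>n. f n \<in> H" "\<And>n. norm (x - f n) < d + 1 / Suc n" by metis
  define u where "u n = 1 / real (Suc n)" for n
  \<comment> \<open>The midpoint lies in \<open>H\<close>, so the sum of the two difference vectors
    has norm at least 2 d. The factor 4 d + 2 is twice the 2 d + 1 in (d + u)^2 \<le> d^2 + (2 d +
    1) u, which uses u \<le> 1.\<close>
  have par: "(norm (f m - f n))\<^sup>2 \<le> (4 * d + 2) * (u m + u n)" for m n
  proof -
    have mid: "(1/2) *\<^sub>R (f m + f n) \<in> H"
      using H(1) f(1) by (intro csubspace_scaleR csubspace_add)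
    have "(norm (f m - f n))\<^sup>2 + (norm ((x - f m) + (x - f n)))\<^sup>2 =
        2 * (norm (x - f m))\<^sup>2 + 2 * (norm (x - f n))\<^sup>2"
      using norm_add_power2[of "x - f m" "x - f n"] norm_diff_power2[of "x - f m" "x - f n"]
      by (simp add: norm_minus_commute)
    moreover have "(x - f m) + (x - f n) = 2 *\<^sub>R (x - (1/2) *\<^sub>R (f m + f n))"
      by (simp add: scaleR_right_diff_distrib scaleR_2)
    then have "norm ((x - f m) + (x - f n)) = 2 * norm (x - (1/2) *\<^sub>R (f m + f n))"
      by simp
    then have "2 * d \<le> norm ((x - f m) + (x - f n))"
      using d_le[OF mid] by simp
    then have "(2 * d)\<^sup>2 \<le> (norm ((x - f m) + (x - f n)))\<^sup>2"
      using d0 by (intro power_mono) auto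
    moreover have "(norm (x - f k))\<^sup>2 \<le> d\<^sup>2 + (2 * d + 1) * u k" for k
    proof -
      have "(norm (x - f k))\<^sup>2 \<le> (d + u k)\<^sup>2"
        using f(2)[of k] by (intro power_mono) (auto simp: u_def)
      also have "\<dots> = d\<^sup>2 + 2 * d * u k + u k * u k"
        by (simp add: power2_eq_square algebra_simps)
      also have "u k * u k \<le> 1 * u k"
        by (intro mult_right_mono) (auto simp: u_def)
      finally show ?thesis by (simp add: algebra_simps)
    qed
    from this[of m] this[of n] have "2 * (norm (x - f m))\<^sup>2 + 2 * (norm (x - f n))\<^sup>2 \<le>
        4 * d\<^sup>2 + (4 * d + 2) * (u m + u n)"
      by (simp add: algebra_simps)
    ultimately show ?thesis by (simp add: power_mult_distrib)
  qed
  have "Cauchy f"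
  proof (rule CauchyI)
    fix e :: real assume e: "0 < e"
    have "(\<lambda>n. (4 * d + 2) * u n) \<longlonglongrightarrow> (4 * d + 2) * 0"
      unfolding u_def
      by (intro tendsto_mult tendsto_const LIMSEQ_Suc lim_1_over_n)
    then have "\<forall>\<^sub>F n in sequentially. (4 * d + 2) * u n < e\<^sup>2 / 2"
      using e by (intro order_tendstoD(2)[of _ 0]) auto
    then obtain M where M: "\<And>n. n \<ge> M \<Longrightarrow> (4 * d + 2) * u n < e\<^sup>2 / 2"
      unfolding eventually_sequentially by blast
    have "norm (f m - f n) < e" if "m \<ge> M" "n \<ge> M" for m n
    proof -
      have "(norm (f m - f n))\<^sup>2 < e\<^sup>2"
        using par[of m n] M[OF that(1)] M[OF that(2)] by (simp add: algebra_simps)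
      then show ?thesis by (rule power2_less_imp_less) (use e in simp)
    qed
    then show "\<exists>M. \<forall>m\<ge>M. \<forall>n\<ge>M. norm (f m - f n) < e" by blast
  qed
  then obtain p where p: "f \<longlonglongrightarrow> p"
    using Cauchy_convergent convergent_def by blast
  have "p \<in> H" using closed_sequentially[OF H(2) f(1) p] .
  have "(\<lambda>n. norm (x - f n)) \<longlonglongrightarrow> norm (x - p)"
    by (intro tendsto_intros p)
  moreover have "(\<lambda>n. d + 1 / real (Suc n)) \<longlonglongrightarrow> d + 0"
    by (intro tendsto_add tendsto_const LIMSEQ_Suc lim_1_over_n)
  ultimately have "norm (x - p) \<le> d + 0"
    by (rule LIMSEQ_le) (use f(2) in \<open>auto intro: less_imp_le\<close>)
  then have "norm (x - p) \<le> norm (x - h)" if "h \<in> H" for h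
    using d_le[OF that] by simp
  then show ?thesis
    using that \<open>p \<in> H\<close> by blast
qed

lemma hspace_projection:
  assumes "hspace H"
  obtains p where "p \<in> H" "\<And>h. h \<in> H \<Longrightarrow> cinner h (x - p) = 0"
proof -
  obtain p where p: "p \<in> H" "\<And>h. h \<in> H \<Longrightarrow> norm (x - p) \<le> norm (x - h)"
    by (rule hspace_nearest_point[OF assms, of x]) blast
  have H: "csubspace H" using assms by (simp add: hspace_def)
  have "cinner h (x - p) = 0" if "h \<in> H" for h
  proof (cases "h = 0")
    case False
    \<comment> \<open>The best multiple of \<open>h\<close>: moving from \<open>p\<close> to
      \<open>p + c *\<^sub>C h\<close> lowers the squared distance by
      \<open>(cmod c * norm h)^2\<close>, which minimality of \<open>p\<close> forces to be
      0.\<close>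
    define c where "c = cinner h (x - p) / of_real ((norm h)\<^sup>2)"
    have "p + c *\<^sub>C h \<in> H" using H p(1) that by (intro csubspace_add csubspace_scaleC)
    from p(2)[OF this] have "(norm (x - p))\<^sup>2 \<le> (norm (x - p - c *\<^sub>C h))\<^sup>2"
      by (simp add: diff_diff_eq)
    also have "\<dots> = (norm (x - p))\<^sup>2 + (cmod c * norm h)\<^sup>2 - 2 * Re (c * cinner (x - p) h)"
      by (simp add: norm_diff_power2 cinner_scaleC_right norm_scaleC)
    also have "c * cinner (x - p) h = of_real ((cmod c * norm h)\<^sup>2)"
    proof -
      have "cinner (x - p) h = cnj (cinner h (x - p))" by (rule cinner_commute)
      also have "cinner h (x - p) = c * of_real ((norm h)\<^sup>2)"
        using False by (simp add: c_def)
      finally have "c * cinner (x - p) h = (c * cnj c) * of_real ((norm h)\<^sup>2)" by simp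
      then show ?thesis
        by (simp add: complex_norm_square[symmetric] power_mult_distrib)
    qed
    finally have "(cmod c * norm h)\<^sup>2 \<le> 0" by simp
    then have "c = 0" using False by simp
    then show ?thesis using False by (simp add: c_def)
  qed simp
  with p(1) that show ?thesis by blast
qed

text \<open>The component \<open>w\<close> of \<open>u\<close> orthogonal to the kernel represents
  the functional up to a scalar, because every \<open>x\<close> differs from a multiple of
  \<open>w\<close> by an element of the kernel.\<close>

lemma Riesz_representation:
  fixes \<phi> :: "'a::chilbert_space \<Rightarrow> complex"
  assumes "bounded_clinear \<phi>"
  obtains z where "\<And>x. \<phi> x = cinner z x"
proof (cases "\<forall>x. \<phi> x = 0")
  case True
  then show ?thesis using that[of 0] by simp
next
  case False
  then obtain u where u: "\<phi> u \<noteq> 0" by blast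
  have "hspace {x. \<phi> x = (\<lambda>x. 0) x}"
    by (intro hspace_Collect_eq assms bounded_clinear_0)
  then obtain p where p: "\<phi> p = 0" "\<And>h. \<phi> h = 0 \<Longrightarrow> cinner h (u - p) = 0"
    using hspace_projection[of "{x. \<phi> x = 0}" u] by auto
  define w where "w = u - p"
  have w: "\<phi> w \<noteq> 0" using u p(1) by (simp add: w_def bounded_clinear_diff[OF assms])
  then have w0: "w \<noteq> 0" using bounded_clinear_zero[OF assms] by auto
  define z where "z = (cnj (\<phi> w) / of_real ((norm w)\<^sup>2)) *\<^sub>C w"
  have "\<phi> x = cinner z x" for x
  proof -
    have "\<phi> (x - (\<phi> x / \<phi> w) *\<^sub>C w) = 0"
      using w by (simp add: bounded_clinearD[OF assms] scaleC_complex_def)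
    from p(2)[OF this] have "cinner w (x - (\<phi> x / \<phi> w) *\<^sub>C w) = 0"
      unfolding w_def by (metis cinner_commute complex_cnj_zero)
    then have "cinner w x = (\<phi> x / \<phi> w) * of_real ((norm w)\<^sup>2)"
      by (simp add: cinner_simps cinner_self)
    then show ?thesis using w w0 by (simp add: z_def cinner_scaleC_left)
  qed
  then show ?thesis using that by blast
qed

text \<open>Riesz in the first argument for each fixed \<open>y\<close>, after conjugation since
  that argument is antilinear; uniqueness of the representing vector makes \<open>C\<close> linear.
  This is how the partial trace is obtained from its matrix elements.\<close>

lemma bounded_form_representation:
  fixes s :: "'a::chilbert_space \<Rightarrow> 'a \<Rightarrow> complex"
  assumes "\<And>x y y'. s x (y + y') = s x y + s x y'" "\<And>x c y. s x (c *\<^sub>C y) = c * s x y"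
    and "\<And>x x' y. s (x + x') y = s x y + s x' y" "\<And>x c y. s (c *\<^sub>C x) y = cnj c * s x y"
    and "\<And>x y. cmod (s x y) \<le> K * (norm x * norm y)"
  obtains C where "bounded_clinear C" "\<And>x y. s x y = cinner x (C y)"
proof -
  have "\<exists>z. \<forall>x. s x y = cinner x z" for y
  proof -
    have "bounded_clinear (\<lambda>x. cnj (s x y))"
      using assms(3-5) unfolding bounded_clinear_def
      by (auto simp: scaleC_complex_def mult_ac intro!: exI[of _ "K * norm y"])
    then obtain z where "\<And>x. cnj (s x y) = cinner z x"
      using Riesz_representation by blast
    then have "s x y = cinner x z" for x
      by (metis cinner_commute complex_cnj_cnj)
    then show ?thesis by blast
  qed
  then obtain C where C: "\<And>x y. s x y = cinner x (C y)" by metis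
  have "bounded_clinear C"
    unfolding bounded_clinear_def
  proof (intro conjI allI exI)
    show "C (x + y) = C x + C y" for x y
      by (rule cinner_eqI) (metis C assms(1) cinner_add_right)
    show "C (c *\<^sub>C x) = c *\<^sub>C C x" for c x
      by (rule cinner_eqI) (metis C assms(2) cinner_scaleC_right)
    show "norm (C y) \<le> K * norm y" for y
    proof (cases "C y = 0")
      case True
      show ?thesis
      proof (cases "y = 0")
        case False
        \<comment> \<open>The sign of \<open>K\<close> comes from the bound at the pair
          \<open>y\<close>, \<open>y\<close>.\<close>
        have "0 \<le> K * (norm y * norm y)"
          using assms(5)[of y y] norm_ge_zero order_trans by blast
        then show ?thesis using True False by (auto simp: zero_le_mult_iff mult_le_0_iff)
      qed (use True in simp)
    next
      case False
      have "norm (C y) * norm (C y) = cmod (cinner (C y) (C y))"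
        by (simp add: cinner_self norm_mult power2_eq_square)
      also have "\<dots> \<le> K * norm y * norm (C y)"
        using assms(5)[of "C y" y] C by (simp add: mult_ac)
      finally show ?thesis using False by simp
    qed
  qed
  with C that show ?thesis by blast
qed

section \<open>Orthonormal sets and bases of arbitrary cardinality\<close>

definition orthonormal_set :: "'a::chilbert_space set \<Rightarrow> bool" where
  "orthonormal_set B \<longleftrightarrow> (\<forall>e\<in>B. \<forall>f\<in>B. cinner e f = (if e = f then 1 else 0))"

lemma is_onb_iff: "is_onb H B \<longleftrightarrow> B \<subseteq> H \<and> orthonormal_set B \<and> H \<subseteq> closure (cspan B)"
  by (simp add: is_onb_def orthonormal_set_def)

lemma orthonormal_setD: "orthonormal_set B \<Longrightarrow> e \<in> B \<Longrightarrow> f \<in> B \<Longrightarrow> cinner e f = (if e = f then 1 else 0)"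
  by (simp add: orthonormal_set_def)

lemma orthonormal_set_subset: "orthonormal_set B \<Longrightarrow> A \<subseteq> B \<Longrightarrow> orthonormal_set A"
  unfolding orthonormal_set_def by (meson subsetD)

text \<open>Zorn's lemma: a maximal orthonormal set is total, since otherwise the normalised
  remainder of a projection onto its closed span could be added.\<close>

lemma onb_exists:
  assumes "hspace H"
  obtains B where "is_onb H B"
proof -
  let ?A = "{B. B \<subseteq> H \<and> orthonormal_set B}"
  have "\<exists>U\<in>?A. \<forall>X\<in>C. X \<subseteq> U" if C: "subset.chain ?A C" for C
  proof (intro bexI[of _ "\<Union>C"] ballI)
    show "\<Union>C \<in> ?A"
      unfolding mem_Collect_eq orthonormal_set_def
    proof (intro conjI ballI)
      show "\<Union>C \<subseteq> H" using C by (auto simp: subset.chain_def)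
      fix e f assume "e \<in> \<Union>C" "f \<in> \<Union>C"
      then obtain X Y where XY: "X \<in> C" "Y \<in> C" "e \<in> X" "f \<in> Y" by blast
      then have "X \<subseteq> Y \<or> Y \<subseteq> X" using C unfolding subset.chain_def by blast
      then obtain Z where "Z \<in> C" "e \<in> Z" "f \<in> Z" using XY by blast
      moreover have "orthonormal_set Z" using C \<open>Z \<in> C\<close> by (auto simp: subset.chain_def)
      ultimately show "cinner e f = (if e = f then 1 else 0)" by (simp add: orthonormal_setD)
    qed
  qed auto
  then obtain B where B: "B \<in> ?A" "\<And>X. X \<in> ?A \<Longrightarrow> B \<subseteq> X \<Longrightarrow> X = B"
    using subset_Zorn'[of ?A] subset_Zorn[of ?A] by auto
  have sub: "closure (cspan B) \<subseteq> H" using closure_cspan_minimal[OF assms] B(1) by blast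
  have "x \<in> closure (cspan B)" if "x \<in> H" for x
  proof (rule ccontr)
    assume x: "x \<notin> closure (cspan B)"
    obtain p where p: "p \<in> closure (cspan B)" "\<And>h. h \<in> closure (cspan B) \<Longrightarrow> cinner h (x - p) = 0"
      using hspace_projection[OF hspace_closure_cspan] by blast
    define e where "e = (1 / of_real (norm (x - p)) :: complex) *\<^sub>C (x - p)"
    have nz: "norm (x - p) \<noteq> 0" using x p(1) by auto
    have "e \<in> H"
      unfolding e_def using assms that p(1) sub by (auto simp: hspace_def intro!: csubspaceD)
    have "norm e = 1"
      using nz by (simp add: e_def norm_scaleC norm_divide del: norm_eq_zero right_minus_eq)
    then have e1: "cinner e e = 1" by (simp add: cinner_self)
    have eB: "cinner b e = 0" "cinner e b = 0" if "b \<in> B" for b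
    proof -
      show "cinner b e = 0"
        using p(2)[OF in_closure_cspan[OF that]] by (simp add: e_def cinner_scaleC_right)
      then show "cinner e b = 0" by (metis cinner_commute complex_cnj_zero)
    qed
    have "e \<notin> B" using eB(1) e1 by force
    have "orthonormal_set (insert e B)"
      using B(1) eB e1 \<open>e \<notin> B\<close> by (auto simp: orthonormal_set_def)
    then have "insert e B = B" using B(1) \<open>e \<in> H\<close> by (intro B(2)) auto
    with \<open>e \<notin> B\<close> show False by blast
  qed
  then have "is_onb H B" using B(1) by (auto simp: is_onb_iff)
  then show ?thesis by (rule that)
qed

lemma norm_sum_orthonormal:
  assumes "orthonormal_set F" "finite F"
  shows "(norm (\<Sum>e\<in>F. c e *\<^sub>C e))\<^sup>2 = (\<Sum>e\<in>F. (cmod (c e))\<^sup>2)"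
proof -
  have "complex_of_real ((norm (\<Sum>e\<in>F. c e *\<^sub>C e))\<^sup>2) = (\<Sum>e\<in>F. \<Sum>f\<in>F. cnj (c e) * (if e = f then 1 else 0) * c f)"
    unfolding norm_sum_power2 using orthonormal_setD[OF assms(1)] by (intro sum.cong refl) auto
  also have "\<dots> = (\<Sum>e\<in>F. \<Sum>f\<in>F. if e = f then cnj (c e) * c e else 0)"
    by (intro sum.cong refl) auto
  also have "\<dots> = (\<Sum>e\<in>F. cnj (c e) * c e)"
    using assms(2) by (intro sum.cong refl) simp
  also have "\<dots> = complex_of_real (\<Sum>e\<in>F. (cmod (c e))\<^sup>2)"
    unfolding of_real_sum complex_norm_square by (simp only: mult.commute)
  finally show ?thesis by (simp only: of_real_eq_iff)
qed

lemma cinner_orthonormal_sum: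
  assumes "orthonormal_set F" "finite F" "e \<in> F"
  shows "cinner e (\<Sum>f\<in>F. c f *\<^sub>C f) = c e"
proof -
  have "cinner e (\<Sum>f\<in>F. c f *\<^sub>C f) = (\<Sum>f\<in>F. if e = f then c f else 0)"
    unfolding cinner_sum_right cinner_scaleC_right
    using orthonormal_setD[OF assms(1,3)] by (intro sum.cong refl) auto
  then show ?thesis using assms(2,3) by simp
qed

lemma Bessel_inequality:
  assumes "orthonormal_set F" "finite F"
  shows "(\<Sum>e\<in>F. (cmod (cinner e x))\<^sup>2) \<le> (norm x)\<^sup>2"
proof -
  define y where "y = (\<Sum>e\<in>F. cinner e x *\<^sub>C e)"
  have "(norm y)\<^sup>2 = (\<Sum>e\<in>F. (cmod (cinner e x))\<^sup>2)"
    unfolding y_def by (rule norm_sum_orthonormal[OF assms])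
  moreover have "cinner y (x - y) = 0"
  proof -
    have "cinner y (x - y) = (\<Sum>e\<in>F. cnj (cinner e x) * cinner e (x - y))"
      by (subst y_def) (simp only: cinner_sum_left cinner_scaleC_left)
    also have "\<dots> = 0"
      by (intro sum.neutral ballI)
        (simp add: y_def cinner_diff_right cinner_orthonormal_sum[OF assms])
    finally show ?thesis .
  qed
  then have "(norm x)\<^sup>2 = (norm y)\<^sup>2 + (norm (x - y))\<^sup>2"
    using norm_add_power2[of y "x - y"] by simp
  ultimately show ?thesis by simp
qed

text \<open>The partial sums are uniformly bounded, so the vectors on which they converge to
  \<open>S\<close> form a closed subspace. It yields the expansion in a basis and the convergence of
  the evolution operator, where summation is over an arbitrary index set.\<close>

lemma has_sum_dense:
  fixes T :: "'i \<Rightarrow> 'a::chilbert_space \<Rightarrow> 'b::chilbert_space" and S :: "'a \<Rightarrow> 'b"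
  assumes T: "\<And>i. bounded_clinear (T i)" and S: "bounded_clinear S"
    and K: "\<And>F x. finite F \<Longrightarrow> F \<subseteq> I \<Longrightarrow> norm (\<Sum>i\<in>F. T i x) \<le> K * norm x"
    and dense: "\<And>d. d \<in> D \<Longrightarrow> ((\<lambda>i. T i d) has_sum S d) I"
    and x: "x \<in> closure (cspan D)"
  shows "((\<lambda>i. T i x) has_sum S x) I"
proof -
  let ?H = "{x. ((\<lambda>i. T i x) has_sum S x) I}"
  have "csubspace ?H"
  proof (rule cvs.subspaceI)
    show "0 \<in> ?H"
      by (simp add: bounded_clinear_zero[OF T] bounded_clinear_zero[OF S])
    show "x + y \<in> ?H" if "x \<in> ?H" "y \<in> ?H" for x y
      using that by (simp add: bounded_clinear_add[OF T] bounded_clinear_add[OF S] has_sum_add)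
    show "c *\<^sub>C x \<in> ?H" if "x \<in> ?H" for c x
      using that has_sum_bounded_linear[OF bounded_clinear_bounded_linear[OF bounded_clinear_scaleC_const[of c]]]
      by (auto simp: bounded_clinear_scaleC[OF T] bounded_clinear_scaleC[OF S])
  qed
  moreover have "closure ?H \<subseteq> ?H"
  proof
    fix x assume "x \<in> closure ?H"
    obtain K' where K': "0 < K'" "\<And>x. norm (S x) \<le> norm x * K'"
      using bounded_linear.pos_bounded[OF bounded_clinear_bounded_linear[OF S]] by blast
    define L where "L = \<bar>K\<bar> + K' + 1"
    have L: "0 < L" using K'(1) by (simp add: L_def)
    have "(sum (\<lambda>i. T i x) \<longlongrightarrow> S x) (finite_subsets_at_top I)"
    proof (rule tendstoI)
      fix e :: real assume e: "0 < e"
      obtain y where y: "y \<in> ?H" "dist y x < e / (2 * L)"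
        using \<open>x \<in> closure ?H\<close> e L unfolding closure_approachable by (meson divide_pos_pos mult_pos_pos zero_less_numeral)
      have "\<forall>\<^sub>F F in finite_subsets_at_top I. dist (sum (\<lambda>i. T i y) F) (S y) < e / 2"
        using y(1) tendstoD[of "sum (\<lambda>i. T i y)" "S y" "finite_subsets_at_top I" "e / 2"] e
        by (simp add: has_sum_def)
      moreover have "\<forall>\<^sub>F F in finite_subsets_at_top I. finite F \<and> F \<subseteq> I"
        by (rule eventually_finite_subsets_at_top_weakI) auto
      ultimately show "\<forall>\<^sub>F F in finite_subsets_at_top I. dist (sum (\<lambda>i. T i x) F) (S x) < e"
      proof eventually_elim
        case (elim F)
        have eq: "(\<Sum>i\<in>F. T i x) - S x = (\<Sum>i\<in>F. T i (x - y)) + ((\<Sum>i\<in>F. T i y) - S y) - S (x - y)"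
          by (simp add: bounded_clinear_diff[OF T] bounded_clinear_diff[OF S] sum_subtractf)
        have "norm ((\<Sum>i\<in>F. T i x) - S x) \<le>
            norm (\<Sum>i\<in>F. T i (x - y)) + norm ((\<Sum>i\<in>F. T i y) - S y) + norm (S (x - y))"
          unfolding eq
          using norm_triangle_ineq4[of "(\<Sum>i\<in>F. T i (x - y)) + ((\<Sum>i\<in>F. T i y) - S y)" "S (x - y)"]
            norm_triangle_ineq[of "\<Sum>i\<in>F. T i (x - y)" "(\<Sum>i\<in>F. T i y) - S y"] by linarith
        also have "norm (\<Sum>i\<in>F. T i (x - y)) \<le> \<bar>K\<bar> * norm (x - y)"
          using K[of F "x - y"] elim(2) by (meson abs_ge_self mult_right_mono norm_ge_zero order_trans)
        also have "norm (S (x - y)) \<le> K' * norm (x - y)"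
          using K'(2) by (simp add: mult.commute)
        also have "norm ((\<Sum>i\<in>F. T i y) - S y) < e / 2"
          using elim(1) by (simp add: dist_norm)
        finally have "norm ((\<Sum>i\<in>F. T i x) - S x) < (\<bar>K\<bar> + K') * norm (x - y) + e / 2"
          by (simp add: algebra_simps)
        also have "(\<bar>K\<bar> + K') * norm (x - y) \<le> L * norm (x - y)"
          by (simp add: L_def mult_right_mono)
        also have "\<dots> \<le> L * (e / (2 * L))"
          using y(2) L by (intro mult_left_mono) (auto simp: dist_norm norm_minus_commute)
        also have "\<dots> = e / 2" using L by simp
        finally show ?case by (simp add: dist_norm)
      qed
    qed
    then show "x \<in> ?H" by (simp add: has_sum_def)
  qed
  ultimately have "hspace ?H"
    unfolding hspace_def closure_subset_eq by (rule conjI)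
  moreover have "D \<subseteq> ?H" by (auto intro: dense)
  ultimately have "x \<in> ?H" by (rule subsetD[OF closure_cspan_minimal x])
  then show ?thesis by simp
qed

lemma onb_expansion:
  assumes "is_onb H B" "x \<in> H"
  shows "((\<lambda>e. cinner e x *\<^sub>C e) has_sum x) B"
proof (rule has_sum_dense[where D = B and K = 1 and S = "\<lambda>x. x"])
  have B: "orthonormal_set B" using assms(1) by (simp add: is_onb_iff)
  show "bounded_clinear (\<lambda>x. cinner e x *\<^sub>C e)" for e
    unfolding bounded_clinear_def
    by (auto simp: cinner_simps scaleC_add_left scaleC_scaleC norm_scaleC intro!: exI[of _ "norm e * norm e"])
      (metis cinner_Cauchy_Schwarz mult.assoc mult.commute mult_right_mono norm_ge_zero)
  show "norm (\<Sum>e\<in>F. cinner e x *\<^sub>C e) \<le> 1 * norm x" if "finite F" "F \<subseteq> B" for F x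
  proof -
    have "(norm (\<Sum>e\<in>F. cinner e x *\<^sub>C e))\<^sup>2 \<le> (norm x)\<^sup>2"
      using norm_sum_orthonormal[OF orthonormal_set_subset[OF B that(2)] that(1)]
        Bessel_inequality[OF orthonormal_set_subset[OF B that(2)] that(1)] by simp
    then have "norm (\<Sum>e\<in>F. cinner e x *\<^sub>C e) \<le> norm x" by (rule power2_le_imp_le) simp
    then show ?thesis by simp
  qed
  show "((\<lambda>e. cinner e d *\<^sub>C e) has_sum d) B" if "d \<in> B" for d
  proof -
    have "((\<lambda>e. cinner e d *\<^sub>C e) has_sum d) {d}"
      using orthonormal_setD[OF B that that] by (intro has_sum_finiteI) auto
    then show ?thesis
      by (rule has_sum_cong_neutral[THEN iffD1, rotated -1])
        (use that orthonormal_setD[OF B] in auto)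
  qed
  show "x \<in> closure (cspan B)" using assms by (auto simp: is_onb_iff)
qed (rule bounded_clinear_id)

section \<open>Positive operators and the trace\<close>

definition positive_on :: "'a::chilbert_space set \<Rightarrow> ('a \<Rightarrow> 'a) \<Rightarrow> bool" where
  "positive_on H T \<longleftrightarrow> bounded_op_on H T \<and> (\<forall>x\<in>H. 0 \<le> cinner x (T x))"

lemma positive_onD:
  assumes "positive_on H T"
  shows positive_on_bounded: "bounded_op_on H T"
    and positive_on_nonneg: "x \<in> H \<Longrightarrow> 0 \<le> cinner x (T x)"
  using assms by (auto simp: positive_on_def)

lemma positive_on_diag_real:
  assumes "positive_on H T" "x \<in> H"
  shows "cinner x (T x) = of_real (Re (cinner x (T x)))" "0 \<le> Re (cinner x (T x))"
  using positive_on_nonneg[OF assms] by (auto simp: less_eq_complex_def complex_eq_iff)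

text \<open>Positivity at x + y fixes the imaginary parts of the off-diagonal elements, positivity
  at x + i y their real parts.\<close>

lemma positive_on_hermitian:
  assumes "positive_on H T" "csubspace H" "x \<in> H" "y \<in> H"
  shows "cinner (T x) y = cinner x (T y)"
proof -
  have bd: "bounded_op_on H T" by (rule positive_on_bounded[OF assms(1)])
  define a b where "a = cinner x (T y)" and "b = cinner y (T x)"
  have "0 \<le> cinner (x + y) (T (x + y))"
    using assms by (intro positive_on_nonneg[OF assms(1)] csubspace_add)
  also have "\<dots> = cinner x (T x) + cinner y (T y) + (a + b)"
    using assms by (simp add: bounded_op_on_add[OF bd] cinner_simps a_def b_def)
  finally have 1: "Im a + Im b = 0"
    using positive_on_nonneg[OF assms(1,3)] positive_on_nonneg[OF assms(1,4)]
    by (simp add: less_eq_complex_def)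
  have "0 \<le> cinner (x + \<i> *\<^sub>C y) (T (x + \<i> *\<^sub>C y))"
    using assms by (intro positive_on_nonneg[OF assms(1)] csubspace_add csubspace_scaleC)
  also have "\<dots> = cinner x (T x) + cinner y (T y) + \<i> * (a - b)"
    using assms by (simp add: bounded_op_on_add[OF bd] bounded_op_on_scaleC[OF bd]
        csubspace_scaleC cinner_simps a_def b_def algebra_simps)
  finally have 2: "Re a - Re b = 0"
    using positive_on_nonneg[OF assms(1,3)] positive_on_nonneg[OF assms(1,4)]
    by (simp add: less_eq_complex_def)
  have "cinner (T x) y = cnj b" unfolding b_def by (rule cinner_commute)
  also have "\<dots> = a" using 1 2 by (simp add: complex_eq_iff)
  finally show ?thesis by (simp add: a_def)
qed

lemma psd_kernel_positive_on:
  assumes T: "positive_on H T" and H: "csubspace H" and x: "\<And>i. i \<in> F \<Longrightarrow> x i \<in> H"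
  shows "psd_kernel F (\<lambda>i j. cinner (x i) (T (x j)))"
proof (rule psd_kernelI)
  fix i j assume "i \<in> F" "j \<in> F"
  then show "cinner (x j) (T (x i)) = cnj (cinner (x i) (T (x j)))"
    by (metis positive_on_hermitian[OF T H] cinner_commute x)
next
  fix c
  have "0 \<le> cinner (\<Sum>i\<in>F. c i *\<^sub>C x i) (T (\<Sum>i\<in>F. c i *\<^sub>C x i))"
    using x H by (intro positive_on_nonneg[OF T] csubspace_sum csubspace_scaleC)
  also have "T (\<Sum>i\<in>F. c i *\<^sub>C x i) = (\<Sum>i\<in>F. c i *\<^sub>C T (x i))"
    by (rule bounded_op_on_sum[OF positive_on_bounded[OF T] H]) (rule x)
  also have "cinner (\<Sum>i\<in>F. c i *\<^sub>C x i) (\<Sum>i\<in>F. c i *\<^sub>C T (x i)) =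
      (\<Sum>i\<in>F. \<Sum>j\<in>F. cnj (c i) * cinner (x i) (T (x j)) * c j)"
    unfolding cinner_sum_right cinner_sum_left
    by (subst sum.swap) (simp add: cinner_simps mult_ac)
  finally show "0 \<le> (\<Sum>i\<in>F. \<Sum>j\<in>F. cnj (c i) * cinner (x i) (T (x j)) * c j)" .
qed

text \<open>In the kernel of \<open>T\<close> on the two vectors \<open>x\<close> and
  \<open>T x\<close> the diagonal entry of \<open>x\<close> vanishes, hence its row, which contains
  the squared norm of \<open>T x\<close>.\<close>

lemma positive_on_eq_0:
  assumes T: "positive_on H T" and H: "csubspace H" and x: "x \<in> H" "cinner x (T x) = 0"
  shows "T x = 0"
proof -
  have Tx: "T x \<in> H" by (rule bounded_op_on_in[OF positive_on_bounded[OF T] x(1)])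
  have "psd_kernel {x, T x} (\<lambda>i j. cinner i (T j))"
    using psd_kernel_positive_on[OF T H, of "{x, T x}" "\<lambda>i. i"] x(1) Tx by auto
  then have "cinner x (T (T x)) = 0"
    by (rule psd_kernel_zero_row) (use x(2) in auto)
  then have "cinner (T x) (T x) = 0"
    using positive_on_hermitian[OF T H x(1) Tx] by simp
  then show ?thesis by simp
qed

lemma tendsto_bounded_op_on:
  assumes T: "bounded_op_on H T" and H: "csubspace H"
    and g: "(g \<longlongrightarrow> x) F" "\<forall>\<^sub>F n in F. g n \<in> H" "x \<in> H"
  shows "((\<lambda>n. T (g n)) \<longlongrightarrow> T x) F"
proof -
  obtain K where K: "0 \<le> K" "\<And>x. x \<in> H \<Longrightarrow> norm (T x) \<le> K * norm x"
    using bounded_op_on_bound[OF T] by blast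
  have diff: "T (u - v) = T u - T v" if "u \<in> H" "v \<in> H" for u v
    using bounded_op_on_add[OF T csubspace_diff[OF H that] that(2)] by simp
  have "((\<lambda>n. K * norm (g n - x)) \<longlongrightarrow> K * norm (x - x)) F"
    by (intro tendsto_intros g)
  moreover have "\<forall>\<^sub>F n in F. norm (T (g n) - T x) \<le> K * norm (g n - x)"
    using g(2)
  proof eventually_elim
    case (elim n)
    then show ?case
      using K(2)[OF csubspace_diff[OF H elim g(3)]] diff[OF elim g(3)] by simp
  qed
  ultimately have "((\<lambda>n. T (g n) - T x) \<longlongrightarrow> 0) F"
    using Lim_null_comparison[of "\<lambda>n. T (g n) - T x" "\<lambda>n. K * norm (g n - x)" F] by simp
  then show ?thesis by (rule LIM_zero_cancel)
qed

text \<open>Compressing \<open>T\<close> to the span of finitely many vectors of \<open>B\<close> reduces the claim to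
  \<open>tr ((1 - M) T) \<ge> 0\<close> for the Gram type matrix \<open>M \<le> 1\<close> of the compressed vectors of \<open>F\<close>.\<close>

lemma positive_trace_le:
  assumes T: "positive_on H T" and H: "hspace H" and B: "is_onb H B"
    and bound: "\<And>G. finite G \<Longrightarrow> G \<subseteq> B \<Longrightarrow> (\<Sum>e\<in>G. Re (cinner e (T e))) \<le> K"
    and F: "finite F" "orthonormal_set F" "F \<subseteq> H"
  shows "(\<Sum>f\<in>F. Re (cinner f (T f))) \<le> K"
proof -
  have cs: "csubspace H" using H by (simp add: hspace_def)
  have Bo: "orthonormal_set B" and BH: "B \<subseteq> H" using B by (auto simp: is_onb_iff)
  define P :: "'a set \<Rightarrow> 'a \<Rightarrow> 'a" where "P G f = (\<Sum>e\<in>G. cinner e f *\<^sub>C e)" for G f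
  have PH: "P G f \<in> H" if "G \<subseteq> B" for G f
    unfolding P_def using that BH by (intro csubspace_sum[OF cs] csubspace_scaleC[OF cs]) auto
  have le: "(\<Sum>f\<in>F. Re (cinner (P G f) (T (P G f)))) \<le> K" if G: "finite G" "G \<subseteq> B" for G
  proof -
    have Go: "orthonormal_set G" using Bo G(2) by (rule orthonormal_set_subset)
    have GH: "i \<in> H" if "i \<in> G" for i using that G(2) BH by blast
    let ?M = "\<lambda>i j. \<Sum>f\<in>F. cnj (cinner i f) * cinner j f"
    let ?N = "\<lambda>i j. (if i = j then 1 else 0) - ?M i j"
    \<comment> \<open>The form of \<open>?M\<close> at \<open>c\<close> is the sum of the squared
      coefficients along \<open>F\<close> of the vector \<open>w\<close>, so Bessel's inequality
      bounds it by the squared norm of \<open>w\<close>, the form of the identity.\<close>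
    have "psd_kernel G ?N"
    proof (rule psd_kernelI)
      fix i j
      show "?N j i = cnj (?N i j)" by (simp add: mult.commute)
    next
      fix c
      define w where "w = (\<Sum>j\<in>G. cnj (c j) *\<^sub>C j)"
      have wf: "cinner w f = (\<Sum>j\<in>G. c j * cinner j f)" for f
        by (simp add: w_def cinner_sum_left cinner_scaleC_left)
      have "(\<Sum>i\<in>G. \<Sum>j\<in>G. cnj (c i) * (if i = j then 1 else 0) * c j) = (\<Sum>i\<in>G. \<Sum>j\<in>G. if i = j then cnj (c i) * c i else 0)"
        by (intro sum.cong refl) auto
      also have "\<dots> = (\<Sum>i\<in>G. cnj (c i) * c i)" using G(1) by simp
      also have "\<dots> = of_real (\<Sum>i\<in>G. (cmod (cnj (c i)))\<^sup>2)"
        unfolding of_real_sum complex_norm_square by (simp only: complex_cnj_cnj)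
      also have "\<dots> = of_real ((norm w)\<^sup>2)"
        unfolding w_def by (simp only: norm_sum_orthonormal[OF Go G(1)])
      finally have d: "(\<Sum>i\<in>G. \<Sum>j\<in>G. cnj (c i) * (if i = j then 1 else 0) * c j) = of_real ((norm w)\<^sup>2)" .
      have "(\<Sum>i\<in>G. \<Sum>j\<in>G. cnj (c i) * ?M i j * c j) =
          (\<Sum>i\<in>G. \<Sum>j\<in>G. \<Sum>f\<in>F. cnj (c i * cinner i f) * (c j * cinner j f))"
        by (intro sum.cong refl) (simp add: sum_distrib_left sum_distrib_right mult_ac)
      also have "\<dots> = (\<Sum>i\<in>G. \<Sum>f\<in>F. \<Sum>j\<in>G. cnj (c i * cinner i f) * (c j * cinner j f))"
        by (intro sum.cong refl sum.swap)
      also have "\<dots> = (\<Sum>f\<in>F. \<Sum>i\<in>G. \<Sum>j\<in>G. cnj (c i * cinner i f) * (c j * cinner j f))"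
        by (rule sum.swap)
      also have "\<dots> = (\<Sum>f\<in>F. cnj (cinner w f) * cinner w f)"
        unfolding wf cnj_sum sum_product ..
      also have "\<dots> = of_real (\<Sum>f\<in>F. (cmod (cinner f w))\<^sup>2)"
        unfolding of_real_sum complex_norm_square
        by (intro sum.cong refl) (metis cinner_commute)
      finally have m: "(\<Sum>i\<in>G. \<Sum>j\<in>G. cnj (c i) * ?M i j * c j) = of_real (\<Sum>f\<in>F. (cmod (cinner f w))\<^sup>2)" .
      have "(\<Sum>i\<in>G. \<Sum>j\<in>G. cnj (c i) * ?N i j * c j) =
         (\<Sum>i\<in>G. \<Sum>j\<in>G. cnj (c i) * (if i = j then 1 else 0) * c j) - (\<Sum>i\<in>G. \<Sum>j\<in>G. cnj (c i) * ?M i j * c j)"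
        by (simp only: right_diff_distrib left_diff_distrib sum_subtractf)
      also have "\<dots> = of_real ((norm w)\<^sup>2 - (\<Sum>f\<in>F. (cmod (cinner f w))\<^sup>2))"
        unfolding d m by simp
      finally show "0 \<le> (\<Sum>i\<in>G. \<Sum>j\<in>G. cnj (c i) * ?N i j * c j)"
        using Bessel_inequality[OF F(2,1), of w] by (simp add: less_eq_complex_def)
    qed
    \<comment> \<open>The double sum is the trace of the product of 1 - M with the compression of
      \<open>T\<close> to \<open>G\<close>, nonnegative by the Schur argument.\<close>
    from psd_kernel_sum_mult_nonneg[OF G(1) this psd_kernel_positive_on[OF T cs, of G "\<lambda>i. i"]] GH
    have "0 \<le> (\<Sum>i\<in>G. \<Sum>j\<in>G. ?N i j * cinner i (T j))" by blast
    also have "\<dots> = (\<Sum>i\<in>G. \<Sum>j\<in>G. (if i = j then 1 else 0) * cinner i (T j)) - (\<Sum>i\<in>G. \<Sum>j\<in>G. ?M i j * cinner i (T j))"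
      by (simp only: left_diff_distrib sum_subtractf)
    also have "(\<Sum>i\<in>G. \<Sum>j\<in>G. (if i = j then 1 else 0) * cinner i (T j)) = (\<Sum>i\<in>G. \<Sum>j\<in>G. if i = j then cinner i (T i) else 0)"
      by (intro sum.cong refl) auto
    also have "\<dots> = (\<Sum>i\<in>G. cinner i (T i))" using G(1) by simp
    also have "(\<Sum>i\<in>G. \<Sum>j\<in>G. ?M i j * cinner i (T j)) = (\<Sum>f\<in>F. cinner (P G f) (T (P G f)))"
    proof -
      have TP: "T (P G f) = (\<Sum>e\<in>G. cinner e f *\<^sub>C T e)" for f
        unfolding P_def by (rule bounded_op_on_sum[OF positive_on_bounded[OF T] cs]) (rule GH)
      have "cinner (P G f) (T (P G f)) = (\<Sum>i\<in>G. \<Sum>j\<in>G. cnj (cinner i f) * cinner j f * cinner i (T j))" for f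
        unfolding TP unfolding P_def cinner_sum_right cinner_sum_left
        by (subst sum.swap) (simp add: cinner_simps mult_ac)
      then have "(\<Sum>f\<in>F. cinner (P G f) (T (P G f))) = (\<Sum>f\<in>F. \<Sum>i\<in>G. \<Sum>j\<in>G. cnj (cinner i f) * cinner j f * cinner i (T j))"
        by simp
      also have "\<dots> = (\<Sum>i\<in>G. \<Sum>f\<in>F. \<Sum>j\<in>G. cnj (cinner i f) * cinner j f * cinner i (T j))"
        by (rule sum.swap)
      also have "\<dots> = (\<Sum>i\<in>G. \<Sum>j\<in>G. \<Sum>f\<in>F. cnj (cinner i f) * cinner j f * cinner i (T j))"
        by (intro sum.cong refl sum.swap)
      finally show ?thesis by (simp only: sum_distrib_right)
    qed
    finally have "(\<Sum>f\<in>F. Re (cinner (P G f) (T (P G f)))) \<le> (\<Sum>i\<in>G. Re (cinner i (T i)))"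
      by (simp add: less_eq_complex_def)
    also have "\<dots> \<le> K" by (rule bound[OF G])
    finally show ?thesis .
  qed
  \<comment> \<open>The compressions converge along the finite subsets of \<open>B\<close> because
    \<open>P G f\<close> is a partial sum of the expansion of \<open>f\<close> and \<open>T\<close>
    is bounded.\<close>
  have "((\<lambda>G. \<Sum>f\<in>F. Re (cinner (P G f) (T (P G f)))) \<longlongrightarrow> (\<Sum>f\<in>F. Re (cinner f (T f)))) (finite_subsets_at_top B)"
  proof (intro tendsto_sum tendsto_Re cinner.tendsto)
    fix f assume "f \<in> F"
    then have f: "f \<in> H" using F(3) by blast
    show P: "((\<lambda>G. P G f) \<longlongrightarrow> f) (finite_subsets_at_top B)"
      using onb_expansion[OF B f] by (simp add: has_sum_def P_def)
    show "((\<lambda>G. T (P G f)) \<longlongrightarrow> T f) (finite_subsets_at_top B)"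
      by (rule tendsto_bounded_op_on[OF positive_on_bounded[OF T] cs P _ f])
        (rule eventually_finite_subsets_at_top_weakI, rule PH)
  qed
  then show ?thesis
    by (rule tendsto_upperbound) (auto intro: eventually_finite_subsets_at_top_weakI le)
qed

text \<open>Partial sums in one basis are bounded by the full sum in the other; this gives
  summability, and applied in both directions the equality of the sums.\<close>

lemma positive_trace_basis_independent:
  assumes T: "positive_on H T" and H: "hspace H" and B: "is_onb H B" "is_onb H B'"
    and s: "((\<lambda>e. Re (cinner e (T e))) has_sum s) B"
  shows "((\<lambda>e. Re (cinner e (T e))) has_sum s) B'"
proof -
  have bound: "(\<Sum>e\<in>F. Re (cinner e (T e))) \<le> s"
    if C: "is_onb H C" "is_onb H C'" and s: "((\<lambda>e. Re (cinner e (T e))) has_sum s) C"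
      and F: "finite F" "F \<subseteq> C'" for C C' s F
  proof (rule positive_trace_le[OF T H C(1) _ F(1)])
    show "orthonormal_set F" "F \<subseteq> H"
      using C(2) F(2) orthonormal_set_subset by (auto simp: is_onb_iff)
    show "(\<Sum>e\<in>G. Re (cinner e (T e))) \<le> s" if "finite G" "G \<subseteq> C" for G
    proof (rule finite_sum_le_has_sum[OF s that])
      show "0 \<le> Re (cinner x (T x))" if "x \<in> C - G" for x
        using that C(1) by (intro positive_on_diag_real(2)[OF T]) (auto simp: is_onb_iff)
    qed
  qed
  have le: "s' \<le> s" if "is_onb H C" "is_onb H C'" "((\<lambda>e. Re (cinner e (T e))) has_sum s) C"
    "((\<lambda>e. Re (cinner e (T e))) has_sum s') C'" for C C' s s'
  proof (rule has_sum_le_finite_sums[OF that(4)])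
    fix F assume "finite F" "F \<subseteq> C'"
    then show "(\<Sum>e\<in>F. Re (cinner e (T e))) \<le> s"
      by (rule bound[OF that(1-3)])
  qed
  have "(\<lambda>e. Re (cinner e (T e))) summable_on B'"
  proof (rule nonneg_bdd_above_summable_on)
    show "0 \<le> Re (cinner e (T e))" if "e \<in> B'" for e
      using that B(2) by (intro positive_on_diag_real(2)[OF T]) (auto simp: is_onb_iff)
    show "bdd_above (sum (\<lambda>e. Re (cinner e (T e))) ` {F. F \<subseteq> B' \<and> finite F})"
    proof (rule bdd_aboveI2)
      fix F assume "F \<in> {F. F \<subseteq> B' \<and> finite F}"
      then show "(\<Sum>e\<in>F. Re (cinner e (T e))) \<le> s"
        by (intro bound[OF B s]) auto
    qed
  qed
  then obtain s' where s': "((\<lambda>e. Re (cinner e (T e))) has_sum s') B'"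
    by (auto simp: summable_on_def)
  have "s = s'"
    using le[OF B s s'] le[OF B(2,1) s' s] by simp
  with s' show ?thesis by simp
qed

lemma positive_has_sum_Re_iff:
  assumes "positive_on H T" "B \<subseteq> H"
  shows "((\<lambda>e. cinner e (T e)) has_sum of_real s) B \<longleftrightarrow> ((\<lambda>e. Re (cinner e (T e))) has_sum s) B"
proof -
  have "((\<lambda>e. cinner e (T e)) has_sum of_real s) B \<longleftrightarrow>
      ((\<lambda>e. complex_of_real (Re (cinner e (T e)))) has_sum of_real s) B"
    using assms positive_on_diag_real(1) by (intro has_sum_cong) blast
  then show ?thesis by (simp add: has_sum_of_real_iff)
qed

lemma density_op_positive: "density_op H \<rho> \<Longrightarrow> positive_on H \<rho>"
  by (auto simp: density_op_def positive_on_def complex_nonneg_Reals_iff less_eq_complex_def)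

lemma density_op_bounded: "density_op H \<rho> \<Longrightarrow> bounded_op_on H \<rho>"
  by (simp add: density_op_def)

lemma density_op_trace:
  assumes "density_op H \<rho>" "is_onb H B"
  shows "((\<lambda>e. Re (cinner e (\<rho> e))) has_sum 1) B"
  using assms positive_has_sum_Re_iff[OF density_op_positive[OF assms(1)], of B 1]
  by (simp add: density_op_def is_onb_iff)

text \<open>\<open>density_op\<close> asks for trace 1 in every orthonormal basis; by basis
  independence one basis is enough.\<close>

lemma density_opI:
  assumes "positive_on H \<rho>" "hspace H" "is_onb H B" "((\<lambda>e. Re (cinner e (\<rho> e))) has_sum 1) B"
  shows "density_op H \<rho>"
  unfolding density_op_def
proof (intro conjI ballI allI impI)
  show "bounded_op_on H \<rho>" using assms(1) by (rule positive_on_bounded)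
  show "cinner x (\<rho> x) \<in> \<real>\<^sub>\<ge>\<^sub>0" if "x \<in> H" for x
    using positive_on_nonneg[OF assms(1) that] by (simp add: complex_nonneg_Reals_iff less_eq_complex_def)
  fix C assume C: "is_onb H C"
  show "((\<lambda>e. cinner e (\<rho> e)) has_sum 1) C"
    using positive_trace_basis_independent[OF assms(1-3) C assms(4)] C
      positive_has_sum_Re_iff[OF assms(1), of C 1] by (simp add: is_onb_iff)
qed


lemma density_op_nonzero:
  assumes "density_op H \<rho>" "hspace H"
  obtains x where "x \<in> H" "cinner x (\<rho> x) \<noteq> 0"
proof -
  obtain B where B: "is_onb H B" using onb_exists[OF assms(2)] .
  have "\<exists>x\<in>B. cinner x (\<rho> x) \<noteq> 0"
  proof (rule ccontr)
    assume "\<not> ?thesis"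
    then have "((\<lambda>e. Re (cinner e (\<rho> e))) has_sum 1) B \<longleftrightarrow> ((\<lambda>e. 0::real) has_sum 1) B"
      by (intro has_sum_cong) auto
    then have "((\<lambda>e. 0::real) has_sum 1) B"
      using density_op_trace[OF assms(1) B] by simp
    then show False using has_sum_unique[OF has_sum_0_simp] by fastforce
  qed
  then show ?thesis using B that by (auto simp: is_onb_iff)
qed


section \<open>Tensor products of operators\<close>

lemma hilbert_tensorD:
  assumes "hilbert_tensor H K \<tau>"
  shows hilbert_tensor_add_left: "x \<in> H \<Longrightarrow> x' \<in> H \<Longrightarrow> y \<in> K \<Longrightarrow> \<tau> (x + x') y = \<tau> x y + \<tau> x' y"
    and hilbert_tensor_add_right: "x \<in> H \<Longrightarrow> y \<in> K \<Longrightarrow> y' \<in> K \<Longrightarrow> \<tau> x (y + y') = \<tau> x y + \<tau> x y'"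
    and hilbert_tensor_scaleC_left: "x \<in> H \<Longrightarrow> y \<in> K \<Longrightarrow> \<tau> (c *\<^sub>C x) y = c *\<^sub>C \<tau> x y"
    and hilbert_tensor_scaleC_right: "x \<in> H \<Longrightarrow> y \<in> K \<Longrightarrow> \<tau> x (c *\<^sub>C y) = c *\<^sub>C \<tau> x y"
    and hilbert_tensor_cinner: "x \<in> H \<Longrightarrow> x' \<in> H \<Longrightarrow> y \<in> K \<Longrightarrow> y' \<in> K \<Longrightarrow>
      cinner (\<tau> x y) (\<tau> x' y') = cinner x x' * cinner y y'"
    and hilbert_tensor_dense: "z \<in> closure (cspan {\<tau> x y |x y. x \<in> H \<and> y \<in> K})"
  using assms by (auto simp: hilbert_tensor_def)

lemma hilbert_tensor_norm:
  assumes "hilbert_tensor H K \<tau>" "x \<in> H" "y \<in> K"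
  shows "norm (\<tau> x y) = norm x * norm y"
proof -
  have "complex_of_real ((norm (\<tau> x y))\<^sup>2) = complex_of_real ((norm x * norm y)\<^sup>2)"
    using hilbert_tensor_cinner[OF assms(1,2,2,3,3)] by (simp add: cinner_self power_mult_distrib)
  then have "(norm (\<tau> x y))\<^sup>2 = (norm x * norm y)\<^sup>2" by (simp only: of_real_eq_iff)
  then show ?thesis by simp
qed

lemma hilbert_tensor_dense_image:
  "hilbert_tensor H K \<tau> \<Longrightarrow> UNIV \<subseteq> closure (cspan ((\<lambda>(x, y). \<tau> x y) ` (H \<times> K)))"
proof -
  assume "hilbert_tensor H K \<tau>"
  moreover have "(\<lambda>(x, y). \<tau> x y) ` (H \<times> K) = {\<tau> x y |x y. x \<in> H \<and> y \<in> K}" by auto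
  ultimately show ?thesis by (simp add: hilbert_tensor_def)
qed

text \<open>The norm bound of \<open>A\<close> on the combination of the \<open>x i\<close>, in the
  form that can be multiplied over tensor factors.\<close>

lemma psd_kernel_operator_bound:
  assumes A: "bounded_op_on H A" and H: "csubspace H" and a: "0 \<le> a" "\<And>x. x \<in> H \<Longrightarrow> norm (A x) \<le> a * norm x"
    and x: "\<And>i. i \<in> F \<Longrightarrow> x i \<in> H"
  shows "psd_kernel F (\<lambda>i j. of_real (a\<^sup>2) * cinner (x i) (x j) - cinner (A (x i)) (A (x j)))"
proof (rule psd_kernelI)
  fix i j assume "i \<in> F" "j \<in> F"
  show "of_real (a\<^sup>2) * cinner (x j) (x i) - cinner (A (x j)) (A (x i)) =
      cnj (of_real (a\<^sup>2) * cinner (x i) (x j) - cinner (A (x i)) (A (x j)))"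
    using cinner_commute[of "x j" "x i"] cinner_commute[of "A (x j)" "A (x i)"] by simp
next
  fix c
  define z where "z = (\<Sum>i\<in>F. c i *\<^sub>C x i)"
  have z: "z \<in> H" unfolding z_def using x by (intro csubspace_sum[OF H] csubspace_scaleC[OF H])
  have Az: "A z = (\<Sum>i\<in>F. c i *\<^sub>C A (x i))"
    unfolding z_def by (rule bounded_op_on_sum[OF A H]) (rule x)
  have "(norm (A z))\<^sup>2 \<le> (a * norm z)\<^sup>2"
    using a(2)[OF z] by (intro power_mono) auto
  then have "0 \<le> complex_of_real (a\<^sup>2) * of_real ((norm z)\<^sup>2) - of_real ((norm (A z))\<^sup>2)"
    by (simp add: less_eq_complex_def power_mult_distrib)
  also have "\<dots> = of_real (a\<^sup>2) * (\<Sum>i\<in>F. \<Sum>j\<in>F. cnj (c i) * cinner (x i) (x j) * c j) -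
      (\<Sum>i\<in>F. \<Sum>j\<in>F. cnj (c i) * cinner (A (x i)) (A (x j)) * c j)"
    unfolding Az unfolding z_def norm_sum_power2 ..
  also have "\<dots> = (\<Sum>i\<in>F. \<Sum>j\<in>F. cnj (c i) *
      (of_real (a\<^sup>2) * cinner (x i) (x j) - cinner (A (x i)) (A (x j))) * c j)"
    by (simp add: right_diff_distrib left_diff_distrib sum_subtractf sum_distrib_left mult.assoc
        mult.left_commute)
  finally show "0 \<le> (\<Sum>i\<in>F. \<Sum>j\<in>F. cnj (c i) *
      (of_real (a\<^sup>2) * cinner (x i) (x j) - cinner (A (x i)) (A (x j))) * c j)" .
qed

lemma tensor_op_eqI:
  assumes "hilbert_tensor H K \<tau>" "bounded_clinear C" "\<And>x y. x \<in> H \<Longrightarrow> y \<in> K \<Longrightarrow> C (\<tau> x y) = \<tau> (A x) (B y)"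
  shows "tensor_op H K \<tau> A B = C"
  unfolding tensor_op_def bounded_op_on_UNIV
proof (rule the_equality)
  fix C' assume C': "bounded_clinear C' \<and> (\<forall>x\<in>H. \<forall>y\<in>K. C' (\<tau> x y) = \<tau> (A x) (B y))"
  show "C' = C"
    by (rule bounded_clinear_eqI[OF _ assms(2) hilbert_tensor_dense_image[OF assms(1)]])
      (use C' assms(3) in auto)
qed (use assms in blast)

text \<open>Gram kernels of product vectors are products of Gram kernels, so the bound a b on finite
  sums follows from the bounds of the factors by \<open>psd_kernel_mult_diff\<close>. The explicit
  constant is what later makes the partial sums of the evolution contractions.\<close>

lemma tensor_op_exists:
  assumes \<tau>: "hilbert_tensor H K \<tau>" and H: "csubspace H" and K: "csubspace K"
    and A: "bounded_op_on H A" "0 \<le> a" "\<And>x. x \<in> H \<Longrightarrow> norm (A x) \<le> a * norm x"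
    and B: "bounded_op_on K B" "0 \<le> b" "\<And>y. y \<in> K \<Longrightarrow> norm (B y) \<le> b * norm y"
  shows tensor_op_bounded': "bounded_clinear (tensor_op H K \<tau> A B)"
    and tensor_op_apply': "\<And>x y. x \<in> H \<Longrightarrow> y \<in> K \<Longrightarrow> tensor_op H K \<tau> A B (\<tau> x y) = \<tau> (A x) (B y)"
    and tensor_op_norm_le: "norm (tensor_op H K \<tau> A B z) \<le> a * b * norm z"
proof -
  obtain C where C: "bounded_clinear C" "\<And>p. p \<in> H \<times> K \<Longrightarrow> C ((\<lambda>(x, y). \<tau> x y) p) = (\<lambda>(x, y). \<tau> (A x) (B y)) p"
    "\<And>z. norm (C z) \<le> a * b * norm z"
  proof (rule bounded_clinear_extension_kernel[OF hilbert_tensor_dense_image[OF \<tau>]])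
    show "0 \<le> a * b" using A(2) B(2) by simp
    fix F assume F: "finite F" "F \<subseteq> H \<times> K"
    have "psd_kernel F (\<lambda>p q. (of_real (a\<^sup>2) * cinner (fst p) (fst q)) * (of_real (b\<^sup>2) * cinner (snd p) (snd q)) -
        cinner (A (fst p)) (A (fst q)) * cinner (B (snd p)) (B (snd q)))"
    proof (rule psd_kernel_mult_diff[OF F(1)])
      show "psd_kernel F (\<lambda>p q. of_real (a\<^sup>2) * cinner (fst p) (fst q) - cinner (A (fst p)) (A (fst q)))"
        using F(2) by (intro psd_kernel_operator_bound[OF A(1) H A(2,3)]) auto
      show "psd_kernel F (\<lambda>p q. of_real (b\<^sup>2) * cinner (snd p) (snd q) - cinner (B (snd p)) (B (snd q)))"
        using F(2) by (intro psd_kernel_operator_bound[OF B(1) K B(2,3)]) auto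
      show "psd_kernel F (\<lambda>p q. of_real (b\<^sup>2) * cinner (snd p) (snd q))"
        by (intro psd_kernel_mult[OF F(1)] psd_kernel_const psd_kernel_cinner) (simp add: less_eq_complex_def)
      show "psd_kernel F (\<lambda>p q. cinner (A (fst p)) (A (fst q)))"
        by (rule psd_kernel_cinner)
    qed
    then show "psd_kernel F (\<lambda>i j. of_real ((a * b)\<^sup>2) * cinner ((\<lambda>(x, y). \<tau> x y) i) ((\<lambda>(x, y). \<tau> x y) j) -
        cinner ((\<lambda>(x, y). \<tau> (A x) (B y)) i) ((\<lambda>(x, y). \<tau> (A x) (B y)) j))"
    proof (rule psd_kernel_cong[THEN iffD1, rotated])
      fix p q assume "p \<in> F" "q \<in> F"
      then have "fst p \<in> H" "fst q \<in> H" "snd p \<in> K" "snd q \<in> K" using F(2) by auto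
      then show "(of_real (a\<^sup>2) * cinner (fst p) (fst q)) * (of_real (b\<^sup>2) * cinner (snd p) (snd q)) -
        cinner (A (fst p)) (A (fst q)) * cinner (B (snd p)) (B (snd q)) = of_real ((a * b)\<^sup>2) * cinner ((\<lambda>(x, y). \<tau> x y) p) ((\<lambda>(x, y). \<tau> x y) q) -
        cinner ((\<lambda>(x, y). \<tau> (A x) (B y)) p) ((\<lambda>(x, y). \<tau> (A x) (B y)) q)"
        by (simp add: case_prod_unfold hilbert_tensor_cinner[OF \<tau>] bounded_op_on_in[OF A(1)]
            bounded_op_on_in[OF B(1)] power_mult_distrib)
    qed
  qed blast
  have "tensor_op H K \<tau> A B = C"
    by (rule tensor_op_eqI[OF \<tau> C(1)]) (use C(2) in auto)
  then show "bounded_clinear (tensor_op H K \<tau> A B)"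
    "\<And>x y. x \<in> H \<Longrightarrow> y \<in> K \<Longrightarrow> tensor_op H K \<tau> A B (\<tau> x y) = \<tau> (A x) (B y)"
    "norm (tensor_op H K \<tau> A B z) \<le> a * b * norm z"
    using C(1) C(2)[of "(_, _)"] C(3) by auto
qed

lemma
  assumes "hilbert_tensor H K \<tau>" "csubspace H" "csubspace K" "bounded_op_on H A" "bounded_op_on K B"
  shows tensor_op_bounded: "bounded_clinear (tensor_op H K \<tau> A B)"
    and tensor_op_apply: "x \<in> H \<Longrightarrow> y \<in> K \<Longrightarrow> tensor_op H K \<tau> A B (\<tau> x y) = \<tau> (A x) (B y)"
proof -
  obtain a where a: "0 \<le> a" "\<And>x. x \<in> H \<Longrightarrow> norm (A x) \<le> a * norm x"
    using bounded_op_on_bound[OF assms(4)] by blast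
  obtain b where b: "0 \<le> b" "\<And>y. y \<in> K \<Longrightarrow> norm (B y) \<le> b * norm y"
    using bounded_op_on_bound[OF assms(5)] by blast
  note * = tensor_op_exists[OF assms(1-4) a assms(5) b]
  show "bounded_clinear (tensor_op H K \<tau> A B)" by (rule *)
  show "x \<in> H \<Longrightarrow> y \<in> K \<Longrightarrow> tensor_op H K \<tau> A B (\<tau> x y) = \<tau> (A x) (B y)" by (rule *)
qed

lemma hilbert_tensorsD:
  assumes "hilbert_tensors I H \<tau>"
  shows hilbert_tensors_add: "x \<in> Pi I H \<Longrightarrow> k \<in> I \<Longrightarrow> u \<in> H k \<Longrightarrow> v \<in> H k \<Longrightarrow>
      \<tau> (x(k := u + v)) = \<tau> (x(k := u)) + \<tau> (x(k := v))"
    and hilbert_tensors_scaleC: "x \<in> Pi I H \<Longrightarrow> k \<in> I \<Longrightarrow> u \<in> H k \<Longrightarrow> \<tau> (x(k := c *\<^sub>C u)) = c *\<^sub>C \<tau> (x(k := u))"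
    and hilbert_tensors_cinner: "x \<in> Pi I H \<Longrightarrow> y \<in> Pi I H \<Longrightarrow> cinner (\<tau> x) (\<tau> y) = (\<Prod>k\<in>I. cinner (x k) (y k))"
    and hilbert_tensors_dense: "UNIV \<subseteq> closure (cspan (\<tau> ` Pi I H))"
  using assms by (auto simp: hilbert_tensors_def)

text \<open>\<open>\<tau>\<close> takes total functions as arguments, but its inner products see
  only the coordinates in \<open>I\<close>; by density the other coordinates do not influence the
  product vector.\<close>

lemma hilbert_tensors_cong:
  assumes "hilbert_tensors I H \<tau>" "x \<in> Pi I H" "\<And>k. k \<in> I \<Longrightarrow> x k = y k"
  shows "\<tau> x = \<tau> y"
proof (rule cinner_eqI_dense[OF hilbert_tensors_dense[OF assms(1)]])
  fix s assume "s \<in> \<tau> ` Pi I H"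
  then obtain z where z: "z \<in> Pi I H" "s = \<tau> z" by blast
  have "y \<in> Pi I H" using assms(2,3) by (auto simp: Pi_iff)
  then show "cinner s (\<tau> x) = cinner s (\<tau> y)"
    using assms(2,3) z by (simp add: hilbert_tensors_cinner[OF assms(1)])
qed

lemma tensor_ops_eqI:
  assumes "hilbert_tensors I H \<tau>" "bounded_clinear C" "\<And>x. x \<in> Pi I H \<Longrightarrow> C (\<tau> x) = \<tau> (\<lambda>k. A k (x k))"
  shows "tensor_ops I H \<tau> A = C"
  unfolding tensor_ops_def bounded_op_on_UNIV
proof (rule the_equality)
  fix C' assume C': "bounded_clinear C' \<and> (\<forall>x\<in>Pi I H. C' (\<tau> x) = \<tau> (\<lambda>k. A k (x k)))"
  show "C' = C"
    by (rule bounded_clinear_eqI[OF _ assms(2) hilbert_tensors_dense[OF assms(1)]])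
      (use C' assms(3) in auto)
qed (use assms in blast)

lemma
  assumes \<tau>: "hilbert_tensors I H \<tau>" and H: "\<And>k. k \<in> I \<Longrightarrow> csubspace (H k)"
    and A: "\<And>k. k \<in> I \<Longrightarrow> bounded_op_on (H k) (A k)"
  shows tensor_ops_bounded: "bounded_clinear (tensor_ops I H \<tau> A)"
    and tensor_ops_apply: "\<And>x. x \<in> Pi I H \<Longrightarrow> tensor_ops I H \<tau> A (\<tau> x) = \<tau> (\<lambda>k. A k (x k))"
proof -
  have "\<forall>k\<in>I. \<exists>a\<ge>0. \<forall>x\<in>H k. norm (A k x) \<le> a * norm x"
    using bounded_op_on_bound[OF A] by metis
  then obtain a where a: "\<And>k. k \<in> I \<Longrightarrow> 0 \<le> a k" "\<And>k x. k \<in> I \<Longrightarrow> x \<in> H k \<Longrightarrow> norm (A k x) \<le> a k * norm x"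
    by metis
  obtain C where C: "bounded_clinear C" "\<And>x. x \<in> Pi I H \<Longrightarrow> C (\<tau> x) = \<tau> (\<lambda>k. A k (x k))"
  proof (rule bounded_clinear_extension_kernel[OF hilbert_tensors_dense[OF \<tau>], of "prod a I"])
    show "0 \<le> prod a I" using a(1) by (rule prod_nonneg)
    fix F assume F: "finite F" "F \<subseteq> Pi I H"
    have xF: "x k \<in> H k" if "x \<in> F" "k \<in> I" for x k using that F(2) by (auto simp: Pi_iff)
    have "psd_kernel F (\<lambda>x y. (\<Prod>k\<in>I. of_real ((a k)\<^sup>2) * cinner (x k) (y k)) - (\<Prod>k\<in>I. cinner (A k (x k)) (A k (y k))))"
    proof (rule psd_kernel_prod_diff[OF F(1)])
      fix k assume k: "k \<in> I"
      show "psd_kernel F (\<lambda>x y. of_real ((a k)\<^sup>2) * cinner (x k) (y k) - cinner (A k (x k)) (A k (y k)))"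
        using a k xF by (intro psd_kernel_operator_bound[OF A[OF k] H[OF k]]) auto
      show "psd_kernel F (\<lambda>x y. of_real ((a k)\<^sup>2) * cinner (x k) (y k))"
        by (intro psd_kernel_mult[OF F(1)] psd_kernel_const psd_kernel_cinner) (simp add: less_eq_complex_def)
      show "psd_kernel F (\<lambda>x y. cinner (A k (x k)) (A k (y k)))"
        by (rule psd_kernel_cinner)
    qed
    then show "psd_kernel F (\<lambda>x y. of_real ((prod a I)\<^sup>2) * cinner (\<tau> x) (\<tau> y) -
        cinner (\<tau> (\<lambda>k. A k (x k))) (\<tau> (\<lambda>k. A k (y k))))"
    proof (rule psd_kernel_cong[THEN iffD1, rotated])
      fix x y assume "x \<in> F" "y \<in> F"
      then have xy: "x \<in> Pi I H" "y \<in> Pi I H" using F(2) by auto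
      then have "(\<lambda>k. A k (x k)) \<in> Pi I H" "(\<lambda>k. A k (y k)) \<in> Pi I H"
        using bounded_op_on_in[OF A] by (auto simp: Pi_iff)
      then show "(\<Prod>k\<in>I. of_real ((a k)\<^sup>2) * cinner (x k) (y k)) - (\<Prod>k\<in>I. cinner (A k (x k)) (A k (y k))) =
          of_real ((prod a I)\<^sup>2) * cinner (\<tau> x) (\<tau> y) - cinner (\<tau> (\<lambda>k. A k (x k))) (\<tau> (\<lambda>k. A k (y k)))"
        using xy by (simp add: hilbert_tensors_cinner[OF \<tau>] prod.distrib prod_power_distrib)
    qed
  qed blast
  have "tensor_ops I H \<tau> A = C"
    by (rule tensor_ops_eqI[OF \<tau> C]) 
  then show "bounded_clinear (tensor_ops I H \<tau> A)"
    "\<And>x. x \<in> Pi I H \<Longrightarrow> tensor_ops I H \<tau> A (\<tau> x) = \<tau> (\<lambda>k. A k (x k))"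
    using C by auto
qed

text \<open>Maps such as \<open>\<tau>\<close> with all arguments but one fixed are linear only on a
  subspace and take values in another type, which fits neither \<open>bounded_clinear\<close> nor
  \<open>bounded_op_on\<close>.\<close>

definition bounded_clinear_on :: "'a::chilbert_space set \<Rightarrow> ('a \<Rightarrow> 'b::chilbert_space) \<Rightarrow> bool" where
  "bounded_clinear_on H f \<longleftrightarrow> (\<forall>x\<in>H. \<forall>y\<in>H. f (x + y) = f x + f y) \<and>
     (\<forall>c. \<forall>x\<in>H. f (c *\<^sub>C x) = c *\<^sub>C f x) \<and> (\<exists>K. \<forall>x\<in>H. norm (f x) \<le> K * norm x)"

lemma bounded_clinear_onI:
  assumes "\<And>x y. x \<in> H \<Longrightarrow> y \<in> H \<Longrightarrow> f (x + y) = f x + f y" "\<And>c x. x \<in> H \<Longrightarrow> f (c *\<^sub>C x) = c *\<^sub>C f x"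
    "\<And>x. x \<in> H \<Longrightarrow> norm (f x) \<le> K * norm x"
  shows "bounded_clinear_on H f"
  unfolding bounded_clinear_on_def using assms by blast

lemma bounded_op_on_imp_clinear_on: "bounded_op_on H A \<Longrightarrow> bounded_clinear_on H A"
  by (simp add: bounded_op_on_def bounded_clinear_on_def)

lemma hspace_preimage:
  assumes f: "bounded_clinear_on H f" and H: "hspace H" and L: "hspace L"
  shows "hspace {x \<in> H. f x \<in> L}"
proof -
  have cH: "csubspace H" and clH: "closed H" and cL: "csubspace L" and clL: "closed L"
    using H L by (auto simp: hspace_def)
  obtain K where K: "\<And>x. x \<in> H \<Longrightarrow> norm (f x) \<le> K * norm x"
    using f unfolding bounded_clinear_on_def by blast
  have add: "\<And>x y. x \<in> H \<Longrightarrow> y \<in> H \<Longrightarrow> f (x + y) = f x + f y"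
    and sc: "\<And>c x. x \<in> H \<Longrightarrow> f (c *\<^sub>C x) = c *\<^sub>C f x"
    using f by (auto simp: bounded_clinear_on_def)
  have f0: "f 0 = 0" using sc[OF csubspace_0[OF cH], of 0] by simp
  have diff: "f (u - v) = f u - f v" if "u \<in> H" "v \<in> H" for u v
    using add[OF csubspace_diff[OF cH that] that(2)] by simp
  have "csubspace {x \<in> H. f x \<in> L}"
    by (rule cvs.subspaceI) (simp_all add: csubspaceD[OF cH] csubspaceD[OF cL] f0 add sc)
  moreover have "closed {x \<in> H. f x \<in> L}"
    unfolding closed_sequential_limits
  proof (intro allI impI, elim conjE)
    fix g x assume g: "\<forall>n. g n \<in> {x \<in> H. f x \<in> L}" "g \<longlonglongrightarrow> x"
    then have gH: "g n \<in> H" and gL: "f (g n) \<in> L" for n by auto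
    have xH: "x \<in> H" by (rule closed_sequentially[OF clH gH g(2)])
    have "(\<lambda>n. K * norm (g n - x)) \<longlonglongrightarrow> K * norm (x - x)"
      by (intro tendsto_intros g(2))
    moreover have "norm (f (g n) - f x) \<le> K * norm (g n - x)" for n
      using K[OF csubspace_diff[OF cH gH[of n] xH]] diff[OF gH[of n] xH] by simp
    ultimately have "(\<lambda>n. f (g n) - f x) \<longlonglongrightarrow> 0"
      using Lim_null_comparison[of "\<lambda>n. f (g n) - f x" "\<lambda>n. K * norm (g n - x)" sequentially] by simp
    then have "(\<lambda>n. f (g n)) \<longlonglongrightarrow> f x" by (rule LIM_zero_cancel)
    then have "f x \<in> L" by (rule closed_sequentially[OF clL gL])
    with xH show "x \<in> {x \<in> H. f x \<in> L}" by simp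
  qed
  ultimately show ?thesis by (simp add: hspace_def)
qed

text \<open>The preimage of a closed subspace is a closed subspace, so membership can be tested on a
  dense spanning set. \<open>L = {0}\<close> gives equality of operators; a closed span as
  \<open>L\<close> gives density of product vectors.\<close>

lemma bounded_clinear_on_in_hspace:
  assumes "bounded_clinear_on H f" "hspace H" "hspace L" "D \<subseteq> H" "H \<subseteq> closure (cspan D)"
    "\<And>d. d \<in> D \<Longrightarrow> f d \<in> L" "x \<in> H"
  shows "f x \<in> L"
proof -
  have "D \<subseteq> {x \<in> H. f x \<in> L}" using assms(4,6) by auto
  from closure_cspan_minimal[OF hspace_preimage[OF assms(1-3)] this] show ?thesis
    using assms(5,7) by auto
qed

lemma hspace_0: "hspace {0}"
  by (auto simp: hspace_def intro!: cvs.subspaceI)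

lemma bounded_op_on_eqI:
  assumes A: "bounded_op_on H A" "bounded_op_on H B" and H: "hspace H" and D: "D \<subseteq> H" "H \<subseteq> closure (cspan D)"
    and eq: "\<And>d. d \<in> D \<Longrightarrow> A d = B d" and x: "x \<in> H"
  shows "A x = B x"
proof -
  obtain a where a: "0 \<le> a" "\<And>x. x \<in> H \<Longrightarrow> norm (A x) \<le> a * norm x"
    using bounded_op_on_bound[OF A(1)] by blast
  obtain b where b: "0 \<le> b" "\<And>x. x \<in> H \<Longrightarrow> norm (B x) \<le> b * norm x"
    using bounded_op_on_bound[OF A(2)] by blast
  have "bounded_clinear_on H (\<lambda>x. A x - B x)"
  proof (rule bounded_clinear_onI)
    show "norm (A x - B x) \<le> (a + b) * norm x" if "x \<in> H" for x
      using norm_triangle_ineq4[of "A x" "B x"] a(2)[OF that] b(2)[OF that] by (simp add: algebra_simps)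
  qed (simp_all add: bounded_op_onD[OF A(1)] bounded_op_onD[OF A(2)] scaleC.diff_right)
  then have "A x - B x \<in> {0}"
    by (rule bounded_clinear_on_in_hspace[OF _ H hspace_0 D]) (use eq x in auto)
  then show ?thesis by simp
qed


section \<open>Product bases and product states\<close>

text \<open>One factor is enlarged at a time: first \<open>x\<close> ranges over \<open>H\<close>
  with \<open>y\<close> still in \<open>E\<close>, then \<open>y\<close> over
  \<open>K\<close>.\<close>

lemma hilbert_tensor_dense_subsets:
  assumes \<tau>: "hilbert_tensor H K \<tau>" and H: "hspace H" and K: "hspace K"
    and D: "D \<subseteq> H" "H \<subseteq> closure (cspan D)" and E: "E \<subseteq> K" "K \<subseteq> closure (cspan E)"
  shows "UNIV \<subseteq> closure (cspan ((\<lambda>(x, y). \<tau> x y) ` (D \<times> E)))"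
proof -
  let ?L = "closure (cspan ((\<lambda>(x, y). \<tau> x y) ` (D \<times> E)))"
  have L: "hspace ?L" by (rule hspace_closure_cspan)
  have 1: "\<tau> x y \<in> ?L" if y: "y \<in> E" and x: "x \<in> H" for x y
  proof (rule bounded_clinear_on_in_hspace[OF _ H L D])
    have yK: "y \<in> K" using y E(1) by blast
    show "bounded_clinear_on H (\<lambda>x. \<tau> x y)"
      by (rule bounded_clinear_onI[of _ _ "norm y"])
        (simp_all add: yK hilbert_tensor_add_left[OF \<tau>] hilbert_tensor_scaleC_left[OF \<tau>]
          hilbert_tensor_norm[OF \<tau>])
    show "\<tau> d y \<in> ?L" if "d \<in> D" for d
      using that y by (intro in_closure_cspan) auto
  qed (rule x)
  have 2: "\<tau> x y \<in> ?L" if x: "x \<in> H" and y: "y \<in> K" for x y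
  proof (rule bounded_clinear_on_in_hspace[OF _ K L E])
    show "bounded_clinear_on K (\<lambda>y. \<tau> x y)"
      by (rule bounded_clinear_onI[of _ _ "norm x"])
        (simp_all add: x hilbert_tensor_add_right[OF \<tau>] hilbert_tensor_scaleC_right[OF \<tau>]
          hilbert_tensor_norm[OF \<tau>])
  qed (use 1 x y in auto)
  have "(\<lambda>(x, y). \<tau> x y) ` (H \<times> K) \<subseteq> ?L" using 2 by auto
  from closure_cspan_minimal[OF L this] hilbert_tensor_dense_image[OF \<tau>] show ?thesis by blast
qed

lemma hilbert_tensors_norm:
  assumes "hilbert_tensors I H \<tau>" "x \<in> Pi I H"
  shows "norm (\<tau> x) = (\<Prod>k\<in>I. norm (x k))"
proof -
  have "complex_of_real ((norm (\<tau> x))\<^sup>2) = complex_of_real ((\<Prod>k\<in>I. norm (x k))\<^sup>2)"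
    using hilbert_tensors_cinner[OF assms assms(2)]
    by (simp add: cinner_self prod_power_distrib)
  then have "(norm (\<tau> x))\<^sup>2 = (\<Prod>k\<in>I. norm (x k))\<^sup>2" by (simp only: of_real_eq_iff)
  then show ?thesis by (simp add: prod_nonneg)
qed

lemma fun_upd_in_Pi: "x \<in> Pi I H \<Longrightarrow> u \<in> H k \<Longrightarrow> x(k := u) \<in> Pi I H"
  by (auto simp: Pi_iff)

lemma hilbert_tensors_bounded_clinear_on:
  assumes "hilbert_tensors I H \<tau>" "finite I" "x \<in> Pi I H" "k \<in> I"
  shows "bounded_clinear_on (H k) (\<lambda>u. \<tau> (x(k := u)))"
proof (rule bounded_clinear_onI)
  show "norm (\<tau> (x(k := u))) \<le> (\<Prod>l\<in>I - {k}. norm (x l)) * norm u" if "u \<in> H k" for u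
  proof -
    have "norm (\<tau> (x(k := u))) = (\<Prod>l\<in>I. norm ((x(k := u)) l))"
      by (rule hilbert_tensors_norm[OF assms(1) fun_upd_in_Pi[OF assms(3) that]])
    also have "\<dots> = norm u * (\<Prod>l\<in>I - {k}. norm (x l))"
      using assms(2,4) by (subst prod.remove[of _ k]) (auto intro!: prod.cong)
    finally show ?thesis by simp
  qed
qed (use assms in \<open>simp_all add: hilbert_tensors_add hilbert_tensors_scaleC\<close>)

lemma hilbert_tensors_dense_subsets:
  assumes \<tau>: "hilbert_tensors I H \<tau>" and I: "finite I" and H: "\<And>k. k \<in> I \<Longrightarrow> hspace (H k)"
    and D: "\<And>k. k \<in> I \<Longrightarrow> D k \<subseteq> H k" "\<And>k. k \<in> I \<Longrightarrow> H k \<subseteq> closure (cspan (D k))"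
  shows "UNIV \<subseteq> closure (cspan (\<tau> ` Pi I D))"
proof -
  let ?L = "closure (cspan (\<tau> ` Pi I D))"
  have L: "hspace ?L" by (rule hspace_closure_cspan)
  \<comment> \<open>\<open>J\<close> is the set of coordinates that may already range over all of
    \<open>H k\<close>; the others still lie in \<open>D k\<close>.\<close>
  have "\<tau> x \<in> ?L" if "finite J" "J \<subseteq> I" "x \<in> Pi I H" "\<And>k. k \<in> I - J \<Longrightarrow> x k \<in> D k" for J x
    using that
  proof (induction J arbitrary: x rule: finite_induct)
    case empty
    then have "x \<in> Pi I D" by auto
    then show ?case by (intro in_closure_cspan) auto
  next
    case (insert j J)
    have j: "j \<in> I" using insert.prems(1) by simp
    have "\<tau> (x(j := x j)) \<in> ?L"
    proof (rule bounded_clinear_on_in_hspace[OF hilbert_tensors_bounded_clinear_on[OF \<tau> I insert.prems(2) j] H[OF j] L D(1,2)[OF j]])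
      fix u assume "u \<in> D j"
      then show "\<tau> (x(j := u)) \<in> ?L"
        using insert.prems D(1)[OF j] by (intro insert.IH fun_upd_in_Pi) auto
    next
      show "x j \<in> H j" using insert.prems(2) j by auto
    qed
    then show ?case by simp
  qed
  from this[OF I subset_refl] have "\<tau> ` Pi I H \<subseteq> ?L" by auto
  from closure_cspan_minimal[OF L this] hilbert_tensors_dense[OF \<tau>] show ?thesis by blast
qed

lemma hilbert_tensor_onb:
  assumes \<tau>: "hilbert_tensor H K \<tau>" and H: "hspace H" and K: "hspace K"
    and B: "is_onb H B" and C: "is_onb K C"
  shows "is_onb UNIV ((\<lambda>(x, y). \<tau> x y) ` (B \<times> C))" "inj_on (\<lambda>(x, y). \<tau> x y) (B \<times> C)"
proof -
  have BC: "B \<subseteq> H" "orthonormal_set B" "C \<subseteq> K" "orthonormal_set C" using B C by (auto simp: is_onb_iff)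
  have ip: "cinner (\<tau> x y) (\<tau> x' y') = (if x = x' \<and> y = y' then 1 else 0)"
    if "x \<in> B" "x' \<in> B" "y \<in> C" "y' \<in> C" for x x' y y'
    using that BC by (subst hilbert_tensor_cinner[OF \<tau>]) (auto simp: orthonormal_setD)
  show inj: "inj_on (\<lambda>(x, y). \<tau> x y) (B \<times> C)"
  proof (rule inj_onI, clarify)
    fix x x' y y' assume xy: "x \<in> B" "x' \<in> B" "y \<in> C" "y' \<in> C" "\<tau> x y = \<tau> x' y'"
    then show "x = x' \<and> y = y'" using ip[of x x' y y'] ip[of x x y y] by (auto split: if_splits)
  qed
  show "is_onb UNIV ((\<lambda>(x, y). \<tau> x y) ` (B \<times> C))"
    unfolding is_onb_iff
  proof (intro conjI)
    show "UNIV \<subseteq> closure (cspan ((\<lambda>(x, y). \<tau> x y) ` (B \<times> C)))"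
      using B C by (intro hilbert_tensor_dense_subsets[OF \<tau> H K]) (auto simp: is_onb_iff)
    show "orthonormal_set ((\<lambda>(x, y). \<tau> x y) ` (B \<times> C))"
      unfolding orthonormal_set_def
    proof (intro ballI)
      fix e f assume "e \<in> (\<lambda>(x, y). \<tau> x y) ` (B \<times> C)" "f \<in> (\<lambda>(x, y). \<tau> x y) ` (B \<times> C)"
      then obtain x y x' y' where *: "x \<in> B" "y \<in> C" "x' \<in> B" "y' \<in> C" "e = \<tau> x y" "f = \<tau> x' y'" by auto
      have "e = f \<longleftrightarrow> x = x' \<and> y = y'"
        using inj_onD[OF inj, of "(x, y)" "(x', y')"] * by auto
      then show "cinner e f = (if e = f then 1 else 0)" using * ip by simp
    qed
  qed simp
qed

lemma hilbert_tensors_onb: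
  assumes \<tau>: "hilbert_tensors I H \<tau>" and I: "finite I" and H: "\<And>k. k \<in> I \<Longrightarrow> hspace (H k)"
    and B: "\<And>k. k \<in> I \<Longrightarrow> is_onb (H k) (B k)"
  shows "is_onb UNIV (\<tau> ` PiE I B)" "inj_on \<tau> (PiE I B)"
proof -
  have Bk: "B k \<subseteq> H k" "orthonormal_set (B k)" if "k \<in> I" for k using B[OF that] by (auto simp: is_onb_iff)
  have sub: "x \<in> Pi I H" if "x \<in> PiE I B" for x using that Bk(1) by (auto simp: PiE_iff Pi_iff)
  have ip: "cinner (\<tau> x) (\<tau> y) = (if x = y then 1 else 0)" if xy: "x \<in> PiE I B" "y \<in> PiE I B" for x y
  proof -
    have "cinner (\<tau> x) (\<tau> y) = (\<Prod>k\<in>I. cinner (x k) (y k))"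
      by (rule hilbert_tensors_cinner[OF \<tau> sub[OF xy(1)] sub[OF xy(2)]])
    also have "\<dots> = (\<Prod>k\<in>I. if x k = y k then 1 else 0)"
      using xy Bk(2) by (intro prod.cong refl orthonormal_setD) (auto simp: PiE_iff)
    also have "\<dots> = (if x = y then 1 else 0)"
    proof (cases "x = y")
      case False
      then obtain k where "k \<in> I" "x k \<noteq> y k" using PiE_ext[OF xy] by blast
      then show ?thesis using False I by (auto intro: prod_zero)
    qed simp
    finally show ?thesis .
  qed
  show inj: "inj_on \<tau> (PiE I B)"
  proof (rule inj_onI)
    fix x y assume xy: "x \<in> PiE I B" "y \<in> PiE I B" "\<tau> x = \<tau> y"
    then show "x = y" using ip[of x y] ip[of x x] by (auto split: if_splits)
  qed
  \<comment> \<open>Extensional families give the same product vectors as arbitrary ones, and only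
    for them is the indexing of the basis injective.\<close>
  have "\<tau> ` Pi I B \<subseteq> \<tau> ` PiE I B"
  proof
    fix z assume "z \<in> \<tau> ` Pi I B"
    then obtain x where x: "x \<in> Pi I B" "z = \<tau> x" by blast
    have "x \<in> Pi I H" using x(1) Bk(1) by (auto simp: Pi_iff)
    then have "\<tau> x = \<tau> (restrict x I)" by (rule hilbert_tensors_cong[OF \<tau>]) simp
    moreover have "restrict x I \<in> PiE I B" using x(1) by auto
    ultimately show "z \<in> \<tau> ` PiE I B" using x(2) by blast
  qed
  moreover have "\<tau> ` PiE I B \<subseteq> \<tau> ` Pi I B" by (intro image_mono) (auto simp: PiE_iff)
  ultimately have eq: "\<tau> ` PiE I B = \<tau> ` Pi I B" by blast
  show "is_onb UNIV (\<tau> ` PiE I B)"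
    unfolding is_onb_iff
  proof (intro conjI)
    show "UNIV \<subseteq> closure (cspan (\<tau> ` PiE I B))"
      unfolding eq using B by (intro hilbert_tensors_dense_subsets[OF \<tau> I H]) (auto simp: is_onb_iff)
    show "orthonormal_set (\<tau> ` PiE I B)"
      unfolding orthonormal_set_def using ip inj_on_eq_iff[OF inj] by (auto simp del: PiE_iff)
  qed simp
qed

section \<open>Positivity and trace of product operators\<close>

lemma positive_on_UNIV_I:
  assumes C: "bounded_clinear C" and dense: "UNIV \<subseteq> closure (cspan (g ` X))"
    and psd: "\<And>F. finite F \<Longrightarrow> F \<subseteq> X \<Longrightarrow> psd_kernel F (\<lambda>i j. cinner (g i) (C (g j)))"
  shows "positive_on UNIV C"
proof -
  let ?P = "{z. 0 \<le> Re (cinner z (C z)) \<and> Im (cinner z (C z)) = 0}"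
  have "continuous_on UNIV C"
    by (rule linear_continuous_on[OF bounded_clinear_bounded_linear[OF C]])
  then have cont: "continuous_on UNIV (\<lambda>z. cinner z (C z))"
    by (intro cinner.continuous_on continuous_on_id)
  have "closed ?P"
    unfolding Collect_conj_eq
    by (intro closed_Int closed_Collect_le closed_Collect_eq continuous_on_Re continuous_on_Im cont
        continuous_on_const)
  moreover have "cspan (g ` X) \<subseteq> ?P"
  proof
    fix z assume z: "z \<in> cspan (g ` X)"
    obtain t r where t: "finite t" "t \<subseteq> g ` X" "z = (\<Sum>a\<in>t. r a *\<^sub>C a)"
      using z[unfolded cvs.span_explicit mem_Collect_eq] by (elim exE conjE)
    obtain F where F: "F \<subseteq> X" "inj_on g F" "t = g ` F"
      using t(2) unfolding subset_image_inj by (elim exE conjE)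
    have finF: "finite F" using t(1) F by (simp add: finite_image_iff)
    have "z = (\<Sum>i\<in>F. r (g i) *\<^sub>C g i)" using t(3) F by (simp add: sum.reindex)
    then have "cinner z (C z) = (\<Sum>i\<in>F. \<Sum>j\<in>F. cnj (r (g i)) * cinner (g i) (C (g j)) * r (g j))"
      by (simp add: bounded_clinear_sum[OF C] bounded_clinear_scaleC[OF C] cinner_sum_left
          cinner_sum_right cinner_simps sum_distrib_left mult_ac) (rule sum.swap)
    then have "0 \<le> cinner z (C z)"
      using psd_kernel_nonneg[OF psd[OF finF F(1)], of "\<lambda>i. r (g i)"] by (simp only:)
    then show "z \<in> ?P" by (simp add: less_eq_complex_def)
  qed
  ultimately have "closure (cspan (g ` X)) \<subseteq> ?P" by (rule closure_minimal[rotated])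
  then show ?thesis
    using dense C by (auto simp: positive_on_def bounded_op_on_UNIV less_eq_complex_def)
qed

lemma positive_on_tensor_op:
  assumes \<tau>: "hilbert_tensor H K \<tau>" and H: "csubspace H" and K: "csubspace K"
    and A: "positive_on H A" and B: "positive_on K B"
  shows "positive_on UNIV (tensor_op H K \<tau> A B)"
proof (rule positive_on_UNIV_I[OF tensor_op_bounded[OF \<tau> H K positive_on_bounded[OF A] positive_on_bounded[OF B]]
      hilbert_tensor_dense_image[OF \<tau>]])
  fix F assume F: "finite F" "F \<subseteq> H \<times> K"
  have "psd_kernel F (\<lambda>p q. cinner (fst p) (A (fst q)) * cinner (snd p) (B (snd q)))"
    using F by (intro psd_kernel_mult psd_kernel_positive_on[OF A H] psd_kernel_positive_on[OF B K]) auto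
  then show "psd_kernel F (\<lambda>i j. cinner ((\<lambda>(x, y). \<tau> x y) i) (tensor_op H K \<tau> A B ((\<lambda>(x, y). \<tau> x y) j)))"
  proof (rule psd_kernel_cong[THEN iffD1, rotated])
    fix p q assume "p \<in> F" "q \<in> F"
    then have "fst p \<in> H" "fst q \<in> H" "snd p \<in> K" "snd q \<in> K" using F(2) by auto
    then show "cinner (fst p) (A (fst q)) * cinner (snd p) (B (snd q)) =
        cinner ((\<lambda>(x, y). \<tau> x y) p) (tensor_op H K \<tau> A B ((\<lambda>(x, y). \<tau> x y) q))"
      using A B by (simp add: case_prod_unfold tensor_op_apply[OF \<tau> H K] positive_on_bounded
          hilbert_tensor_cinner[OF \<tau>] bounded_op_on_in)
  qed
qed

lemma positive_on_tensor_ops: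
  assumes \<tau>: "hilbert_tensors I H \<tau>" and H: "\<And>k. k \<in> I \<Longrightarrow> csubspace (H k)"
    and A: "\<And>k. k \<in> I \<Longrightarrow> positive_on (H k) (A k)"
  shows "positive_on UNIV (tensor_ops I H \<tau> A)"
proof -
  have A': "bounded_op_on (H k) (A k)" if "k \<in> I" for k
    by (rule positive_on_bounded[OF A[OF that]])
  note ops = tensor_ops_bounded[OF \<tau> H A'] tensor_ops_apply[OF \<tau> H A']
  show ?thesis
  proof (rule positive_on_UNIV_I[OF ops(1) hilbert_tensors_dense[OF \<tau>]])
    fix F assume F: "finite F" "F \<subseteq> Pi I H"
    have "psd_kernel F (\<lambda>x y. \<Prod>k\<in>I. cinner (x k) (A k (y k)))"
      using F by (intro psd_kernel_prod psd_kernel_positive_on[OF A H]) auto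
    then show "psd_kernel F (\<lambda>x y. cinner (\<tau> x) (tensor_ops I H \<tau> A (\<tau> y)))"
    proof (rule psd_kernel_cong[THEN iffD1, rotated])
      fix x y assume "x \<in> F" "y \<in> F"
      then have xy: "x \<in> Pi I H" "y \<in> Pi I H" using F(2) by auto
      then have "(\<lambda>k. A k (y k)) \<in> Pi I H" using bounded_op_on_in[OF A'] by (auto simp: Pi_iff)
      with xy show "(\<Prod>k\<in>I. cinner (x k) (A k (y k))) = cinner (\<tau> x) (tensor_ops I H \<tau> A (\<tau> y))"
        by (simp add: ops(2) hilbert_tensors_cinner[OF \<tau>])
    qed
  qed auto
qed

text \<open>Nonnegativity turns convergence of the iterated sum into summability over the product,
  which is what makes the trace of a product operator the product of the traces.\<close>

lemma has_sum_mult_nonneg: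
  fixes f :: "'a \<Rightarrow> real" and g :: "'b \<Rightarrow> real"
  assumes f: "(f has_sum a) A" "\<And>x. x \<in> A \<Longrightarrow> 0 \<le> f x" and g: "(g has_sum b) B" "\<And>y. y \<in> B \<Longrightarrow> 0 \<le> g y"
  shows "((\<lambda>(x, y). f x * g y) has_sum a * b) (A \<times> B)"
proof -
  have 1: "((\<lambda>y. (\<lambda>(x, y). f x * g y) (x, y)) has_sum f x * b) B" if "x \<in> A" for x
    using has_sum_cmult_right[OF g(1), of "f x"] by simp
  have 2: "((\<lambda>x. f x * b) has_sum a * b) A"
    by (rule has_sum_cmult_left[OF f(1)])
  have "(\<lambda>(x, y). f x * g y) summable_on Sigma A (\<lambda>_. B)"
    by (rule summable_on_SigmaI[OF 1]) (use 2 f(2) g(2) in \<open>auto intro: has_sum_imp_summable\<close>)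
  from has_sum_SigmaI[OF 1 2 this] show ?thesis by simp
qed

lemma has_sum_prod_PiE:
  fixes f :: "'k \<Rightarrow> 'a \<Rightarrow> real"
  assumes "finite I" "\<And>k. k \<in> I \<Longrightarrow> (f k has_sum s k) (B k)" "\<And>k x. k \<in> I \<Longrightarrow> x \<in> B k \<Longrightarrow> 0 \<le> f k x"
  shows "((\<lambda>g. \<Prod>k\<in>I. f k (g k)) has_sum (\<Prod>k\<in>I. s k)) (PiE I B)"
  using assms
proof (induction I rule: finite_induct)
  case empty
  show ?case by (rule has_sum_finiteI) simp_all
next
  case (insert j I)
  have pi: "PiE (insert j I) B = (\<lambda>(y, g). g(j := y)) ` (B j \<times> PiE I B)"
    by (rule PiE_insert_eq)
  have inj: "inj_on (\<lambda>(y, g). g(j := y)) (B j \<times> PiE I B)"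
    using insert.hyps(2) by (rule inj_combinator)
  have "((\<lambda>(y, g). f j y * (\<Prod>k\<in>I. f k (g k))) has_sum s j * (\<Prod>k\<in>I. s k)) (B j \<times> PiE I B)"
    by (rule has_sum_mult_nonneg)
      (use insert.IH insert.prems in \<open>auto intro!: prod_nonneg simp: PiE_iff\<close>)
  also have "?this \<longleftrightarrow> (((\<lambda>g. \<Prod>k\<in>insert j I. f k (g k)) \<circ> (\<lambda>(y, g). g(j := y))) has_sum (\<Prod>k\<in>insert j I. s k)) (B j \<times> PiE I B)"
  proof -
    have "(\<Prod>k\<in>I. f k ((g(j := y)) k)) = (\<Prod>k\<in>I. f k (g k))" for g y
      using insert.hyps(2) by (intro prod.cong) auto
    then have "(\<lambda>(y, g). f j y * (\<Prod>k\<in>I. f k (g k))) = (\<lambda>g. \<Prod>k\<in>insert j I. f k (g k)) \<circ> (\<lambda>(y, g). g(j := y))"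
      using insert.hyps by (intro ext) (simp add: case_prod_unfold o_def)
    then show ?thesis using insert.hyps by simp
  qed
  also have "\<dots> \<longleftrightarrow> ((\<lambda>g. \<Prod>k\<in>insert j I. f k (g k)) has_sum (\<Prod>k\<in>insert j I. s k)) (PiE (insert j I) B)"
    unfolding pi by (rule has_sum_reindex[OF inj, symmetric])
  finally show ?case .
qed

lemma density_op_tensor_op:
  assumes \<tau>: "hilbert_tensor H K \<tau>" and H: "hspace H" and K: "hspace K"
    and A: "density_op H A" and B: "density_op K B"
  shows "density_op UNIV (tensor_op H K \<tau> A B)"
proof -
  have cs: "csubspace H" "csubspace K" using H K by (auto simp: hspace_def)
  obtain C where C: "is_onb H C" using onb_exists[OF H] by blast
  obtain D where D: "is_onb K D" using onb_exists[OF K] by blast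
  have CD: "C \<subseteq> H" "D \<subseteq> K" using C D by (auto simp: is_onb_iff)
  note pos = density_op_positive[OF A] density_op_positive[OF B]
  note onb = hilbert_tensor_onb[OF \<tau> H K C D]
  show ?thesis
  proof (rule density_opI[OF positive_on_tensor_op[OF \<tau> cs pos] hspace_UNIV onb(1)])
    have "((\<lambda>(x, y). Re (cinner x (A x)) * Re (cinner y (B y))) has_sum 1 * 1) (C \<times> D)"
      using density_op_trace[OF A C] density_op_trace[OF B D] positive_on_diag_real(2)[OF pos(1)]
        positive_on_diag_real(2)[OF pos(2)] CD by (intro has_sum_mult_nonneg) auto
    also have "?this \<longleftrightarrow> (((\<lambda>e. Re (cinner e (tensor_op H K \<tau> A B e))) \<circ> (\<lambda>(x, y). \<tau> x y)) has_sum 1) (C \<times> D)"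
      unfolding mult_1
    proof (rule has_sum_cong)
      fix p assume "p \<in> C \<times> D"
      then obtain x y where p: "p = (x, y)" "x \<in> H" "y \<in> K" using CD by auto
      have "cinner (\<tau> x y) (tensor_op H K \<tau> A B (\<tau> x y)) = cinner x (A x) * cinner y (B y)"
        using p(2,3) density_op_bounded[OF A] density_op_bounded[OF B]
        by (simp add: tensor_op_apply[OF \<tau> cs] hilbert_tensor_cinner[OF \<tau>] bounded_op_on_in)
      also have "\<dots> = of_real (Re (cinner x (A x)) * Re (cinner y (B y)))"
        using positive_on_diag_real(1)[OF pos(1) p(2)] positive_on_diag_real(1)[OF pos(2) p(3)] by simp
      finally show "(\<lambda>(x, y). Re (cinner x (A x)) * Re (cinner y (B y))) p =
          ((\<lambda>e. Re (cinner e (tensor_op H K \<tau> A B e))) \<circ> (\<lambda>(x, y). \<tau> x y)) p"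
        using p(1) by simp
    qed
    also have "\<dots> \<longleftrightarrow> ((\<lambda>e. Re (cinner e (tensor_op H K \<tau> A B e))) has_sum 1) ((\<lambda>(x, y). \<tau> x y) ` (C \<times> D))"
      by (rule has_sum_reindex[OF onb(2), symmetric])
    finally show "((\<lambda>e. Re (cinner e (tensor_op H K \<tau> A B e))) has_sum 1) ((\<lambda>(x, y). \<tau> x y) ` (C \<times> D))" .
  qed
qed

lemma density_op_tensor_ops:
  assumes \<tau>: "hilbert_tensors I H \<tau>" and I: "finite I" and H: "\<And>k. k \<in> I \<Longrightarrow> hspace (H k)"
    and A: "\<And>k. k \<in> I \<Longrightarrow> density_op (H k) (A k)"
  shows "density_op UNIV (tensor_ops I H \<tau> A)"
proof -
  have cs: "csubspace (H k)" if "k \<in> I" for k using H[OF that] by (simp add: hspace_def)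
  have "\<forall>k\<in>I. \<exists>B. is_onb (H k) B" using onb_exists[OF H] by metis
  then obtain B where B: "\<And>k. k \<in> I \<Longrightarrow> is_onb (H k) (B k)" by metis
  have BH: "B k \<subseteq> H k" if "k \<in> I" for k using B[OF that] by (simp add: is_onb_iff)
  have pos: "positive_on (H k) (A k)" if "k \<in> I" for k by (rule density_op_positive[OF A[OF that]])
  have bd: "bounded_op_on (H k) (A k)" if "k \<in> I" for k by (rule density_op_bounded[OF A[OF that]])
  note onb = hilbert_tensors_onb[OF \<tau> I H B]
  have "positive_on UNIV (tensor_ops I H \<tau> A)" by (rule positive_on_tensor_ops[OF \<tau> cs pos])
  moreover have "is_onb UNIV (\<tau> ` PiE I B)" by (rule onb(1))
  moreover have "((\<lambda>e. Re (cinner e (tensor_ops I H \<tau> A e))) has_sum 1) (\<tau> ` PiE I B)"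
  proof -
    have "((\<lambda>g. \<Prod>k\<in>I. Re (cinner (g k) (A k (g k)))) has_sum (\<Prod>k\<in>I. 1)) (PiE I B)"
    proof (rule has_sum_prod_PiE[OF I])
      show "((\<lambda>x. Re (cinner x (A k x))) has_sum 1) (B k)" if "k \<in> I" for k
        by (rule density_op_trace[OF A[OF that] B[OF that]])
      show "0 \<le> Re (cinner x (A k x))" if "k \<in> I" "x \<in> B k" for k x
        using BH that by (intro positive_on_diag_real(2)[OF pos]) auto
    qed
    also have "?this \<longleftrightarrow> (((\<lambda>e. Re (cinner e (tensor_ops I H \<tau> A e))) \<circ> \<tau>) has_sum 1) (PiE I B)"
      unfolding prod.neutral_const
    proof (rule has_sum_cong)
      fix g assume g: "g \<in> PiE I B"
      have gH: "g \<in> Pi I H" using g BH by (auto simp: PiE_iff Pi_iff)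
      then have Ag: "(\<lambda>k. A k (g k)) \<in> Pi I H" using bounded_op_on_in[OF bd] by (auto simp: Pi_iff)
      have "cinner (\<tau> g) (tensor_ops I H \<tau> A (\<tau> g)) = (\<Prod>k\<in>I. cinner (g k) (A k (g k)))"
        using tensor_ops_apply[OF \<tau> cs bd gH] hilbert_tensors_cinner[OF \<tau> gH Ag] by simp
      also have "\<dots> = (\<Prod>k\<in>I. of_real (Re (cinner (g k) (A k (g k)))))"
        using gH by (intro prod.cong refl positive_on_diag_real(1)[OF pos]) (auto simp: Pi_iff)
      also have "\<dots> = of_real (\<Prod>k\<in>I. Re (cinner (g k) (A k (g k))))" by simp
      finally show "(\<Prod>k\<in>I. Re (cinner (g k) (A k (g k)))) = ((\<lambda>e. Re (cinner e (tensor_ops I H \<tau> A e))) \<circ> \<tau>) g"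
        by (simp only: o_apply Re_complex_of_real)
    qed
    also have "\<dots> \<longleftrightarrow> ((\<lambda>e. Re (cinner e (tensor_ops I H \<tau> A e))) has_sum 1) (\<tau> ` PiE I B)"
      by (rule has_sum_reindex[OF onb(2), symmetric])
    finally show ?thesis .
  qed
  ultimately show ?thesis by (rule density_opI[OF _ hspace_UNIV])
qed

section \<open>Unitary operators\<close>

text \<open>The inverse is carried along as a second operator: \<open>adj\<close> is defined on
  whole types, whereas these operators act on closed subspaces and are unspecified outside.\<close>

definition unitary_pair :: "'a::chilbert_space set \<Rightarrow> ('a \<Rightarrow> 'a) \<Rightarrow> ('a \<Rightarrow> 'a) \<Rightarrow> bool" where
  "unitary_pair H W W' \<longleftrightarrow> bounded_op_on H W \<and> bounded_op_on H W' \<and>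
     (\<forall>x\<in>H. W' (W x) = x \<and> W (W' x) = x) \<and> (\<forall>x\<in>H. \<forall>y\<in>H. cinner (W x) y = cinner x (W' y))"

lemma unitary_pairD:
  assumes "unitary_pair H W W'"
  shows unitary_pair_bounded: "bounded_op_on H W" "bounded_op_on H W'"
    and unitary_pair_inverse: "x \<in> H \<Longrightarrow> W' (W x) = x" "x \<in> H \<Longrightarrow> W (W' x) = x"
    and unitary_pair_adjoint: "x \<in> H \<Longrightarrow> y \<in> H \<Longrightarrow> cinner (W x) y = cinner x (W' y)"
    and unitary_pair_in: "x \<in> H \<Longrightarrow> W x \<in> H" "x \<in> H \<Longrightarrow> W' x \<in> H"
  using assms by (auto simp: unitary_pair_def bounded_op_on_in)

lemma unitary_pair_sym: "unitary_pair H W W' \<Longrightarrow> unitary_pair H W' W"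
  unfolding unitary_pair_def by (metis cinner_commute)

lemma unitary_pair_cinner:
  "unitary_pair H W W' \<Longrightarrow> x \<in> H \<Longrightarrow> y \<in> H \<Longrightarrow> cinner (W x) (W y) = cinner x y"
  using unitary_pairD by metis

lemma bounded_op_on_compose:
  assumes "bounded_op_on H A" "bounded_op_on H B"
  shows "bounded_op_on H (\<lambda>x. A (B x))"
proof -
  obtain a where a: "0 \<le> a" "\<And>x. x \<in> H \<Longrightarrow> norm (A x) \<le> a * norm x"
    using bounded_op_on_bound[OF assms(1)] by blast
  obtain b where b: "0 \<le> b" "\<And>x. x \<in> H \<Longrightarrow> norm (B x) \<le> b * norm x"
    using bounded_op_on_bound[OF assms(2)] by blast
  have "norm (A (B x)) \<le> (a * b) * norm x" if "x \<in> H" for x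
    using a(2)[OF bounded_op_on_in[OF assms(2) that]] mult_left_mono[OF b(2)[OF that] a(1)] by simp
  then show ?thesis
    using assms unfolding bounded_op_on_def by auto
qed

lemma unitary_pair_compose:
  assumes "unitary_pair H V V'" "unitary_pair H W W'"
  shows "unitary_pair H (\<lambda>x. V (W x)) (\<lambda>x. W' (V' x))"
  unfolding unitary_pair_def
  using unitary_pair_inverse[OF assms(1)] unitary_pair_inverse[OF assms(2)]
    unitary_pair_in[OF assms(1)] unitary_pair_in[OF assms(2)]
    unitary_pair_adjoint[OF assms(1)] unitary_pair_adjoint[OF assms(2)]
    unitary_pair_bounded[OF assms(1)] unitary_pair_bounded[OF assms(2)]
  by (simp add: bounded_op_on_compose)

lemma unitary_pair_imp_unitary_on: "unitary_pair H W W' \<Longrightarrow> unitary_on H W"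
  unfolding unitary_on_def
proof (intro conjI ballI)
  assume W: "unitary_pair H W W'"
  show "bounded_op_on H W" by (rule unitary_pair_bounded[OF W])
  show "W ` H = H"
    using unitary_pair_in[OF W] unitary_pair_inverse[OF W] by (metis image_subset_iff image_eqI subsetI subset_antisym)
  show "cinner (W x) (W y) = cinner x y" if "x \<in> H" "y \<in> H" for x y
    by (rule unitary_pair_cinner[OF W that])
qed

lemma unitary_group_pair:
  assumes "unitary_group H W"
  shows "unitary_pair H (W t) (W (- t))"
proof -
  have bd: "bounded_op_on H (W s)" and ip: "x \<in> H \<Longrightarrow> y \<in> H \<Longrightarrow> cinner (W s x) (W s y) = cinner x y" for s x y
    using assms by (auto simp: unitary_group_def unitary_on_def)
  have add: "x \<in> H \<Longrightarrow> W (s + t) x = W s (W t x)" and 0: "x \<in> H \<Longrightarrow> W 0 x = x" for s t x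
    using assms by (auto simp: unitary_group_def)
  have inv: "W (- s) (W s x) = x" if "x \<in> H" for s x
    using add[OF that, of "- s" s] 0[OF that] by simp
  have "cinner (W t x) y = cinner x (W (- t) y)" if "x \<in> H" "y \<in> H" for x y
  proof -
    have "cinner (W t x) (W t (W (- t) y)) = cinner x (W (- t) y)"
      using that bounded_op_on_in[OF bd] by (intro ip) auto
    then show ?thesis using inv[OF that(2), of "- t"] by simp
  qed
  then show ?thesis
    unfolding unitary_pair_def using bd inv[of _ t] inv[of _ "- t"] by simp
qed

lemma unitary_pair_onb:
  assumes W: "unitary_pair H W W'" and H: "hspace H" and B: "is_onb H B"
  shows "is_onb H (W ` B)" "inj_on W B"
proof -
  have BH: "B \<subseteq> H" "orthonormal_set B" "H \<subseteq> closure (cspan B)" using B by (auto simp: is_onb_iff)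
  show inj: "inj_on W B"
    using BH(1) unitary_pair_inverse(1)[OF W] by (intro inj_on_inverseI[of _ W']) auto
  show "is_onb H (W ` B)"
    unfolding is_onb_iff
  proof (intro conjI subsetI)
    show "x \<in> H" if "x \<in> W ` B" for x using that BH(1) unitary_pair_in[OF W] by auto
    show "orthonormal_set (W ` B)"
      unfolding orthonormal_set_def
    proof (intro ballI)
      fix e f assume "e \<in> W ` B" "f \<in> W ` B"
      then obtain x y where xy: "x \<in> B" "y \<in> B" "e = W x" "f = W y" by blast
      then have "cinner e f = cinner x y" using BH(1) unitary_pair_cinner[OF W] by auto
      then show "cinner e f = (if e = f then 1 else 0)"
        using xy orthonormal_setD[OF BH(2) xy(1,2)] inj_on_eq_iff[OF inj xy(1,2)] by simp
    qed
    fix x assume x: "x \<in> H"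
    have "W (W' x) \<in> closure (cspan (W ` B))"
      by (rule bounded_clinear_on_in_hspace[OF bounded_op_on_imp_clinear_on[OF unitary_pair_bounded(1)[OF W]]
            H hspace_closure_cspan BH(1,3)])
        (use x unitary_pair_in[OF W] in \<open>auto intro: in_closure_cspan\<close>)
    then show "x \<in> closure (cspan (W ` B))" using unitary_pair_inverse[OF W] x by simp
  qed
qed

text \<open>The trace of the conjugated operator in the basis \<open>B\<close> is the trace of
  \<open>\<rho>\<close> in the basis \<open>W'\<close> applied to \<open>B\<close>.\<close>

lemma density_op_conj:
  assumes W: "unitary_pair H W W'" and H: "hspace H" and \<rho>: "density_op H \<rho>"
  shows "density_op H (\<lambda>x. W (\<rho> (W' x)))"
proof -
  obtain B where B: "is_onb H B" using onb_exists[OF H] by blast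
  have BH: "B \<subseteq> H" using B by (simp add: is_onb_iff)
  have eq: "cinner x (W (\<rho> (W' x))) = cinner (W' x) (\<rho> (W' x))" if "x \<in> H" for x
    using that unitary_pair_in[OF W] bounded_op_on_in[OF density_op_bounded[OF \<rho>]]
    by (simp add: unitary_pair_adjoint[OF unitary_pair_sym[OF W]])
  show ?thesis
  proof (rule density_opI[OF _ H B])
    show "positive_on H (\<lambda>x. W (\<rho> (W' x)))"
      unfolding positive_on_def
      using eq positive_on_nonneg[OF density_op_positive[OF \<rho>]] unitary_pair_in[OF W]
        bounded_op_on_compose[OF unitary_pair_bounded(1)[OF W]
          bounded_op_on_compose[OF density_op_bounded[OF \<rho>] unitary_pair_bounded(2)[OF W]]]
      by simp
    note onb = unitary_pair_onb[OF unitary_pair_sym[OF W] H B]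
    have "((\<lambda>e. Re (cinner e (\<rho> e))) \<circ> W' has_sum 1) B"
      using density_op_trace[OF \<rho> onb(1)] has_sum_reindex[OF onb(2)] by blast
    then show "((\<lambda>e. Re (cinner e (W (\<rho> (W' e))))) has_sum 1) B"
      by (rule has_sum_cong[THEN iffD1, rotated]) (use eq BH in auto)
  qed
qed

lemma bounded_clinear_cinner_left: "bounded_clinear (cinner x)"
  unfolding bounded_clinear_def using cinner_Cauchy_Schwarz
  by (auto simp: cinner_simps scaleC_complex_def)

text \<open>Density is used once for each argument; since the first one is antilinear, the second
  pass works with the conjugated form.\<close>

lemma adjoint_dense:
  assumes C: "bounded_clinear C" and C': "bounded_clinear C'" and S: "UNIV \<subseteq> closure (cspan S)"
    and eq: "\<And>a b. a \<in> S \<Longrightarrow> b \<in> S \<Longrightarrow> cinner (C a) b = cinner a (C' b)"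
  shows "cinner (C x) y = cinner x (C' y)"
proof -
  have 1: "cinner (C a) y = cinner a (C' y)" if "a \<in> S" for a y
  proof -
    have "cinner (C a) = (\<lambda>y. cinner a (C' y))"
      by (rule bounded_clinear_eqI[OF bounded_clinear_cinner_left
          bounded_clinear_compose[OF bounded_clinear_cinner_left C'] S]) (rule eq[OF that])
    then show ?thesis by metis
  qed
  have "(\<lambda>x. cinner y (C x)) = cinner (C' y)"
  proof (rule bounded_clinear_eqI[OF bounded_clinear_compose[OF bounded_clinear_cinner_left C]
        bounded_clinear_cinner_left S])
    show "cinner y (C a) = cinner (C' y) a" if "a \<in> S" for a
      using 1[OF that, of y] by (metis cinner_commute)
  qed
  then have "cinner y (C x) = cinner (C' y) x" by metis
  then show ?thesis by (metis cinner_commute)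
qed

lemma unitary_pairI_dense:
  assumes C: "bounded_clinear C" and C': "bounded_clinear C'" and S: "UNIV \<subseteq> closure (cspan S)"
    and inv: "\<And>s. s \<in> S \<Longrightarrow> C' (C s) = s" "\<And>s. s \<in> S \<Longrightarrow> C (C' s) = s"
    and eq: "\<And>a b. a \<in> S \<Longrightarrow> b \<in> S \<Longrightarrow> cinner (C a) b = cinner a (C' b)"
  shows "unitary_pair UNIV C C'"
proof -
  have "(\<lambda>x. C' (C x)) = (\<lambda>x. x)"
    by (rule bounded_clinear_eqI[OF bounded_clinear_compose[OF C' C] bounded_clinear_id S]) (rule inv(1))
  moreover have "(\<lambda>x. C (C' x)) = (\<lambda>x. x)"
    by (rule bounded_clinear_eqI[OF bounded_clinear_compose[OF C C'] bounded_clinear_id S]) (rule inv(2))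
  moreover have "cinner (C x) y = cinner x (C' y)" for x y
    by (rule adjoint_dense[OF C C' S]) (rule eq)
  ultimately show ?thesis
    using C C' unfolding unitary_pair_def bounded_op_on_UNIV by metis
qed

lemma adj_eqI:
  assumes "\<And>x y. cinner (B x) y = cinner x (A y)"
  shows "adj A = B"
  unfolding adj_def
proof (rule the_equality)
  fix B' assume B': "\<forall>x y. cinner (B' x) y = cinner x (A y)"
  show "B' = B"
  proof
    fix x
    show "B' x = B x" by (rule cinner_eqI) (metis B' assms cinner_commute)
  qed
qed (use assms in blast)

lemma adj_unitary_pair: "unitary_pair UNIV U U' \<Longrightarrow> adj U = U'"
  by (rule adj_eqI) (metis UNIV_I unitary_pair_adjoint unitary_pair_sym)

lemma unitary_pair_tensor_op:
  assumes \<tau>: "hilbert_tensor H K \<tau>" and H: "csubspace H" and K: "csubspace K"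
    and A: "unitary_pair H A A'" and B: "unitary_pair K B B'"
  shows "unitary_pair UNIV (tensor_op H K \<tau> A B) (tensor_op H K \<tau> A' B')"
proof -
  note bd = unitary_pair_bounded[OF A] unitary_pair_bounded[OF B]
  note ap = tensor_op_apply[OF \<tau> H K bd(1,3)] tensor_op_apply[OF \<tau> H K bd(2,4)]
  show ?thesis
  proof (rule unitary_pairI_dense[OF tensor_op_bounded[OF \<tau> H K bd(1,3)] tensor_op_bounded[OF \<tau> H K bd(2,4)]
        hilbert_tensor_dense_image[OF \<tau>]])
    fix s assume "s \<in> (\<lambda>(x, y). \<tau> x y) ` (H \<times> K)"
    then obtain x y where s: "x \<in> H" "y \<in> K" "s = \<tau> x y" by auto
    then show "tensor_op H K \<tau> A' B' (tensor_op H K \<tau> A B s) = s"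
      "tensor_op H K \<tau> A B (tensor_op H K \<tau> A' B' s) = s"
      by (simp_all add: ap unitary_pairD[OF A] unitary_pairD[OF B])
    fix s' assume "s' \<in> (\<lambda>(x, y). \<tau> x y) ` (H \<times> K)"
    then obtain x' y' where s': "x' \<in> H" "y' \<in> K" "s' = \<tau> x' y'" by auto
    show "cinner (tensor_op H K \<tau> A B s) s' = cinner s (tensor_op H K \<tau> A' B' s')"
      using s s' by (simp add: ap unitary_pairD[OF A] unitary_pairD[OF B] hilbert_tensor_cinner[OF \<tau>])
  qed
qed

lemma unitary_pair_tensor_ops:
  assumes \<tau>: "hilbert_tensors I H \<tau>" and H: "\<And>k. k \<in> I \<Longrightarrow> csubspace (H k)"
    and A: "\<And>k. k \<in> I \<Longrightarrow> unitary_pair (H k) (A k) (A' k)"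
  shows "unitary_pair UNIV (tensor_ops I H \<tau> A) (tensor_ops I H \<tau> A')"
proof -
  have bd: "bounded_op_on (H k) (A k)" "bounded_op_on (H k) (A' k)" if "k \<in> I" for k
    using unitary_pair_bounded[OF A[OF that]] by auto
  note ap = tensor_ops_apply[OF \<tau> H bd(1)] tensor_ops_apply[OF \<tau> H bd(2)]
  have in_Pi: "(\<lambda>k. A k (x k)) \<in> Pi I H" "(\<lambda>k. A' k (x k)) \<in> Pi I H" if "x \<in> Pi I H" for x
    using that unitary_pair_in[OF A] by (auto simp: Pi_iff)
  show ?thesis
  proof (rule unitary_pairI_dense[OF tensor_ops_bounded[OF \<tau> H bd(1)] tensor_ops_bounded[OF \<tau> H bd(2)]
        hilbert_tensors_dense[OF \<tau>]])
    fix s assume "s \<in> \<tau> ` Pi I H"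
    then obtain x where x: "x \<in> Pi I H" "s = \<tau> x" by auto
    have "\<tau> (\<lambda>k. A' k (A k (x k))) = \<tau> x" "\<tau> (\<lambda>k. A k (A' k (x k))) = \<tau> x"
      using x(1) unitary_pair_inverse[OF A] by (auto intro!: hilbert_tensors_cong[OF \<tau> x(1), symmetric] simp: Pi_iff)
    then show "tensor_ops I H \<tau> A' (tensor_ops I H \<tau> A s) = s" "tensor_ops I H \<tau> A (tensor_ops I H \<tau> A' s) = s"
      using x in_Pi[OF x(1)] by (simp_all add: ap)
    fix s' assume "s' \<in> \<tau> ` Pi I H"
    then obtain y where y: "y \<in> Pi I H" "s' = \<tau> y" by auto
    have "(\<Prod>k\<in>I. cinner (A k (x k)) (y k)) = (\<Prod>k\<in>I. cinner (x k) (A' k (y k)))"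
      using x(1) y(1) by (intro prod.cong refl unitary_pair_adjoint[OF A]) (auto simp: Pi_iff)
    then show "cinner (tensor_ops I H \<tau> A s) s' = cinner s (tensor_ops I H \<tau> A' s')"
      using x y in_Pi[OF x(1)] in_Pi[OF y(1)] by (simp add: ap hilbert_tensors_cinner[OF \<tau>])
  qed auto
qed


section \<open>Separable states\<close>

text \<open>Orthonormal systems of length 1 already contribute to the supremum.\<close>

lemma cinner_le_trace_norm:
  assumes "norm x = 1" "norm y = 1"
  shows "ennreal (cmod (cinner x (A y))) \<le> trace_norm A"
proof -
  have "orthonormal 1 (\<lambda>_. x)" "orthonormal 1 (\<lambda>_. y)"
    using assms by (auto simp: orthonormal_def cinner_self)
  then have "(1, \<lambda>_. x, \<lambda>_. y) \<in> {(n, e, f). orthonormal n e \<and> orthonormal n f}" by simp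
  from SUP_upper[OF this, of "\<lambda>(n, e, f). ennreal (\<Sum>j<n. cmod (cinner (e j) (A (f j))))"]
  show ?thesis by (simp add: trace_norm_def)
qed

text \<open>Trace-norm limits enter only through single matrix elements; \<open>x\<close> and
  \<open>y\<close> are normalised so that they form orthonormal systems of length 1.\<close>

lemma trace_norm_limit_cinner:
  assumes S: "\<And>n. bounded_clinear (S n)" and \<sigma>: "bounded_clinear \<sigma>"
    and lim: "(\<lambda>n. trace_norm (\<lambda>x. S n x - \<sigma> x)) \<longlonglongrightarrow> 0"
  shows "(\<lambda>n. cinner x (S n y)) \<longlonglongrightarrow> cinner x (\<sigma> y)"
proof (cases "x = 0 \<or> y = 0")
  case True
  then show ?thesis by (auto simp: bounded_clinear_zero[OF S] bounded_clinear_zero[OF \<sigma>])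
next
  case False
  define u v where "u = x /\<^sub>R norm x" and "v = y /\<^sub>R norm y"
  have uv: "norm u = 1" "norm v = 1" "x = norm x *\<^sub>R u" "y = norm y *\<^sub>R v"
    using False by (auto simp: u_def v_def)
  have "(\<lambda>n. ennreal (cmod (cinner u (S n v - \<sigma> v)))) \<longlonglongrightarrow> 0"
    by (rule tendsto_sandwich[OF _ _ tendsto_const lim])
      (auto intro!: always_eventually cinner_le_trace_norm uv)
  then have "(\<lambda>n. cmod (cinner u (S n v - \<sigma> v))) \<longlonglongrightarrow> 0"
    using tendsto_ennreal_iff[of "\<lambda>n. cmod (cinner u (S n v - \<sigma> v))" sequentially 0] by simp
  then have "(\<lambda>n. cinner u (S n v) - cinner u (\<sigma> v)) \<longlonglongrightarrow> 0"
    by (simp add: tendsto_norm_zero_iff cinner_diff_right)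
  then have "(\<lambda>n. cinner u (S n v)) \<longlonglongrightarrow> cinner u (\<sigma> v)"
    by (rule LIM_zero_cancel)
  then have "(\<lambda>n. of_real (norm x) * (of_real (norm y) * cinner u (S n v))) \<longlonglongrightarrow>
      of_real (norm x) * (of_real (norm y) * cinner u (\<sigma> v))"
    by (intro tendsto_intros)
  moreover have "cinner x (T y) = of_real (norm x) * (of_real (norm y) * cinner u (T v))"
    if "bounded_clinear T" for T
    by (subst uv(3), subst uv(4)) (simp only: bounded_clinear_scaleR[OF that] cinner_scaleR_left
        cinner_scaleR_right mult.left_commute)
  ultimately show ?thesis using S \<sigma> by simp
qed

lemma bounded_clinear_product_mixture:
  assumes \<tau>: "hilbert_tensor H K \<tau>" and H: "csubspace H" and K: "csubspace K"
    and "product_mixture H K \<tau> \<sigma>"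
  shows "bounded_clinear \<sigma>"
proof -
  obtain m :: nat and p \<alpha> \<beta> where *: "\<forall>j<m. 0 \<le> p j \<and> density_op H (\<alpha> j) \<and> density_op K (\<beta> j)"
    "\<sigma> = (\<lambda>x. \<Sum>j<m. p j *\<^sub>R tensor_op H K \<tau> (\<alpha> j) (\<beta> j) x)"
    using assms(4) unfolding product_mixture_def by blast
  show ?thesis
    unfolding *(2) scaleR_scaleC using *(1)
    by (intro bounded_clinear_sum_fun bounded_clinear_compose[OF bounded_clinear_scaleC_const]
        tensor_op_bounded[OF \<tau> H K]) (auto intro: density_op_bounded)
qed

lemma psd_kernel_transpose:
  assumes "psd_kernel F K"
  shows "psd_kernel F (\<lambda>i j. K j i)"
proof (rule psd_kernelI)
  show "K i j = cnj (K j i)" if "i \<in> F" "j \<in> F" for i j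
    using psd_kernel_hermitian[OF assms that(2,1)] .
  fix c
  show "0 \<le> (\<Sum>i\<in>F. \<Sum>j\<in>F. cnj (c i) * K j i * c j)"
    using psd_kernel_nonneg[OF assms, of "\<lambda>i. cnj (c i)"] by (subst sum.swap) (simp add: mult_ac)
qed

text \<open>The Peres criterion in coordinates: \<open>e i\<close> and \<open>e j\<close> stand in
  exchanged places, which is partial transposition of the first factor. On a product state the
  double sum is that of a transposed positive kernel against a positive kernel, and mixing and
  limits preserve the sign.\<close>

lemma separable_partial_transpose_nonneg:
  assumes \<tau>: "hilbert_tensor H K \<tau>" and H: "csubspace H" and K: "csubspace K"
    and sep: "separable H K \<tau> \<sigma>" and \<sigma>: "bounded_clinear \<sigma>"
    and F: "finite F" and e: "\<And>i. i \<in> F \<Longrightarrow> e i \<in> H" and u: "\<And>i. i \<in> F \<Longrightarrow> u i \<in> K"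
  shows "0 \<le> (\<Sum>i\<in>F. \<Sum>j\<in>F. cinner (\<tau> (e j) (u i)) (\<sigma> (\<tau> (e i) (u j))))"
proof -
  let ?Q = "\<lambda>\<sigma>. \<Sum>i\<in>F. \<Sum>j\<in>F. cinner (\<tau> (e j) (u i)) (\<sigma> (\<tau> (e i) (u j)))"
  obtain S where S: "\<And>n::nat. product_mixture H K \<tau> (S n)" and lim: "(\<lambda>n. trace_norm (\<lambda>x. S n x - \<sigma> x)) \<longlonglongrightarrow> 0"
    using sep unfolding separable_def by blast
  have "0 \<le> ?Q (S n)" for n
  proof -
    obtain m :: nat and p \<alpha> \<beta> where *: "\<forall>j<m. 0 \<le> p j \<and> density_op H (\<alpha> j) \<and> density_op K (\<beta> j)"
      "S n = (\<lambda>x. \<Sum>j<m. p j *\<^sub>R tensor_op H K \<tau> (\<alpha> j) (\<beta> j) x)"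
      using S[of n] unfolding product_mixture_def by blast
    have "?Q (S n) = (\<Sum>i\<in>F. \<Sum>j\<in>F. \<Sum>l<m. of_real (p l) * (cinner (e j) (\<alpha> l (e i)) * cinner (u i) (\<beta> l (u j))))"
    proof (intro sum.cong refl)
      fix i j assume ij: "i \<in> F" "j \<in> F"
      have "cinner (\<tau> (e j) (u i)) (tensor_op H K \<tau> (\<alpha> l) (\<beta> l) (\<tau> (e i) (u j))) =
          cinner (e j) (\<alpha> l (e i)) * cinner (u i) (\<beta> l (u j))" if "l < m" for l
        using * that e u ij by (simp add: tensor_op_apply[OF \<tau> H K] density_op_bounded
            hilbert_tensor_cinner[OF \<tau>] bounded_op_on_in)
      then show "cinner (\<tau> (e j) (u i)) (S n (\<tau> (e i) (u j))) =
          (\<Sum>l<m. of_real (p l) * (cinner (e j) (\<alpha> l (e i)) * cinner (u i) (\<beta> l (u j))))"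
        unfolding *(2) cinner_sum_right cinner_scaleR_right by (intro sum.cong refl) simp
    qed
    also have "\<dots> = (\<Sum>i\<in>F. \<Sum>l<m. \<Sum>j\<in>F. of_real (p l) * (cinner (e j) (\<alpha> l (e i)) * cinner (u i) (\<beta> l (u j))))"
      by (intro sum.cong refl sum.swap)
    also have "\<dots> = (\<Sum>l<m. \<Sum>i\<in>F. \<Sum>j\<in>F. of_real (p l) * (cinner (e j) (\<alpha> l (e i)) * cinner (u i) (\<beta> l (u j))))"
      by (rule sum.swap)
    also have "\<dots> = (\<Sum>l<m. of_real (p l) * (\<Sum>i\<in>F. \<Sum>j\<in>F. cinner (e j) (\<alpha> l (e i)) * cinner (u i) (\<beta> l (u j))))"
      by (simp only: sum_distrib_left)
    also have "0 \<le> \<dots>"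
    proof (rule sum_nonneg, rule mult_nonneg_nonneg)
      fix l assume "l \<in> {..<m}"
      then have l: "0 \<le> p l" "positive_on H (\<alpha> l)" "positive_on K (\<beta> l)"
        using *(1) density_op_positive by auto
      show "0 \<le> complex_of_real (p l)" using l(1) by (simp add: less_eq_complex_def)
      show "0 \<le> (\<Sum>i\<in>F. \<Sum>j\<in>F. cinner (e j) (\<alpha> l (e i)) * cinner (u i) (\<beta> l (u j)))"
        using e u by (intro psd_kernel_sum_mult_nonneg[OF F] psd_kernel_transpose[of F "\<lambda>i j. cinner (e i) (\<alpha> l (e j))"]
            psd_kernel_positive_on[OF l(2) H] psd_kernel_positive_on[OF l(3) K])
    qed
    finally show ?thesis .
  qed
  \<comment> \<open>Restated as membership in a closed set, so that the limit can be taken.\<close>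
  then have "?Q (S n) \<in> \<real>\<^sub>\<ge>\<^sub>0" for n
    by (simp only: complex_nonneg_Reals_iff less_eq_complex_def zero_complex.sel)
  moreover have "(\<lambda>n. ?Q (S n)) \<longlonglongrightarrow> ?Q \<sigma>"
    by (intro tendsto_sum trace_norm_limit_cinner[OF bounded_clinear_product_mixture[OF \<tau> H K S] \<sigma> lim])
  ultimately have "?Q \<sigma> \<in> \<real>\<^sub>\<ge>\<^sub>0"
    by (rule closed_sequentially[OF closed_nonneg_Reals_complex])
  then show ?thesis
    unfolding complex_nonneg_Reals_iff less_eq_complex_def by simp
qed

section \<open>Dephased states\<close>

text \<open>The environment is any closed subspace \<open>K\<close>, so that the locale serves the
  complete environment as well as a single observed one. Time is fixed, and \<open>W' i\<close> is
  the inverse of \<open>W i\<close>.\<close>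

locale dephasing_model =
  fixes ket :: "'i \<Rightarrow> 's::chilbert_space" and K :: "'b::chilbert_space set"
    and \<tau> :: "'s \<Rightarrow> 'b \<Rightarrow> 'c::chilbert_space" and \<epsilon> :: "'i \<Rightarrow> real" and t :: real
    and W W' :: "'i \<Rightarrow> 'b \<Rightarrow> 'b"
  assumes ket: "cinner (ket i) (ket j) = (if i = j then 1 else 0)"
    and ket_dense: "closure (cspan (range ket)) = UNIV"
    and tensor: "hilbert_tensor UNIV K \<tau>"
    and hspace_K: "hspace K"
    and unitary: "unitary_pair K (W i) (W' i)"
begin

abbreviation "U \<equiv> dephasing_unitary ket K \<tau> \<epsilon> t W"
abbreviation "U' \<equiv> dephasing_unitary ket K \<tau> \<epsilon> (- t) W'"

definition phase :: "'i \<Rightarrow> complex" where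
  "phase i = exp (- \<i> * of_real (\<epsilon> i * t))"

lemma phase_cnj: "cnj (phase i) = exp (- \<i> * of_real (\<epsilon> i * (- t)))"
  by (simp add: phase_def exp_cnj)

lemma phase_mult_cnj [simp]: "phase i * cnj (phase i) = 1" "cnj (phase i) * phase i = 1"
  unfolding phase_cnj unfolding phase_def by (simp_all flip: exp_add)

lemma phase_nonzero [simp]: "phase i \<noteq> 0"
  by (simp add: phase_def)

lemma csubspace_K: "csubspace K"
  using hspace_K by (simp add: hspace_def)

lemma gens_dense: "UNIV \<subseteq> closure (cspan ((\<lambda>(i, y). \<tau> (ket i) y) ` (UNIV \<times> K)))"
proof -
  have "UNIV \<subseteq> closure (cspan ((\<lambda>(x, y). \<tau> x y) ` (range ket \<times> K)))"
    by (rule hilbert_tensor_dense_subsets[OF tensor hspace_UNIV hspace_K])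
      (auto simp: ket_dense intro: in_closure_cspan)
  also have "(\<lambda>(x, y). \<tau> x y) ` (range ket \<times> K) = (\<lambda>(i, y). \<tau> (ket i) y) ` (UNIV \<times> K)"
    by force
  finally show ?thesis .
qed

lemma bounded_op_on_proj: "bounded_op_on UNIV (proj v)"
proof -
  have "norm (cinner v x) * norm v \<le> (norm v * norm v) * norm x" for x
    using mult_right_mono[OF cinner_Cauchy_Schwarz[of v x] norm_ge_zero[of v]] by (simp add: mult_ac)
  then show ?thesis
    unfolding bounded_op_on_def proj_def
    by (auto simp: cinner_simps scaleC_add_left scaleC_scaleC norm_scaleC intro!: exI[of _ "norm v * norm v"])
qed

text \<open>An infinite sum has no usable value before convergence is known. Its limit
  \<open>C\<close> is therefore built first, from the values on the vectors ket i \<otimes> y, and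
  the sum is then shown to converge to \<open>C\<close> on these vectors with uniformly bounded
  partial sums.\<close>

lemma dephasing_unitary_exists:
  shows U_bounded: "bounded_clinear U"
    and U_apply: "y \<in> K \<Longrightarrow> U (\<tau> (ket i) y) = phase i *\<^sub>C \<tau> (ket i) (W i y)"
proof -
  let ?g = "\<lambda>(i, y). \<tau> (ket i) y" and ?g' = "\<lambda>(i, y). phase i *\<^sub>C \<tau> (ket i) (W i y)"
  have WK: "W i y \<in> K" if "y \<in> K" for i y using unitary_pair_in[OF unitary that] by blast
  obtain C where C: "bounded_clinear C" "\<And>p. p \<in> UNIV \<times> K \<Longrightarrow> C (?g p) = ?g' p" "\<And>x. norm (C x) \<le> 1 * norm x"
  proof (rule bounded_clinear_extension_kernel[OF gens_dense zero_le_one])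
    fix F assume F: "finite F" "F \<subseteq> (UNIV :: 'i set) \<times> K"
    \<comment> \<open>The prescribed values have the same inner products as the generators, so the
      difference of the Gram kernels is identically 0.\<close>
    have "psd_kernel F (\<lambda>p q. 0)"
      by (rule psd_kernel_const) simp
    then show "psd_kernel F (\<lambda>p q. of_real (1\<^sup>2) * cinner (?g p) (?g q) - cinner (?g' p) (?g' q))"
    proof (rule psd_kernel_cong[THEN iffD1, rotated])
      fix p q assume "p \<in> F" "q \<in> F"
      then have "p \<in> UNIV \<times> K" "q \<in> UNIV \<times> K" using F(2) by blast+
      then obtain i y j z where pq: "p = (i, y)" "q = (j, z)" "y \<in> K" "z \<in> K"
        by (elim SigmaE)
      have "cinner (phase i *\<^sub>C \<tau> (ket i) (W i y)) (phase j *\<^sub>C \<tau> (ket j) (W j z)) =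
          (cnj (phase i) * phase j) * (cinner (ket i) (ket j) * cinner (W i y) (W j z))"
        using pq WK by (simp add: cinner_simps hilbert_tensor_cinner[OF tensor])
      also have "\<dots> = cinner (ket i) (ket j) * cinner y z"
        using pq by (auto simp: ket unitary_pair_cinner[OF unitary])
      finally show "0 = of_real (1\<^sup>2) * cinner (?g p) (?g q) - cinner (?g' p) (?g' q)"
        using pq by (simp add: hilbert_tensor_cinner[OF tensor])
    qed
  qed blast
  define T where "T i x = phase i *\<^sub>C tensor_op UNIV K \<tau> (proj (ket i)) (W i) x" for i x
  have T: "bounded_clinear (T i)" for i
    unfolding T_def
    by (intro bounded_clinear_compose[OF bounded_clinear_scaleC_const]
        tensor_op_bounded[OF tensor csubspace_UNIV csubspace_K bounded_op_on_proj] unitary_pair_bounded[OF unitary])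
  have T_gen: "T i (\<tau> (ket j) y) = (if i = j then phase i *\<^sub>C \<tau> (ket i) (W i y) else 0)" if "y \<in> K" for i j y
  proof -
    have "\<tau> (0 *\<^sub>C ket i) (W i y) = 0 *\<^sub>C \<tau> (ket i) (W i y)"
      using WK[OF that] by (intro hilbert_tensor_scaleC_left[OF tensor]) auto
    then have z: "\<tau> 0 (W i y) = 0" by simp
    have "tensor_op UNIV K \<tau> (proj (ket i)) (W i) (\<tau> (ket j) y) = \<tau> (proj (ket i) (ket j)) (W i y)"
      by (rule tensor_op_apply[OF tensor csubspace_UNIV csubspace_K bounded_op_on_proj
            unitary_pair_bounded(1)[OF unitary] UNIV_I that])
    then show ?thesis
      unfolding T_def by (auto simp: proj_def ket z)
  qed
  have sum: "((\<lambda>i. T i x) has_sum C x) UNIV" for x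
  proof (rule has_sum_dense[OF T C(1)])
    show "x \<in> closure (cspan (?g ` (UNIV \<times> K)))" using gens_dense by blast
    show "((\<lambda>i. T i d) has_sum C d) UNIV" if d: "d \<in> ?g ` (UNIV \<times> K)" for d
    proof -
      obtain j y where jy: "y \<in> K" "d = \<tau> (ket j) y" using d by auto
      have "((\<lambda>i. T i d) has_sum C d) {j}"
        using jy T_gen[OF jy(1)] C(2)[of "(j, y)"] by (intro has_sum_finiteI) auto
      then show ?thesis
        by (rule has_sum_cong_neutral[THEN iffD1, rotated -1]) (use jy T_gen in auto)
    qed
    fix F :: "'i set" and x assume F: "finite F" "F \<subseteq> UNIV"
    \<comment> \<open>The projection onto finitely many kets: the partial sum over \<open>F\<close>
      is \<open>C\<close> after A \<otimes> 1, a product of contractions.\<close>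
    define A where "A x = (\<Sum>i\<in>F. proj (ket i) x)" for x
    have ketF: "orthonormal_set (ket ` F)" "inj_on ket F"
    proof -
      have eq: "i = j" if "ket i = ket j" for i j
        using that ket[of i j] ket[of j j] by (auto split: if_splits)
      then show "inj_on ket F" by (intro inj_onI)
      show "orthonormal_set (ket ` F)" unfolding orthonormal_set_def by (auto simp: ket dest: eq)
    qed
    have A1: "norm (A x) \<le> 1 * norm x" for x
    proof -
      have "A x = (\<Sum>e\<in>ket ` F. cinner e x *\<^sub>C e)"
        unfolding A_def proj_def using ketF(2) by (simp add: sum.reindex)
      then have "(norm (A x))\<^sup>2 \<le> (norm x)\<^sup>2"
        using norm_sum_orthonormal[OF ketF(1)] Bessel_inequality[OF ketF(1)] F(1) by simp
      then have "norm (A x) \<le> norm x" by (rule power2_le_imp_le) simp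
      then show ?thesis by simp
    qed
    have A2: "bounded_op_on UNIV A"
      unfolding A_def bounded_op_on_UNIV
      by (intro bounded_clinear_sum_fun) (use bounded_op_on_proj in \<open>simp add: bounded_op_on_UNIV\<close>)
    have id2: "bounded_op_on K (\<lambda>y. y)" by (auto simp: bounded_op_on_def intro: exI[of _ 1])
    have id3: "norm y \<le> 1 * norm y" for y :: 'b by simp
    note P = tensor_op_exists[OF tensor csubspace_UNIV csubspace_K A2 zero_le_one A1 id2 zero_le_one id3]
    have "(\<lambda>x. \<Sum>i\<in>F. T i x) = (\<lambda>x. C (tensor_op UNIV K \<tau> A (\<lambda>y. y) x))"
    proof (rule bounded_clinear_eqI[OF _ _ gens_dense])
      show "bounded_clinear (\<lambda>x. \<Sum>i\<in>F. T i x)" by (intro bounded_clinear_sum_fun T)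
      show "bounded_clinear (\<lambda>x. C (tensor_op UNIV K \<tau> A (\<lambda>y. y) x))"
        by (rule bounded_clinear_compose[OF C(1) P(1)])
      fix d assume "d \<in> ?g ` (UNIV \<times> K)"
      then obtain j y where jy: "y \<in> K" "d = \<tau> (ket j) y" by auto
      have "A (ket j) = (\<Sum>i\<in>F. if i = j then ket j else 0)"
        unfolding A_def proj_def by (intro sum.cong refl) (auto simp: ket)
      then have Aj: "A (ket j) = (if j \<in> F then ket j else 0)" using F(1) by simp
      have "\<tau> (0 *\<^sub>C ket j) y = 0 *\<^sub>C \<tau> (ket j) y"
        using jy by (intro hilbert_tensor_scaleC_left[OF tensor]) auto
      then have z: "\<tau> 0 y = 0" by simp
      show "(\<Sum>i\<in>F. T i d) = C (tensor_op UNIV K \<tau> A (\<lambda>y. y) d)"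
        using F(1) jy T_gen[OF jy(1)] C(2)[of "(j, y)"] z bounded_clinear_zero[OF C(1)]
        by (simp add: P(2) Aj)
    qed
    then have "norm (\<Sum>i\<in>F. T i x) = norm (C (tensor_op UNIV K \<tau> A (\<lambda>y. y) x))" by metis
    also have "\<dots> \<le> norm (tensor_op UNIV K \<tau> A (\<lambda>y. y) x)" using C(3) by simp
    also have "\<dots> \<le> 1 * norm x" using P(3)[of x] by simp
    finally show "norm (\<Sum>i\<in>F. T i x) \<le> 1 * norm x" .
  qed
  have "U = C"
    unfolding dephasing_unitary_def phase_def[symmetric] T_def[symmetric]
    using infsumI[OF sum] by blast
  then show "bounded_clinear U" "y \<in> K \<Longrightarrow> U (\<tau> (ket i) y) = phase i *\<^sub>C \<tau> (ket i) (W i y)"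
    using C(1) C(2)[of "(i, y)"] by auto
qed

end

context dephasing_model
begin

text \<open>Inverse and adjoint of \<open>U\<close> arise from the same construction at time
  \<open>- t\<close> with \<open>W\<close> and \<open>W'\<close> exchanged, so their properties are
  instances of those of \<open>U\<close>.\<close>

interpretation inv: dephasing_model ket K \<tau> \<epsilon> "- t" W' W
  using ket ket_dense tensor hspace_K unitary_pair_sym[OF unitary] by unfold_locales auto

lemma U'_bounded: "bounded_clinear U'"
  by (rule inv.U_bounded)

lemma U'_apply: "y \<in> K \<Longrightarrow> U' (\<tau> (ket i) y) = cnj (phase i) *\<^sub>C \<tau> (ket i) (W' i y)"
  using inv.U_apply unfolding phase_cnj inv.phase_def by blast

lemma unitary_pair_U: "unitary_pair UNIV U U'"
proof (rule unitary_pairI_dense[OF U_bounded U'_bounded gens_dense])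
  fix s assume "s \<in> (\<lambda>(i, y). \<tau> (ket i) y) ` (UNIV \<times> K)"
  then obtain i y where s: "y \<in> K" "s = \<tau> (ket i) y" by auto
  then show "U' (U s) = s" "U (U' s) = s"
    by (simp_all add: U_apply U'_apply unitary_pairD[OF unitary] bounded_clinear_scaleC[OF U_bounded]
        bounded_clinear_scaleC[OF U'_bounded])
  fix s' assume "s' \<in> (\<lambda>(i, y). \<tau> (ket i) y) ` (UNIV \<times> K)"
  then obtain j z where s': "z \<in> K" "s' = \<tau> (ket j) z" by auto
  show "cinner (U s) s' = cinner s (U' s')"
    using s s' by (auto simp: U_apply U'_apply cinner_simps hilbert_tensor_cinner[OF tensor]
        unitary_pairD[OF unitary] ket)
qed

lemma adj_U: "adj U = U'"
  by (rule adj_unitary_pair[OF unitary_pair_U])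

end

lemma density_op_proj:
  assumes "norm \<psi> = 1"
  shows "density_op UNIV (proj \<psi>)"
proof -
  obtain B where B: "is_onb (UNIV :: 'a set) B" using onb_exists[OF hspace_UNIV] by blast
  have eq: "cinner x (proj \<psi> x) = of_real ((cmod (cinner x \<psi>))\<^sup>2)" for x
    unfolding proj_def cinner_scaleC_right complex_norm_square
    by (subst cinner_commute[of \<psi> x]) (rule mult.commute)
  show ?thesis
  proof (rule density_opI[OF _ hspace_UNIV B])
    have "norm (proj \<psi> x) \<le> 1 * norm x" for x
      using cinner_Cauchy_Schwarz[of \<psi> x] assms by (simp add: proj_def norm_scaleC)
    then have "bounded_op_on UNIV (proj \<psi>)"
      unfolding bounded_op_on_def
      by (intro conjI exI[of _ 1]) (auto simp: proj_def cinner_simps scaleC_add_left scaleC_scaleC)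
    then show "positive_on UNIV (proj \<psi>)"
      unfolding positive_on_def by (simp add: eq less_eq_complex_def)
    have "((\<lambda>e. Re (cinner \<psi> (cinner e \<psi> *\<^sub>C e))) has_sum Re (cinner \<psi> \<psi>)) B"
      by (intro has_sum_Re has_sum_bounded_linear[OF bounded_clinear_bounded_linear[OF bounded_clinear_cinner_left]]
          onb_expansion[OF B]) simp
    moreover have "Re (cinner \<psi> (cinner e \<psi> *\<^sub>C e)) = Re (cinner e (proj \<psi> e))" for e
      by (simp add: proj_def cinner_scaleC_right mult.commute)
    ultimately show "((\<lambda>e. Re (cinner e (proj \<psi> e))) has_sum 1) B"
      using assms by (simp add: cinner_self)
  qed
qed

text \<open>Applied to the block of the partial transpose that belongs to two pointer states, an
  operator on two copies of \<open>K\<close>.\<close>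

lemma bounded_op_on_matrix:
  assumes "bounded_op_on K A" "bounded_op_on K B" "bounded_op_on K C" "bounded_op_on K D" "csubspace K"
  shows "bounded_op_on (K \<times> K) (\<lambda>w. (A (fst w) + B (snd w), C (fst w) + D (snd w)))"
proof -
  obtain a where a: "0 \<le> a" "\<And>x. x \<in> K \<Longrightarrow> norm (A x) \<le> a * norm x"
    using bounded_op_on_bound[OF assms(1)] by blast
  obtain b where b: "0 \<le> b" "\<And>x. x \<in> K \<Longrightarrow> norm (B x) \<le> b * norm x"
    using bounded_op_on_bound[OF assms(2)] by blast
  obtain c where c: "0 \<le> c" "\<And>x. x \<in> K \<Longrightarrow> norm (C x) \<le> c * norm x"
    using bounded_op_on_bound[OF assms(3)] by blast
  obtain d where d: "0 \<le> d" "\<And>x. x \<in> K \<Longrightarrow> norm (D x) \<le> d * norm x"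
    using bounded_op_on_bound[OF assms(4)] by blast
  have "norm (A (fst w) + B (snd w), C (fst w) + D (snd w)) \<le> (a + b + c + d) * norm w"
    if w: "w \<in> K \<times> K" for w
  proof -
    have uv: "fst w \<in> K" "snd w \<in> K" using w by auto
    have n: "norm (fst w) \<le> norm w" "norm (snd w) \<le> norm w"
      using norm_fst_le[of "fst w" "snd w"] norm_snd_le[of "snd w" "fst w"] by auto
    have "norm (A (fst w) + B (snd w), C (fst w) + D (snd w)) \<le>
        norm (A (fst w)) + norm (B (snd w)) + (norm (C (fst w)) + norm (D (snd w)))"
      using norm_Pair_le[of "A (fst w) + B (snd w)" "C (fst w) + D (snd w)"]
        norm_triangle_ineq[of "A (fst w)" "B (snd w)"] norm_triangle_ineq[of "C (fst w)" "D (snd w)"]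
      by linarith
    also have "\<dots> \<le> a * norm w + b * norm w + (c * norm w + d * norm w)"
      using a(2)[OF uv(1)] b(2)[OF uv(2)] c(2)[OF uv(1)] d(2)[OF uv(2)]
        mult_left_mono[OF n(1) a(1)] mult_left_mono[OF n(2) b(1)]
        mult_left_mono[OF n(1) c(1)] mult_left_mono[OF n(2) d(1)]
      by linarith
    finally show ?thesis by (simp add: algebra_simps)
  qed
  then have "\<exists>k. \<forall>w\<in>K \<times> K. norm (A (fst w) + B (snd w), C (fst w) + D (snd w)) \<le> k * norm w"
    by blast
  then show ?thesis
    unfolding bounded_op_on_def
    using bounded_op_onD[OF assms(1)] bounded_op_onD[OF assms(2)] bounded_op_onD[OF assms(3)]
      bounded_op_onD[OF assms(4)] csubspace_add[OF assms(5)]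
    by (auto simp: scaleC_prod_def scaleC_add_right algebra_simps)
qed

text \<open>\<open>\<psi>\<close> enters through its pointer coefficients and its norm;
  \<open>R\<close> is the initial state of whatever environment \<open>K\<close> stands for, the
  product state of all of them or the state of one.\<close>

locale dephased_state = dephasing_model ket K \<tau> \<epsilon> t W W'
  for ket :: "'i \<Rightarrow> 's::chilbert_space" and K :: "'b::chilbert_space set"
    and \<tau> :: "'s \<Rightarrow> 'b \<Rightarrow> 'c::chilbert_space" and \<epsilon> t W W' +
  fixes a :: "'i \<Rightarrow> complex" and \<psi> :: 's and R :: "'b \<Rightarrow> 'b"
  assumes amp: "cinner (ket i) \<psi> = a i" and amp_nonzero: "a i \<noteq> 0"
    and norm_psi: "norm \<psi> = 1" and density_R: "density_op K R"
begin

abbreviation "\<sigma> \<equiv> U \<circ> tensor_op UNIV K \<tau> (proj \<psi>) R \<circ> adj U"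

lemma density_op_state: "density_op UNIV \<sigma>"
proof -
  have "density_op UNIV (\<lambda>x. U (tensor_op UNIV K \<tau> (proj \<psi>) R (U' x)))"
    by (intro density_op_conj[OF unitary_pair_U hspace_UNIV]
        density_op_tensor_op[OF tensor hspace_UNIV hspace_K density_op_proj[OF norm_psi] density_R])
  then show ?thesis by (simp add: adj_U o_def)
qed

lemma bounded_clinear_state: "bounded_clinear \<sigma>"
  using density_op_bounded[OF density_op_state] by (simp only: bounded_op_on_UNIV)

text \<open>The evolution is diagonal in the pointer basis, so moving it to both arguments as its
  inverse leaves phases, amplitudes and a matrix element of \<open>R\<close>.\<close>

lemma state_matrix:
  assumes "y \<in> K" "y' \<in> K"
  shows "cinner (\<tau> (ket i) y) (\<sigma> (\<tau> (ket j) y')) =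
    (phase i * a i) * cnj (phase j * a j) * cinner (W' i y) (R (W' j y'))"
proof -
  have W': "W' l z \<in> K" if "z \<in> K" for l z by (rule unitary_pair_in(2)[OF unitary that])
  have RW': "R (W' l z) \<in> K" if "z \<in> K" for l z
    by (rule bounded_op_on_in[OF density_op_bounded[OF density_R] W'[OF that]])
  note T = tensor_op_bounded[OF tensor csubspace_UNIV csubspace_K bounded_op_on_proj density_op_bounded[OF density_R]]
    tensor_op_apply[OF tensor csubspace_UNIV csubspace_K bounded_op_on_proj density_op_bounded[OF density_R]]
  have "cinner (\<tau> (ket i) y) (\<sigma> (\<tau> (ket j) y')) =
      cinner (U' (\<tau> (ket i) y)) (tensor_op UNIV K \<tau> (proj \<psi>) R (U' (\<tau> (ket j) y')))"
    using unitary_pair_adjoint[OF unitary_pair_sym[OF unitary_pair_U]] by (simp add: adj_U)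
  also have "\<dots> = phase i * cnj (phase j) * cinner (\<tau> (ket i) (W' i y)) (\<tau> (proj \<psi> (ket j)) (R (W' j y')))"
    using assms W' by (simp add: U'_apply bounded_clinear_scaleC[OF T(1)] T(2) cinner_simps)
  also have "cinner (\<tau> (ket i) (W' i y)) (\<tau> (proj \<psi> (ket j)) (R (W' j y'))) =
      (cinner \<psi> (ket j) * cinner (ket i) \<psi>) * cinner (W' i y) (R (W' j y'))"
    using assms W' RW' by (simp add: hilbert_tensor_cinner[OF tensor] proj_def cinner_scaleC_right)
  also have "cinner \<psi> (ket j) = cnj (a j)"
    unfolding amp[symmetric] by (rule cinner_commute)
  finally show ?thesis by (simp add: amp mult_ac)
qed

text \<open>The factors \<open>phase i * a i\<close> do not vanish and are absorbed into the test
  vectors, so that positivity of the partial transpose becomes a statement on \<open>R\<close> and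
  \<open>W'\<close> alone.\<close>

lemma separable_matrix_nonneg:
  assumes sep: "separable UNIV K \<tau> \<sigma>" and F: "finite F" and g: "\<And>l. l \<in> F \<Longrightarrow> g l \<in> K"
  shows "0 \<le> (\<Sum>l\<in>F. \<Sum>m\<in>F. cinner (W' m (g l)) (R (W' l (g m))))"
proof -
  define s where "s i = phase i * a i" for i
  have s: "s i \<noteq> 0" for i by (simp add: s_def amp_nonzero)
  define f where "f l = (1 / s l) *\<^sub>C g l" for l
  have fK: "f l \<in> K" if "l \<in> F" for l
    unfolding f_def by (rule csubspace_scaleC[OF csubspace_K g[OF that]])
  have "0 \<le> (\<Sum>l\<in>F. \<Sum>m\<in>F. cinner (\<tau> (ket m) (f l)) (\<sigma> (\<tau> (ket l) (f m))))"
    by (rule separable_partial_transpose_nonneg[OF tensor csubspace_UNIV csubspace_K sep bounded_clinear_state F])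
      (use fK in auto)
  also have "\<dots> = (\<Sum>l\<in>F. \<Sum>m\<in>F. cinner (W' m (g l)) (R (W' l (g m))))"
  proof (intro sum.cong refl)
    fix l m assume lm: "l \<in> F" "m \<in> F"
    have bd: "bounded_op_on K (W' i)" for i by (rule unitary_pair_bounded(2)[OF unitary])
    have "cinner (\<tau> (ket m) (f l)) (\<sigma> (\<tau> (ket l) (f m))) =
        s m * cnj (s l) * cinner (W' m (f l)) (R (W' l (f m)))"
      unfolding s_def by (rule state_matrix) (use fK lm in auto)
    also have "W' m (f l) = (1 / s l) *\<^sub>C W' m (g l)"
      unfolding f_def by (rule bounded_op_on_scaleC[OF bd g[OF lm(1)]])
    also have "W' l (f m) = (1 / s m) *\<^sub>C W' l (g m)"
      unfolding f_def by (rule bounded_op_on_scaleC[OF bd g[OF lm(2)]])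
    also have "R ((1 / s m) *\<^sub>C W' l (g m)) = (1 / s m) *\<^sub>C R (W' l (g m))"
      by (rule bounded_op_on_scaleC[OF density_op_bounded[OF density_R] bounded_op_on_in[OF bd g[OF lm(2)]]])
    finally show "cinner (\<tau> (ket m) (f l)) (\<sigma> (\<tau> (ket l) (f m))) = cinner (W' m (g l)) (R (W' l (g m)))"
      using s[of m] s[of l] by (simp add: cinner_simps)
  qed
  finally show ?thesis .
qed

text \<open>For \<open>C = W\<^sub>i' W\<^sub>j\<close> the partial transpose, tested on the vectors \<open>(W\<^sub>j e, - W\<^sub>i e)\<close>, has the
  expectation values \<open>\<langle>C e, R C e\<rangle> - 2 \<langle>e, R e\<rangle> + \<langle>C' e, R C' e\<rangle>\<close>. They are nonnegative, and their sum
  over an orthonormal basis is \<open>1 - 2 + 1 = 0\<close>; so each of these vectors is in the kernel.\<close>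

theorem separable_imp_conditional_eq:
  assumes sep: "separable UNIV K \<tau> \<sigma>" and ij: "i \<noteq> j" and x: "x \<in> K"
  shows "W i (R (W' i x)) = W j (R (W' j x))"
proof -
  have R: "bounded_op_on K R" "positive_on K R"
    using density_R by (rule density_op_bounded, rule density_op_positive)
  have W: "bounded_op_on K (W l)" "bounded_op_on K (W' l)" for l
    by (rule unitary_pair_bounded[OF unitary])+
  have in_K: "W l z \<in> K" "W' l z \<in> K" "R z \<in> K" if "z \<in> K" for l z
    using that by (auto intro: bounded_op_on_in[OF W(1)] bounded_op_on_in[OF W(2)] bounded_op_on_in[OF R(1)])
  have adj: "cinner z (W l y) = cinner (W' l z) y" if "z \<in> K" "y \<in> K" for l z y
    using unitary_pair_adjoint[OF unitary_pair_sym[OF unitary] that] by simp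
  have inv: "W' l (W l z) = z" "W l (W' l z) = z" if "z \<in> K" for l z
    by (rule unitary_pair_inverse[OF unitary that])+
  \<comment> \<open>The block of the partial transpose for \<open>i\<close> and \<open>j\<close>,
    with the coefficients divided out: compared with the state itself, the entries
    \<open>W i R W' j\<close> and \<open>W j R W' i\<close> have exchanged places.\<close>
  define M where "M w = (W i (R (W' i (fst w))) + W j (R (W' i (snd w))),
    W i (R (W' j (fst w))) + W j (R (W' j (snd w))))" for w
  have M_form: "cinner w (M w) = (\<Sum>l\<in>{i, j}. \<Sum>m\<in>{i, j}. cinner (W' m (g l)) (R (W' l (g m))))"
    if "w \<in> K \<times> K" "g = (\<lambda>l. if l = i then fst w else snd w)" for w g
    using that ij in_K by (auto simp: M_def cinner_prod_def cinner_add_right adj)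
  have WRW: "bounded_op_on K (\<lambda>x. W l (R (W' m x)))" for l m
    by (rule bounded_op_on_compose[OF W(1) bounded_op_on_compose[OF R(1) W(2)]])
  have M: "positive_on (K \<times> K) M"
    unfolding positive_on_def
  proof (intro conjI ballI)
    show "bounded_op_on (K \<times> K) M"
      unfolding M_def by (rule bounded_op_on_matrix[OF WRW WRW WRW WRW csubspace_K])
    fix w assume w: "w \<in> K \<times> K"
    show "0 \<le> cinner w (M w)"
      unfolding M_form[OF w refl]
      by (rule separable_matrix_nonneg[OF sep]) (use w in auto)
  qed
  have csKK: "csubspace (K \<times> K)"
    by (rule cvs.subspaceI) (auto simp: csubspaceD[OF csubspace_K] scaleC_prod_def zero_prod_def)
  obtain B where B: "is_onb K B" using onb_exists[OF hspace_K] by blast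
  have BK: "B \<subseteq> K" "K \<subseteq> closure (cspan B)" using B by (auto simp: is_onb_iff)
  define q where "q e = (W j e, - W i e)" for e
  have qK: "q e \<in> K \<times> K" if "e \<in> K" for e
    using in_K[OF that] csubspace_scaleC[OF csubspace_K, of "W i e" "-1"] by (simp add: q_def)
  have neg: "W' l (- z) = - W' l z" "R (- z) = - R z" if "z \<in> K" for l z
    using bounded_op_on_scaleC[OF W(2) that, where c = "-1"]
      bounded_op_on_scaleC[OF R(1) that, where c = "-1"] by simp_all
  have q_form: "Re (cinner (q e) (M (q e))) = Re (cinner (W' i (W j e)) (R (W' i (W j e)))) +
      Re (cinner (W' j (W i e)) (R (W' j (W i e)))) - 2 * Re (cinner e (R e))" if e: "e \<in> K" for e
    unfolding M_form[OF qK[OF e] refl]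
    using ij in_K e by (simp add: q_def neg inv cinner_minus_left cinner_minus_right)
  \<comment> \<open>The product of \<open>W' k\<close> and \<open>W l\<close> carries
    \<open>B\<close> to another orthonormal basis, in which the trace of \<open>R\<close> is 1 as
    well.\<close>
  have tr: "((\<lambda>e. Re (cinner (W' k (W l e)) (R (W' k (W l e))))) has_sum 1) B" for k l
  proof -
    note onb = unitary_pair_onb[OF unitary_pair_compose[OF unitary_pair_sym[OF unitary[of k]] unitary[of l]] hspace_K B]
    have "((\<lambda>e. Re (cinner e (R e))) \<circ> (\<lambda>x. W' k (W l x)) has_sum 1) B"
      using density_op_trace[OF density_R onb(1)] has_sum_reindex[OF onb(2)] by blast
    then show ?thesis by (simp add: o_def)
  qed
  have "((\<lambda>e. Re (cinner (q e) (M (q e)))) has_sum (1 + 1) + (- 2) * 1) B \<longleftrightarrow>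
    ((\<lambda>e. Re (cinner (W' i (W j e)) (R (W' i (W j e)))) +
      Re (cinner (W' j (W i e)) (R (W' j (W i e)))) + (- 2) * Re (cinner e (R e))) has_sum (1 + 1) + (- 2) * 1) B"
    by (rule has_sum_cong) (use BK q_form in auto)
  moreover have "((\<lambda>e. Re (cinner (W' i (W j e)) (R (W' i (W j e)))) +
      Re (cinner (W' j (W i e)) (R (W' j (W i e)))) + (- 2) * Re (cinner e (R e))) has_sum (1 + 1) + (- 2) * 1) B"
    by (intro has_sum_add tr has_sum_cmult_right density_op_trace[OF density_R B])
  ultimately have sum0: "((\<lambda>e. Re (cinner (q e) (M (q e)))) has_sum 0) B" by simp
  have Mq: "M (q e) = 0" if e: "e \<in> B" for e
  proof (rule positive_on_eq_0[OF M csKK])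
    have eK: "e \<in> K" using e BK by blast
    show "q e \<in> K \<times> K" by (rule qK[OF eK])
    have "Re (cinner (q e) (M (q e))) = 0"
      by (rule nonneg_has_sum_le_0D[OF sum0 order_refl _ e])
        (use BK positive_on_diag_real(2)[OF M qK] in auto)
    then show "cinner (q e) (M (q e)) = 0"
      using positive_on_diag_real(1)[OF M qK[OF eK]] by simp
  qed
  \<comment> \<open>On the basis this is the first component of \<open>M (q e) = 0\<close>; the
    claim is the case \<open>y = W' j x\<close>.\<close>
  have "W i (R (W' i (W j y))) = W j (R y)" if y: "y \<in> K" for y
  proof (rule bounded_op_on_eqI[OF _ _ hspace_K BK(1,2) _ y])
    show "bounded_op_on K (\<lambda>y. W i (R (W' i (W j y))))"
      by (rule bounded_op_on_compose[OF WRW W(1)])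
    show "bounded_op_on K (\<lambda>y. W j (R y))"
      by (rule bounded_op_on_compose[OF W(1) R(1)])
    fix e assume e: "e \<in> B"
    then have eK: "e \<in> K" using BK by blast
    have "W j (- R e) = - W j (R e)"
      using bounded_op_on_scaleC[OF W(1) in_K(3)[OF eK], where c = "-1"] by simp
    then show "W i (R (W' i (W j e))) = W j (R e)"
      using Mq[OF e] in_K[OF eK] eK
      by (simp add: M_def q_def zero_prod_def neg inv)
  qed
  from this[OF in_K(2)[OF x, of j]] show ?thesis by (simp add: inv[OF x])
qed

end


section \<open>Marginals\<close>

text \<open>Summing over a basis forces \<open>c = d\<close>. The difference of the two operators
  then has vanishing quadratic form, hence is positive with null diagonal, and so it is 0.\<close>

lemma positive_on_proportional_eq:
  assumes H: "hspace H" and \<rho>: "density_op H \<rho>" "density_op H \<rho>'" and c: "c \<noteq> 0"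
    and eq: "\<And>x. x \<in> H \<Longrightarrow> c * cinner x (\<rho> x) = d * cinner x (\<rho>' x)" and x: "x \<in> H"
  shows "\<rho> x = \<rho>' x"
proof -
  have cs: "csubspace H" using H by (simp add: hspace_def)
  note bd = density_op_bounded[OF \<rho>(1)] density_op_bounded[OF \<rho>(2)]
  obtain B where B: "is_onb H B" using onb_exists[OF H] by blast
  have "((\<lambda>e. cinner e (\<rho> e)) has_sum 1) B" "((\<lambda>e. cinner e (\<rho>' e)) has_sum 1) B"
    using \<rho> B by (auto simp: density_op_def)
  then have "((\<lambda>e. c * cinner e (\<rho> e)) has_sum c * 1) B" "((\<lambda>e. d * cinner e (\<rho>' e)) has_sum d * 1) B"
    using has_sum_cmult_right[of "\<lambda>e. cinner e (\<rho> e)" B 1 c]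
      has_sum_cmult_right[of "\<lambda>e. cinner e (\<rho>' e)" B 1 d] by auto
  moreover have "((\<lambda>e. c * cinner e (\<rho> e)) has_sum c * 1) B \<longleftrightarrow> ((\<lambda>e. d * cinner e (\<rho>' e)) has_sum c * 1) B"
    using eq B by (intro has_sum_cong) (auto simp: is_onb_iff)
  ultimately have "c = d" using has_sum_unique by fastforce
  then have eq': "cinner x (\<rho> x) = cinner x (\<rho>' x)" if "x \<in> H" for x
    using eq[OF that] c by simp
  have id: "bounded_op_on H (\<lambda>x. x)" by (auto simp: bounded_op_on_def intro: exI[of _ 1])
  obtain a where a: "0 \<le> a" "\<And>x. x \<in> H \<Longrightarrow> norm (\<rho> x) \<le> a * norm x"
    using bounded_op_on_bound[OF bd(1)] by blast
  obtain b where b: "0 \<le> b" "\<And>x. x \<in> H \<Longrightarrow> norm (\<rho>' x) \<le> b * norm x"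
    using bounded_op_on_bound[OF bd(2)] by blast
  have n: "norm (\<rho> x - \<rho>' x) \<le> (a + b) * norm x" if "x \<in> H" for x
    using norm_triangle_ineq4[of "\<rho> x" "\<rho>' x"] a(2)[OF that] b(2)[OF that] by (simp add: algebra_simps)
  have "positive_on H (\<lambda>x. \<rho> x - \<rho>' x)"
    unfolding positive_on_def bounded_op_on_def
    using n bounded_op_onD[OF bd(1)] bounded_op_onD[OF bd(2)] csubspace_diff[OF cs] eq'
    by (auto simp: scaleC.diff_right cinner_diff_right)
  then have "\<rho> x - \<rho>' x = 0"
    by (rule positive_on_eq_0[OF _ cs x]) (simp add: cinner_diff_right eq'[OF x])
  then show ?thesis by simp
qed

text \<open>A marginal is read off by freezing the other coordinates at vectors with nonzero
  expectation; their product joins the constant. The free constants \<open>c\<close> and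
  \<open>d\<close> take up weights of the pointer states or the unobserved factor.\<close>

lemma tensor_marginals_eq:
  assumes I: "finite I" and H: "\<And>k. k \<in> I \<Longrightarrow> hspace (H k)"
    and \<rho>: "\<And>k. k \<in> I \<Longrightarrow> density_op (H k) (\<rho> k)" "\<And>k. k \<in> I \<Longrightarrow> density_op (H k) (\<rho>' k)"
    and c: "c \<noteq> 0"
    and eq: "\<And>x. x \<in> Pi I H \<Longrightarrow> c * (\<Prod>k\<in>I. cinner (x k) (\<rho> k (x k))) = d * (\<Prod>k\<in>I. cinner (x k) (\<rho>' k (x k)))"
    and k: "k \<in> I" and x: "x \<in> H k"
  shows "\<rho> k x = \<rho>' k x"
proof -
  have "\<forall>l\<in>I. \<exists>z\<in>H l. cinner z (\<rho> l z) \<noteq> 0"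
    using density_op_nonzero[OF \<rho>(1) H] by metis
  then obtain z where z: "\<And>l. l \<in> I \<Longrightarrow> z l \<in> H l" "\<And>l. l \<in> I \<Longrightarrow> cinner (z l) (\<rho> l (z l)) \<noteq> 0"
    by metis
  define c' where "c' = c * (\<Prod>l\<in>I - {k}. cinner (z l) (\<rho> l (z l)))"
  define d' where "d' = d * (\<Prod>l\<in>I - {k}. cinner (z l) (\<rho>' l (z l)))"
  show ?thesis
  proof (rule positive_on_proportional_eq[OF H[OF k] \<rho>(1)[OF k] \<rho>(2)[OF k] _ _ x])
    show "c' \<noteq> 0" using c z(2) I by (simp add: c'_def)
    fix u assume u: "u \<in> H k"
    have split: "(\<Prod>l\<in>I. cinner ((z(k := u)) l) (r l ((z(k := u)) l))) =
        cinner u (r k u) * (\<Prod>l\<in>I - {k}. cinner (z l) (r l (z l)))" for r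
      using I k by (subst prod.remove[of _ k]) (auto intro!: prod.cong)
    have "z(k := u) \<in> Pi I H" using z(1) u by auto
    from eq[OF this] show "c' * cinner u (\<rho> k u) = d' * cinner u (\<rho>' k u)"
      unfolding split c'_def d'_def by (simp add: mult_ac)
  qed
qed

section \<open>The partial trace\<close>

locale tripartite =
  fixes \<tau>NE :: "'n::chilbert_space \<Rightarrow> 'c::chilbert_space \<Rightarrow> 'b::chilbert_space"
    and \<tau>SNE :: "'s::chilbert_space \<Rightarrow> 'b \<Rightarrow> 't::chilbert_space"
    and \<tau>SE :: "'s \<Rightarrow> 'c \<Rightarrow> 'r::chilbert_space"
  assumes NE: "hilbert_tensor UNIV UNIV \<tau>NE" and SNE: "hilbert_tensor UNIV UNIV \<tau>SNE"
    and SE: "hilbert_tensor UNIV UNIV \<tau>SE"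
begin

text \<open>Inserting a fixed middle vector multiplies inner products by its squared norm, so the
  difference of Gram kernels is 0. The partial trace is the sum over a basis of \<open>A\<close>
  compressed by these maps.\<close>

lemma reorder_exists:
  "\<exists>C. bounded_clinear C \<and> (\<forall>x y. C (\<tau>SE x y) = \<tau>SNE x (\<tau>NE n y))"
proof -
  obtain C where C: "bounded_clinear C"
    "\<And>p. p \<in> UNIV \<times> UNIV \<Longrightarrow> C ((\<lambda>(x, y). \<tau>SE x y) p) = (\<lambda>(x, y). \<tau>SNE x (\<tau>NE n y)) p"
    "\<And>z. norm (C z) \<le> norm n * norm z"
  proof (rule bounded_clinear_extension_kernel[OF hilbert_tensor_dense_image[OF SE] norm_ge_zero[of n]])
    fix F :: "('s \<times> 'c) set"
    have "psd_kernel F (\<lambda>p q. 0)" by (rule psd_kernel_const) simp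
    then show "psd_kernel F (\<lambda>p q. of_real ((norm n)\<^sup>2) * cinner ((\<lambda>(x, y). \<tau>SE x y) p) ((\<lambda>(x, y). \<tau>SE x y) q) -
        cinner ((\<lambda>(x, y). \<tau>SNE x (\<tau>NE n y)) p) ((\<lambda>(x, y). \<tau>SNE x (\<tau>NE n y)) q))"
      by (rule psd_kernel_cong[THEN iffD1, rotated])
        (simp add: case_prod_unfold hilbert_tensor_cinner[OF SE] hilbert_tensor_cinner[OF SNE]
          hilbert_tensor_cinner[OF NE] cinner_self)
  qed blast
  then show ?thesis by auto
qed

definition reorder :: "'n \<Rightarrow> 'r \<Rightarrow> 't" where
  "reorder n = (SOME C. bounded_clinear C \<and> (\<forall>x y. C (\<tau>SE x y) = \<tau>SNE x (\<tau>NE n y)))"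

lemma reorder_bounded: "bounded_clinear (reorder n)" and reorder_apply: "reorder n (\<tau>SE x y) = \<tau>SNE x (\<tau>NE n y)"
  using someI_ex[OF reorder_exists[of n]] unfolding reorder_def[symmetric] by blast+

lemma reorder_eqI:
  assumes "bounded_clinear f" "bounded_clinear g" "\<And>x y. f (\<tau>SE x y) = g (\<tau>SE x y)"
  shows "f = g"
  by (rule bounded_clinear_eqI[OF assms(1,2) hilbert_tensor_dense_image[OF SE]]) (use assms(3) in auto)

lemma reorder_add: "reorder (n + n') u = reorder n u + reorder n' u"
proof -
  have "reorder (n + n') = (\<lambda>u. reorder n u + reorder n' u)"
    by (rule reorder_eqI[OF reorder_bounded bounded_clinear_plus[OF reorder_bounded reorder_bounded]])
      (simp add: reorder_apply hilbert_tensor_add_left[OF NE] hilbert_tensor_add_right[OF SNE])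
  then show ?thesis by metis
qed

lemma reorder_scaleC: "reorder (c *\<^sub>C n) u = c *\<^sub>C reorder n u"
proof -
  have "reorder (c *\<^sub>C n) = (\<lambda>u. c *\<^sub>C reorder n u)"
    by (rule reorder_eqI[OF reorder_bounded bounded_clinear_compose[OF bounded_clinear_scaleC_const reorder_bounded]])
      (simp add: reorder_apply hilbert_tensor_scaleC_left[OF NE] hilbert_tensor_scaleC_right[OF SNE])
  then show ?thesis by metis
qed

lemma reorder_cinner: "cinner (reorder n u) (reorder n' u') = cinner n n' * cinner u u'"
proof -
  have sc: "bounded_clinear (\<lambda>u'. c * cinner u u')" for c and u :: 'r
    using bounded_clinear_compose[OF bounded_clinear_scaleC_const[of c] bounded_clinear_cinner_left[of u]]
    by (simp add: scaleC_complex_def)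
  have 1: "cinner (reorder n (\<tau>SE x y)) (reorder n' u') = cinner n n' * cinner (\<tau>SE x y) u'" for x y n n' u'
  proof -
    have "(\<lambda>u'. cinner (reorder n (\<tau>SE x y)) (reorder n' u')) = (\<lambda>u'. cinner n n' * cinner (\<tau>SE x y) u')"
      by (rule reorder_eqI[OF bounded_clinear_compose[OF bounded_clinear_cinner_left reorder_bounded] sc])
        (simp add: reorder_apply hilbert_tensor_cinner[OF SE] hilbert_tensor_cinner[OF SNE]
          hilbert_tensor_cinner[OF NE] mult_ac)
    then show ?thesis by metis
  qed
  have "(\<lambda>u. cinner (reorder n' u') (reorder n u)) = (\<lambda>u. cinner n' n * cinner u' u)"
  proof (rule reorder_eqI[OF bounded_clinear_compose[OF bounded_clinear_cinner_left reorder_bounded] sc])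
    fix x y
    have "cinner (reorder n' u') (reorder n (\<tau>SE x y)) = cnj (cinner (reorder n (\<tau>SE x y)) (reorder n' u'))"
      by (rule cinner_commute)
    also have "\<dots> = cinner n' n * cinner u' (\<tau>SE x y)"
      using cinner_commute[of n' n] cinner_commute[of u' "\<tau>SE x y"] by (simp add: 1)
    finally show "cinner (reorder n' u') (reorder n (\<tau>SE x y)) = cinner n' n * cinner u' (\<tau>SE x y)" .
  qed
  then have "cinner (reorder n' u') (reorder n u) = cinner n' n * cinner u' u" by metis
  then have "cnj (cinner (reorder n' u') (reorder n u)) = cnj (cinner n' n * cinner u' u)" by simp
  then show ?thesis
    using cinner_commute[of "reorder n u" "reorder n' u'"] cinner_commute[of n n'] cinner_commute[of u u'] by simp
qed

lemma reorder_norm: "norm (reorder n u) = norm u * norm n"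
proof -
  have "(norm (reorder n u))\<^sup>2 = (norm u * norm n)\<^sup>2"
    by (simp add: norm_power2_cinner reorder_cinner power_mult_distrib)
      (simp add: cinner_self mult.commute flip: of_real_power)
  then show ?thesis
    by (metis norm_ge_zero mult_nonneg_nonneg power2_eq_imp_eq)
qed

section \<open>Existence of the partial trace by polarisation\<close>

context
  fixes A :: "'t \<Rightarrow> 't"
  assumes A: "density_op UNIV A"
begin

lemma A_bounded: "bounded_clinear A"
  using density_op_bounded[OF A] by (simp add: bounded_op_on_UNIV)

text \<open>For a unit vector \<open>v\<close> the vectors \<open>reorder e v\<close> are
  orthonormal together with the \<open>e\<close>, so the sum is at most the trace of
  \<open>A\<close>; a general \<open>u\<close> contributes its squared norm as a factor.\<close>

lemma trace_slice_le:
  assumes G: "orthonormal_set G" "finite G"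
  shows "(\<Sum>e\<in>G. Re (cinner (reorder e u) (A (reorder e u)))) \<le> (norm u)\<^sup>2"
proof (cases "u = 0")
  case True
  then show ?thesis by (simp add: bounded_clinear_zero[OF reorder_bounded])
next
  case False
  define v where "v = u /\<^sub>R norm u"
  have v: "norm v = 1" "u = norm u *\<^sub>R v" using False by (auto simp: v_def)
  have ip: "cinner (reorder e v) (reorder f v) = cinner e f" for e f
    using v(1) by (simp add: reorder_cinner cinner_self)
  have inj: "inj_on (\<lambda>e. reorder e v) G"
  proof (rule inj_onI)
    fix e f assume ef: "e \<in> G" "f \<in> G" "reorder e v = reorder f v"
    then have "cinner e f = cinner f f" using ip[of e f] ip[of f f] by simp
    then show "e = f" using orthonormal_setD[OF G(1)] ef by (metis zero_neq_one)
  qed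
  obtain B where B: "is_onb (UNIV :: 't set) B" using onb_exists[OF hspace_UNIV] by blast
  have pos: "positive_on UNIV A" by (rule density_op_positive[OF A])
  have "(\<Sum>f\<in>(\<lambda>e. reorder e v) ` G. Re (cinner f (A f))) \<le> 1"
  proof (rule positive_trace_le[OF pos hspace_UNIV B])
    show "(\<Sum>e\<in>F. Re (cinner e (A e))) \<le> 1" if "finite F" "F \<subseteq> B" for F
      by (rule finite_sum_le_has_sum[OF density_op_trace[OF A B] that]) (rule positive_on_diag_real(2)[OF pos UNIV_I])
    show "orthonormal_set ((\<lambda>e. reorder e v) ` G)"
      unfolding orthonormal_set_def using ip orthonormal_setD[OF G(1)] inj_on_eq_iff[OF inj] by auto
  qed (use G in auto)
  then have "(\<Sum>e\<in>G. Re (cinner (reorder e v) (A (reorder e v)))) \<le> 1"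
    using inj by (simp add: sum.reindex)
  moreover have "Re (cinner (reorder e u) (A (reorder e u))) = (norm u)\<^sup>2 * Re (cinner (reorder e v) (A (reorder e v)))" for e
    by (subst (1 2) v(2)) (simp add: bounded_clinear_scaleR[OF reorder_bounded] bounded_clinear_scaleR[OF A_bounded]
        cinner_scaleR_left cinner_scaleR_right power2_eq_square)
  ultimately show ?thesis
    by (simp add: sum_distrib_left[symmetric] mult_left_le)
qed

text \<open>The diagonal value <u, C u> of the partial trace C that is to be constructed.\<close>

definition slice_trace :: "'r \<Rightarrow> real" where
  "slice_trace u = (THE s. \<forall>B. is_onb UNIV B \<longrightarrow> ((\<lambda>e. Re (cinner (reorder e u) (A (reorder e u)))) has_sum s) B)"

text \<open>For fixed \<open>u\<close> the matrix elements as a form in the middle vectors are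
  represented by a positive operator \<open>T\<close> on the traced-out space, and the trace of
  \<open>T\<close> is the same in all bases.\<close>

lemma slice_trace_exists:
  "\<exists>s. s \<le> (norm u)\<^sup>2 \<and> (\<forall>B. is_onb UNIV B \<longrightarrow> ((\<lambda>e. Re (cinner (reorder e u) (A (reorder e u)))) has_sum s) B)"
proof -
  have pos: "positive_on UNIV A" by (rule density_op_positive[OF A])
  define K where "K = norm u"
  have K: "0 \<le> K" "\<And>n. norm (reorder n u) \<le> K * norm n"
    by (simp_all add: K_def reorder_norm)
  obtain L where L: "0 \<le> L" "\<And>x. norm (A x) \<le> L * norm x"
    using bounded_op_on_bound[OF density_op_bounded[OF A]] by auto
  obtain T where T: "bounded_clinear T" "\<And>n n'. cinner (reorder n u) (A (reorder n' u)) = cinner n (T n')"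
  proof (rule bounded_form_representation[of "\<lambda>n n'. cinner (reorder n u) (A (reorder n' u))" "K * (L * K)"])
    fix n n'
    have "cmod (cinner (reorder n u) (A (reorder n' u))) \<le> norm (reorder n u) * norm (A (reorder n' u))"
      by (rule cinner_Cauchy_Schwarz)
    also have "\<dots> \<le> (K * norm n) * (L * (K * norm n'))"
      using K L by (intro mult_mono order_trans[OF L(2)] mult_left_mono) auto
    finally show "cmod (cinner (reorder n u) (A (reorder n' u))) \<le> K * (L * K) * (norm n * norm n')"
      by (simp add: mult_ac)
  qed (simp_all add: reorder_add reorder_scaleC bounded_clinear_add[OF A_bounded] bounded_clinear_scaleC[OF A_bounded] cinner_simps)
  have Tpos: "positive_on UNIV T"
    using T(1) positive_on_nonneg[OF pos] by (auto simp: positive_on_def bounded_op_on_UNIV T(2)[symmetric])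
  obtain B where B: "is_onb (UNIV :: 'n set) B" using onb_exists[OF hspace_UNIV] by blast
  have Bo: "orthonormal_set B" using B by (simp add: is_onb_iff)
  have bound: "(\<Sum>e\<in>F. Re (cinner e (T e))) \<le> (norm u)\<^sup>2" if "finite F" "F \<subseteq> B" for F
    using trace_slice_le[OF orthonormal_set_subset[OF Bo that(2)] that(1), of u] by (simp add: T(2))
  have "(\<lambda>e. Re (cinner e (T e))) summable_on B"
  proof (rule nonneg_bdd_above_summable_on)
    show "0 \<le> Re (cinner e (T e))" for e
      by (rule positive_on_diag_real(2)[OF Tpos UNIV_I])
    show "bdd_above (sum (\<lambda>e. Re (cinner e (T e))) ` {F. F \<subseteq> B \<and> finite F})"
      by (rule bdd_aboveI2) (use bound in auto)
  qed
  then obtain s where s: "((\<lambda>e. Re (cinner e (T e))) has_sum s) B" by (auto simp: summable_on_def)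
  have "s \<le> (norm u)\<^sup>2" by (rule has_sum_le_finite_sums[OF s bound])
  moreover have "((\<lambda>e. Re (cinner (reorder e u) (A (reorder e u)))) has_sum s) C" if "is_onb UNIV C" for C
    unfolding T(2) by (rule positive_trace_basis_independent[OF Tpos hspace_UNIV B that s])
  ultimately show ?thesis by blast
qed

lemma slice_trace_has_sum: "is_onb UNIV B \<Longrightarrow> ((\<lambda>e. Re (cinner (reorder e u) (A (reorder e u)))) has_sum slice_trace u) B"
  and slice_trace_le: "slice_trace u \<le> (norm u)\<^sup>2" and slice_trace_nonneg: "0 \<le> slice_trace u"
proof -
  obtain s where s: "s \<le> (norm u)\<^sup>2"
    "\<And>B. is_onb UNIV B \<Longrightarrow> ((\<lambda>e. Re (cinner (reorder e u) (A (reorder e u)))) has_sum s) B"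
    using slice_trace_exists[of u] by blast
  obtain C where C: "is_onb (UNIV :: 'n set) C" using onb_exists[OF hspace_UNIV] by blast
  have "slice_trace u = s"
    unfolding slice_trace_def using s(2) has_sum_unique[OF s(2)[OF C]] C by (intro the_equality) blast+
  then show "is_onb UNIV B \<Longrightarrow> ((\<lambda>e. Re (cinner (reorder e u) (A (reorder e u)))) has_sum slice_trace u) B" "slice_trace u \<le> (norm u)\<^sup>2"
    using s by auto
  show "0 \<le> slice_trace u"
    unfolding \<open>slice_trace u = s\<close>
    by (rule has_sum_nonneg[OF s(2)[OF C]]) (rule positive_on_diag_real(2)[OF density_op_positive[OF A] UNIV_I])
qed

text \<open>Polarisation of \<open>slice_trace\<close>: off-diagonal sums converge as combinations
  of four convergent sums of nonnegative terms.\<close>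

definition trace_form :: "'r \<Rightarrow> 'r \<Rightarrow> complex" where
  "trace_form u v = (of_real (slice_trace (u + v)) - of_real (slice_trace (u - v)) -
     \<i> * (of_real (slice_trace (u + \<i> *\<^sub>C v)) - of_real (slice_trace (u - \<i> *\<^sub>C v)))) / 4"

lemma trace_form_has_sum:
  assumes B: "is_onb UNIV B"
  shows "((\<lambda>e. cinner (reorder e u) (A (reorder e v))) has_sum trace_form u v) B"
proof -
  have pos: "positive_on UNIV A" by (rule density_op_positive[OF A])
  define Q where "Q e w = cinner (reorder e w) (A (reorder e w))" for e w
  have Q: "Q e w = of_real (Re (cinner (reorder e w) (A (reorder e w))))" for e w
    unfolding Q_def by (rule positive_on_diag_real(1)[OF pos UNIV_I])
  have Qsum: "((\<lambda>e. Q e w) has_sum of_real (slice_trace w)) B" for w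
    unfolding Q by (subst has_sum_of_real_iff) (rule slice_trace_has_sum[OF B])
  have pol: "cinner (reorder e u) (A (reorder e v)) =
      (1 / 4) * (Q e (u + v) + (- 1) * Q e (u - v) + ((- \<i>) * Q e (u + \<i> *\<^sub>C v) + \<i> * Q e (u - \<i> *\<^sub>C v)))" for e
  proof -
    define x y where "x = reorder e u" and "y = reorder e v"
    define a b c d where "a = cinner x (A x)" and "b = cinner x (A y)" and "c = cinner y (A x)"
      and "d = cinner y (A y)"
    have "Q e (u + v) = a + b + c + d" "Q e (u - v) = a - b - c + d"
      "Q e (u + \<i> *\<^sub>C v) = a + \<i> * b - \<i> * c + d" "Q e (u - \<i> *\<^sub>C v) = a - \<i> * b + \<i> * c + d"
      by (simp_all add: Q_def x_def y_def a_def b_def c_def d_def bounded_clinearD[OF reorder_bounded]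
          bounded_clinearD[OF A_bounded] cinner_simps algebra_simps)
    moreover have "b = (1 / 4) * ((a + b + c + d) + (- 1) * (a - b - c + d) +
        ((- \<i>) * (a + \<i> * b - \<i> * c + d) + \<i> * (a - \<i> * b + \<i> * c + d)))"
      by (simp add: algebra_simps)
    ultimately show ?thesis
      by (simp only: b_def x_def y_def)
  qed
  have "((\<lambda>e. (1 / 4) * (Q e (u + v) + (- 1) * Q e (u - v) + ((- \<i>) * Q e (u + \<i> *\<^sub>C v) + \<i> * Q e (u - \<i> *\<^sub>C v))))
      has_sum (1 / 4) * (of_real (slice_trace (u + v)) + (- 1) * of_real (slice_trace (u - v)) +
        ((- \<i>) * of_real (slice_trace (u + \<i> *\<^sub>C v)) + \<i> * of_real (slice_trace (u - \<i> *\<^sub>C v))))) B"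
    by (intro has_sum_cmult_right has_sum_add Qsum)
  moreover have "trace_form u v = (1 / 4) * (of_real (slice_trace (u + v)) + (- 1) * of_real (slice_trace (u - v)) +
        ((- \<i>) * of_real (slice_trace (u + \<i> *\<^sub>C v)) + \<i> * of_real (slice_trace (u - \<i> *\<^sub>C v))))"
    unfolding trace_form_def by (simp add: algebra_simps add_divide_distrib diff_divide_distrib)
  ultimately show ?thesis
    unfolding pol by (simp only:)
qed

text \<open>By real homogeneity unit vectors suffice, and for them each of the four terms of the
  polarisation is at most a squared norm.\<close>

lemma trace_form_bound: "cmod (trace_form u v) \<le> 2 * (norm u * norm v)"
proof -
  obtain B where B: "is_onb (UNIV :: 'n set) B" using onb_exists[OF hspace_UNIV] by blast
  have trace_form_scale: "trace_form (a *\<^sub>R x) (b *\<^sub>R y) = of_real (a * b) * trace_form x y" for a b x y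
  proof -
    have "((\<lambda>e. of_real (a * b) * cinner (reorder e x) (A (reorder e y))) has_sum of_real (a * b) * trace_form x y) B"
      by (intro has_sum_cmult_right trace_form_has_sum[OF B])
    moreover have "of_real (a * b) * cinner (reorder e x) (A (reorder e y)) = cinner (reorder e (a *\<^sub>R x)) (A (reorder e (b *\<^sub>R y)))" for e
      by (simp add: bounded_clinear_scaleR[OF reorder_bounded] bounded_clinear_scaleR[OF A_bounded]
          cinner_scaleR_left cinner_scaleR_right)
    ultimately have "((\<lambda>e. cinner (reorder e (a *\<^sub>R x)) (A (reorder e (b *\<^sub>R y)))) has_sum of_real (a * b) * trace_form x y) B"
      by (simp only:)
    with trace_form_has_sum[OF B] show ?thesis by (rule has_sum_unique)
  qed
  show ?thesis
  proof (cases "u = 0 \<or> v = 0")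
    case True
    then show ?thesis using trace_form_scale[of 0 u 1 v] trace_form_scale[of 1 u 0 v] by auto
  next
    case False
    define x y where "x = u /\<^sub>R norm u" and "y = v /\<^sub>R norm v"
    have xy: "norm x = 1" "norm y = 1" "u = norm u *\<^sub>R x" "v = norm v *\<^sub>R y"
      using False by (auto simp: x_def y_def)
    have tri: "cmod (a - b - \<i> * (c - d)) \<le> cmod a + cmod b + cmod c + cmod d" for a b c d
      using norm_triangle_ineq4[of "a - b" "\<i> * (c - d)"] norm_triangle_ineq4[of a b] norm_triangle_ineq4[of c d]
      by (simp add: norm_mult)
    have "cmod (trace_form x y) \<le> (slice_trace (x + y) + slice_trace (x - y) + slice_trace (x + \<i> *\<^sub>C y) + slice_trace (x - \<i> *\<^sub>C y)) / 4"
      unfolding trace_form_def norm_divide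
      using tri[of "of_real (slice_trace (x + y))" "of_real (slice_trace (x - y))" "of_real (slice_trace (x + \<i> *\<^sub>C y))" "of_real (slice_trace (x - \<i> *\<^sub>C y))"]
        slice_trace_nonneg by simp
    also have "\<dots> \<le> ((norm (x + y))\<^sup>2 + (norm (x - y))\<^sup>2 + (norm (x + \<i> *\<^sub>C y))\<^sup>2 + (norm (x - \<i> *\<^sub>C y))\<^sup>2) / 4"
      using slice_trace_le[of "x + y"] slice_trace_le[of "x - y"] slice_trace_le[of "x + \<i> *\<^sub>C y"] slice_trace_le[of "x - \<i> *\<^sub>C y"] by simp
    \<comment> \<open>By the parallelogram law each pair of squares adds up to 4.\<close>
    also have "\<dots> = 2"
      using xy(1,2) by (simp add: norm_add_power2 norm_diff_power2 norm_scaleC)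
    finally have "cmod (trace_form x y) \<le> 2" .
    moreover have "cmod (trace_form u v) = norm u * norm v * cmod (trace_form x y)"
      by (subst xy(3), subst xy(4)) (simp only: trace_form_scale, simp add: norm_mult)
    moreover have "norm u * norm v * cmod (trace_form x y) \<le> norm u * norm v * 2"
      using \<open>cmod (trace_form x y) \<le> 2\<close> by (rule mult_left_mono) simp
    ultimately show ?thesis by simp
  qed
qed

text \<open>Uniqueness of sums in one basis \<open>B0\<close> makes \<open>trace_form\<close>
  sesquilinear, so it is represented by an operator; that operator works for all bases because
  \<open>slice_trace\<close> does.\<close>

theorem partial_trace_density_op:
  shows partial_trace_bounded: "bounded_clinear (partial_trace \<tau>NE \<tau>SNE \<tau>SE A)"
    and partial_trace_has_sum: "is_onb UNIV B \<Longrightarrow>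
      ((\<lambda>e. cinner (\<tau>SNE x (\<tau>NE e y)) (A (\<tau>SNE x' (\<tau>NE e y')))) has_sum
        cinner (\<tau>SE x y) (partial_trace \<tau>NE \<tau>SNE \<tau>SE A (\<tau>SE x' y'))) B"
proof -
  obtain B0 where B0: "is_onb (UNIV :: 'n set) B0" using onb_exists[OF hspace_UNIV] by blast
  have eqI: "trace_form u v = c" if "((\<lambda>e. cinner (reorder e u) (A (reorder e v))) has_sum c) B0" for u v c
    using trace_form_has_sum[OF B0] that by (rule has_sum_unique)
  obtain C where C: "bounded_clinear C" "\<And>u v. trace_form u v = cinner u (C v)"
  proof (rule bounded_form_representation[of trace_form 2])
    show "trace_form x (y + y') = trace_form x y + trace_form x y'" for x y y'
      using has_sum_add[OF trace_form_has_sum[OF B0, of x y] trace_form_has_sum[OF B0, of x y']]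
      by (intro eqI) (simp add: bounded_clinear_add[OF reorder_bounded] bounded_clinear_add[OF A_bounded] cinner_simps)
    show "trace_form (x + x') y = trace_form x y + trace_form x' y" for x x' y
      using has_sum_add[OF trace_form_has_sum[OF B0, of x y] trace_form_has_sum[OF B0, of x' y]]
      by (intro eqI) (simp add: bounded_clinear_add[OF reorder_bounded] cinner_simps)
    show "trace_form x (c *\<^sub>C y) = c * trace_form x y" for x c y
      using has_sum_cmult_right[OF trace_form_has_sum[OF B0, of x y], of c]
      by (intro eqI) (simp add: bounded_clinear_scaleC[OF reorder_bounded] bounded_clinear_scaleC[OF A_bounded] cinner_simps)
    show "trace_form (c *\<^sub>C x) y = cnj c * trace_form x y" for x c y
      using has_sum_cmult_right[OF trace_form_has_sum[OF B0, of x y], of "cnj c"]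
      by (intro eqI) (simp add: bounded_clinear_scaleC[OF reorder_bounded] cinner_simps)
  qed (rule trace_form_bound, blast)
  have Csum: "((\<lambda>e. cinner (\<tau>SNE x (\<tau>NE e y)) (A (\<tau>SNE x' (\<tau>NE e y')))) has_sum
      cinner (\<tau>SE x y) (C (\<tau>SE x' y'))) B" if "is_onb UNIV B" for B x y x' y'
    using trace_form_has_sum[OF that, of "\<tau>SE x y" "\<tau>SE x' y'"] by (simp only: reorder_apply C(2))
  have "partial_trace \<tau>NE \<tau>SNE \<tau>SE A = C"
    unfolding partial_trace_def bounded_op_on_UNIV
  proof (rule the_equality)
    fix C' assume C': "bounded_clinear C' \<and> (\<forall>B x y x' y'. is_onb UNIV B \<longrightarrow>
      ((\<lambda>e. cinner (\<tau>SNE x (\<tau>NE e y)) (A (\<tau>SNE x' (\<tau>NE e y')))) has_sum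
        cinner (\<tau>SE x y) (C' (\<tau>SE x' y'))) B)"
    show "C' = C"
    proof (rule reorder_eqI)
      fix x' y'
      show "C' (\<tau>SE x' y') = C (\<tau>SE x' y')"
      proof (rule cinner_eqI_dense[OF hilbert_tensor_dense_image[OF SE]])
        fix z assume "z \<in> (\<lambda>(x, y). \<tau>SE x y) ` (UNIV \<times> UNIV)"
        then obtain x y where "z = \<tau>SE x y" by auto
        then show "cinner z (C' (\<tau>SE x' y')) = cinner z (C (\<tau>SE x' y'))"
          using C' B0 has_sum_unique[OF _ Csum[OF B0]] by blast
      qed
    qed (use C' C(1) in auto)
  qed (use C(1) Csum in auto)
  then show "bounded_clinear (partial_trace \<tau>NE \<tau>SNE \<tau>SE A)"
    "is_onb UNIV B \<Longrightarrow>
      ((\<lambda>e. cinner (\<tau>SNE x (\<tau>NE e y)) (A (\<tau>SNE x' (\<tau>NE e y')))) has_sum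
        cinner (\<tau>SE x y) (partial_trace \<tau>NE \<tau>SNE \<tau>SE A (\<tau>SE x' y'))) B"
    using C(1) Csum by auto
qed

end

end

section \<open>Generators of unitary groups\<close>

lemma has_vector_derivative_iff_quotient:
  fixes f :: "real \<Rightarrow> 'a::real_normed_vector"
  shows "(f has_vector_derivative v) (at t) \<longleftrightarrow> ((\<lambda>h. (f (t + h) - f t) /\<^sub>R h) \<longlongrightarrow> v) (at 0)"
proof -
  have "(f has_vector_derivative v) (at t) \<longleftrightarrow> ((\<lambda>h. norm (f (t + h) - f t - h *\<^sub>R v) / norm h) \<longlongrightarrow> 0) (at 0)"
    by (simp add: has_vector_derivative_def has_derivative_at bounded_linear_scaleR_left)
  also have "\<dots> \<longleftrightarrow> ((\<lambda>h. norm ((f (t + h) - f t) /\<^sub>R h - v)) \<longlongrightarrow> 0) (at 0)"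
  proof (rule Lim_cong_within)
    fix h :: real assume "h \<noteq> 0"
    then have "(f (t + h) - f t) /\<^sub>R h - v = (f (t + h) - f t - h *\<^sub>R v) /\<^sub>R h"
      by (simp add: scaleR_diff_right)
    then show "norm (f (t + h) - f t - h *\<^sub>R v) / norm h = norm ((f (t + h) - f t) /\<^sub>R h - v)"
      by (simp add: divide_inverse mult.commute)
  qed auto
  also have "\<dots> \<longleftrightarrow> ((\<lambda>h. (f (t + h) - f t) /\<^sub>R h) \<longlongrightarrow> v) (at 0)"
    by (simp add: tendsto_norm_zero_iff LIM_zero_iff)
  finally show ?thesis .
qed

lemma unitary_groupD:
  assumes "unitary_group H W"
  shows unitary_group_0: "x \<in> H \<Longrightarrow> W 0 x = x"
    and unitary_group_add: "x \<in> H \<Longrightarrow> W (s + t) x = W s (W t x)"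
    and unitary_group_in: "x \<in> H \<Longrightarrow> W t x \<in> H"
    and unitary_group_bounded: "bounded_op_on H (W t)"
    and unitary_group_continuous: "x \<in> H \<Longrightarrow> continuous_on UNIV (\<lambda>t. W t x)"
    and unitary_group_cinner: "x \<in> H \<Longrightarrow> y \<in> H \<Longrightarrow> cinner (W t x) (W t y) = cinner x y"
    and unitary_group_norm: "x \<in> H \<Longrightarrow> norm (W t x) = norm x"
proof -
  show "x \<in> H \<Longrightarrow> W 0 x = x" "x \<in> H \<Longrightarrow> W (s + t) x = W s (W t x)" "bounded_op_on H (W t)"
    "x \<in> H \<Longrightarrow> continuous_on UNIV (\<lambda>t. W t x)"
    using assms by (auto simp: unitary_group_def unitary_on_def)
  then show "x \<in> H \<Longrightarrow> W t x \<in> H" by (blast intro: bounded_op_on_in)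
  show ip: "cinner (W t x) (W t y) = cinner x y" if "x \<in> H" "y \<in> H" for x y
    using assms that by (auto simp: unitary_group_def unitary_on_def)
  show "x \<in> H \<Longrightarrow> norm (W t x) = norm x"
    using ip[of x x] by (simp add: cinner_self del: of_real_power)
qed

text \<open>For \<open>x\<close> in the domain of the generator, \<open>generator_pair W x y\<close> says that \<open>y = V x\<close> where
  \<open>W t = exp (- \<i> V t)\<close>.\<close>

definition generator_pair :: "(real \<Rightarrow> 'a::chilbert_space \<Rightarrow> 'a) \<Rightarrow> 'a \<Rightarrow> 'a \<Rightarrow> bool" where
  "generator_pair W x y \<longleftrightarrow> ((\<lambda>h. (W h x - x) /\<^sub>R h) \<longlongrightarrow> (- \<i>) *\<^sub>C y) (at 0)"

lemma generates_iff:
  "generates H V W \<longleftrightarrow> unitary_group H W \<and> V = {(x, y) \<in> H \<times> H. generator_pair W x y}"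
  by (simp add: generates_def generator_pair_def)

lemma generator_pair_quotient:
  assumes W: "unitary_group H W" and H: "hspace H" and x: "x \<in> H" "y \<in> H" "generator_pair W x y"
  shows "((\<lambda>h. (W (t + h) x - W t x) /\<^sub>R h) \<longlongrightarrow> (- \<i>) *\<^sub>C W t y) (at 0)"
    and "((\<lambda>h. (W h (W t x) - W t x) /\<^sub>R h) \<longlongrightarrow> (- \<i>) *\<^sub>C W t y) (at 0)"
proof -
  have cs: "csubspace H" using H by (simp add: hspace_def)
  note bd = unitary_group_bounded[OF W, of t]
  have inH: "(W h x - x) /\<^sub>R h \<in> H" for h
    using unitary_group_in[OF W x(1)] x(1) by (intro csubspace_scaleR[OF cs] csubspace_diff[OF cs])
  have lim: "((\<lambda>h. W t ((W h x - x) /\<^sub>R h)) \<longlongrightarrow> W t ((- \<i>) *\<^sub>C y)) (at 0)"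
  proof (rule tendsto_bounded_op_on[OF bd cs])
    show "((\<lambda>h. (W h x - x) /\<^sub>R h) \<longlongrightarrow> (- \<i>) *\<^sub>C y) (at 0)"
      using x(3) by (simp only: generator_pair_def)
    show "(- \<i>) *\<^sub>C y \<in> H" by (rule csubspace_scaleC[OF cs x(2)])
  qed (simp add: inH)
  have "W t ((W h x - x) /\<^sub>R h) = (W t (W h x) - W t x) /\<^sub>R h" for h
  proof -
    have mem: "W h x \<in> H" "(- 1) *\<^sub>C x \<in> H"
      by (rule unitary_group_in[OF W x(1)], rule csubspace_scaleC[OF cs x(1)])
    have "W t ((W h x - x) /\<^sub>R h) = W t (of_real (inverse h) *\<^sub>C (W h x + (- 1) *\<^sub>C x))"
      by (simp add: scaleR_scaleC)
    also have "\<dots> = of_real (inverse h) *\<^sub>C (W t (W h x) + (- 1) *\<^sub>C W t x)"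
      by (simp only: bounded_op_on_scaleC[OF bd csubspace_add[OF cs mem]] bounded_op_on_add[OF bd mem]
          bounded_op_on_scaleC[OF bd x(1)])
    finally show ?thesis by (simp add: scaleR_scaleC)
  qed
  then have *: "((\<lambda>h. (W t (W h x) - W t x) /\<^sub>R h) \<longlongrightarrow> (- \<i>) *\<^sub>C W t y) (at 0)"
    using lim by (simp only: bounded_op_on_scaleC[OF bd x(2)])
  have "W (t + h) x = W t (W h x)" "W h (W t x) = W t (W h x)" for h
    using unitary_group_add[OF W x(1), of t h] unitary_group_add[OF W x(1), of h t] by (simp_all add: add.commute)
  with * show "((\<lambda>h. (W (t + h) x - W t x) /\<^sub>R h) \<longlongrightarrow> (- \<i>) *\<^sub>C W t y) (at 0)"
    "((\<lambda>h. (W h (W t x) - W t x) /\<^sub>R h) \<longlongrightarrow> (- \<i>) *\<^sub>C W t y) (at 0)"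
    by simp_all
qed

lemma generator_pair_invariant:
  "unitary_group H W \<Longrightarrow> hspace H \<Longrightarrow> x \<in> H \<Longrightarrow> y \<in> H \<Longrightarrow> generator_pair W x y \<Longrightarrow>
    generator_pair W (W t x) (W t y)"
  using generator_pair_quotient(2) unfolding generator_pair_def by blast

lemma generator_pair_has_vector_derivative:
  "unitary_group H W \<Longrightarrow> hspace H \<Longrightarrow> x \<in> H \<Longrightarrow> y \<in> H \<Longrightarrow> generator_pair W x y \<Longrightarrow>
    ((\<lambda>t. W t x) has_vector_derivative (- \<i>) *\<^sub>C W t y) (at t)"
  unfolding has_vector_derivative_iff_quotient by (rule generator_pair_quotient(1))

text \<open>Mean value inequality: the derivative of the path deviates from its value at 0 by
  \<open>W s y - y\<close> up to a phase. The bound does not involve \<open>x\<close>, which is what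
  lets it pass to limits of graph points.\<close>

lemma generator_pair_bound:
  assumes W: "unitary_group UNIV W" and xy: "generator_pair W x y"
    and h: "\<bar>h\<bar> \<le> \<delta>" and e: "\<And>s. \<bar>s\<bar> \<le> \<delta> \<Longrightarrow> norm (W s y - y) \<le> e"
  shows "norm (W h x - x - h *\<^sub>R ((- \<i>) *\<^sub>C y)) \<le> \<bar>h\<bar> * e"
proof -
  have "norm (W h x - W 0 x - (h - 0) *\<^sub>R ((- \<i>) *\<^sub>C W 0 y)) \<le> norm (h - 0) * e"
  proof (rule vector_differentiable_bound_linearization[where S = "{- \<delta>..\<delta>}"])
    show "((\<lambda>t. W t x) has_vector_derivative (- \<i>) *\<^sub>C W s y) (at s within {- \<delta>..\<delta>})" for s
      by (rule has_vector_derivative_at_within)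
        (rule generator_pair_has_vector_derivative[OF W hspace_UNIV UNIV_I UNIV_I xy])
    show "closed_segment 0 h \<subseteq> {- \<delta>..\<delta>}"
      using h by (intro closed_segment_subset) auto
    show "norm ((- \<i>) *\<^sub>C W s y - (- \<i>) *\<^sub>C W 0 y) \<le> e" if "s \<in> {- \<delta>..\<delta>}" for s
      using e[of s] that by (auto simp: unitary_group_0[OF W] norm_scaleC norm_minus_commute simp flip: scaleC.diff_right)
    show "0 \<in> {- \<delta>..\<delta>}" using h by auto
  qed
  then show ?thesis by (simp add: unitary_group_0[OF W])
qed

text \<open>A generator is closed because the first-order error is controlled by the second
  component of the pair alone, hence uniformly along a convergent sequence in the graph.\<close>

lemma generator_graph_hspace:
  assumes W: "unitary_group UNIV W"
  shows "hspace {(x, y). generator_pair W x y}"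
proof -
  let ?G = "{(x, y). generator_pair W x y}"
  have Wl: "bounded_clinear (W t)" for t
    using unitary_group_bounded[OF W] by (simp add: bounded_op_on_UNIV)
  have "csubspace ?G"
  proof (rule cvs.subspaceI)
    show "0 \<in> ?G"
      by (simp add: zero_prod_def generator_pair_def bounded_clinear_zero[OF Wl])
    show "p + r \<in> ?G" if pr: "p \<in> ?G" "r \<in> ?G" for p r
    proof -
      have "((\<lambda>h. (W h (fst p) - fst p) /\<^sub>R h + (W h (fst r) - fst r) /\<^sub>R h) \<longlongrightarrow>
          (- \<i>) *\<^sub>C snd p + (- \<i>) *\<^sub>C snd r) (at 0)"
        using pr by (intro tendsto_add) (auto simp: generator_pair_def)
      then show ?thesis
        by (simp add: case_prod_unfold generator_pair_def bounded_clinear_add[OF Wl]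
            scaleC_add_right algebra_simps)
    qed
    show "c *\<^sub>C p \<in> ?G" if p: "p \<in> ?G" for c p
    proof -
      have "((\<lambda>h. c *\<^sub>C ((W h (fst p) - fst p) /\<^sub>R h)) \<longlongrightarrow> c *\<^sub>C ((- \<i>) *\<^sub>C snd p)) (at 0)"
        using p by (intro scaleC.tendsto tendsto_const) (auto simp: generator_pair_def)
      moreover have "c *\<^sub>C ((W h (fst p) - fst p) /\<^sub>R h) = (W h (c *\<^sub>C fst p) - c *\<^sub>C fst p) /\<^sub>R h" for h
        by (simp add: bounded_clinear_scaleC[OF Wl] scaleR_scaleC[where 'a = 'a] scaleC_scaleC mult.commute
            scaleC.diff_right)
      moreover have "c *\<^sub>C ((- \<i>) *\<^sub>C snd p) = (- \<i>) *\<^sub>C (c *\<^sub>C snd p)"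
        by (simp add: scaleC_scaleC mult.commute)
      ultimately show ?thesis
        by (simp only: mem_Collect_eq case_prod_unfold generator_pair_def scaleC_prod_def fst_conv snd_conv)
    qed
  qed
  moreover have "closed ?G"
    unfolding closed_sequential_limits
  proof (intro allI impI, elim conjE)
    fix g :: "nat \<Rightarrow> 'a \<times> 'a" and p assume g: "\<forall>n. g n \<in> ?G" "g \<longlonglongrightarrow> p"
    define x y where "x = fst p" and "y = snd p"
    have lim: "(\<lambda>n. fst (g n)) \<longlonglongrightarrow> x" "(\<lambda>n. snd (g n)) \<longlonglongrightarrow> y"
      using tendsto_fst[OF g(2)] tendsto_snd[OF g(2)] by (simp_all add: x_def y_def)
    have gG: "generator_pair W (fst (g n)) (snd (g n))" for n
      using g(1) by (simp add: case_prod_unfold)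
    have "((\<lambda>h. (W h x - x) /\<^sub>R h) \<longlongrightarrow> (- \<i>) *\<^sub>C y) (at 0)"
    proof (rule tendstoI)
      fix e :: real assume e: "0 < e"
      have "isCont (\<lambda>t. W t y) 0"
        using unitary_group_continuous[OF W, of y] by (simp add: continuous_on_eq_continuous_at)
      then obtain d where d: "0 < d" "\<And>s. dist s 0 < d \<Longrightarrow> dist (W s y) (W 0 y) < e / 2"
        unfolding continuous_at_eps_delta using e by (meson half_gt_zero)
      have est: "norm (W h x - x - h *\<^sub>R ((- \<i>) *\<^sub>C y)) \<le> \<bar>h\<bar> * (e / 2)" if h: "\<bar>h\<bar> < d" for h
      proof (rule LIMSEQ_le)
        show "(\<lambda>n. norm (W h (fst (g n)) - fst (g n) - h *\<^sub>R ((- \<i>) *\<^sub>C snd (g n)))) \<longlonglongrightarrow>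
            norm (W h x - x - h *\<^sub>R ((- \<i>) *\<^sub>C y))"
          by (intro tendsto_norm tendsto_diff tendsto_scaleR scaleC.tendsto tendsto_const lim
              bounded_linear.tendsto[OF bounded_clinear_bounded_linear[OF Wl]])
        have "(\<lambda>n. \<bar>h\<bar> * (e / 2 + 2 * norm (snd (g n) - y))) \<longlonglongrightarrow> \<bar>h\<bar> * (e / 2 + 2 * norm (y - y))"
          by (intro tendsto_intros lim)
        then show "(\<lambda>n. \<bar>h\<bar> * (e / 2 + 2 * norm (snd (g n) - y))) \<longlonglongrightarrow> \<bar>h\<bar> * (e / 2)" by simp
        \<comment> \<open>Replacing \<open>snd (g n)\<close> by \<open>y\<close> costs their
          distance twice, once under the isometry \<open>W s\<close> and once without it.\<close>
        have "norm (W h (fst (g n)) - fst (g n) - h *\<^sub>R ((- \<i>) *\<^sub>C snd (g n))) \<le>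
            \<bar>h\<bar> * (e / 2 + 2 * norm (snd (g n) - y))" for n
        proof (rule generator_pair_bound[OF W gG order_refl])
          fix s assume "\<bar>s\<bar> \<le> \<bar>h\<bar>"
          then have "norm (W s y - y) \<le> e / 2"
            using d(2)[of s] h by (simp add: dist_norm unitary_group_0[OF W])
          moreover have "norm (W s (snd (g n)) - snd (g n)) \<le>
              norm (W s (snd (g n) - y)) + norm (W s y - y) + norm (snd (g n) - y)"
          proof -
            have "W s (snd (g n)) - snd (g n) = W s (snd (g n) - y) + (W s y - y) - (snd (g n) - y)"
              by (simp add: bounded_clinear_diff[OF Wl])
            then show ?thesis
              using norm_triangle_ineq4[of "W s (snd (g n) - y) + (W s y - y)" "snd (g n) - y"]
                norm_triangle_ineq[of "W s (snd (g n) - y)" "W s y - y"] by simp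
          qed
          ultimately show "norm (W s (snd (g n)) - snd (g n)) \<le> e / 2 + 2 * norm (snd (g n) - y)"
            by (simp add: unitary_group_norm[OF W])
        qed
        then show "\<exists>N. \<forall>n\<ge>N. norm (W h (fst (g n)) - fst (g n) - h *\<^sub>R ((- \<i>) *\<^sub>C snd (g n))) \<le>
            \<bar>h\<bar> * (e / 2 + 2 * norm (snd (g n) - y))" by blast
      qed
      have "dist ((W h x - x) /\<^sub>R h) ((- \<i>) *\<^sub>C y) < e" if h: "h \<noteq> 0" "dist h 0 < d" for h
      proof -
        have "(W h x - x) /\<^sub>R h - (- \<i>) *\<^sub>C y = (W h x - x - h *\<^sub>R ((- \<i>) *\<^sub>C y)) /\<^sub>R h"
          using h(1) by (simp add: scaleR_diff_right scaleR_add_right)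
        then have "norm ((W h x - x) /\<^sub>R h - (- \<i>) *\<^sub>C y) = norm (W h x - x - h *\<^sub>R ((- \<i>) *\<^sub>C y)) / \<bar>h\<bar>"
          by (simp only: norm_scaleR) (simp add: divide_inverse mult.commute)
        also have "\<dots> \<le> e / 2"
          using est[of h] h by (simp add: dist_norm divide_le_eq mult.commute)
        also have "\<dots> < e" using e by simp
        finally show ?thesis by (simp only: dist_norm)
      qed
      then show "\<forall>\<^sub>F h in at 0. dist ((W h x - x) /\<^sub>R h) ((- \<i>) *\<^sub>C y) < e"
        unfolding eventually_at using d(1) by auto
    qed
    then show "p \<in> ?G" by (simp add: case_prod_unfold generator_pair_def x_def y_def)
  qed
  ultimately show ?thesis by (simp add: hspace_def)
qed

text \<open>The solution is exp (c t) times \<open>p 0\<close>, which is unbounded in one direction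
  of time unless \<open>p 0 = 0\<close>.\<close>

lemma bounded_exponential_solution:
  fixes p :: "real \<Rightarrow> complex"
  assumes p: "\<And>t. (p has_vector_derivative of_real c * p t) (at t)" and c: "c \<noteq> 0"
    and M: "\<And>t. cmod (p t) \<le> M"
  shows "p 0 = 0"
proof (rule ccontr)
  assume nz: "p 0 \<noteq> 0"
  have "((\<lambda>t. exp (- c * t) *\<^sub>R p t) has_vector_derivative 0) (at t)" for t
  proof -
    have "((\<lambda>t. exp (- c * t)) has_field_derivative - c * exp (- c * t)) (at t)"
      by (auto intro!: derivative_eq_intros)
    from has_vector_derivative_scaleR[OF this p[of t]] show ?thesis
      by (simp add: scaleR_conv_of_real)
  qed
  then obtain k where k: "\<And>t. exp (- c * t) *\<^sub>R p t = k"
    using has_vector_derivative_zero_constant[OF convex_UNIV, of "\<lambda>t. exp (- c * t) *\<^sub>R p t"]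
    by (metis UNIV_I)
  have pt: "cmod (p t) = exp (c * t) * cmod (p 0)" for t
  proof -
    have "exp (- c * t) * cmod (p t) = cmod (p 0)"
      using arg_cong[OF trans[OF k[of t] k[of 0, symmetric]], of norm] by simp
    then have "exp (c * t) * (exp (- c * t) * cmod (p t)) = exp (c * t) * cmod (p 0)" by simp
    then show ?thesis by (simp flip: mult.assoc exp_add)
  qed
  have M0: "0 \<le> M" using M[of 0] norm_ge_zero order_trans by blast
  \<comment> \<open>The time, with the sign of \<open>c\<close>, at which the modulus of
    \<open>p\<close> would reach M + 1.\<close>
  define T where "T = ln ((M + 1) / cmod (p 0)) / c"
  have "exp (c * T) = (M + 1) / cmod (p 0)"
    using c nz M0 by (simp add: T_def)
  then have "cmod (p T) = M + 1"
    using nz pt[of T] by simp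
  then show False using M[of T] by simp
qed

text \<open>A vector \<open>(x, y)\<close> of the graph of the generator \<open>V\<close> that is orthogonal to the graph over \<open>C\<close>
  makes \<open>f t = \<langle>x, W t d\<rangle>\<close> and \<open>g t = \<langle>y, W t d\<rangle>\<close> satisfy \<open>f' = - \<i> g\<close> and \<open>g' = \<i> f\<close>; the bounded
  functions \<open>f \<mp> \<i> g\<close> are then multiples of \<open>exp (\<plusminus> t)\<close>, so they vanish.\<close>

theorem generates_closure_of_core:
  assumes W: "unitary_group UNIV W"
    and C: "\<And>x y. (x, y) \<in> C \<Longrightarrow> generator_pair W x y"
    and inv: "\<And>t x y. (x, y) \<in> C \<Longrightarrow> (W t x, W t y) \<in> cspan C"
    and dense: "UNIV \<subseteq> closure (cspan (fst ` C))"
  shows "generates UNIV (closure (cspan C)) W"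
proof -
  let ?G = "{(x, y). generator_pair W x y}"
  have G: "hspace ?G" by (rule generator_graph_hspace[OF W])
  have Wl: "bounded_clinear (W t)" for t
    using unitary_group_bounded[OF W] by (simp add: bounded_op_on_UNIV)
  have sub: "closure (cspan C) \<subseteq> ?G"
    by (rule closure_cspan_minimal[OF G]) (use C in auto)
  have "?G \<subseteq> closure (cspan C)"
  proof
    fix z assume z: "z \<in> ?G"
    \<comment> \<open>The projection onto the closed span of \<open>C\<close>; the remainder
      \<open>z - p\<close> is orthogonal to it and still in the graph, and is shown to
      vanish.\<close>
    obtain p where p: "p \<in> closure (cspan C)" "\<And>h. h \<in> closure (cspan C) \<Longrightarrow> cinner h (z - p) = 0"
      using hspace_projection[OF hspace_closure_cspan] by blast
    define x y where "x = fst (z - p)" and "y = snd (z - p)"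
    have "z - p \<in> ?G"
      using z p(1) sub G by (intro csubspace_diff) (auto simp: hspace_def)
    then have xy: "generator_pair W x y" by (simp add: case_prod_unfold x_def y_def)
    have orth: "cinner x u + cinner y v = 0" if "(u, v) \<in> cspan C" for u v
    proof -
      have "(u, v) \<in> closure (cspan C)" using that closure_subset by blast
      from p(2)[OF this] have "cinner u x + cinner v y = 0" by (simp add: cinner_prod_def x_def y_def)
      then have "cnj (cinner u x + cinner v y) = 0" by simp
      then show ?thesis using cinner_commute[of x u] cinner_commute[of y v] by simp
    qed
    have "cinner d x = cinner d 0" if d: "d \<in> fst ` C" for d
    proof -
      obtain e where de: "(d, e) \<in> C" using d by force
      define f g where "f t = cinner x (W t d)" and "g t = cinner y (W t d)" for t
      have df: "(f has_vector_derivative (- \<i>) * g t) (at t)" for t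
      proof -
        \<comment> \<open>\<open>f\<close> is differentiated on the side of \<open>x\<close>, which
          brings in \<open>y\<close>; \<open>g\<close> is differentiated on the side of
          \<open>d\<close>, where orthogonality to the invariant span turns <y, W t e> into - f
          t.\<close>
        have f_eq: "f = (\<lambda>t. cinner (W (- t) x) d)"
        proof
          fix t
          have "cinner (W t (W (- t) x)) (W t d) = cinner (W (- t) x) d"
            by (rule unitary_group_cinner[OF W]) auto
          then show "f t = cinner (W (- t) x) d"
            using unitary_group_add[OF W UNIV_I, of t "- t" x] by (simp add: f_def unitary_group_0[OF W])
        qed
        have "((\<lambda>t. W t x) \<circ> uminus has_vector_derivative (- 1) *\<^sub>R ((- \<i>) *\<^sub>C W (- t) y)) (at t)"
        proof (rule vector_diff_chain_at)
          show "(uminus has_vector_derivative (- 1 :: real)) (at t)"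
            by (auto intro!: derivative_eq_intros)
          show "((\<lambda>t. W t x) has_vector_derivative (- \<i>) *\<^sub>C W (- t) y) (at (- t))"
            by (rule generator_pair_has_vector_derivative[OF W hspace_UNIV UNIV_I UNIV_I xy])
        qed
        then have "((\<lambda>t. W (- t) x) has_vector_derivative \<i> *\<^sub>C W (- t) y) (at t)"
          by (simp add: o_def)
        from bounded_linear.has_vector_derivative[OF cinner.bounded_linear_left this, of d]
        have "(f has_vector_derivative (- \<i>) * cinner (W (- t) y) d) (at t)"
          unfolding f_eq by (simp add: cinner_scaleC_left)
        moreover have "cinner (W t (W (- t) y)) (W t d) = cinner (W (- t) y) d"
          by (rule unitary_group_cinner[OF W]) auto
        then have "cinner (W (- t) y) d = g t"
          using unitary_group_add[OF W UNIV_I, of t "- t" y] by (simp add: g_def unitary_group_0[OF W])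
        ultimately show ?thesis by simp
      qed
      have dg: "(g has_vector_derivative \<i> * f t) (at t)" for t
      proof -
        from bounded_linear.has_vector_derivative[OF cinner.bounded_linear_right
            generator_pair_has_vector_derivative[OF W hspace_UNIV UNIV_I UNIV_I C[OF de]], of y t]
        have "(g has_vector_derivative (- \<i>) * cinner y (W t e)) (at t)"
          by (simp add: g_def[abs_def] cinner_scaleC_right cinner_minus_right)
        moreover have "cinner y (W t e) = - f t"
          using orth[OF inv[OF de, of t]] by (simp add: f_def eq_neg_iff_add_eq_0 add.commute)
        ultimately show ?thesis by simp
      qed
      have bd: "cmod (f t) \<le> norm x * norm d" "cmod (g t) \<le> norm y * norm d" for t
        using cinner_Cauchy_Schwarz[of x "W t d"] cinner_Cauchy_Schwarz[of y "W t d"]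
        by (simp_all add: f_def g_def unitary_group_norm[OF W])
      have dig: "((\<lambda>t. \<i> * g t) has_vector_derivative \<i> * (\<i> * f t)) (at t)" for t
        by (rule bounded_linear.has_vector_derivative[OF bounded_linear_mult_right dg])
      have "((\<lambda>t. f t - \<i> * g t) has_vector_derivative of_real 1 * (f t - \<i> * g t)) (at t)" for t
        using has_vector_derivative_diff[OF df[of t] dig[of t]] by (simp add: algebra_simps)
      then have 1: "f 0 - \<i> * g 0 = 0"
        by (rule bounded_exponential_solution[where M = "norm x * norm d + norm y * norm d"])
          (use bd norm_triangle_ineq4 in \<open>auto simp: norm_mult intro!: order_trans[OF norm_triangle_ineq4] add_mono\<close>)
      have "((\<lambda>t. f t + \<i> * g t) has_vector_derivative of_real (- 1) * (f t + \<i> * g t)) (at t)" for t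
        using has_vector_derivative_add[OF df[of t] dig[of t]] by (simp add: algebra_simps)
      then have 2: "f 0 + \<i> * g 0 = 0"
        by (rule bounded_exponential_solution[where M = "norm x * norm d + norm y * norm d"])
          (use bd in \<open>auto simp: norm_mult intro!: order_trans[OF norm_triangle_ineq] add_mono\<close>)
      have "f 0 = ((f 0 - \<i> * g 0) + (f 0 + \<i> * g 0)) / 2" by simp
      then have "f 0 = 0" unfolding 1 2 by simp
      then have "cinner x d = 0" by (simp add: f_def unitary_group_0[OF W])
      then show ?thesis by (metis cinner_commute complex_cnj_zero cinner_zero_right)
    qed
    then have x0: "x = 0" by (rule cinner_eqI_dense[OF dense])
    \<comment> \<open>Generators are single valued: for \<open>x = 0\<close> the difference quotient
      is constantly 0.\<close>
    have "y = 0"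
    proof -
      have "((\<lambda>h::real. 0) \<longlongrightarrow> (- \<i>) *\<^sub>C y) (at 0)"
        using xy by (simp add: generator_pair_def x0 bounded_clinear_zero[OF Wl])
      then have "(- \<i>) *\<^sub>C y = 0" by (simp add: tendsto_const_iff)
      then have "norm ((- \<i>) *\<^sub>C y) = 0" by simp
      then show ?thesis by (simp add: norm_scaleC)
    qed
    with x0 have "z - p = 0" by (simp add: x_def y_def prod_eq_iff)
    then show "z \<in> closure (cspan C)" using p(1) by simp
  qed
  with sub W show ?thesis
    unfolding generates_iff by auto
qed

section \<open>Products of unitary groups\<close>

text \<open>Convergence of the norms and of the inner products with the limit gives strong
  convergence. For product vectors both are products of convergent factors.\<close>

lemma tendsto_cinnerI:
  assumes "((\<lambda>t. cinner (f t) (f t)) \<longlongrightarrow> cinner l l) F" "((\<lambda>t. cinner (f t) l) \<longlongrightarrow> cinner l l) F"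
  shows "(f \<longlongrightarrow> l) F"
proof -
  have "((\<lambda>t. Re (cinner (f t) (f t)) + Re (cinner l l) - 2 * Re (cinner (f t) l)) \<longlongrightarrow>
      Re (cinner l l) + Re (cinner l l) - 2 * Re (cinner l l)) F"
    by (intro tendsto_intros assms)
  then have "((\<lambda>t. (norm (f t - l))\<^sup>2) \<longlongrightarrow> 0) F"
    by (simp add: norm_diff_power2 norm_power2_cinner[symmetric])
  then have "((\<lambda>t. sqrt ((norm (f t - l))\<^sup>2)) \<longlongrightarrow> sqrt 0) F"
    by (rule tendsto_real_sqrt)
  then show ?thesis
    by (simp add: tendsto_norm_zero_iff LIM_zero_iff)
qed

lemma tendsto_hilbert_tensor:
  assumes \<tau>: "hilbert_tensor H K \<tau>" and f: "(f \<longlongrightarrow> x) F" "\<And>t. f t \<in> H" "x \<in> H"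
    and g: "(g \<longlongrightarrow> y) F" "\<And>t. g t \<in> K" "y \<in> K"
  shows "((\<lambda>t. \<tau> (f t) (g t)) \<longlongrightarrow> \<tau> x y) F"
  by (rule tendsto_cinnerI)
    (auto simp: hilbert_tensor_cinner[OF \<tau>] f(2,3) g(2,3) intro!: tendsto_mult cinner.tendsto f(1) g(1))

lemma tendsto_hilbert_tensors:
  assumes \<tau>: "hilbert_tensors I H \<tau>" and f: "\<And>k. k \<in> I \<Longrightarrow> ((\<lambda>t. f t k) \<longlongrightarrow> x k) F"
    "\<And>t. f t \<in> Pi I H" "x \<in> Pi I H"
  shows "((\<lambda>t. \<tau> (f t)) \<longlongrightarrow> \<tau> x) F"
  by (rule tendsto_cinnerI)
    (auto simp: hilbert_tensors_cinner[OF \<tau>] f(2,3) intro!: tendsto_prod cinner.tendsto f(1))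

text \<open>Strong continuity extends to the closed span because the operators are isometric:
  convergence of vectors is uniform in time, and uniform limits of continuous paths are
  continuous.\<close>

lemma unitary_groupI_dense:
  assumes pair: "\<And>t. unitary_pair UNIV (U t) (U (- t))" and S: "UNIV \<subseteq> closure (cspan S)"
    and U0: "\<And>s. s \<in> S \<Longrightarrow> U 0 s = s" and add: "\<And>a b s. s \<in> S \<Longrightarrow> U (a + b) s = U a (U b s)"
    and cont: "\<And>s. s \<in> S \<Longrightarrow> continuous_on UNIV (\<lambda>t. U t s)"
  shows "unitary_group UNIV U"
  unfolding unitary_group_def
proof (intro conjI allI ballI)
  have bd: "bounded_clinear (U t)" for t
    using unitary_pair_bounded(1)[OF pair] by (simp add: bounded_op_on_UNIV)
  show "unitary_on UNIV (U t)" for t by (rule unitary_pair_imp_unitary_on[OF pair])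
  have "U 0 = (\<lambda>x. x)" by (rule bounded_clinear_eqI[OF bd bounded_clinear_id S U0])
  then show "U 0 x = x" for x by simp
  have "U (a + b) = (\<lambda>x. U a (U b x))" for a b
    by (rule bounded_clinear_eqI[OF bd bounded_clinear_compose[OF bd bd] S add])
  then show "U (a + b) x = U a (U b x)" for a b x by simp
  have norm: "norm (U t x) = norm x" for t x
    using unitary_pair_cinner[OF pair UNIV_I UNIV_I, of t x x] by (simp add: cinner_self del: of_real_power)
  have "hspace {x. continuous_on UNIV (\<lambda>t. U t x)}"
    unfolding hspace_def
  proof
    show "csubspace {x. continuous_on UNIV (\<lambda>t. U t x)}"
      by (rule cvs.subspaceI)
        (auto simp: bounded_clinearD[OF bd] intro!: continuous_on_add scaleC.continuous_on continuous_on_const)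
    show "closed {x. continuous_on UNIV (\<lambda>t. U t x)}"
      unfolding closed_sequential_limits
    proof (intro allI impI, elim conjE)
      fix g :: "nat \<Rightarrow> 'a" and x
      assume g: "\<forall>n. g n \<in> {x. continuous_on UNIV (\<lambda>t. U t x)}" "g \<longlonglongrightarrow> x"
      have "continuous_on UNIV (\<lambda>t. U t x)"
      proof (rule uniform_limit_theorem)
        show "\<forall>\<^sub>F n in sequentially. continuous_on UNIV (\<lambda>t. U t (g n))" using g(1) by simp
        show "uniform_limit UNIV (\<lambda>n t. U t (g n)) (\<lambda>t. U t x) sequentially"
        proof (rule uniform_limitI)
          fix e :: real assume "0 < e"
          then have "\<forall>\<^sub>F n in sequentially. dist (g n) x < e" by (rule tendstoD[OF g(2)])
          then show "\<forall>\<^sub>F n in sequentially. \<forall>t\<in>UNIV. dist (U t (g n)) (U t x) < e"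
            by (simp add: dist_norm norm flip: bounded_clinear_diff[OF bd])
        qed
      qed simp
      then show "x \<in> {x. continuous_on UNIV (\<lambda>t. U t x)}" by simp
    qed
  qed
  from closure_cspan_minimal[OF this, of S] S cont show "continuous_on UNIV (\<lambda>t. U t x)" for x by auto
qed

lemma continuous_on_UNIV_tendstoI:
  "(\<And>t. (f \<longlongrightarrow> f t) (at t)) \<Longrightarrow> continuous_on UNIV f"
  by (simp add: continuous_on_def)

lemma unitary_group_tendsto: "unitary_group H W \<Longrightarrow> x \<in> H \<Longrightarrow> ((\<lambda>t. W t x) \<longlongrightarrow> W t x) (at t)"
  using unitary_group_continuous[of H W x] by (simp add: continuous_on_def)

lemma unitary_group_tensor_op:
  assumes \<tau>: "hilbert_tensor H K \<tau>" and H: "csubspace H" and K: "csubspace K"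
    and V: "unitary_group H V" and W: "unitary_group K W"
  shows "unitary_group UNIV (\<lambda>t. tensor_op H K \<tau> (V t) (W t))"
proof (rule unitary_groupI_dense[OF _ hilbert_tensor_dense_image[OF \<tau>]])
  show "unitary_pair UNIV (tensor_op H K \<tau> (V t) (W t)) (tensor_op H K \<tau> (V (- t)) (W (- t)))" for t
    by (rule unitary_pair_tensor_op[OF \<tau> H K unitary_group_pair[OF V] unitary_group_pair[OF W]])
  note ap = tensor_op_apply[OF \<tau> H K unitary_group_bounded[OF V] unitary_group_bounded[OF W]]
  fix s assume "s \<in> (\<lambda>(x, y). \<tau> x y) ` (H \<times> K)"
  then obtain x y where s: "x \<in> H" "y \<in> K" "s = \<tau> x y" by auto
  show "tensor_op H K \<tau> (V 0) (W 0) s = s"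
    using s by (simp add: ap unitary_group_0[OF V] unitary_group_0[OF W])
  show "tensor_op H K \<tau> (V (a + b)) (W (a + b)) s = tensor_op H K \<tau> (V a) (W a) (tensor_op H K \<tau> (V b) (W b) s)" for a b
    using s by (simp add: ap unitary_group_add[OF V] unitary_group_add[OF W] unitary_group_in[OF V]
        unitary_group_in[OF W])
  have "((\<lambda>t. \<tau> (V t x) (W t y)) \<longlongrightarrow> \<tau> (V t x) (W t y)) (at t)" for t
    using s by (intro tendsto_hilbert_tensor[OF \<tau>] unitary_group_tendsto[OF V] unitary_group_tendsto[OF W]
        unitary_group_in[OF V] unitary_group_in[OF W])
  then show "continuous_on UNIV (\<lambda>t. tensor_op H K \<tau> (V t) (W t) s)"
    using s by (intro continuous_on_UNIV_tendstoI) (simp add: ap)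
qed

lemma unitary_group_tensor_ops:
  assumes \<tau>: "hilbert_tensors I H \<tau>" and H: "\<And>k. k \<in> I \<Longrightarrow> csubspace (H k)"
    and W: "\<And>k. k \<in> I \<Longrightarrow> unitary_group (H k) (W k)"
  shows "unitary_group UNIV (\<lambda>t. tensor_ops I H \<tau> (\<lambda>k. W k t))"
proof -
  have bd: "bounded_op_on (H k) (W k t)" if "k \<in> I" for k t by (rule unitary_group_bounded[OF W[OF that]])
  have pair: "unitary_pair (H k) (W k t) (W k (- t))" if "k \<in> I" for k t by (rule unitary_group_pair[OF W[OF that]])
  have ap: "tensor_ops I H \<tau> (\<lambda>k. W k t) (\<tau> x) = \<tau> (\<lambda>k. W k t (x k))" if "x \<in> Pi I H" for x t
    by (rule tensor_ops_apply[OF \<tau> H bd that])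
  have in_Pi: "(\<lambda>k. W k t (x k)) \<in> Pi I H" if "x \<in> Pi I H" for x t
    using that unitary_group_in[OF W] by (auto simp: Pi_iff)
  show ?thesis
  proof (rule unitary_groupI_dense[OF _ hilbert_tensors_dense[OF \<tau>]])
    show "unitary_pair UNIV (tensor_ops I H \<tau> (\<lambda>k. W k t)) (tensor_ops I H \<tau> (\<lambda>k. W k (- t)))" for t
      by (rule unitary_pair_tensor_ops[OF \<tau> H pair])
    fix s assume "s \<in> \<tau> ` Pi I H"
    then obtain x where x: "x \<in> Pi I H" "s = \<tau> x" by auto
    have "\<tau> (\<lambda>k. W k 0 (x k)) = \<tau> x"
      using x(1) unitary_group_0[OF W] by (intro hilbert_tensors_cong[OF \<tau> x(1), symmetric]) (auto simp: Pi_iff)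
    then show "tensor_ops I H \<tau> (\<lambda>k. W k 0) s = s" using x by (simp add: ap)
    have "\<tau> (\<lambda>k. W k (a + b) (x k)) = \<tau> (\<lambda>k. W k a (W k b (x k)))" for a b
      using x(1) unitary_group_add[OF W] by (intro hilbert_tensors_cong[OF \<tau> in_Pi[OF x(1)]]) (auto simp: Pi_iff)
    then show "tensor_ops I H \<tau> (\<lambda>k. W k (a + b)) s =
        tensor_ops I H \<tau> (\<lambda>k. W k a) (tensor_ops I H \<tau> (\<lambda>k. W k b) s)" for a b
      using x in_Pi[OF x(1)] by (simp add: ap)
    have "((\<lambda>t. \<tau> (\<lambda>k. W k t (x k))) \<longlongrightarrow> \<tau> (\<lambda>k. W k t (x k))) (at t)" for t
      using x(1) by (intro tendsto_hilbert_tensors[OF \<tau>] in_Pi unitary_group_tendsto[OF W]) auto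
    then show "continuous_on UNIV (\<lambda>t. tensor_ops I H \<tau> (\<lambda>k. W k t) s)"
      using x by (intro continuous_on_UNIV_tendstoI) (simp add: ap)
  qed
qed

text \<open>The same data with a one-parameter group for each pointer state; every time
  \<open>t\<close> yields an instance of \<open>dephasing_model\<close>.\<close>

locale dephasing_group =
  fixes ket :: "'i \<Rightarrow> 's::chilbert_space" and K :: "'b::chilbert_space set"
    and \<tau> :: "'s \<Rightarrow> 'b \<Rightarrow> 'c::chilbert_space" and \<epsilon> :: "'i \<Rightarrow> real"
    and W :: "'i \<Rightarrow> real \<Rightarrow> 'b \<Rightarrow> 'b"
  assumes ket: "cinner (ket i) (ket j) = (if i = j then 1 else 0)"
    and ket_dense: "closure (cspan (range ket)) = UNIV"
    and tensor: "hilbert_tensor UNIV K \<tau>"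
    and hspace_K: "hspace K"
    and group: "unitary_group K (W i)"
begin

sublocale model: dephasing_model ket K \<tau> \<epsilon> t "\<lambda>i. W i t" "\<lambda>i. W i (- t)" for t
  by unfold_locales (rule ket ket_dense tensor hspace_K unitary_group_pair[OF group])+

definition U :: "real \<Rightarrow> 'c \<Rightarrow> 'c" where
  "U t = dephasing_unitary ket K \<tau> \<epsilon> t (\<lambda>i. W i t)"

lemma U_bounded: "bounded_clinear (U t)"
  unfolding U_def by (rule model.U_bounded)

lemma U_apply: "y \<in> K \<Longrightarrow> U t (\<tau> (ket i) y) = exp (- \<i> * of_real (\<epsilon> i * t)) *\<^sub>C \<tau> (ket i) (W i t y)"
  unfolding U_def model.phase_def[symmetric] by (rule model.U_apply)

lemma unitary_group_U: "unitary_group UNIV U"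
proof (rule unitary_groupI_dense[OF _ model.gens_dense])
  show "unitary_pair UNIV (U t) (U (- t))" for t
    unfolding U_def by (rule model.unitary_pair_U)
  fix s assume "s \<in> (\<lambda>(i, y). \<tau> (ket i) y) ` (UNIV \<times> K)"
  then obtain i y where s: "y \<in> K" "s = \<tau> (ket i) y" by auto
  note W = unitary_group_0[OF group] unitary_group_add[OF group] unitary_group_in[OF group]
  show "U 0 s = s" using s by (simp add: U_apply W)
  show "U (a + b) s = U a (U b s)" for a b
    using s by (simp add: U_apply W bounded_clinear_scaleC[OF U_bounded] scaleC_scaleC algebra_simps exp_diff exp_minus field_simps)
  have "((\<lambda>t. exp (- \<i> * of_real (\<epsilon> i * t)) *\<^sub>C \<tau> (ket i) (W i t y)) \<longlongrightarrow> exp (- \<i> * of_real (\<epsilon> i * t)) *\<^sub>C \<tau> (ket i) (W i t y)) (at t)" for t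
    using s by (intro scaleC.tendsto tendsto_intros tendsto_hilbert_tensor[OF tensor] unitary_group_tendsto[OF group] W(3)) auto
  then show "continuous_on UNIV (\<lambda>t. U t s)"
    using s by (intro continuous_on_UNIV_tendstoI) (simp add: U_apply)
qed

end


section \<open>Product rules\<close>

lemma quotient_imp_tendsto:
  fixes f :: "real \<Rightarrow> 'a::real_normed_vector"
  assumes "((\<lambda>h. (f h - x) /\<^sub>R h) \<longlongrightarrow> v) (at 0)"
  shows "(f \<longlongrightarrow> x) (at 0)"
proof -
  have "((\<lambda>h. x + h *\<^sub>R ((f h - x) /\<^sub>R h)) \<longlongrightarrow> x + 0 *\<^sub>R v) (at 0)"
    by (intro tendsto_intros assms)
  moreover have "\<forall>\<^sub>F h in at 0. x + h *\<^sub>R ((f h - x) /\<^sub>R h) = f h"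
    by (auto simp: eventually_at intro!: exI[of _ 1])
  ultimately show ?thesis
    using Lim_transform_eventually by fastforce
qed

lemma bounded_clinear_on_quotient:
  assumes f: "bounded_clinear_on H f" and H: "csubspace H" and u: "u \<in> H" "v \<in> H"
  shows "(f u - f v) /\<^sub>R h = f ((u - v) /\<^sub>R h)"
proof -
  have add: "\<And>x y. x \<in> H \<Longrightarrow> y \<in> H \<Longrightarrow> f (x + y) = f x + f y"
    and sc: "\<And>c x. x \<in> H \<Longrightarrow> f (c *\<^sub>C x) = c *\<^sub>C f x"
    using f by (auto simp: bounded_clinear_on_def)
  have "f (u - v) = f u - f v" using add[OF csubspace_diff[OF H u] u(2)] by simp
  then show ?thesis using sc[OF csubspace_diff[OF H u], of "of_real (inverse h)"] by (simp add: scaleR_scaleC)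
qed

lemma hilbert_tensor_clinear_on_left:
  assumes \<tau>: "hilbert_tensor H K \<tau>" and y: "y \<in> K"
  shows "bounded_clinear_on H (\<lambda>x. \<tau> x y)"
  by (rule bounded_clinear_onI[of _ _ "norm y"])
    (simp_all add: y hilbert_tensor_add_left[OF \<tau>] hilbert_tensor_scaleC_left[OF \<tau>] hilbert_tensor_norm[OF \<tau>])

lemma hilbert_tensor_clinear_on_right:
  assumes \<tau>: "hilbert_tensor H K \<tau>" and x: "x \<in> H"
  shows "bounded_clinear_on K (\<lambda>y. \<tau> x y)"
  by (rule bounded_clinear_onI[of _ _ "norm x"])
    (simp_all add: x hilbert_tensor_add_right[OF \<tau>] hilbert_tensor_scaleC_right[OF \<tau>] hilbert_tensor_norm[OF \<tau>])

text \<open>Leibniz rule, from the difference split as (f h - x) \<otimes> g h + x \<otimes> (g h -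
  y).\<close>

lemma hilbert_tensor_quotient:
  assumes \<tau>: "hilbert_tensor H K \<tau>" and H: "csubspace H" and K: "csubspace K"
    and f: "\<And>h. f h \<in> H" "x \<in> H" "x' \<in> H" "((\<lambda>h. (f h - x) /\<^sub>R h) \<longlongrightarrow> x') (at 0)"
    and g: "\<And>h. g h \<in> K" "y \<in> K" "y' \<in> K" "((\<lambda>h. (g h - y) /\<^sub>R h) \<longlongrightarrow> y') (at 0)"
  shows "((\<lambda>h. (\<tau> (f h) (g h) - \<tau> x y) /\<^sub>R h) \<longlongrightarrow> \<tau> x' y + \<tau> x y') (at 0)"
proof -
  have "((\<lambda>h. \<tau> ((f h - x) /\<^sub>R h) (g h) + \<tau> x ((g h - y) /\<^sub>R h)) \<longlongrightarrow> \<tau> x' y + \<tau> x y') (at 0)"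
    by (intro tendsto_add tendsto_hilbert_tensor[OF \<tau>] f g quotient_imp_tendsto[OF g(4)] tendsto_const
        csubspace_scaleR[OF H] csubspace_scaleR[OF K] csubspace_diff[OF H] csubspace_diff[OF K])
  moreover have "\<tau> ((f h - x) /\<^sub>R h) (g h) + \<tau> x ((g h - y) /\<^sub>R h) = (\<tau> (f h) (g h) - \<tau> x y) /\<^sub>R h" for h
    unfolding bounded_clinear_on_quotient[OF hilbert_tensor_clinear_on_left[OF \<tau> g(1)] H f(1,2), symmetric]
      bounded_clinear_on_quotient[OF hilbert_tensor_clinear_on_right[OF \<tau> f(2)] K g(1,2), symmetric]
    by (simp flip: scaleR_add_right)
  ultimately show ?thesis by simp
qed

lemma hilbert_tensors_quotient:
  assumes \<tau>: "hilbert_tensors I H \<tau>" and I: "finite I" and H: "\<And>k. k \<in> I \<Longrightarrow> csubspace (H k)"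
    and f: "\<And>h. f h \<in> Pi I H" "x \<in> Pi I H" "\<And>k. k \<in> I \<Longrightarrow> x' k \<in> H k"
    and lim: "\<And>k. k \<in> I \<Longrightarrow> ((\<lambda>h. (f h k - x k) /\<^sub>R h) \<longlongrightarrow> x' k) (at 0)"
  shows "((\<lambda>h. (\<tau> (f h) - \<tau> x) /\<^sub>R h) \<longlongrightarrow> (\<Sum>k\<in>I. \<tau> (x(k := x' k)))) (at 0)"
proof -
  \<comment> \<open>The family in which the coordinates in \<open>J\<close> have already moved to
    time \<open>h\<close>; enlarging \<open>J\<close> one coordinate at a time telescopes the
    difference.\<close>
  define z where "z J h = (\<lambda>k. if k \<in> J then f h k else x k)" for J h
  have zP: "z J h \<in> Pi I H" for J h
    using f(1)[of h] f(2) by (auto simp: z_def Pi_iff)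
  have "((\<lambda>h. (\<tau> (z J h) - \<tau> x) /\<^sub>R h) \<longlongrightarrow> (\<Sum>k\<in>J. \<tau> (x(k := x' k)))) (at 0)" if "finite J" "J \<subseteq> I" for J
    using that
  proof (induction J rule: finite_induct)
    case empty
    have "z {} h = x" for h by (simp add: z_def)
    then show ?case by simp
  next
    case (insert j J)
    have j: "j \<in> I" using insert.prems by simp
    have fj: "f h j \<in> H j" and xj: "x j \<in> H j" for h
      using f(1)[of h] f(2) j by (auto simp: Pi_iff)
    have "z (insert j J) h = (z J h)(j := f h j)" for h by (auto simp: z_def)
    moreover have "z J h = (z J h)(j := x j)" for h using insert.hyps(2) by (auto simp: z_def)
    ultimately have step: "(\<tau> (z (insert j J) h) - \<tau> (z J h)) /\<^sub>R h = \<tau> ((z J h)(j := (f h j - x j) /\<^sub>R h))" for h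
      using bounded_clinear_on_quotient[OF hilbert_tensors_bounded_clinear_on[OF \<tau> I zP[of J h] j] H[OF j] fj[of h] xj, of h]
      by metis
    have "((\<lambda>h. \<tau> ((z J h)(j := (f h j - x j) /\<^sub>R h))) \<longlongrightarrow> \<tau> (x(j := x' j))) (at 0)"
    proof (rule tendsto_hilbert_tensors[OF \<tau>])
      show "x(j := x' j) \<in> Pi I H" by (rule fun_upd_in_Pi[OF f(2) f(3)[OF j]])
      show "(z J h)(j := (f h j - x j) /\<^sub>R h) \<in> Pi I H" for h
        by (intro fun_upd_in_Pi zP csubspace_scaleR[OF H[OF j]] csubspace_diff[OF H[OF j]] fj xj)
      show "((\<lambda>h. ((z J h)(j := (f h j - x j) /\<^sub>R h)) k) \<longlongrightarrow> (x(j := x' j)) k) (at 0)" if "k \<in> I" for k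
        using lim[OF that] quotient_imp_tendsto[OF lim[OF that]] by (cases "k \<in> J") (auto simp: z_def)
    qed
    moreover have "J \<subseteq> I" using insert.prems by blast
    ultimately have "((\<lambda>h. (\<tau> (z (insert j J) h) - \<tau> (z J h)) /\<^sub>R h + (\<tau> (z J h) - \<tau> x) /\<^sub>R h) \<longlongrightarrow>
        \<tau> (x(j := x' j)) + (\<Sum>k\<in>J. \<tau> (x(k := x' k)))) (at 0)"
      unfolding step by (intro tendsto_add insert.IH)
    moreover have "(\<tau> (z (insert j J) h) - \<tau> (z J h)) /\<^sub>R h + (\<tau> (z J h) - \<tau> x) /\<^sub>R h =
        (\<tau> (z (insert j J) h) - \<tau> x) /\<^sub>R h" for h
      by (simp flip: scaleR_add_right)
    ultimately show ?case
      unfolding sum.insert[OF insert.hyps] by (simp only:)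
  qed
  from this[OF I subset_refl] have "((\<lambda>h. (\<tau> (z I h) - \<tau> x) /\<^sub>R h) \<longlongrightarrow> (\<Sum>k\<in>I. \<tau> (x(k := x' k)))) (at 0)" .
  moreover have "\<tau> (z I h) = \<tau> (f h)" for h
    by (rule hilbert_tensors_cong[OF \<tau> zP]) (simp add: z_def)
  ultimately show ?thesis by simp
qed

lemma phase_quotient:
  "((\<lambda>h. (exp (- \<i> * of_real (e * h)) - 1) /\<^sub>R h) \<longlongrightarrow> - \<i> * of_real e) (at 0)"
proof -
  have "((\<lambda>z. exp (- \<i> * (of_real e * z))) has_field_derivative - \<i> * of_real e) (at (of_real 0))"
    by (auto intro!: derivative_eq_intros)
  from has_vector_derivative_real_field[OF this, of UNIV] show ?thesis
    unfolding has_vector_derivative_iff_quotient by simp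
qed

lemma scaleC_quotient:
  fixes v :: "real \<Rightarrow> 'a::chilbert_space"
  assumes c: "((\<lambda>h. (c h - 1) /\<^sub>R h) \<longlongrightarrow> c') (at 0)" and v: "((\<lambda>h. (v h - w) /\<^sub>R h) \<longlongrightarrow> w') (at 0)"
  shows "((\<lambda>h. (c h *\<^sub>C v h - w) /\<^sub>R h) \<longlongrightarrow> w' + c' *\<^sub>C w) (at 0)"
proof -
  have "((\<lambda>h. c h *\<^sub>C ((v h - w) /\<^sub>R h) + ((c h - 1) /\<^sub>R h) *\<^sub>C w) \<longlongrightarrow> 1 *\<^sub>C w' + c' *\<^sub>C w) (at 0)"
    by (intro tendsto_add scaleC.tendsto v c tendsto_const quotient_imp_tendsto[OF c])
  moreover have "c h *\<^sub>C ((v h - w) /\<^sub>R h) + ((c h - 1) /\<^sub>R h) *\<^sub>C w = (c h *\<^sub>C v h - w) /\<^sub>R h" for h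
    by (simp add: scaleC.scaleR_left scaleC.scaleR_right scaleC.diff_right scaleC.diff_left flip: scaleR_add_right)
  ultimately show ?thesis by simp
qed

section \<open>The dephasing model\<close>

locale dephasing_system =
  fixes M :: "('i, 's::chilbert_space, 'n::chilbert_space, 'e::chilbert_space, 'c::chilbert_space,
    'b::chilbert_space, 't::chilbert_space, 'r::chilbert_space) dephasing"
  assumes M: "pure_dephasing M"
begin

abbreviation "I \<equiv> {1..env_num M}"

lemma ket: "cinner (ket M i) (ket M j) = (if i = j then 1 else 0)"
  and ket_dense: "closure (cspan (range (ket M))) = UNIV"
  and obs: "hilbert_tensors I (env M) (tens_obs M)"
  and tens_env: "hilbert_tensor UNIV UNIV (tens_env M)"
  and tens_tot: "hilbert_tensor UNIV UNIV (tens_tot M)"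
  and tens_red: "hilbert_tensor UNIV UNIV (tens_red M)"
  and self_adjoint_not: "self_adjoint_on UNIV (V_not M i)"
  and generates_not: "generates UNIV (V_not M i) (W_not M i)"
  and density_not: "density_op UNIV (R_not M)"
  and amp_sum: "((\<lambda>i. (cmod (amp M i))\<^sup>2) has_sum 1) UNIV"
  and amp_nonzero: "amp M i \<noteq> 0"
  and psi0_sum: "((\<lambda>i. amp M i *\<^sub>C ket M i) has_sum psi0 M) UNIV"
  using M by (simp_all add: pure_dephasing_def)

lemma hspace_env: "k \<in> I \<Longrightarrow> hspace (env M k)"
  and self_adjoint_obs: "k \<in> I \<Longrightarrow> self_adjoint_on (env M k) (V_obs M i k)"
  and generates_obs: "k \<in> I \<Longrightarrow> generates (env M k) (V_obs M i k) (W_obs M i k)"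
  and density_rho: "k \<in> I \<Longrightarrow> density_op (env M k) (rho M k)"
  using M unfolding pure_dephasing_def by blast+

lemma csubspace_env: "k \<in> I \<Longrightarrow> csubspace (env M k)"
  using hspace_env by (simp add: hspace_def)

lemma group_not: "unitary_group UNIV (W_not M i)"
  using generates_not by (simp add: generates_def)

lemma group_obs: "k \<in> I \<Longrightarrow> unitary_group (env M k) (W_obs M i k)"
  using generates_obs by (simp add: generates_def)

lemma ex_distinct: "\<exists>i j :: 'i. i \<noteq> j"
  using M by (simp add: pure_dephasing_def)

definition obs_evol :: "'i \<Rightarrow> real \<Rightarrow> 'c \<Rightarrow> 'c" where
  "obs_evol i t = tensor_ops I (env M) (tens_obs M) (\<lambda>k. W_obs M i k t)"

definition env_evol :: "'i \<Rightarrow> real \<Rightarrow> 'b \<Rightarrow> 'b" where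
  "env_evol i t = tensor_op UNIV UNIV (tens_env M) (W_not M i t) (obs_evol i t)"

definition obs_state :: "'c \<Rightarrow> 'c" where
  "obs_state = tensor_ops I (env M) (tens_obs M) (rho M)"

definition env_state :: "'b \<Rightarrow> 'b" where
  "env_state = tensor_op UNIV UNIV (tens_env M) (R_not M) obs_state"

lemma group_obs_evol: "unitary_group UNIV (obs_evol i)"
  unfolding obs_evol_def by (rule unitary_group_tensor_ops[OF obs csubspace_env group_obs])

lemma group_env_evol: "unitary_group UNIV (env_evol i)"
  unfolding env_evol_def
  by (rule unitary_group_tensor_op[OF tens_env csubspace_UNIV csubspace_UNIV group_not group_obs_evol])

lemma obs_evol_apply:
  assumes "x \<in> Pi I (env M)"
  shows "obs_evol i t (tens_obs M x) = tens_obs M (\<lambda>k. W_obs M i k t (x k))"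
  unfolding obs_evol_def
  by (rule tensor_ops_apply[OF obs csubspace_env unitary_group_bounded[OF group_obs] assms])

lemma env_evol_apply: "env_evol i t (tens_env M n y) = tens_env M (W_not M i t n) (obs_evol i t y)"
  unfolding env_evol_def
  by (rule tensor_op_apply[OF tens_env csubspace_UNIV csubspace_UNIV unitary_group_bounded[OF group_not]
        unitary_group_bounded[OF group_obs_evol] UNIV_I UNIV_I])

lemma density_obs_state: "density_op UNIV obs_state"
  unfolding obs_state_def by (rule density_op_tensor_ops[OF obs _ hspace_env density_rho]) simp_all

lemma density_env_state: "density_op UNIV env_state"
  unfolding env_state_def
  by (rule density_op_tensor_op[OF tens_env hspace_UNIV hspace_UNIV density_not density_obs_state])

lemma amp: "cinner (ket M i) (psi0 M) = amp M i"
proof -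
  have "((\<lambda>j. cinner (ket M i) (amp M j *\<^sub>C ket M j)) has_sum cinner (ket M i) (psi0 M)) UNIV"
    by (rule has_sum_bounded_linear[OF bounded_clinear_bounded_linear[OF bounded_clinear_cinner_left] psi0_sum])
  moreover have "((\<lambda>j. cinner (ket M i) (amp M j *\<^sub>C ket M j)) has_sum amp M i) UNIV"
    by (rule has_sum_finite_neutralI[of "{i}"]) (auto simp: cinner_scaleC_right ket)
  ultimately show ?thesis by (rule has_sum_unique)
qed

lemma norm_psi0: "norm (psi0 M) = 1"
proof -
  have "((\<lambda>j. cinner (psi0 M) (amp M j *\<^sub>C ket M j)) has_sum cinner (psi0 M) (psi0 M)) UNIV"
    by (rule has_sum_bounded_linear[OF bounded_clinear_bounded_linear[OF bounded_clinear_cinner_left] psi0_sum])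
  moreover have "cinner (psi0 M) (amp M j *\<^sub>C ket M j) = of_real ((cmod (amp M j))\<^sup>2)" for j
    using cinner_commute[of "psi0 M" "ket M j"]
    unfolding cinner_scaleC_right amp complex_norm_square by simp
  ultimately have "((\<lambda>j. complex_of_real ((cmod (amp M j))\<^sup>2)) has_sum cinner (psi0 M) (psi0 M)) UNIV"
    by (simp only:)
  moreover have "((\<lambda>j. complex_of_real ((cmod (amp M j))\<^sup>2)) has_sum of_real 1) UNIV"
    using amp_sum by (simp only: has_sum_of_real_iff)
  ultimately have "cinner (psi0 M) (psi0 M) = of_real 1" by (rule has_sum_unique)
  then have "(norm (psi0 M))\<^sup>2 = 1" by (simp add: norm_power2_cinner)
  then show ?thesis using norm_ge_zero[of "psi0 M"] by (auto simp: power2_eq_1_iff)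
qed

sublocale total: dephasing_group "ket M" UNIV "tens_tot M" "energy M" env_evol
  by unfold_locales (rule ket ket_dense tens_tot hspace_UNIV group_env_evol)+

sublocale total_state: dephased_state "ket M" UNIV "tens_tot M" "energy M" t "\<lambda>i. env_evol i t"
    "\<lambda>i. env_evol i (- t)" "amp M" "psi0 M" env_state for t
  by unfold_locales (rule amp amp_nonzero norm_psi0 density_env_state)+

lemma evolution_eq: "evolution M = total.U"
proof
  show "evolution M t = total.U t" for t
    unfolding total.U_def evolution_def unfolding env_evol_def obs_evol_def ..
qed

lemma total_state_eq:
  "total_state M t = evolution M t \<circ> tensor_op UNIV UNIV (tens_tot M) (proj (psi0 M)) env_state \<circ> adj (evolution M t)"
  by (simp add: total_state_def env_state_def obs_state_def)


subsection \<open>The Hamiltonian\<close>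

abbreviation prod_vec :: "'i \<Rightarrow> 'n \<Rightarrow> (nat \<Rightarrow> 'e) \<Rightarrow> 't" where
  "prod_vec i n x \<equiv> tens_tot M (ket M i) (tens_env M n (tens_obs M x))"

text \<open>The pairs of vector and image on which the Hamiltonian is given explicitly; the domains
  of the factors depend on the pointer state \<open>i\<close>.\<close>

definition core :: "('t \<times> 't) set" where
  "core = {(prod_vec i n x, energy M i *\<^sub>R prod_vec i n x + prod_vec i n' x +
     (\<Sum>k=1..env_num M. prod_vec i n (x(k := x' k)))) | i n n' x x'.
       (n, n') \<in> V_not M i \<and> (\<forall>k\<in>I. (x k, x' k) \<in> V_obs M i k)}"

text \<open>The definition writes out scalar multiplication of pairs; identifying it with that of
  the product Hilbert space makes the core theorem applicable.\<close>

lemma hamiltonian_eq: "hamiltonian M = closure (cspan core)"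
proof -
  have "(\<lambda>c (u, v). (c *\<^sub>C u, c *\<^sub>C v)) = (scaleC :: complex \<Rightarrow> 't \<times> 't \<Rightarrow> 't \<times> 't)"
    by (intro ext) (simp add: scaleC_prod_def case_prod_unfold)
  moreover have "{(P n x, energy M i *\<^sub>R P n x + P n' x + (\<Sum>k=1..env_num M. P n (x(k := x' k)))) | P i n n' x x'.
          P = (\<lambda>n x. tens_tot M (ket M i) (tens_env M n (tens_obs M x))) \<and>
          (n, n') \<in> V_not M i \<and> (\<forall>k\<in>{1..env_num M}. (x k, x' k) \<in> V_obs M i k)} = core"
    (is "?A = _")
  proof (rule set_eqI, rule iffI)
    fix z assume z: "z \<in> ?A"
    obtain P i n n' x x' where *: "z = (P n x, energy M i *\<^sub>R P n x + P n' x + (\<Sum>k=1..env_num M. P n (x(k := x' k))))"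
      "P = prod_vec i" "(n, n') \<in> V_not M i" "\<forall>k\<in>I. (x k, x' k) \<in> V_obs M i k"
      using z[unfolded mem_Collect_eq] by (elim exE conjE)
    show "z \<in> core"
      unfolding core_def *(1,2) using *(3,4) by blast
  next
    fix z assume z: "z \<in> core"
    obtain i n n' x x' where *: "z = (prod_vec i n x, energy M i *\<^sub>R prod_vec i n x + prod_vec i n' x +
        (\<Sum>k=1..env_num M. prod_vec i n (x(k := x' k))))"
      "(n, n') \<in> V_not M i" "\<forall>k\<in>I. (x k, x' k) \<in> V_obs M i k"
      using z[unfolded core_def mem_Collect_eq] by (elim exE conjE)
    show "z \<in> ?A"
      unfolding *(1)
      by (rule CollectI, rule exI[of _ "prod_vec i"], rule exI[of _ i], rule exI[of _ n], rule exI[of _ n'],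
          rule exI[of _ x], rule exI[of _ x']) (intro conjI refl *(2,3))
  qed
  ultimately show ?thesis unfolding hamiltonian_def by (simp only:)
qed

lemma V_not_iff: "(n, n') \<in> V_not M i \<longleftrightarrow> generator_pair (W_not M i) n n'"
  using generates_not[of i] unfolding generates_iff by auto

lemma V_obs_iff: "k \<in> I \<Longrightarrow> (u, u') \<in> V_obs M i k \<longleftrightarrow> u \<in> env M k \<and> u' \<in> env M k \<and> generator_pair (W_obs M i k) u u'"
  using generates_obs[of k i] unfolding generates_iff by auto

lemma evolution_prod_vec:
  assumes "x \<in> Pi I (env M)"
  shows "evolution M t (prod_vec i n x) =
    exp (- \<i> * of_real (energy M i * t)) *\<^sub>C prod_vec i (W_not M i t n) (\<lambda>k. W_obs M i k t (x k))"
  using assms by (simp only: evolution_eq total.U_apply UNIV_I env_evol_apply obs_evol_apply)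

text \<open>The Leibniz rule is applied from the inside out: to the observed factors, to the
  unobserved factor, to the constant ket and to the phase, which contributes the energy.\<close>

lemma core_generator_pair:
  assumes "(u, v) \<in> core"
  shows "generator_pair (evolution M) u v"
proof -
  obtain i n n' x x' where *: "u = prod_vec i n x" "v = energy M i *\<^sub>R prod_vec i n x + prod_vec i n' x +
     (\<Sum>k\<in>I. prod_vec i n (x(k := x' k)))" "(n, n') \<in> V_not M i" "\<And>k. k \<in> I \<Longrightarrow> (x k, x' k) \<in> V_obs M i k"
    using assms unfolding core_def by blast
  have x: "x \<in> Pi I (env M)" and x': "\<And>k. k \<in> I \<Longrightarrow> x' k \<in> env M k"
    using *(4) V_obs_iff by auto
  have mx': "(- \<i>) *\<^sub>C x' k \<in> env M k" if "k \<in> I" for k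
    by (rule csubspace_scaleC[OF csubspace_env[OF that] x'[OF that]])
  define z where "z h = tens_obs M (\<lambda>k. W_obs M i k h (x k))" for h
  have "((\<lambda>h. (z h - tens_obs M x) /\<^sub>R h) \<longlongrightarrow> (\<Sum>k\<in>I. tens_obs M (x(k := (- \<i>) *\<^sub>C x' k)))) (at 0)"
    unfolding z_def
  proof (rule hilbert_tensors_quotient[OF obs _ csubspace_env _ x mx'])
    show "(\<lambda>k. W_obs M i k h (x k)) \<in> Pi I (env M)" for h
      using x unitary_group_in[OF group_obs] by (auto simp: Pi_iff)
    show "((\<lambda>h. (W_obs M i k h (x k) - x k) /\<^sub>R h) \<longlongrightarrow> (- \<i>) *\<^sub>C x' k) (at 0)" if "k \<in> I" for k
      using *(4)[OF that] V_obs_iff[OF that] by (simp only: generator_pair_def)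
  qed simp_all
  also have "(\<Sum>k\<in>I. tens_obs M (x(k := (- \<i>) *\<^sub>C x' k))) = (- \<i>) *\<^sub>C (\<Sum>k\<in>I. tens_obs M (x(k := x' k)))"
    unfolding cvs.scale_sum_right
    by (intro sum.cong refl hilbert_tensors_scaleC[OF obs x] x')
  finally have z: "((\<lambda>h. (z h - tens_obs M x) /\<^sub>R h) \<longlongrightarrow> (- \<i>) *\<^sub>C (\<Sum>k\<in>I. tens_obs M (x(k := x' k)))) (at 0)" .
  define e where "e = tens_env M n' (tens_obs M x) + tens_env M n (\<Sum>k\<in>I. tens_obs M (x(k := x' k)))"
  have n: "((\<lambda>h. (W_not M i h n - n) /\<^sub>R h) \<longlongrightarrow> (- \<i>) *\<^sub>C n') (at 0)"
    using *(3) unfolding V_not_iff generator_pair_def .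
  have "((\<lambda>h. (tens_env M (W_not M i h n) (z h) - tens_env M n (tens_obs M x)) /\<^sub>R h) \<longlongrightarrow>
      tens_env M ((- \<i>) *\<^sub>C n') (tens_obs M x) + tens_env M n ((- \<i>) *\<^sub>C (\<Sum>k\<in>I. tens_obs M (x(k := x' k))))) (at 0)"
    by (rule hilbert_tensor_quotient[OF tens_env csubspace_UNIV csubspace_UNIV _ _ _ n _ _ _ z]) simp_all
  also have "tens_env M ((- \<i>) *\<^sub>C n') (tens_obs M x) + tens_env M n ((- \<i>) *\<^sub>C (\<Sum>k\<in>I. tens_obs M (x(k := x' k)))) = (- \<i>) *\<^sub>C e"
    unfolding e_def scaleC_add_right
    by (simp only: hilbert_tensor_scaleC_left[OF tens_env UNIV_I UNIV_I] hilbert_tensor_scaleC_right[OF tens_env UNIV_I UNIV_I])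
  finally have E: "((\<lambda>h. (tens_env M (W_not M i h n) (z h) - tens_env M n (tens_obs M x)) /\<^sub>R h) \<longlongrightarrow> (- \<i>) *\<^sub>C e) (at 0)" .
  define v1 where "v1 h = prod_vec i (W_not M i h n) (\<lambda>k. W_obs M i k h (x k))" for h
  have "((\<lambda>h. (v1 h - u) /\<^sub>R h) \<longlongrightarrow>
      tens_tot M 0 (tens_env M n (tens_obs M x)) + tens_tot M (ket M i) ((- \<i>) *\<^sub>C e)) (at 0)"
    unfolding v1_def *(1) z_def[symmetric]
    by (rule hilbert_tensor_quotient[OF tens_tot csubspace_UNIV csubspace_UNIV _ _ _ _ _ _ _ E]) simp_all
  also have "tens_tot M 0 (tens_env M n (tens_obs M x)) = 0"
    using hilbert_tensor_scaleC_left[OF tens_tot UNIV_I UNIV_I, of 0 0 "tens_env M n (tens_obs M x)"] by simp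
  also have "0 + tens_tot M (ket M i) ((- \<i>) *\<^sub>C e) = (- \<i>) *\<^sub>C tens_tot M (ket M i) e"
    by (simp only: hilbert_tensor_scaleC_right[OF tens_tot UNIV_I UNIV_I] add_0)
  finally have "((\<lambda>h. (exp (- \<i> * of_real (energy M i * h)) *\<^sub>C v1 h - u) /\<^sub>R h) \<longlongrightarrow>
      (- \<i>) *\<^sub>C tens_tot M (ket M i) e + (- \<i> * of_real (energy M i)) *\<^sub>C u) (at 0)"
    by (rule scaleC_quotient[OF phase_quotient])
  also have "(\<lambda>h. (exp (- \<i> * of_real (energy M i * h)) *\<^sub>C v1 h - u) /\<^sub>R h) = (\<lambda>h. (evolution M h u - u) /\<^sub>R h)"
    unfolding *(1) v1_def evolution_prod_vec[OF x] ..
  also have "(- \<i>) *\<^sub>C tens_tot M (ket M i) e + (- \<i> * of_real (energy M i)) *\<^sub>C u = (- \<i>) *\<^sub>C v"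
  proof -
    have bt: "bounded_clinear (tens_tot M (ket M i))" "bounded_clinear (tens_env M n)"
      using hilbert_tensor_clinear_on_right[OF tens_tot UNIV_I] hilbert_tensor_clinear_on_right[OF tens_env UNIV_I]
      by (simp_all add: bounded_clinear_on_def bounded_clinear_def)
    have "tens_tot M (ket M i) e = prod_vec i n' x + (\<Sum>k\<in>I. prod_vec i n (x(k := x' k)))"
      by (simp add: e_def bounded_clinear_add[OF bt(1)] bounded_clinear_sum[OF bt(1)] bounded_clinear_sum[OF bt(2)])
    then have "v = tens_tot M (ket M i) e + of_real (energy M i) *\<^sub>C u"
      by (simp add: *(1,2) scaleR_scaleC add_ac)
    then show ?thesis by (simp add: scaleC_add_right scaleC_scaleC)
  qed
  finally show ?thesis unfolding generator_pair_def .
qed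

text \<open>Each domain is invariant under its own group, so a core vector evolves into a phase
  times a core vector; because of the phase the result lies in the span.\<close>

lemma core_invariant:
  assumes "(u, v) \<in> core"
  shows "(evolution M t u, evolution M t v) \<in> cspan core"
proof -
  obtain i n n' x x' where *: "u = prod_vec i n x" "v = energy M i *\<^sub>R prod_vec i n x + prod_vec i n' x +
     (\<Sum>k\<in>I. prod_vec i n (x(k := x' k)))" "(n, n') \<in> V_not M i" "\<And>k. k \<in> I \<Longrightarrow> (x k, x' k) \<in> V_obs M i k"
    using assms unfolding core_def by blast
  have x: "x \<in> Pi I (env M)" and x': "\<And>k. k \<in> I \<Longrightarrow> x' k \<in> env M k"
    using *(4) V_obs_iff by auto
  define c where "c = exp (- \<i> * of_real (energy M i * t))"
  define m m' y y' where "m = W_not M i t n" and "m' = W_not M i t n'"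
    and "y = (\<lambda>k. W_obs M i k t (x k))" and "y' = (\<lambda>k. W_obs M i k t (x' k))"
  define w where "w = energy M i *\<^sub>R prod_vec i m y + prod_vec i m' y + (\<Sum>k\<in>I. prod_vec i m (y(k := y' k)))"
  have "(m, m') \<in> V_not M i"
    using *(3) generator_pair_invariant[OF group_not hspace_UNIV UNIV_I UNIV_I] by (simp add: V_not_iff m_def m'_def)
  moreover have "(y k, y' k) \<in> V_obs M i k" if "k \<in> I" for k
    using *(4)[OF that] generator_pair_invariant[OF group_obs[OF that] hspace_env[OF that]]
      unitary_group_in[OF group_obs[OF that]]
    by (simp add: V_obs_iff[OF that] y_def y'_def)
  ultimately have "(prod_vec i m y, w) \<in> core"
    unfolding core_def w_def by blast
  then have "c *\<^sub>C (prod_vec i m y, w) \<in> cspan core"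
    by (intro cvs.span_scale cvs.span_base)
  moreover have "evolution M t u = c *\<^sub>C prod_vec i m y"
    unfolding *(1) evolution_prod_vec[OF x] c_def m_def y_def ..
  moreover have "evolution M t v = c *\<^sub>C w"
  proof -
    note bd = total.U_bounded[of t, folded evolution_eq]
    have "evolution M t (prod_vec i n (x(k := x' k))) = c *\<^sub>C prod_vec i m (y(k := y' k))" if "k \<in> I" for k
    proof -
      have "(\<lambda>l. W_obs M i l t ((x(k := x' k)) l)) = y(k := y' k)" by (auto simp: y_def y'_def)
      then show ?thesis
        using evolution_prod_vec[OF fun_upd_in_Pi[OF x x'[OF that]], of t i n] by (simp only: c_def m_def)
    qed
    then have "(\<Sum>k\<in>I. evolution M t (prod_vec i n (x(k := x' k)))) = (\<Sum>k\<in>I. c *\<^sub>C prod_vec i m (y(k := y' k)))"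
      by (intro sum.cong refl)
    moreover have "evolution M t (prod_vec i n x) = c *\<^sub>C prod_vec i m y" "evolution M t (prod_vec i n' x) = c *\<^sub>C prod_vec i m' y"
      unfolding evolution_prod_vec[OF x] c_def m_def m'_def y_def by (rule refl)+
    ultimately have "evolution M t v = energy M i *\<^sub>R (c *\<^sub>C prod_vec i m y) + c *\<^sub>C prod_vec i m' y +
        (\<Sum>k\<in>I. c *\<^sub>C prod_vec i m (y(k := y' k)))"
      unfolding *(2) bounded_clinear_add[OF bd] bounded_clinear_scaleR[OF bd] bounded_clinear_sum[OF bd]
      by (simp only:)
    then show ?thesis
      unfolding w_def scaleC_add_right cvs.scale_sum_right scaleC.scaleR_right by (simp only:)
  qed
  ultimately show ?thesis by (simp add: scaleC_prod_def)
qed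

text \<open>Self-adjoint operators have dense domains, and products of dense sets span densely. This
  is done for each ket separately, since the domains differ.\<close>

lemma core_dense: "UNIV \<subseteq> closure (cspan (fst ` core))"
proof -
  let ?L = "closure (cspan (fst ` core))"
  have L: "hspace ?L" by (rule hspace_closure_cspan)
  have dom: "Domain V \<subseteq> H" "H \<subseteq> closure (cspan (Domain V))" if "self_adjoint_on H V"
    for H and V :: "('z::chilbert_space \<times> 'z) set"
  proof -
    show "Domain V \<subseteq> H" using that unfolding self_adjoint_on_def by blast
    have "H \<subseteq> closure (Domain V)" using that unfolding self_adjoint_on_def by blast
    also have "\<dots> \<subseteq> closure (cspan (Domain V))" by (intro closure_mono) (auto intro: cvs.span_base)
    finally show "H \<subseteq> closure (cspan (Domain V))" .
  qed
  have gens: "tens_tot M (ket M i) y \<in> ?L" for i y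
  proof -
    let ?D = "Pi I (\<lambda>k. Domain (V_obs M i k))"
    have D: "UNIV \<subseteq> closure (cspan (tens_obs M ` ?D))"
      by (rule hilbert_tensors_dense_subsets[OF obs _ hspace_env]) (use dom[OF self_adjoint_obs] in auto)
    have E: "UNIV \<subseteq> closure (cspan ((\<lambda>(n, z). tens_env M n z) ` (Domain (V_not M i) \<times> tens_obs M ` ?D)))"
      by (rule hilbert_tensor_dense_subsets[OF tens_env hspace_UNIV hspace_UNIV])
        (use D dom[OF self_adjoint_not] in auto)
    show ?thesis
    proof (rule bounded_clinear_on_in_hspace[OF hilbert_tensor_clinear_on_right[OF tens_tot UNIV_I] hspace_UNIV L _ E _ UNIV_I])
      fix d assume "d \<in> (\<lambda>(n, z). tens_env M n z) ` (Domain (V_not M i) \<times> tens_obs M ` ?D)"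
      then obtain n x where d: "n \<in> Domain (V_not M i)" "x \<in> ?D" "d = tens_env M n (tens_obs M x)" by auto
      obtain n' where n': "(n, n') \<in> V_not M i" using d(1) by blast
      have "\<forall>k\<in>I. \<exists>z. (x k, z) \<in> V_obs M i k" using d(2) by auto
      then obtain x' where x': "\<forall>k\<in>I. (x k, x' k) \<in> V_obs M i k" by metis
      have "(prod_vec i n x, energy M i *\<^sub>R prod_vec i n x + prod_vec i n' x +
         (\<Sum>k=1..env_num M. prod_vec i n (x(k := x' k)))) \<in> core"
        unfolding core_def using n' x' by blast
      then have "tens_tot M (ket M i) d \<in> fst ` core" unfolding d(3) by force
      then show "tens_tot M (ket M i) d \<in> ?L" by (rule in_closure_cspan)
    qed simp
  qed
  have "(\<lambda>(i, y). tens_tot M (ket M i) y) ` (UNIV \<times> UNIV) \<subseteq> ?L" using gens by auto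
  from closure_cspan_minimal[OF L this] total.model.gens_dense show ?thesis by blast
qed

theorem generates_hamiltonian: "generates UNIV (hamiltonian M) (evolution M)"
  unfolding hamiltonian_eq
  by (rule generates_closure_of_core[OF _ core_generator_pair core_invariant core_dense])
    (unfold evolution_eq, rule total.unitary_group_U)


subsection \<open>Separability\<close>

lemma total_state_eq_dephased:
  "total_state M t = dephasing_unitary (ket M) UNIV (tens_tot M) (energy M) t (\<lambda>i. env_evol i t) \<circ>
     tensor_op UNIV UNIV (tens_tot M) (proj (psi0 M)) env_state \<circ>
     adj (dephasing_unitary (ket M) UNIV (tens_tot M) (energy M) t (\<lambda>i. env_evol i t))"
  unfolding total_state_eq evolution_eq total.U_def ..

text \<open>Conjugating factor by factor is conjugating the product state as a whole, the form in
  which the separability argument delivers its equality.\<close>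

lemma obs_cond_eq:
  "tensor_ops I (env M) (tens_obs M) (rho_cond M t i) = (\<lambda>y. obs_evol i t (obs_state (obs_evol i (- t) y)))"
proof (rule tensor_ops_eqI[OF obs])
  have bd: "bounded_clinear (obs_evol i s)" "bounded_clinear obs_state" for s
    using unitary_group_bounded[OF group_obs_evol] density_op_bounded[OF density_obs_state]
    by (simp_all add: bounded_op_on_UNIV)
  show "bounded_clinear (\<lambda>y. obs_evol i t (obs_state (obs_evol i (- t) y)))"
    by (rule bounded_clinear_compose[OF bd(1) bounded_clinear_compose[OF bd(2) bd(1)]])
  fix x assume x: "x \<in> Pi I (env M)"
  have 1: "(\<lambda>k. W_obs M i k (- t) (x k)) \<in> Pi I (env M)"
    using x unitary_group_in[OF group_obs] by (auto simp: Pi_iff)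
  then have 2: "(\<lambda>k. rho M k (W_obs M i k (- t) (x k))) \<in> Pi I (env M)"
    using bounded_op_on_in[OF density_op_bounded[OF density_rho]] by (auto simp: Pi_iff)
  have "obs_state (tens_obs M (\<lambda>k. W_obs M i k (- t) (x k))) = tens_obs M (\<lambda>k. rho M k (W_obs M i k (- t) (x k)))"
    unfolding obs_state_def
    by (rule tensor_ops_apply[OF obs csubspace_env density_op_bounded[OF density_rho] 1])
  then show "obs_evol i t (obs_state (obs_evol i (- t) (tens_obs M x))) = tens_obs M (\<lambda>k. rho_cond M t i k (x k))"
    by (simp only: obs_evol_apply[OF x] obs_evol_apply[OF 2] rho_cond_def o_apply)
qed

lemma env_cond_eq: "env_cond M t i = (\<lambda>x. env_evol i t (env_state (env_evol i (- t) x)))"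
  unfolding env_cond_def obs_cond_eq
proof (rule tensor_op_eqI[OF tens_env])
  have bd: "bounded_clinear (env_evol i s)" "bounded_clinear env_state" for s
    using unitary_group_bounded[OF group_env_evol] density_op_bounded[OF density_env_state]
    by (simp_all add: bounded_op_on_UNIV)
  show "bounded_clinear (\<lambda>y. env_evol i t (env_state (env_evol i (- t) y)))"
    by (rule bounded_clinear_compose[OF bd(1) bounded_clinear_compose[OF bd(2) bd(1)]])
  fix n y
  have "env_state (tens_env M n' y') = tens_env M (R_not M n') (obs_state y')" for n' y'
    unfolding env_state_def
    by (rule tensor_op_apply[OF tens_env csubspace_UNIV csubspace_UNIV density_op_bounded[OF density_not]
          density_op_bounded[OF density_obs_state] UNIV_I UNIV_I])
  then show "env_evol i t (env_state (env_evol i (- t) (tens_env M n y))) =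
      tens_env M (R_cond M t i n) (obs_evol i t (obs_state (obs_evol i (- t) y)))"
    by (simp only: env_evol_apply R_cond_def o_apply)
qed

lemma density_rho_cond: "k \<in> I \<Longrightarrow> density_op (env M k) (rho_cond M t i k)"
  using density_op_conj[OF unitary_group_pair[OF group_obs] hspace_env density_rho]
  by (simp add: rho_cond_def o_def)

lemma density_R_cond: "density_op UNIV (R_cond M t i)"
  using density_op_conj[OF unitary_group_pair[OF group_not] hspace_UNIV density_not]
  by (simp add: R_cond_def o_def)

lemma obs_cond_form:
  assumes x: "x \<in> Pi I (env M)" and r: "\<And>k. k \<in> I \<Longrightarrow> density_op (env M k) (r k)"
  shows "cinner (tens_obs M x) (tensor_ops I (env M) (tens_obs M) r (tens_obs M x)) = (\<Prod>k\<in>I. cinner (x k) (r k (x k)))"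
proof -
  have "(\<lambda>k. r k (x k)) \<in> Pi I (env M)"
    using x bounded_op_on_in[OF density_op_bounded[OF r]] by (auto simp: Pi_iff)
  moreover have "tensor_ops I (env M) (tens_obs M) r (tens_obs M x) = tens_obs M (\<lambda>k. r k (x k))"
    by (rule tensor_ops_apply[OF obs csubspace_env density_op_bounded[OF r] x])
  ultimately show ?thesis by (simp only: hilbert_tensors_cinner[OF obs x])
qed

lemma env_cond_form:
  assumes x: "x \<in> Pi I (env M)"
  shows "cinner (tens_env M n (tens_obs M x)) (env_cond M t i (tens_env M n (tens_obs M x))) =
    cinner n (R_cond M t i n) * (\<Prod>k\<in>I. cinner (x k) (rho_cond M t i k (x k)))"
proof -
  have "density_op UNIV (tensor_ops I (env M) (tens_obs M) (rho_cond M t i))"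
    by (rule density_op_tensor_ops[OF obs _ hspace_env density_rho_cond]) simp_all
  moreover have "cinner (tens_obs M x) (tensor_ops I (env M) (tens_obs M) (rho_cond M t i) (tens_obs M x)) =
      (\<Prod>k\<in>I. cinner (x k) (rho_cond M t i k (x k)))"
    by (rule obs_cond_form[OF x]) (rule density_rho_cond)
  ultimately show ?thesis
    unfolding env_cond_def
    by (simp add: tensor_op_apply[OF tens_env] density_op_bounded density_R_cond
        hilbert_tensor_cinner[OF tens_env] del: One_nat_def)
qed

lemma separable_imp_env_cond_eq:
  assumes "separable UNIV UNIV (tens_tot M) (total_state M t)" "i \<noteq> j"
  shows "env_cond M t i = env_cond M t j"
  using total_state.separable_imp_conditional_eq[of t i j] assms
  unfolding total_state_eq_dephased env_cond_eq by auto

lemma env_cond_eq_imp_rho_cond_eq: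
  assumes eq: "env_cond M t i = env_cond M t j" and k: "k \<in> I" and x: "x \<in> env M k"
  shows "rho_cond M t i k x = rho_cond M t j k x"
proof -
  \<comment> \<open>The expectations of \<open>R_cond M t i\<close> and \<open>R_cond M t j\<close>
    at \<open>n\<close> serve as the constants \<open>c\<close> and \<open>d\<close> of
    \<open>tensor_marginals_eq\<close>.\<close>
  obtain n where n: "cinner n (R_cond M t i n) \<noteq> 0"
    using density_op_nonzero[OF density_R_cond hspace_UNIV] by blast
  show ?thesis
  proof (rule tensor_marginals_eq[where \<rho> = "rho_cond M t i" and \<rho>' = "rho_cond M t j" and H = "env M" and I = I,
        OF _ hspace_env density_rho_cond density_rho_cond n _ k x])
    fix x assume "x \<in> Pi I (env M)"
    from env_cond_form[OF this, of n t i] env_cond_form[OF this, of n t j]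
    show "cinner n (R_cond M t i n) * (\<Prod>k\<in>I. cinner (x k) (rho_cond M t i k (x k))) =
        cinner n (R_cond M t j n) * (\<Prod>k\<in>I. cinner (x k) (rho_cond M t j k (x k)))"
      unfolding eq by simp
  qed simp_all
qed

text \<open>The separability theorem of \<open>dephased_state\<close>, with the single environment
  \<open>env M k\<close> in the role of \<open>K\<close>.\<close>

lemma pair_separable_imp_rho_cond_eq:
  assumes k: "k \<in> I" and \<tau>: "hilbert_tensor UNIV (env M k) \<tau>"
    and sep: "separable UNIV (env M k) \<tau> (pair_state M t k \<tau>)" and ij: "i \<noteq> j" and x: "x \<in> env M k"
  shows "rho_cond M t i k x = rho_cond M t j k x"
proof -
  interpret pair: dephased_state "ket M" "env M k" \<tau> "energy M" t "\<lambda>i. W_obs M i k t" "\<lambda>i. W_obs M i k (- t)"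
    "amp M" "psi0 M" "rho M k"
    by unfold_locales (rule ket ket_dense \<tau> hspace_env[OF k] unitary_group_pair[OF group_obs[OF k]] amp
        amp_nonzero norm_psi0 density_rho[OF k])+
  show ?thesis
    using pair.separable_imp_conditional_eq[OF _ ij x] sep
    unfolding pair_state_def pair_unitary_def rho_cond_def o_apply by blast
qed


subsection \<open>Spectrum broadcast structure\<close>

sublocale tripartite "tens_env M" "tens_tot M" "tens_red M"
  by unfold_locales (rule tens_env tens_tot tens_red)+

text \<open>On the diagonal the phases cancel, and tracing out the unobserved factor sums
  \<open>R_cond M t i\<close> to 1. The comparison with an SBS state uses these elements
  only.\<close>

lemma reduced_state_diag:
  assumes x: "x \<in> Pi I (env M)"
  shows "cinner (tens_red M (ket M i) (tens_obs M x)) (reduced_state M t (tens_red M (ket M i) (tens_obs M x))) =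
    of_real ((cmod (amp M i))\<^sup>2) * (\<Prod>k\<in>I. cinner (x k) (rho_cond M t i k (x k)))"
proof -
  have dens: "density_op UNIV (total_state M t)"
    unfolding total_state_eq_dephased by (rule total_state.density_op_state)
  obtain B where B: "is_onb (UNIV :: 'n set) B" using onb_exists[OF hspace_UNIV] by blast
  define P where "P = (\<Prod>k\<in>I. cinner (x k) (rho_cond M t i k (x k)))"
  have eq: "cinner (tens_tot M (ket M i) (tens_env M e (tens_obs M x)))
      (total_state M t (tens_tot M (ket M i) (tens_env M e (tens_obs M x)))) =
      of_real ((cmod (amp M i))\<^sup>2) * P * cinner e (R_cond M t i e)" for e
  proof -
    let ?z = "tens_env M e (tens_obs M x)"
    have "cinner (env_evol i (- t) ?z) (env_state (env_evol i (- t) ?z)) = cinner ?z (env_cond M t i ?z)"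
      unfolding env_cond_eq
      using unitary_pair_adjoint[OF unitary_group_pair[OF group_env_evol[of i], of "- t"] UNIV_I UNIV_I] by simp
    moreover have "total.model.phase t i * amp M i * cnj (total.model.phase t i * amp M i) = of_real ((cmod (amp M i))\<^sup>2)"
    proof -
      have "total.model.phase t i * amp M i * cnj (total.model.phase t i * amp M i) =
          (total.model.phase t i * cnj (total.model.phase t i)) * (amp M i * cnj (amp M i))"
        by (simp only: complex_cnj_mult mult_ac)
      then show ?thesis
        unfolding complex_norm_square total.model.phase_mult_cnj by simp
    qed
    ultimately show ?thesis
      unfolding total_state_eq_dephased total_state.state_matrix[OF UNIV_I UNIV_I] env_cond_form[OF x] P_def
      by (simp only: mult_ac)
  qed
  have "((\<lambda>e. of_real ((cmod (amp M i))\<^sup>2) * P * cinner e (R_cond M t i e)) has_sum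
      cinner (tens_red M (ket M i) (tens_obs M x)) (reduced_state M t (tens_red M (ket M i) (tens_obs M x)))) B"
    using partial_trace_has_sum[OF dens B, of "ket M i" "tens_obs M x" "ket M i" "tens_obs M x"]
    unfolding eq reduced_state_def .
  moreover have "((\<lambda>e. of_real ((cmod (amp M i))\<^sup>2) * P * cinner e (R_cond M t i e)) has_sum
      of_real ((cmod (amp M i))\<^sup>2) * P * 1) B"
    using density_R_cond[of t i] B by (intro has_sum_cmult_right) (auto simp: density_op_def)
  ultimately show ?thesis
    unfolding P_def using has_sum_unique by fastforce
qed

theorem rho_cond_eq_imp_not_SBS:
  assumes k: "k \<in> I" and eq: "\<And>i j x. i \<noteq> j \<Longrightarrow> x \<in> env M k \<Longrightarrow> rho_cond M t i k x = rho_cond M t j k x"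
  shows "\<not> is_SBS M (reduced_state M t)"
proof
  assume "is_SBS M (reduced_state M t)"
  then obtain p :: "'i \<Rightarrow> real" and r where
    *: "\<forall>i. \<forall>k\<in>I. density_op (env M k) (r i k)"
      "\<forall>k\<in>I. \<forall>i i'. i \<noteq> i' \<longrightarrow> (\<forall>x\<in>env M k. r i k (r i' k x) = 0)" and
    sum: "\<forall>x. ((\<lambda>i. p i *\<^sub>R tensor_op UNIV UNIV (tens_red M) (proj (ket M i))
      (tensor_ops I (env M) (tens_obs M) (r i)) x) has_sum reduced_state M t x) UNIV"
    unfolding is_SBS_def SBS_def by (elim exE conjE)
  have dens: "density_op (env M k) (r i k)" if "k \<in> I" for i k
    using *(1) that by blast
  have orth: "r i k (r i' k x) = 0" if "k \<in> I" "i \<noteq> i'" "x \<in> env M k" for k i i' x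
    using *(2) that by blast
  have r_eq: "rho_cond M t i k x = r i k x" if x: "x \<in> env M k" for i x
  \<comment> \<open>The amplitude weight is the nonzero constant \<open>c\<close>; the SBS
    probability \<open>p i\<close> enters as \<open>d\<close> and may have any value.\<close>
  proof (rule tensor_marginals_eq[where \<rho> = "rho_cond M t i" and \<rho>' = "r i" and H = "env M" and I = I
        and c = "of_real ((cmod (amp M i))\<^sup>2)" and d = "of_real (p i)",
        OF _ hspace_env density_rho_cond dens _ _ k x])
    show "complex_of_real ((cmod (amp M i))\<^sup>2) \<noteq> 0" using amp_nonzero[of i] by simp
    fix y assume y: "y \<in> Pi I (env M)"
    let ?y = "tens_obs M y"
    have dens': "density_op UNIV (tensor_ops I (env M) (tens_obs M) (r l))" for l
      by (rule density_op_tensor_ops[OF obs _ hspace_env dens]) simp_all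
    have ap: "tensor_op UNIV UNIV (tens_red M) (proj (ket M l)) (tensor_ops I (env M) (tens_obs M) (r l)) (tens_red M (ket M i) ?y) =
        tens_red M (proj (ket M l) (ket M i)) (tensor_ops I (env M) (tens_obs M) (r l) ?y)" for l
      by (rule tensor_op_apply[OF tens_red csubspace_UNIV csubspace_UNIV total.model.bounded_op_on_proj
            density_op_bounded[OF dens'] UNIV_I UNIV_I])
    have z: "tens_red M 0 w = 0" for w
      using hilbert_tensor_scaleC_left[OF tens_red UNIV_I UNIV_I, of 0 0 w] by simp
    have "((\<lambda>l. p l *\<^sub>R tensor_op UNIV UNIV (tens_red M) (proj (ket M l))
      (tensor_ops I (env M) (tens_obs M) (r l)) (tens_red M (ket M i) ?y)) has_sum
      p i *\<^sub>R tens_red M (ket M i) (tensor_ops I (env M) (tens_obs M) (r i) ?y)) UNIV"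
      unfolding ap by (rule has_sum_finite_neutralI[of "{i}"]) (auto simp: proj_def ket z)
    with sum[rule_format] have "reduced_state M t (tens_red M (ket M i) ?y) =
        p i *\<^sub>R tens_red M (ket M i) (tensor_ops I (env M) (tens_obs M) (r i) ?y)"
      using has_sum_unique by blast
    moreover have "cinner ?y (tensor_ops I (env M) (tens_obs M) (r i) ?y) = (\<Prod>k\<in>I. cinner (y k) (r i k (y k)))"
      by (rule obs_cond_form[OF y]) (rule dens)
    ultimately show "of_real ((cmod (amp M i))\<^sup>2) * (\<Prod>k\<in>I. cinner (y k) (rho_cond M t i k (y k))) =
        of_real (p i) * (\<Prod>k\<in>I. cinner (y k) (r i k (y k)))"
      using reduced_state_diag[OF y, of i t]
      by (simp add: cinner_scaleR_right hilbert_tensor_cinner[OF tens_red] ket del: One_nat_def)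
  qed simp_all
  obtain i j :: 'i where ij: "i \<noteq> j" using ex_distinct by blast
  obtain x where x: "x \<in> env M k" "cinner x (r j k x) \<noteq> 0"
    using density_op_nonzero[OF dens[OF k] hspace_env[OF k]] by blast
  have rx: "r j k x \<in> env M k" by (rule bounded_op_on_in[OF density_op_bounded[OF dens[OF k]] x(1)])
  \<comment> \<open>Both components equal the common conditional state, so orthogonality of
    different components says that the square of \<open>r j k\<close> vanishes.\<close>
  have "r j k (r j k x) = r i k (r j k x)"
    using eq[OF ij rx] r_eq[OF rx] by simp
  then have "r j k (r j k x) = 0" using orth[OF k ij x(1)] by simp
  then have "cinner (r j k x) (r j k x) = 0"
    using positive_on_hermitian[OF density_op_positive[OF dens[OF k]] csubspace_env[OF k] x(1) rx] by simp
  then show False using x(2) by simp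
qed

end

section \<open>An entangled state with equal conditional environment states\<close>

text \<open>Self-adjoint operators with square 1 are bounded and have explicit unitary groups, so
  that \<open>pure_dephasing\<close> can be verified directly for the counterexample.\<close>

locale involution =
  fixes A :: "'a::chilbert_space \<Rightarrow> 'a"
  assumes A_add: "A (x + y) = A x + A y" and A_scaleC: "A (c *\<^sub>C x) = c *\<^sub>C A x"
    and A_A: "A (A x) = x" and A_adj: "cinner (A x) y = cinner x (A y)"
begin

lemma A_bounded: "bounded_clinear A"
proof -
  have "(norm (A x))\<^sup>2 = (norm x)\<^sup>2" for x
    by (simp add: norm_power2_cinner A_adj A_A)
  then have "norm (A x) = norm x" for x by simp
  then show ?thesis
    unfolding bounded_clinear_def by (intro conjI allI exI[of _ 1] A_add A_scaleC) simp
qed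

text \<open>exp (- i A t), with the even and the odd powers of \<open>A\<close> collected.\<close>

definition W :: "real \<Rightarrow> 'a \<Rightarrow> 'a" where
  "W t x = of_real (cos t) *\<^sub>C x + (- \<i> * of_real (sin t)) *\<^sub>C A x"

lemma W_bounded: "bounded_clinear (W t)"
  unfolding W_def
  by (rule bounded_clinear_plus[OF bounded_clinear_scaleC_const
        bounded_clinear_compose[OF bounded_clinear_scaleC_const A_bounded]])

lemma W_0: "W 0 x = x"
  by (simp add: W_def)

lemma W_add: "W (s + t) x = W s (W t x)"
proof -
  have "W s (W t x) = (of_real (cos s) * of_real (cos t) + (- \<i> * of_real (sin s)) * (- \<i> * of_real (sin t))) *\<^sub>C x +
      (of_real (cos s) * (- \<i> * of_real (sin t)) + (- \<i> * of_real (sin s)) * of_real (cos t)) *\<^sub>C A x"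
    unfolding W_def A_add A_scaleC A_A scaleC_add_right scaleC_scaleC scaleC_add_left by (simp only: add_ac)
  also have "of_real (cos s) * of_real (cos t) + (- \<i> * of_real (sin s)) * (- \<i> * of_real (sin t)) = complex_of_real (cos (s + t))"
    by (simp add: cos_add complex_eq_iff)
  also have "of_real (cos s) * (- \<i> * of_real (sin t)) + (- \<i> * of_real (sin s)) * of_real (cos t) =
      - \<i> * complex_of_real (sin (s + t))"
    by (simp add: sin_add algebra_simps)
  finally show ?thesis by (simp only: W_def)
qed

lemma W_pair: "unitary_pair UNIV (W t) (W (- t))"
  unfolding unitary_pair_def bounded_op_on_UNIV
  using W_add[of t "- t"] W_add[of "- t" t]
  by (simp add: W_bounded W_0) (simp add: W_def cinner_simps A_adj)

lemma W_group: "unitary_group UNIV W"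
proof (rule unitary_groupI_dense)
  show "unitary_pair UNIV (W t) (W (- t))" for t by (rule W_pair)
  show "UNIV \<subseteq> closure (cspan (UNIV :: 'a set))" by (auto intro: in_closure_cspan)
  show "continuous_on UNIV (\<lambda>t. W t x)" for x
    unfolding W_def by (intro continuous_on_add scaleC.continuous_on continuous_intros)
qed (rule W_0 W_add)+

lemma generator_pair_W: "generator_pair W x y \<longleftrightarrow> y = A x"
proof -
  have c: "((\<lambda>h. (cos h - 1) / h) \<longlongrightarrow> 0) (at (0::real))" and s: "((\<lambda>h. sin h / h) \<longlongrightarrow> 1) (at (0::real))"
    using DERIV_cos[of "0::real"] DERIV_sin[of "0::real"] by (simp_all add: DERIV_def)
  have "((\<lambda>h. of_real ((cos h - 1) / h) *\<^sub>C x + (- \<i> * of_real (sin h / h)) *\<^sub>C A x) \<longlongrightarrow>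
      of_real 0 *\<^sub>C x + (- \<i> * of_real 1) *\<^sub>C A x) (at 0)"
    by (intro tendsto_add scaleC.tendsto tendsto_mult tendsto_of_real c s tendsto_const)
  moreover have "of_real ((cos h - 1) / h) *\<^sub>C x + (- \<i> * of_real (sin h / h)) *\<^sub>C A x = (W h x - x) /\<^sub>R h" for h
  proof -
    have "(W h x - x) /\<^sub>R h = of_real (inverse h) *\<^sub>C (of_real (cos h - 1) *\<^sub>C x + (- \<i> * of_real (sin h)) *\<^sub>C A x)"
      unfolding scaleR_scaleC W_def by (simp add: scaleC.diff_left)
    also have "\<dots> = of_real ((cos h - 1) / h) *\<^sub>C x + (- \<i> * of_real (sin h / h)) *\<^sub>C A x"
      unfolding scaleC_add_right scaleC_scaleC by (simp add: divide_inverse mult_ac)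
    finally show ?thesis ..
  qed
  ultimately have lim: "((\<lambda>h. (W h x - x) /\<^sub>R h) \<longlongrightarrow> (- \<i>) *\<^sub>C A x) (at 0)" by simp
  show ?thesis
  proof
    assume "generator_pair W x y"
    then have "(- \<i>) *\<^sub>C y = (- \<i>) *\<^sub>C A x"
      unfolding generator_pair_def using lim by (intro tendsto_unique[of "at (0::real)"]) simp_all
    then have "\<i> *\<^sub>C ((- \<i>) *\<^sub>C y) = \<i> *\<^sub>C ((- \<i>) *\<^sub>C A x)" by simp
    then show "y = A x" unfolding scaleC_scaleC by simp
  qed (simp only: generator_pair_def lim)
qed

lemma generates_W: "generates UNIV {(x, y). y = A x} W"
  unfolding generates_iff generator_pair_W using W_group by simp

lemma self_adjoint_A: "self_adjoint_on UNIV {(x, y). y = A x}"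
proof -
  have "y = A x" if "\<And>u. cinner (A u) x = cinner u y" for x y
    by (rule cinner_eqI) (use that A_adj in simp)
  moreover have "Domain {(x, y). y = A x} = UNIV" by auto
  ultimately show ?thesis
    unfolding self_adjoint_on_def by (auto simp: A_adj)
qed

end

text \<open>Serves the unobserved environment of the counterexample, whose Hamiltonian is 0.\<close>

lemma trivial_generates: "generates UNIV {(x :: 'a::chilbert_space, y). y = 0} (\<lambda>t x. x)"
proof -
  have "generator_pair (\<lambda>t x. x) x y \<longleftrightarrow> y = 0" for x y :: 'a
  proof -
    have "generator_pair (\<lambda>t x. x) x y \<longleftrightarrow> (- \<i>) *\<^sub>C y = 0"
      unfolding generator_pair_def by (simp add: tendsto_const_iff eq_commute[of 0])
    also have "\<dots> \<longleftrightarrow> norm ((- \<i>) *\<^sub>C y) = 0" by simp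
    finally show ?thesis by (simp add: norm_scaleC)
  qed
  moreover have "unitary_group UNIV (\<lambda>t x :: 'a. x)"
    unfolding unitary_group_def unitary_on_def bounded_op_on_UNIV by (simp add: bounded_clinear_id)
  ultimately show ?thesis unfolding generates_iff by simp
qed

lemma trivial_self_adjoint: "self_adjoint_on UNIV {(x :: 'a::chilbert_space, y). y = 0}"
proof -
  have "y = 0" if "\<And>u. cinner u y = 0" for y :: 'a
    using that[of y] by simp
  moreover have "Domain {(x :: 'a, y :: 'a). y = 0} = UNIV" by auto
  ultimately show ?thesis
    unfolding self_adjoint_on_def by (auto simp: eq_commute[of "0::complex"])
qed

section \<open>Finite-dimensional spaces, states and tensor products for the counterexample\<close>

lemma cinner_axis: "cinner (axis i (1::complex)) v = v $ i" for v :: "complex ^ 'n"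
proof -
  have "cinner (axis i (1::complex)) v = (\<Sum>j\<in>UNIV. if j = i then v $ j else 0)"
    unfolding cinner_vec_def cinner_complex_def by (intro sum.cong refl) (simp add: axis_def)
  then show ?thesis by simp
qed

lemma cinner_axis_axis: "cinner (axis i 1 :: complex ^ 'n) (axis j 1) = (if i = j then 1 else 0)"
  unfolding cinner_axis by (simp add: axis_def)

lemma axis_span: "v \<in> cspan (range (\<lambda>i. axis i (1::complex)))" for v :: "complex ^ 'n"
proof -
  have "v = (\<Sum>i\<in>UNIV. v $ i *\<^sub>C axis i 1)"
    by (simp add: vec_eq_iff scaleC_vec_def scaleC_complex_def axis_def if_distrib cong: if_cong)
  moreover have "(\<Sum>i\<in>UNIV. v $ i *\<^sub>C axis i 1) \<in> cspan (range (\<lambda>i. axis i (1::complex) :: complex ^ 'n))"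
    by (intro cvs.span_sum cvs.span_scale cvs.span_base) auto
  ultimately show ?thesis by simp
qed

lemma axis_onb: "is_onb UNIV (range (\<lambda>i. axis i (1::complex) :: complex ^ 'n))"
  unfolding is_onb_iff orthonormal_set_def
proof (intro conjI ballI)
  show "UNIV \<subseteq> closure (cspan (range (\<lambda>i. axis i (1::complex) :: complex ^ 'n)))"
    using axis_span closure_subset by blast
  fix e f assume "e \<in> range (\<lambda>i. axis i (1::complex) :: complex ^ 'n)" "f \<in> range (\<lambda>i. axis i (1::complex) :: complex ^ 'n)"
  then show "cinner e f = (if e = f then 1 else 0)"
    by (auto simp: cinner_axis_axis axis_eq_axis)
qed simp

lemma positive_on_scaled_identity: "0 \<le> r \<Longrightarrow> positive_on UNIV (\<lambda>v. r *\<^sub>R v)"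
  unfolding positive_on_def bounded_op_on_UNIV scaleR_scaleC
  by (simp add: bounded_clinear_scaleC_const cinner_scaleC_right cinner_self less_eq_complex_def)

lemma density_op_maximally_mixed: "density_op UNIV (\<lambda>v :: complex ^ 'n. (1 / CARD('n)) *\<^sub>R v)"
proof (rule density_opI[OF positive_on_scaled_identity hspace_UNIV axis_onb])
  have inj: "inj (\<lambda>i. axis i (1::complex) :: complex ^ 'n)"
    by (auto simp: inj_on_def axis_eq_axis)
  have "((\<lambda>i :: 'n. 1 / real CARD('n)) has_sum 1) UNIV"
    by (rule has_sum_finiteI) simp_all
  then have "((\<lambda>e. Re (cinner e ((1 / CARD('n)) *\<^sub>R e))) \<circ> (\<lambda>i. axis i (1::complex) :: complex ^ 'n) has_sum 1) UNIV"
    by (simp add: o_def cinner_scaleR_right cinner_axis_axis)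
  then show "((\<lambda>e. Re (cinner e ((1 / CARD('n)) *\<^sub>R e))) has_sum 1) (range (\<lambda>i. axis i (1::complex) :: complex ^ 'n))"
    unfolding has_sum_reindex[OF inj] .
qed simp

lemma density_op_complex: "density_op UNIV (\<lambda>z :: complex. z)"
proof (rule density_opI[of _ _ "{1}"])
  show "positive_on UNIV (\<lambda>z :: complex. z)"
    using positive_on_scaled_identity[of 1] by simp
  have "z \<in> cspan {1 :: complex}" for z
    using cvs.span_scale[OF cvs.span_base, of "1 :: complex" "{1}" z] by (simp add: scaleC_complex_def)
  then have "UNIV \<subseteq> closure (cspan {1 :: complex})"
    using closure_subset by blast
  then show "is_onb UNIV {1 :: complex}"
    by (simp add: is_onb_iff orthonormal_set_def cinner_complex_def)
  show "((\<lambda>e. Re (cinner e e)) has_sum 1) {1 :: complex}"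
    by (rule has_sum_finiteI) (simp_all add: cinner_complex_def)
qed simp

text \<open>Tensoring with a one-dimensional space changes nothing, so the unobserved environment of
  the counterexample can be the complex numbers.\<close>

lemma hilbert_tensor_scaleC_vec: "hilbert_tensor UNIV UNIV (\<lambda>(c::complex) (y::'a::chilbert_space). c *\<^sub>C y)"
proof -
  have "{c *\<^sub>C y |c y. c \<in> UNIV \<and> y \<in> (UNIV :: 'a set)} = UNIV"
    using cvs.scale_one by (auto intro!: exI[of _ "1::complex"])
  then have "closure (cspan {c *\<^sub>C y |c y. c \<in> UNIV \<and> y \<in> (UNIV :: 'a set)}) = UNIV"
    using in_closure_cspan by blast
  then show ?thesis
    unfolding hilbert_tensor_def
    by (simp add: scaleC_add_left scaleC_add_right scaleC_complex_def cinner_complex_def cinner_simps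
        scaleC_scaleC mult_ac)
qed

text \<open>The tensor product with an m-dimensional space as m-tuples of vectors, which makes
  \<open>\<tau>\<close> explicit in coordinates.\<close>

definition kron :: "complex ^ 'm \<Rightarrow> 'a::chilbert_space \<Rightarrow> 'a ^ 'm" where
  "kron x y = (\<chi> i. x $ i *\<^sub>C y)"

lemma hilbert_tensor_kron: "hilbert_tensor UNIV UNIV (kron :: complex ^ 'm \<Rightarrow> 'a::chilbert_space \<Rightarrow> 'a ^ 'm)"
proof -
  have "z \<in> cspan {kron x y |x y. x \<in> UNIV \<and> y \<in> UNIV}" for z :: "'a ^ 'm"
  proof -
    have "z = (\<Sum>i\<in>UNIV. kron (axis i 1) (z $ i))"
      by (simp add: vec_eq_iff kron_def axis_def if_distrib[of "\<lambda>c. c *\<^sub>C _"] cong: if_cong)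
    moreover have "(\<Sum>i\<in>UNIV. kron (axis i 1) (z $ i)) \<in> cspan {kron x y |x y. x \<in> UNIV \<and> y \<in> UNIV}"
      by (intro cvs.span_sum cvs.span_base) blast
    ultimately show ?thesis by simp
  qed
  then have "closure (cspan {kron x y |x y. x \<in> UNIV \<and> (y :: 'a) \<in> UNIV}) = (UNIV :: ('a ^ 'm) set)"
    using closure_subset by blast
  moreover have "cinner (kron x y) (kron x' y') = cinner x x' * cinner y y'" for x x' :: "complex ^ 'm" and y y' :: 'a
    by (simp add: cinner_vec_def kron_def cinner_simps cinner_complex_def sum_distrib_left sum_distrib_right mult_ac)
  ultimately show ?thesis
    unfolding hilbert_tensor_def
    by (simp add: kron_def vec_eq_iff scaleC_add_left scaleC_add_right scaleC_vec_def scaleC_complex_def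
        scaleC_scaleC mult_ac)
qed

text \<open>1, X and Z; the last branch belongs to the third index, which is 0 in the numeral
  type.\<close>

definition pauli :: "3 \<Rightarrow> complex ^ 2 \<Rightarrow> complex ^ 2" where
  "pauli i v = (if i = 1 then v else if i = 2 then (\<chi> l. if l = 1 then v $ 2 else v $ 1)
     else (\<chi> l. if l = 1 then v $ 1 else - v $ 2))"

interpretation pauli: involution "pauli i" for i
proof
  fix x y :: "complex ^ 2" and c
  show "pauli i (x + y) = pauli i x + pauli i y" "pauli i (c *\<^sub>C x) = c *\<^sub>C pauli i x" "pauli i (pauli i x) = x"
    "cinner (pauli i x) y = cinner x (pauli i y)"
    by (simp_all add: pauli_def vec_eq_iff forall_2 scaleC_vec_def scaleC_complex_def cinner_vec_def sum_2 cinner_complex_def)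
qed

text \<open>Two pointer states would not do here: with a finite-dimensional environment, equal
  conditional states commute with the relative unitary, and a common eigenbasis exhibits
  separability. With three pointer states the relative unitaries need not commute.\<close>

definition qutrit_qubit ::
  "(3, complex^3, complex, complex^2, complex^2, complex^2, complex^2^3, complex^2^3) dephasing" where
  "qutrit_qubit = \<lparr>ket = (\<lambda>i. axis i 1), env_num = 1, env = (\<lambda>k. UNIV), tens_obs = (\<lambda>x. x 1),
     tens_env = (\<lambda>c y. c *\<^sub>C y), tens_tot = kron, tens_red = kron, energy = (\<lambda>i. 0),
     V_not = (\<lambda>i. {(x, y). y = 0}), V_obs = (\<lambda>i k. {(x, y). y = pauli i x}),
     W_not = (\<lambda>i t x. x), W_obs = (\<lambda>i k. pauli.W i), amp = (\<lambda>i. of_real (1 / sqrt 3)),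
     psi0 = (\<chi> i. of_real (1 / sqrt 3)), R_not = (\<lambda>z. z), rho = (\<lambda>k v. (1 / 2) *\<^sub>R v)\<rparr>"

lemmas qutrit_qubit_simps = dephasing.simps qutrit_qubit_def

lemma pure_dephasing_qutrit_qubit: "pure_dephasing qutrit_qubit"
proof -
  have kets: "cinner (axis i 1 :: complex ^ 3) (axis j 1) = (if i = j then 1 else 0)" for i j
    by (rule cinner_axis_axis)
  have kets_dense: "closure (cspan (range (\<lambda>i. axis i 1 :: complex ^ 3))) = UNIV"
    using axis_span closure_subset by blast
  have "(\<lambda>x. x 1) ` Pi {1..1::nat} (\<lambda>k. UNIV :: (complex ^ 2) set) = UNIV"
    by (auto simp: image_iff intro: exI[of _ "\<lambda>_. _"])
  then have "closure (cspan ((\<lambda>x. x 1) ` Pi {1..1::nat} (\<lambda>k. UNIV :: (complex ^ 2) set))) = UNIV"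
    using in_closure_cspan by blast
  then have obs: "hilbert_tensors {1..1} (\<lambda>k. UNIV) (\<lambda>x :: nat \<Rightarrow> complex ^ 2. x 1)"
    unfolding hilbert_tensors_def by simp
  have amp: "((\<lambda>i :: 3. (cmod (of_real (1 / sqrt 3)))\<^sup>2) has_sum 1) UNIV"
    by (rule has_sum_finiteI) (simp_all add: norm_divide power_divide)
  have psi: "((\<lambda>i. of_real (1 / sqrt 3) *\<^sub>C axis i 1) has_sum ((\<chi> i. of_real (1 / sqrt 3)) :: complex ^ 3)) UNIV"
    by (rule has_sum_finiteI)
      (simp_all add: vec_eq_iff scaleC_vec_def scaleC_complex_def axis_def if_distrib cong: if_cong)
  have rho: "density_op UNIV (\<lambda>v :: complex ^ 2. (1 / 2) *\<^sub>R v)"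
    using density_op_maximally_mixed[where 'n = 2] by simp
  have ne: "(UNIV :: (complex ^ 2) set) \<noteq> {0}" "\<exists>i j :: 3. i \<noteq> j" "\<exists>z :: complex. z \<noteq> 0"
  proof -
    have "axis 1 1 \<noteq> (0 :: complex ^ 2)" by (simp add: axis_eq_0_iff)
    then show "(UNIV :: (complex ^ 2) set) \<noteq> {0}" by blast
    have "(1 :: 3) \<noteq> 2" by simp
    then show "\<exists>i j :: 3. i \<noteq> j" by blast
    show "\<exists>z :: complex. z \<noteq> 0" by (rule exI[of _ 1]) simp
  qed
  have s3: "complex_of_real (1 / sqrt 3) \<noteq> 0" by simp
  show ?thesis
    unfolding pure_dephasing_def qutrit_qubit_simps
    using kets kets_dense obs hilbert_tensor_scaleC_vec hilbert_tensor_kron trivial_self_adjoint trivial_generates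
      pauli.self_adjoint_A pauli.generates_W amp psi density_op_complex rho ne s3
    by (intro conjI allI ballI) (blast | simp only: hspace_UNIV | simp)+
qed

lemma W_inverse_pauli: "pauli.W i t (pauli.W i (- t) v) = v"
  using pauli.W_add[of i t "- t" v] by (simp add: pauli.W_0)

text \<open>A multiple of the identity is unchanged by every unitary conjugation.\<close>

lemma qutrit_qubit_conditional_eq: "env_cond qutrit_qubit t i = env_cond qutrit_qubit t j"
proof -
  have W: "bounded_clinear (pauli.W i t)" for i t by (rule pauli.W_bounded)
  have "rho_cond qutrit_qubit t i = (\<lambda>k v. (1 / 2) *\<^sub>R v)" for i
    by (intro ext) (simp add: rho_cond_def qutrit_qubit_simps bounded_clinear_scaleR[OF W] W_inverse_pauli)
  moreover have "R_cond qutrit_qubit t i = (\<lambda>v. v)" for i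
    by (intro ext) (simp add: R_cond_def qutrit_qubit_simps)
  ultimately show ?thesis unfolding env_cond_def by simp
qed

lemma qutrit_qubit_entangled:
  "\<not> separable UNIV UNIV (tens_tot qutrit_qubit) (total_state qutrit_qubit (pi / 2))"
proof
  interpret q: dephasing_system qutrit_qubit
    by unfold_locales (rule pure_dephasing_qutrit_qubit)
  \<comment> \<open>Every vector of the environment is a product vector here, so the abstract
    product operators can be evaluated through their action on products.\<close>
  have emb: "y = tens_env qutrit_qubit 1 (tens_obs qutrit_qubit (\<lambda>_. y))" for y
    by (simp add: qutrit_qubit_simps)
  have Pi: "(\<lambda>_. y) \<in> Pi q.I (env qutrit_qubit)" for y
    by (simp add: qutrit_qubit_simps)
  have evol: "q.env_evol i t y = pauli.W i t y" for i t y
    by (subst emb) (simp only: q.env_evol_apply q.obs_evol_apply[OF Pi], simp add: qutrit_qubit_simps)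
  have state: "q.env_state y = (1 / 2) *\<^sub>R y" for y
  proof -
    have "q.obs_state (tens_obs qutrit_qubit (\<lambda>_. y)) = tens_obs qutrit_qubit (\<lambda>k. rho qutrit_qubit k y)"
      unfolding q.obs_state_def
      by (rule tensor_ops_apply[OF q.obs q.csubspace_env density_op_bounded[OF q.density_rho] Pi])
    moreover have "q.env_state (tens_env qutrit_qubit 1 z) = tens_env qutrit_qubit (R_not qutrit_qubit 1) (q.obs_state z)" for z
      unfolding q.env_state_def
      by (rule tensor_op_apply[OF q.tens_env csubspace_UNIV csubspace_UNIV density_op_bounded[OF q.density_not]
            density_op_bounded[OF q.density_obs_state] UNIV_I UNIV_I])
    ultimately show ?thesis
      by (subst emb) (simp add: qutrit_qubit_simps)
  qed
  \<comment> \<open>The time pi / 2 is chosen so that the cosine vanishes and each evolution is a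
    Pauli matrix up to a common phase, which cancels in the form.\<close>
  have quarter: "pauli.W i (- (pi / 2)) v = \<i> *\<^sub>C pauli i v" for i v
    by (simp add: pauli.W_def)
  assume "separable UNIV UNIV (tens_tot qutrit_qubit) (total_state qutrit_qubit (pi / 2))"
  then have sep: "0 \<le> (\<Sum>l\<in>UNIV. \<Sum>m\<in>UNIV. cinner (\<i> *\<^sub>C pauli m (g l)) ((1 / 2) *\<^sub>R (\<i> *\<^sub>C pauli l (g m))))" for g
    using q.total_state.separable_matrix_nonneg[of "pi / 2" UNIV g]
    unfolding q.total_state_eq_dephased evol state quarter by simp
  define w where "w = (axis 1 1 :: complex ^ 2)"
  \<comment> \<open>The diagonal terms add up to 3 / 2 and each of the three pairs of indices
    contributes - 1: the pairs with the identity through the minus sign in \<open>g\<close>, the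
    pair of X and Z because these anticommute.\<close>
  define g where "g l = (if l = 1 then w else - pauli l w)" for l
  have "(\<Sum>l\<in>UNIV. \<Sum>m\<in>UNIV. cinner (\<i> *\<^sub>C pauli m (g l)) ((1 / 2) *\<^sub>R (\<i> *\<^sub>C pauli l (g m)))) = - (3 / 2)"
    by (simp add: sum_3 g_def w_def pauli_def cinner_simps cinner_scaleR_right cinner_vec_def sum_2
        cinner_complex_def axis_def scaleC_vec_def scaleC_complex_def complex_eq_iff)
  with sep[of g] show False by (simp add: less_eq_complex_def)
qed


theorem mainTheorem2:
  fixes M :: "('i, 's::chilbert_space, 'n::chilbert_space, 'e::chilbert_space, 'c::chilbert_space,
      'b::chilbert_space, 't::chilbert_space, 'r::chilbert_space) dephasing"
    and t :: real
  assumes "pure_dephasing M"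
  shows
    "generates UNIV (hamiltonian M) (evolution M) \<and>
     (separable UNIV UNIV (tens_tot M) (total_state M t) \<longrightarrow>
        (\<forall>i j. i \<noteq> j \<longrightarrow>
           env_cond M t i = env_cond M t j \<and>
           (\<forall>k\<in>{1..env_num M}. \<forall>x\<in>env M k. rho_cond M t i k x = rho_cond M t j k x))) \<and>
     \<comment> \<open>the condition is not sufficient in general\<close>
     (\<exists>(M' :: (3, complex^3, complex, complex^2, complex^2, complex^2, complex^2^3, complex^2^3)
            dephasing) t'.
        pure_dephasing M' \<and>
        (\<forall>i j. i \<noteq> j \<longrightarrow> env_cond M' t' i = env_cond M' t' j) \<and>
        \<not> separable UNIV UNIV (tens_tot M') (total_state M' t')) \<and>
     (\<forall>k\<in>{1..env_num M}. \<forall>\<tau> :: 's \<Rightarrow> 'e \<Rightarrow> 'd::chilbert_space.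
        hilbert_tensor UNIV (env M k) \<tau> \<and> separable UNIV (env M k) \<tau> (pair_state M t k \<tau>) \<longrightarrow>
        \<not> is_SBS M (reduced_state M t)) \<and>
     (\<forall>k\<in>{1..env_num M}.
        (\<forall>i j. i \<noteq> j \<longrightarrow> (\<forall>x\<in>env M k. rho_cond M t i k x = rho_cond M t j k x)) \<longrightarrow>
        \<not> is_SBS M (reduced_state M t)) \<and>
     (separable UNIV UNIV (tens_tot M) (total_state M t) \<longrightarrow> \<not> is_SBS M (reduced_state M t))"
proof -
  interpret dephasing_system M by unfold_locales (rule assms)
  have env_cond: "env_cond M t i = env_cond M t j"
    if "separable UNIV UNIV (tens_tot M) (total_state M t)" "i \<noteq> j" for i j
    by (rule separable_imp_env_cond_eq[OF that])
  show ?thesis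
  proof (intro conjI)
    show "generates UNIV (hamiltonian M) (evolution M)"
      by (rule generates_hamiltonian)
    show "separable UNIV UNIV (tens_tot M) (total_state M t) \<longrightarrow>
        (\<forall>i j. i \<noteq> j \<longrightarrow>
           env_cond M t i = env_cond M t j \<and>
           (\<forall>k\<in>{1..env_num M}. \<forall>x\<in>env M k. rho_cond M t i k x = rho_cond M t j k x))"
      using env_cond env_cond_eq_imp_rho_cond_eq by blast
    show "\<exists>(M' :: (3, complex^3, complex, complex^2, complex^2, complex^2, complex^2^3, complex^2^3)
            dephasing) t'.
        pure_dephasing M' \<and>
        (\<forall>i j. i \<noteq> j \<longrightarrow> env_cond M' t' i = env_cond M' t' j) \<and>
        \<not> separable UNIV UNIV (tens_tot M') (total_state M' t')"
      by (intro exI[of _ qutrit_qubit] exI[of _ "pi / 2"] conjI allI impI pure_dephasing_qutrit_qubit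
          qutrit_qubit_conditional_eq qutrit_qubit_entangled)
    show "\<forall>k\<in>{1..env_num M}. \<forall>\<tau> :: 's \<Rightarrow> 'e \<Rightarrow> 'd::chilbert_space.
        hilbert_tensor UNIV (env M k) \<tau> \<and> separable UNIV (env M k) \<tau> (pair_state M t k \<tau>) \<longrightarrow>
        \<not> is_SBS M (reduced_state M t)"
    proof (intro ballI allI impI, elim conjE)
      fix k and \<tau> :: "'s \<Rightarrow> 'e \<Rightarrow> 'd"
      assume k: "k \<in> {1..env_num M}"
        and pair: "hilbert_tensor UNIV (env M k) \<tau>" "separable UNIV (env M k) \<tau> (pair_state M t k \<tau>)"
      show "\<not> is_SBS M (reduced_state M t)"
        by (rule rho_cond_eq_imp_not_SBS[OF k]) (rule pair_separable_imp_rho_cond_eq[OF k pair])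
    qed
    show "\<forall>k\<in>{1..env_num M}.
        (\<forall>i j. i \<noteq> j \<longrightarrow> (\<forall>x\<in>env M k. rho_cond M t i k x = rho_cond M t j k x)) \<longrightarrow>
        \<not> is_SBS M (reduced_state M t)"
      by (intro ballI impI, rule rho_cond_eq_imp_not_SBS) auto
    show "separable UNIV UNIV (tens_tot M) (total_state M t) \<longrightarrow> \<not> is_SBS M (reduced_state M t)"
    proof
      assume sep: "separable UNIV UNIV (tens_tot M) (total_state M t)"
      \<comment> \<open>Any observed environment serves; the first one exists since
        \<open>1 \<le> env_num M\<close>.\<close>
      have k: "1 \<in> {1..env_num M}"
        using assms by (simp add: pure_dephasing_def)
      show "\<not> is_SBS M (reduced_state M t)"
        by (rule rho_cond_eq_imp_not_SBS[OF k]) (rule env_cond_eq_imp_rho_cond_eq[OF env_cond[OF sep] k])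
    qed
  qed
qed

end
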